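(* Let $f:\overline{\mathbb C}\to\overline{\mathbb C}$ be any expansive rational map (of degree at least $2$). Then the set $\mathcal A_f^{\ell}=\iota_f(\mathcal A_f^{\mathrm n})$ is closed in $\hat{\mathcal K}_f^a$, and thus $\mathcal A_f=\mathcal A_f^{\ell}$.
   Context: A rational map $f$ is expansive (also called parabolic) if any two distinct orbits in the Julia set are eventually a definite distance away from each other; equivalently, the Julia set of $f$ contains no critical point of $f$. (Hyperbolic maps are included.) Natural extension and affine part. The natural extension is $\mathcal N_f=\{\hat z=(z_0,z_{-1},\dots)\in\overline{\mathbb C}\times\overline{\mathbb C}\times\cdots: f(z_{-n-1})=z_{-n}\text{ for all }n\ge 0\}$ with the product topology, $\hat f(\hat z)=(f(z_0),z_0,z_{-1},\dots)$ and $\pi_f(\hat z)=z_0$. A point $\hat z$ is regular if some neighborhood $U_0$ of $z_0$ has pull-backs $U_0\leftarrow U_{-1}\leftarrow\cdots$ along $\hat z$ that are eventually univalent. The path components (leaves) of the set of regular points carry a natural Riemann surface structure making all maps $\pi_f\circ\hat f^{-n}$ holomorphic, and the affine part $\mathcal A_f^{\mathrm n}$ is the union of the leaves conformally isomorphic to $\mathbb C$. Affine lamination. Let $\mathcal U$ be the space of non-constant meromorphic functions on $\mathbb C$ with locally uniform convergence, $\hat{\mathcal U}=\mathcal U\times\mathcal U\times\cdots$, $\mathcal K_f=\bigcap_{n\ge0}\{f^n\circ\psi:\psi\in\mathcal U\}$ and $\hat{\mathcal K}_f=\{\hat\psi=(\psi_0,\psi_{-1},\dots)\in\hat{\mathcal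 U}:\psi_0\in\mathcal K_f,\ f\circ\psi_{-n-1}=\psi_{-n}\}$. Write $\hat\psi\sim_a\hat\psi'$ if $\hat\psi(w)=\hat\psi'(bw)$ for some $b\in\mathbb C\setminus\{0\}$ and all $w$; $\hat{\mathcal K}_f^a=\hat{\mathcal K}_f/\!\sim_a$ with the quotient topology. If $\hat z\in\mathcal A_f^{\mathrm n}$ lies on the leaf $L$ and $\phi:\mathbb C\to L$ is a conformal isomorphism with $\phi(0)=\hat z$, put $\iota_f(\hat z)=[(\pi_f\circ\hat f^{-N}\circ\phi)_{N\ge0}]_a\in\hat{\mathcal K}_f^a$ (independent of $\phi$). The affine lamination $\mathcal A_f$ is defined as the closure of $\iota_f(\mathcal A_f^{\mathrm n})$ in $\hat{\mathcal K}_f^a$. *)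

theory Defs
  imports "HOL-Complex_Analysis.Complex_Analysis" "HOL-Real_Asymp.Real_Asymp"
begin

section \<open>The Riemann sphere\<close>

type_synonym csphere = "complex option"

text \<open>\<^term>\<open>None\<close> is the point at infinity.\<close>

definition riemann_sphere :: "csphere topology" where
  "riemann_sphere = Alexandroff_compactification euclidean"

text \<open>Stereographic projection onto the unit sphere of \<open>\<complex> \<times> \<real>\<close>; it sends infinity to the
  north pole \<open>(0, 1)\<close>.\<close>

definition stereo :: "csphere \<Rightarrow> complex \<times> real" where
  "stereo x = (case x of
      None \<Rightarrow> (0, 1)
    | Some z \<Rightarrow> (of_real (2 / (1 + (cmod z)\<^sup>2)) * z, ((cmod z)\<^sup>2 - 1) / ((cmod z)\<^sup>2 + 1)))"

definition chordal :: "csphere \<Rightarrow> csphere \<Rightarrow> real" where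
  "chordal x y = dist (stereo x) (stereo y)"

lemma inj_stereo: "inj stereo"
proof (rule injI)
  fix x y assume eq: "stereo x = stereo y"
  have ht: "snd (stereo (Some z)) = 1 - 2 / (1 + (cmod z)\<^sup>2)" for z
  proof -
    have "1 + (cmod z)\<^sup>2 > 0" by (simp add: add_pos_nonneg)
    then show ?thesis by (simp add: stereo_def field_simps)
  qed
  have pos: "2 / (1 + (cmod z)\<^sup>2) > 0" for z
    by (simp add: add_pos_nonneg)
  have "snd (stereo (Some z)) < 1" for z
    using ht[of z] pos[of z] by linarith
  moreover have "snd (stereo None) = 1" by (simp add: stereo_def)
  ultimately have none: "x = None \<longleftrightarrow> y = None"
    using eq by (metis less_irrefl not_None_eq)
  show "x = y"
  proof (cases x; cases y)
    fix z w assume xy: "x = Some z" "y = Some w"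
    then have "2 / (1 + (cmod z)\<^sup>2) = 2 / (1 + (cmod w)\<^sup>2)"
      using eq ht[of z] ht[of w] by simp
    moreover have "of_real (2 / (1 + (cmod z)\<^sup>2)) * z = of_real (2 / (1 + (cmod w)\<^sup>2)) * w"
      using eq xy by (simp add: stereo_def)
    ultimately have "complex_of_real (2 / (1 + (cmod w)\<^sup>2)) * z = of_real (2 / (1 + (cmod w)\<^sup>2)) * w"
      by metis
    moreover have "complex_of_real (2 / (1 + (cmod w)\<^sup>2)) \<noteq> 0"
      using pos[of w] by (metis less_irrefl of_real_eq_0_iff)
    ultimately show ?thesis using xy by simp
  qed (use none in auto)
qed

lemma openin_riemann_sphere:
  "openin riemann_sphere S \<longleftrightarrow> (\<forall>x\<in>S. \<exists>e>0. \<forall>y. chordal x y < e \<longrightarrow> y \<in> S)"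
proof -
  let ?g = "\<lambda>z. stereo (Some z)"
  have pos: "1 + (cmod z)\<^sup>2 > 0" for z by (simp add: add_pos_nonneg)
  have cont: "continuous_on UNIV ?g"
    unfolding stereo_def option.case
    by (intro continuous_intros) (use pos in \<open>auto simp: less_le add.commute\<close>)
  have lim: "(?g \<longlongrightarrow> stereo None) at_infinity"
  proof -
    have nt: "filterlim (\<lambda>z :: complex. cmod z) at_top at_infinity"
      by (rule filterlim_norm_at_top)
    have "((\<lambda>r :: real. 2 / (1 + r\<^sup>2) * r) \<longlongrightarrow> 0) at_top" by real_asymp
    from filterlim_compose[OF this nt]
    have "((\<lambda>z. of_real (2 / (1 + (cmod z)\<^sup>2)) * z) \<longlongrightarrow> 0) at_infinity"
      by (subst tendsto_norm_zero_iff[symmetric]) (simp add: norm_mult norm_divide abs_of_pos[OF pos] del: of_real_divide)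
    moreover have "((\<lambda>r :: real. (r\<^sup>2 - 1) / (r\<^sup>2 + 1)) \<longlongrightarrow> 1) at_top" by real_asymp
    from filterlim_compose[OF this nt]
    have "((\<lambda>z. ((cmod z)\<^sup>2 - 1) / ((cmod z)\<^sup>2 + 1)) \<longlongrightarrow> 1) at_infinity" .
    ultimately show ?thesis
      unfolding stereo_def option.case by (rule tendsto_Pair)
  qed
  have top: "topspace riemann_sphere = UNIV"
    by (auto simp: riemann_sphere_def) (metis not_None_eq rangeI)
  have "continuous_map riemann_sphere euclidean stereo"
    unfolding continuous_map_def
  proof (intro conjI allI impI)
    fix W :: "(complex \<times> real) set" assume "openin euclidean W"
    then have W: "open W" by simp
    define S where "S = {x \<in> topspace riemann_sphere. stereo x \<in> W}"
    have opn: "open (?g -` W)" using cont W by (rule open_vimage[rotated])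
    show "openin riemann_sphere {x \<in> topspace riemann_sphere. stereo x \<in> W}"
    proof (cases "stereo None \<in> W")
      case False
      have "S = Some ` (?g -` W)"
        using False by (auto simp: S_def top) (metis (no_types) image_eqI not_None_eq vimage_eq)
      then show ?thesis using opn by (simp add: S_def riemann_sphere_def)
    next
      case True
      have "\<forall>\<^sub>F z in at_infinity. ?g z \<in> W"
        using lim W True by (rule topological_tendstoD)
      then obtain b where "\<And>z. cmod z \<ge> b \<Longrightarrow> ?g z \<in> W"
        by (auto simp: eventually_at_infinity)
      then have "- (?g -` W) \<subseteq> cball 0 b"
        by (force simp: not_le[symmetric])
      then have "compact (- (?g -` W))"
        using opn by (meson bounded_cball bounded_subset closed_Compl compact_eq_bounded_closed)
      moreover have "S = insert None (Some ` (topspace euclidean - (- (?g -` W))))"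
        using True by (auto simp: S_def top) (metis (no_types) image_eqI not_None_eq vimage_eq)
      ultimately show ?thesis
        using opn unfolding S_def[symmetric] unfolding riemann_sphere_def openin_Alexandroff_compactification
        by (intro disjI2 exI[of _ "- (?g -` W)"]) (simp add: compact_imp_closed)
    qed
  qed simp
  then have cm: "continuous_map riemann_sphere euclidean stereo" .
  have "compact_space riemann_sphere" by (simp add: riemann_sphere_def)
  then have emb: "embedding_map riemann_sphere euclidean stereo"
    using cm inj_stereo by (intro continuous_imp_embedding_map) (auto simp: top)
  show ?thesis
  proof
    assume "openin riemann_sphere S"
    then have "openin (subtopology euclidean (range stereo)) (stereo ` S)"
      using emb unfolding embedding_map_def top
      by (metis homeomorphic_imp_open_map open_map_def)
    then obtain T where T: "open T" "stereo ` S = T \<inter> range stereo"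
      by (auto simp: openin_subtopology)
    show "\<forall>x\<in>S. \<exists>e>0. \<forall>y. chordal x y < e \<longrightarrow> y \<in> S"
    proof
      fix x assume "x \<in> S"
      then have "stereo x \<in> T" using T by blast
      then obtain e where e: "e > 0" "\<And>p. dist (stereo x) p < e \<Longrightarrow> p \<in> T"
        using T by (metis open_dist dist_commute)
      have "y \<in> S" if "chordal x y < e" for y
      proof -
        have "stereo y \<in> stereo ` S" using e that T unfolding chordal_def by blast
        then show ?thesis using inj_stereo by (simp add: inj_image_mem_iff)
      qed
      then show "\<exists>e>0. \<forall>y. chordal x y < e \<longrightarrow> y \<in> S" using e by blast
    qed
  next
    assume *: "\<forall>x\<in>S. \<exists>e>0. \<forall>y. chordal x y < e \<longrightarrow> y \<in> S"
    then obtain e where e: "\<And>x. x \<in> S \<Longrightarrow> e x > 0" "\<And>x y. x \<in> S \<Longrightarrow> chordal x y < e x \<Longrightarrow> y \<in> S"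
      by metis
    define T where "T = (\<Union>x\<in>S. ball (stereo x) (e x))"
    have "S = {x \<in> topspace riemann_sphere. stereo x \<in> T}"
      using e by (auto simp: T_def top chordal_def intro!: bexI)
    moreover have "open T" by (auto simp: T_def)
    ultimately show "openin riemann_sphere S"
      using openin_continuous_map_preimage[OF cm, of T] by simp
  qed
qed

type_synonym 'a chart = "'a set \<times> ('a \<Rightarrow> complex)"

definition sphere_charts :: "csphere chart set" where
  "sphere_charts =
     {(range Some, the),
      (UNIV - {Some 0}, \<lambda>x. case x of None \<Rightarrow> 0 | Some w \<Rightarrow> inverse w)}"

definition plane_charts :: "complex chart set" where
  "plane_charts = {(UNIV, \<lambda>z. z)}"

definition surface_holomorphic ::
  "'a topology \<Rightarrow> 'a chart set \<Rightarrow> 'b topology \<Rightarrow> 'b chart set \<Rightarrow> ('a \<Rightarrow> 'b) \<Rightarrow> bool" where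
  "surface_holomorphic X A Y B g \<longleftrightarrow>
     continuous_map X Y g \<and>
     (\<forall>(U, x) \<in> A. \<forall>(V, y) \<in> B.
        (\<lambda>t. y (g (inv_into U x t))) holomorphic_on (x ` {p \<in> U. g p \<in> V}))"

definition conformal_isomorphism ::
  "'a topology \<Rightarrow> 'a chart set \<Rightarrow> 'b topology \<Rightarrow> 'b chart set \<Rightarrow> ('a \<Rightarrow> 'b) \<Rightarrow> bool" where
  "conformal_isomorphism X A Y B g \<longleftrightarrow>
     (\<exists>h. homeomorphic_maps X Y g h \<and>
          surface_holomorphic X A Y B g \<and> surface_holomorphic Y B X A h)"


section \<open>Rational maps, Julia set, expansiveness\<close>

definition rational_fun :: "complex poly \<Rightarrow> complex poly \<Rightarrow> csphere \<Rightarrow> csphere" where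
  "rational_fun p q x = (case x of
      Some z \<Rightarrow> if poly q z = 0 then None else Some (poly p z / poly q z)
    | None \<Rightarrow> (let d = max (degree p) (degree q) in
                 if coeff q d = 0 then None else Some (coeff p d / coeff q d)))"

definition rational_map_of_degree :: "nat \<Rightarrow> (csphere \<Rightarrow> csphere) \<Rightarrow> bool" where
  "rational_map_of_degree d f \<longleftrightarrow>
     (\<exists>p q. coprime p q \<and> max (degree p) (degree q) = d \<and> f = rational_fun p q)"

text \<open>Normality of the family of iterates on \<open>U\<close>, convergence being locally uniform for the
  spherical (chordal) metric; \<open>r\<close> enumerates an arbitrary sequence of iterates.\<close>

definition iterates_normal_on :: "(csphere \<Rightarrow> csphere) \<Rightarrow> csphere set \<Rightarrow> bool" where
  "iterates_normal_on f U \<longleftrightarrow>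
     (\<forall>r :: nat \<Rightarrow> nat. \<exists>s g. strict_mono (s :: nat \<Rightarrow> nat) \<and>
        (\<forall>K. compactin riemann_sphere K \<and> K \<subseteq> U \<longrightarrow>
           uniform_limit K (\<lambda>k x. stereo ((f ^^ r (s k)) x)) (\<lambda>x. stereo (g x)) sequentially))"

definition fatou_set :: "(csphere \<Rightarrow> csphere) \<Rightarrow> csphere set" where
  "fatou_set f = \<Union> {U. openin riemann_sphere U \<and> iterates_normal_on f U}"

definition julia_set :: "(csphere \<Rightarrow> csphere) \<Rightarrow> csphere set" where
  "julia_set f = UNIV - fatou_set f"

text \<open>Distinct points of the Julia set count as distinct orbits even if the orbits merge later;
  so expansiveness forces local injectivity, that is, no critical point on the Julia set.\<close>

definition expansive :: "(csphere \<Rightarrow> csphere) \<Rightarrow> bool" where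
  "expansive f \<longleftrightarrow>
     (\<exists>\<delta>>0. \<forall>x \<in> julia_set f. \<forall>y \<in> julia_set f. x \<noteq> y \<longrightarrow>
        (\<exists>n. chordal ((f ^^ n) x) ((f ^^ n) y) \<ge> \<delta>))"


section \<open>Natural extension, leaves, affine part\<close>

text \<open>A backward orbit \<open>(z\<^sub>0, z\<^sub>-\<^sub>1, \<dots>)\<close> is a function \<open>z\<close> on \<^typ>\<open>nat\<close> with \<open>z n = z\<^sub>-\<^sub>n\<close>.\<close>

definition natural_extension :: "(csphere \<Rightarrow> csphere) \<Rightarrow> (nat \<Rightarrow> csphere) set" where
  "natural_extension f = {z. \<forall>n. f (z (Suc n)) = z n}"

definition natural_extension_topology :: "(csphere \<Rightarrow> csphere) \<Rightarrow> (nat \<Rightarrow> csphere) topology" where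
  "natural_extension_topology f =
     subtopology (product_topology (\<lambda>_. riemann_sphere) UNIV) (natural_extension f)"

definition fhat :: "(csphere \<Rightarrow> csphere) \<Rightarrow> (nat \<Rightarrow> csphere) \<Rightarrow> (nat \<Rightarrow> csphere)" where
  "fhat f z = case_nat (f (z 0)) z"

definition fhat_inv :: "(csphere \<Rightarrow> csphere) \<Rightarrow> (nat \<Rightarrow> csphere) \<Rightarrow> (nat \<Rightarrow> csphere)" where
  "fhat_inv f = inv_into (natural_extension f) (fhat f)"

definition nat_proj :: "(nat \<Rightarrow> csphere) \<Rightarrow> csphere" where
  "nat_proj z = z 0"

lemma natural_extension_tail:
  assumes "z \<in> natural_extension f"
  shows "(\<lambda>n. z (Suc n)) \<in> natural_extension f" "fhat f (\<lambda>n. z (Suc n)) = z"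
proof -
  have *: "f (z (Suc n)) = z n" for n
    using assms unfolding natural_extension_def by blast
  show "(\<lambda>n. z (Suc n)) \<in> natural_extension f"
    unfolding natural_extension_def using * by blast
  show "fhat f (\<lambda>n. z (Suc n)) = z"
  proof
    fix n show "fhat f (\<lambda>n. z (Suc n)) n = z n"
      unfolding fhat_def by (cases n) (simp_all only: nat.case *)
  qed
qed

lemma bij_betw_fhat: "bij_betw (fhat f) (natural_extension f) (natural_extension f)"
proof (rule bij_betw_byWitness[where f' = "\<lambda>z n. z (Suc n)"])
  show "\<forall>a\<in>natural_extension f. (\<lambda>n. fhat f a (Suc n)) = a"
    by (simp add: fhat_def)
  show "\<forall>a'\<in>natural_extension f. fhat f (\<lambda>n. a' (Suc n)) = a'"
    using natural_extension_tail(2) by blast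
  show "(\<lambda>z n. z (Suc n)) ` natural_extension f \<subseteq> natural_extension f"
    using natural_extension_tail(1) by blast
  show "fhat f ` natural_extension f \<subseteq> natural_extension f"
  proof
    fix y assume "y \<in> fhat f ` natural_extension f"
    then obtain z where z: "y = fhat f z" "\<And>n. f (z (Suc n)) = z n"
      unfolding natural_extension_def by blast
    have "f (y (Suc n)) = y n" for n
      unfolding z(1) fhat_def by (cases n) (simp_all only: nat.case z(2))
    then show "y \<in> natural_extension f" unfolding natural_extension_def by blast
  qed
qed

lemma fhat_inv_eq:
  assumes "z \<in> natural_extension f"
  shows "fhat_inv f z = (\<lambda>n. z (Suc n))"
  unfolding fhat_inv_def
  using bij_betw_fhat[of f] natural_extension_tail[OF assms]
  by (intro inv_into_f_eq) (auto simp: bij_betw_def)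

lemma nat_proj_fhat_inv:
  assumes "z \<in> natural_extension f"
  shows "nat_proj ((fhat_inv f ^^ N) z) = z N"
proof -
  have "(fhat_inv f ^^ N) z = (\<lambda>n. z (n + N))"
  proof (induction N)
    case (Suc N)
    have "(\<lambda>n. z (n + N)) \<in> natural_extension f"
      using assms unfolding natural_extension_def by auto
    then show ?case using Suc by (simp add: fhat_inv_eq)
  qed simp
  then show ?thesis by (simp add: nat_proj_def)
qed

text \<open>The pull-back of \<open>U\<close> of depth \<open>n\<close> along \<open>z\<close> is the component of \<open>f\<^sup>-\<^sup>n(U)\<close> containing \<open>z\<^sub>-\<^sub>n\<close>.\<close>

definition pullback ::
  "(csphere \<Rightarrow> csphere) \<Rightarrow> (nat \<Rightarrow> csphere) \<Rightarrow> csphere set \<Rightarrow> nat \<Rightarrow> csphere set" where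
  "pullback f z U n =
     connected_component_of_set (subtopology riemann_sphere ((f ^^ n) -` U)) (z n)"

definition univalent_from ::
  "(csphere \<Rightarrow> csphere) \<Rightarrow> (nat \<Rightarrow> csphere) \<Rightarrow> csphere set \<Rightarrow> nat \<Rightarrow> bool" where
  "univalent_from f z U N \<longleftrightarrow> (\<forall>n\<ge>N. inj_on f (pullback f z U (Suc n)))"

definition regular_nbhd ::
  "(csphere \<Rightarrow> csphere) \<Rightarrow> (nat \<Rightarrow> csphere) \<Rightarrow> csphere set \<Rightarrow> bool" where
  "regular_nbhd f z U \<longleftrightarrow>
     openin riemann_sphere U \<and> z 0 \<in> U \<and> (\<exists>N. univalent_from f z U N)"

definition regular_points :: "(csphere \<Rightarrow> csphere) \<Rightarrow> (nat \<Rightarrow> csphere) set" where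
  "regular_points f = {z \<in> natural_extension f. \<exists>U. regular_nbhd f z U}"

definition leaves :: "(csphere \<Rightarrow> csphere) \<Rightarrow> (nat \<Rightarrow> csphere) set set" where
  "leaves f = path_components_of (subtopology (natural_extension_topology f) (regular_points f))"

text \<open>The intrinsic Riemann surface structure of a leaf. A plaque consists of the backward orbits
  that follow the pull-backs of \<open>U\<close> along \<open>z\<close>; the plaques form a basis of the leaf topology,
  which is in general finer than the one induced by the natural extension. If the
  pull-backs are univalent from depth \<open>N\<close> on, then \<open>w \<mapsto> w\<^sub>-\<^sub>N\<close> maps the plaque bijectively onto the
  depth \<open>N\<close> pull-back, and composing with a chart of the sphere gives a chart of the leaf.\<close>

definition plaque ::
  "(csphere \<Rightarrow> csphere) \<Rightarrow> (nat \<Rightarrow> csphere) \<Rightarrow> csphere set \<Rightarrow> (nat \<Rightarrow> csphere) set" where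
  "plaque f z U = {w \<in> natural_extension f. \<forall>n. w n \<in> pullback f z U n}"

definition leaf_topology ::
  "(csphere \<Rightarrow> csphere) \<Rightarrow> (nat \<Rightarrow> csphere) set \<Rightarrow> (nat \<Rightarrow> csphere) topology" where
  "leaf_topology f L =
     subtopology
       (topology_generated_by
          {plaque f z U |z U. z \<in> natural_extension f \<and> regular_nbhd f z U}) L"

definition leaf_charts ::
  "(csphere \<Rightarrow> csphere) \<Rightarrow> (nat \<Rightarrow> csphere) set \<Rightarrow> (nat \<Rightarrow> csphere) chart set" where
  "leaf_charts f L =
     {(plaque f z U, \<lambda>w. x (w N)) |z U N V x.
        z \<in> L \<and> regular_nbhd f z U \<and> univalent_from f z U N \<and>
        (V, x) \<in> sphere_charts \<and> pullback f z U N \<subseteq> V}"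

definition leaf_uniformization ::
  "(csphere \<Rightarrow> csphere) \<Rightarrow> (nat \<Rightarrow> csphere) set \<Rightarrow> (complex \<Rightarrow> nat \<Rightarrow> csphere) \<Rightarrow> bool" where
  "leaf_uniformization f L \<phi> \<longleftrightarrow>
     conformal_isomorphism euclidean plane_charts (leaf_topology f L) (leaf_charts f L) \<phi>"

definition affine_part :: "(csphere \<Rightarrow> csphere) \<Rightarrow> (nat \<Rightarrow> csphere) set" where
  "affine_part f = \<Union> {L \<in> leaves f. \<exists>\<phi>. leaf_uniformization f L \<phi>}"


section \<open>The universal space of meromorphic functions\<close>

text \<open>Meromorphic functions as maps into the sphere, with value infinity at the poles.\<close>

definition mero_space :: "(complex \<Rightarrow> csphere) set" where
  "mero_space =
     {\<psi>. \<not> \<psi> constant_on UNIV \<and>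
         (\<exists>g. g nicely_meromorphic_on UNIV \<and>
              \<psi> = (\<lambda>z. if is_pole g z then None else Some (g z)))}"

definition mero_topology :: "(complex \<Rightarrow> csphere) topology" where
  "mero_topology = topology (\<lambda>W. W \<subseteq> mero_space \<and>
     (\<forall>\<psi>\<in>W. \<exists>K e. compact K \<and> e > 0 \<and>
        {\<xi> \<in> mero_space. \<forall>z\<in>K. chordal (\<psi> z) (\<xi> z) < e} \<subseteq> W))"

lemma openin_mero_topology:
  "openin mero_topology W \<longleftrightarrow> W \<subseteq> mero_space \<and>
     (\<forall>\<psi>\<in>W. \<exists>K e. compact K \<and> e > 0 \<and>
        {\<xi> \<in> mero_space. \<forall>z\<in>K. chordal (\<psi> z) (\<xi> z) < e} \<subseteq> W)" (is "_ \<longleftrightarrow> ?P W")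
proof -
  have "istopology ?P"
    unfolding istopology_def
  proof (rule conjI; intro allI impI)
    fix S T assume S: "?P S" and T: "?P T"
    show "?P (S \<inter> T)"
    proof (intro conjI ballI)
      show "S \<inter> T \<subseteq> mero_space" using S by blast
    next
      fix \<psi> assume \<psi>: "\<psi> \<in> S \<inter> T"
      obtain K e where K: "compact K" "e > 0"
        "{\<xi> \<in> mero_space. \<forall>z\<in>K. chordal (\<psi> z) (\<xi> z) < e} \<subseteq> S"
        using S \<psi> by blast
      obtain K' e' where K': "compact K'" "e' > 0"
        "{\<xi> \<in> mero_space. \<forall>z\<in>K'. chordal (\<psi> z) (\<xi> z) < e'} \<subseteq> T"
        using T \<psi> by blast
      show "\<exists>K e. compact K \<and> e > 0 \<and>
          {\<xi> \<in> mero_space. \<forall>z\<in>K. chordal (\<psi> z) (\<xi> z) < e} \<subseteq> S \<inter> T"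
        using K K' by (intro exI[of _ "K \<union> K'"] exI[of _ "min e e'"]) auto
    qed
  next
    fix \<K> assume *: "\<forall>S\<in>\<K>. ?P S"
    show "?P (\<Union>\<K>)"
    proof (intro conjI ballI)
      show "\<Union>\<K> \<subseteq> mero_space" using * by blast
    next
      fix \<psi> assume "\<psi> \<in> \<Union>\<K>"
      then obtain S where "S \<in> \<K>" "\<psi> \<in> S" by blast
      with * show "\<exists>K e. compact K \<and> e > 0 \<and>
          {\<xi> \<in> mero_space. \<forall>z\<in>K. chordal (\<psi> z) (\<xi> z) < e} \<subseteq> \<Union>\<K>"
        by (meson Union_upper order_trans)
    qed
  qed
  then show ?thesis by (simp add: mero_topology_def)
qed

lemma topspace_mero_topology [simp]: "topspace mero_topology = mero_space"
proof
  show "topspace mero_topology \<subseteq> mero_space"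
    using openin_mero_topology openin_topspace by blast
  have "openin mero_topology mero_space"
    by (auto simp: openin_mero_topology intro!: exI[of _ "{}"] exI[of _ "1::real"])
  then show "mero_space \<subseteq> topspace mero_topology" by (rule openin_subset)
qed

lemma limitin_mero_topology:
  "limitin mero_topology \<sigma> \<psi> F \<longleftrightarrow>
     \<psi> \<in> mero_space \<and> (\<forall>\<^sub>F k in F. \<sigma> k \<in> mero_space) \<and>
     (\<forall>K. compact K \<longrightarrow> uniform_limit K (\<lambda>k z. stereo (\<sigma> k z)) (\<lambda>z. stereo (\<psi> z)) F)"
  (is "?L \<longleftrightarrow> ?R")
proof
  assume L: ?L
  then have \<psi>: "\<psi> \<in> mero_space" by (simp add: limitin_def)
  have ev: "\<forall>\<^sub>F k in F. \<sigma> k \<in> mero_space"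
    using L \<psi> openin_topspace[of mero_topology] by (auto simp: limitin_def)
  have "uniform_limit K (\<lambda>k z. stereo (\<sigma> k z)) (\<lambda>z. stereo (\<psi> z)) F" if K: "compact K" for K
  proof (rule uniform_limitI)
    fix e :: real assume e: "e > 0"
    define V where "V = {\<xi> \<in> mero_space. \<exists>e'<e. \<forall>z\<in>K. chordal (\<psi> z) (\<xi> z) \<le> e'}"
    have "openin mero_topology V"
      unfolding openin_mero_topology
    proof (intro conjI ballI)
      fix \<xi> assume "\<xi> \<in> V"
      then obtain e' where e': "e' < e" "\<forall>z\<in>K. chordal (\<psi> z) (\<xi> z) \<le> e'"
        by (auto simp: V_def)
      have "{\<eta> \<in> mero_space. \<forall>z\<in>K. chordal (\<xi> z) (\<eta> z) < (e - e') / 2} \<subseteq> V"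
      proof clarify
        fix \<eta> assume \<eta>: "\<eta> \<in> mero_space" "\<forall>z\<in>K. chordal (\<xi> z) (\<eta> z) < (e - e') / 2"
        have "chordal (\<psi> z) (\<eta> z) \<le> e' + (e - e') / 2" if "z \<in> K" for z
        proof -
          have "chordal (\<psi> z) (\<eta> z) \<le> chordal (\<psi> z) (\<xi> z) + chordal (\<xi> z) (\<eta> z)"
            unfolding chordal_def by (rule dist_triangle)
          moreover have "chordal (\<psi> z) (\<xi> z) \<le> e'" "chordal (\<xi> z) (\<eta> z) < (e - e') / 2"
            using that e' \<eta> by auto
          ultimately show ?thesis by linarith
        qed
        moreover have "e' + (e - e') / 2 < e" using e' by (simp add: field_simps)
        ultimately show "\<eta> \<in> V" using \<eta> by (auto simp: V_def)
      qed
      then show "\<exists>K e. compact K \<and> e > 0 \<and>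
          {\<eta> \<in> mero_space. \<forall>z\<in>K. chordal (\<xi> z) (\<eta> z) < e} \<subseteq> V"
        using K e' by (intro exI[of _ K] exI[of _ "(e - e') / 2"]) simp
    qed (auto simp: V_def)
    moreover have "\<psi> \<in> V" using \<psi> e by (auto simp: V_def chordal_def)
    ultimately have "\<forall>\<^sub>F k in F. \<sigma> k \<in> V" using L by (auto simp: limitin_def)
    then show "\<forall>\<^sub>F k in F. \<forall>z\<in>K. dist (stereo (\<sigma> k z)) (stereo (\<psi> z)) < e"
      by (rule eventually_mono) (force simp: V_def chordal_def dist_commute)
  qed
  with \<psi> ev show ?R by blast
next
  assume R: ?R
  show ?L
    unfolding limitin_def
  proof (intro conjI allI impI)
    fix W assume W: "openin mero_topology W \<and> \<psi> \<in> W"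
    then obtain K e where K: "compact K" "e > 0"
      "{\<xi> \<in> mero_space. \<forall>z\<in>K. chordal (\<psi> z) (\<xi> z) < e} \<subseteq> W"
      unfolding openin_mero_topology by blast
    have "\<forall>\<^sub>F k in F. \<forall>z\<in>K. dist (stereo (\<sigma> k z)) (stereo (\<psi> z)) < e"
      using R K uniform_limitD by blast
    moreover have "\<forall>\<^sub>F k in F. \<sigma> k \<in> mero_space" using R by blast
    ultimately show "\<forall>\<^sub>F k in F. \<sigma> k \<in> W"
    proof eventually_elim
      case (elim k)
      with K(3) show ?case by (auto simp: chordal_def dist_commute)
    qed
  qed (use R in simp)
qed

definition K_space :: "(csphere \<Rightarrow> csphere) \<Rightarrow> (complex \<Rightarrow> csphere) set" where
  "K_space f = (\<Inter>n. {(f ^^ n) \<circ> \<psi> |\<psi>. \<psi> \<in> mero_space})"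

definition K_hat :: "(csphere \<Rightarrow> csphere) \<Rightarrow> (nat \<Rightarrow> complex \<Rightarrow> csphere) set" where
  "K_hat f = {\<psi>. (\<forall>n. \<psi> n \<in> mero_space) \<and> \<psi> 0 \<in> K_space f \<and> (\<forall>n. f \<circ> \<psi> (Suc n) = \<psi> n)}"

definition K_hat_topology :: "(csphere \<Rightarrow> csphere) \<Rightarrow> (nat \<Rightarrow> complex \<Rightarrow> csphere) topology" where
  "K_hat_topology f = subtopology (product_topology (\<lambda>_. mero_topology) UNIV) (K_hat f)"

lemma topspace_K_hat_topology [simp]: "topspace (K_hat_topology f) = K_hat f"
  by (auto simp: K_hat_topology_def K_hat_def)

definition affine_rel ::
  "(csphere \<Rightarrow> csphere) \<Rightarrow> ((nat \<Rightarrow> complex \<Rightarrow> csphere) \<times> (nat \<Rightarrow> complex \<Rightarrow> csphere)) set" where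
  "affine_rel f =
     {(\<psi>, \<psi>'). \<psi> \<in> K_hat f \<and> \<psi>' \<in> K_hat f \<and> (\<exists>b. b \<noteq> 0 \<and> (\<forall>n w. \<psi> n w = \<psi>' n (b * w)))}"

lemma equiv_affine_rel: "equiv (K_hat f) (affine_rel f)"
proof (rule equivI)
  show "affine_rel f \<subseteq> K_hat f \<times> K_hat f" by (auto simp: affine_rel_def)
  show "refl_on (K_hat f) (affine_rel f)"
    by (auto simp: refl_on_def affine_rel_def intro!: exI[of _ 1])
  show "sym (affine_rel f)"
  proof (rule symI)
    fix x y assume "(x, y) \<in> affine_rel f"
    then obtain b where b: "b \<noteq> 0" "\<And>n w. x n w = y n (b * w)" "x \<in> K_hat f" "y \<in> K_hat f"
      by (auto simp: affine_rel_def)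
    then have "y n w = x n (inverse b * w)" for n w by (simp add: mult.assoc[symmetric])
    with b show "(y, x) \<in> affine_rel f"
      unfolding affine_rel_def using nonzero_imp_inverse_nonzero by blast
  qed
  show "trans (affine_rel f)"
  proof (rule transI)
    fix x y z assume "(x, y) \<in> affine_rel f" "(y, z) \<in> affine_rel f"
    then obtain b c where "b \<noteq> 0" "c \<noteq> 0" "\<And>n w. x n w = y n (b * w)"
      "\<And>n w. y n w = z n (c * w)" "x \<in> K_hat f" "z \<in> K_hat f"
      by (auto simp: affine_rel_def)
    then show "(x, z) \<in> affine_rel f"
      by (auto simp: affine_rel_def intro!: exI[of _ "c * b"] simp: mult.assoc)
  qed
qed

definition quotient_topology :: "'a topology \<Rightarrow> ('a \<times> 'a) set \<Rightarrow> 'a set topology" where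
  "quotient_topology X R = topology (\<lambda>V. V \<subseteq> topspace X // R \<and>
     openin X {x \<in> topspace X. R `` {x} \<in> V})"

lemma openin_quotient_topology:
  "openin (quotient_topology X R) V \<longleftrightarrow>
     V \<subseteq> topspace X // R \<and> openin X {x \<in> topspace X. R `` {x} \<in> V}" (is "_ \<longleftrightarrow> ?P V")
proof -
  have "istopology ?P"
    unfolding istopology_def
  proof (rule conjI; intro allI impI)
    fix S T assume S: "?P S" and T: "?P T"
    have eq: "{x \<in> topspace X. R `` {x} \<in> S \<inter> T} =
        {x \<in> topspace X. R `` {x} \<in> S} \<inter> {x \<in> topspace X. R `` {x} \<in> T}" by blast
    have "openin X {x \<in> topspace X. R `` {x} \<in> S \<inter> T}"
      unfolding eq using S T by (blast intro: openin_Int)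
    then show "?P (S \<inter> T)" using S by blast
  next
    fix \<K> assume *: "\<forall>S\<in>\<K>. ?P S"
    have eq: "{x \<in> topspace X. R `` {x} \<in> \<Union>\<K>} = (\<Union>S\<in>\<K>. {x \<in> topspace X. R `` {x} \<in> S})"
      by blast
    have "openin X {x \<in> topspace X. R `` {x} \<in> \<Union>\<K>}"
      unfolding eq using * by (blast intro: openin_Union)
    then show "?P (\<Union>\<K>)" using * by blast
  qed
  then show ?thesis by (simp add: quotient_topology_def)
qed

lemma topspace_quotient_topology [simp]:
  "topspace (quotient_topology X R) = topspace X // R"
proof
  show "topspace (quotient_topology X R) \<subseteq> topspace X // R"
    using openin_quotient_topology openin_topspace by blast
  have "{x \<in> topspace X. R `` {x} \<in> topspace X // R} = topspace X"
    by (auto simp: quotient_def)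
  then have "openin (quotient_topology X R) (topspace X // R)"
    by (simp add: openin_quotient_topology)
  then show "topspace X // R \<subseteq> topspace (quotient_topology X R)" by (rule openin_subset)
qed

lemma quotient_map_quotient_topology:
  "quotient_map X (quotient_topology X R) (\<lambda>x. R `` {x})"
  by (auto simp: quotient_map_def openin_quotient_topology quotient_def)

definition K_hat_affine ::
  "(csphere \<Rightarrow> csphere) \<Rightarrow> (nat \<Rightarrow> complex \<Rightarrow> csphere) set topology" where
  "K_hat_affine f = quotient_topology (K_hat_topology f) (affine_rel f)"


section \<open>The affine lamination\<close>

text \<open>The choice of \<open>\<phi>\<close> is immaterial: two choices differ by a map \<open>w \<mapsto> b w\<close>.\<close>

definition iota ::
  "(csphere \<Rightarrow> csphere) \<Rightarrow> (nat \<Rightarrow> csphere) \<Rightarrow> (nat \<Rightarrow> complex \<Rightarrow> csphere) set" where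
  "iota f z =
     (let L = (THE L. L \<in> leaves f \<and> z \<in> L);
          \<phi> = (SOME \<phi>. leaf_uniformization f L \<phi> \<and> \<phi> 0 = z)
      in affine_rel f `` {\<lambda>N w. nat_proj ((fhat_inv f ^^ N) (\<phi> w))})"

definition affine_leaves ::
  "(csphere \<Rightarrow> csphere) \<Rightarrow> (nat \<Rightarrow> complex \<Rightarrow> csphere) set set" where
  "affine_leaves f = iota f ` affine_part f"

definition affine_lamination ::
  "(csphere \<Rightarrow> csphere) \<Rightarrow> (nat \<Rightarrow> complex \<Rightarrow> csphere) set set" where
  "affine_lamination f = K_hat_affine f closure_of (iota f ` affine_part f)"

end

(*
  Call an element psi of K_hat injective if w |-> (psi_n w)_n is. The classes in iota (A^n) are
  exactly the classes of injective elements, so one has to show that injectivity passes to limits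
  in K_hat. Let psi^k converge to psi. Montel's theorem, with omitted values taken from the
  backward orbit of a fixed point, makes all components psi^k_n equicontinuous, uniformly in n.
  Since psi^k_n hits the Julia set in a fixed ball, a non-constant limit as n tends to infinity would make the iterates of f equicontinuous near a Julia point; so
  the images of a ball under psi^k_n shrink to the Julia set. Expansiveness makes f uniformly
  locally injective there, so for large n and all large k, psi^k_n identifies two points of the
  ball only if psi^k does, and Hurwitz's theorem gives injectivity of psi.

  An injective psi parametrises a whole leaf: its image is a union of plaques, because by a weak
  Koebe theorem a plaque meeting the image cannot leave it. Conversely a uniformisation of a leaf
  has components in K_hat, and two uniformisations with the same base point differ by an injective
  entire function fixing 0, which is linear.
*)

theory Submission
  imports Defs "HOL-Computational_Algebra.Fundamental_Theorem_Algebra"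
begin

section \<open>Charts of the sphere and the chordal metric\<close>

text \<open>Convergence in \<open>K_hat f\<close> controls each component separately, with no
  uniformity in the depth \<open>n\<close>, whereas injectivity of a backward orbit of maps may
  become visible only at depths that grow along the sequence. The proof is organised around finding
  one depth that serves all late terms. The choice of omitted values makes this possible: if
  \<open>y0\<close> is a second preimage of a fixed point \<open>x0\<close>, a point that reaches
  \<open>y0\<close> after \<open>i\<close> steps lies over \<open>x0\<close> at every depth beyond
  \<open>i\<close>. So one finite set of points is available at all large depths, and locally it is
  hit at most as often as the depth-0 maps take the value \<open>x0\<close>. Such a fixed point is
  found by algebra on polynomials. The estimates on omitted values and on injective functions
  descend from Schottky's theorem, hence the huge but harmless constants. Closedness is proved as
  openness of the set of non-injective elements, which is saturated because injectivity survives a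
  rescaling of the variable. Maps into the sphere are treated through two charts, exchanged by the
  chordal isometry \<open>z |-> 1/z\<close>.\<close>

definition sinv :: "csphere \<Rightarrow> csphere" where
  "sinv x = (case x of None \<Rightarrow> Some 0 | Some z \<Rightarrow> if z = 0 then None else Some (inverse z))"

text \<open>A Boolean selects one of the two charts. Since \<open>flip b\<close> is an involution,
  one map serves as chart and as inverse chart: a point is written
  \<open>flip b (Some z)\<close>.\<close>

definition flip :: "bool \<Rightarrow> csphere \<Rightarrow> csphere" where
  "flip b x = (if b then sinv x else x)"

lemma sinv_simps [simp]:
  "sinv None = Some 0" "sinv (Some 0) = None" "z \<noteq> 0 \<Longrightarrow> sinv (Some z) = Some (inverse z)"
  by (auto simp: sinv_def)

lemma sinv_sinv [simp]: "sinv (sinv x) = x"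
  by (auto simp: sinv_def split: option.splits)

lemma flip_flip [simp]: "flip b (flip b x) = x"
  by (simp add: flip_def)

lemma flip_eq_iff [simp]: "flip b x = flip b y \<longleftrightarrow> x = y"
  by (metis flip_flip)

lemma flip_simps [simp]: "flip False x = x" "flip True x = sinv x"
  by (simp_all add: flip_def)

lemma chordal_commute: "chordal x y = chordal y x"
  by (simp add: chordal_def dist_commute)

lemma chordal_triangle: "chordal x z \<le> chordal x y + chordal y z"
  by (simp add: chordal_def dist_triangle)

lemma chordal_nonneg [simp]: "0 \<le> chordal x y"
  by (simp add: chordal_def)

lemma chordal_eq_0_iff [simp]: "chordal x y = 0 \<longleftrightarrow> x = y"
  using inj_stereo by (auto simp: chordal_def inj_def)

lemma chordal_self [simp]: "chordal x x = 0"
  by simp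

lemma chordal_pos_iff: "0 < chordal x y \<longleftrightarrow> x \<noteq> y"
  using chordal_eq_0_iff[of x y] chordal_nonneg[of x y] by linarith

text \<open>Inversion is the half-turn of the unit sphere about the real axis, hence a chordal
  isometry; this makes every estimate transferable between the charts.\<close>

lemma stereo_sinv: "stereo (sinv x) = (cnj (fst (stereo x)), - snd (stereo x))"
proof (cases x)
  case (Some z)
  show ?thesis
  proof (cases "z = 0")
    case False
    define A where "A = (cmod z)\<^sup>2"
    have A: "A > 0" using False by (simp add: A_def)
    have zz: "complex_of_real A = z * cnj z" using complex_norm_square[of z] by (simp add: A_def)
    have iA: "(cmod (inverse z))\<^sup>2 = 1 / A" by (simp add: A_def norm_inverse power_inverse divide_inverse)
    have r: "2 / (1 + 1 / A) = 2 * A / (1 + A)" using A by (simp add: field_simps)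
    have "complex_of_real (2 / (1 + 1 / A)) * inverse z = of_real (2 / (1 + A)) * (of_real A * inverse z)"
      unfolding r by simp
    also have "of_real A * inverse z = cnj z" using False by (simp add: zz)
    finally have 1: "complex_of_real (2 / (1 + 1 / A)) * inverse z = of_real (2 / (1 + A)) * cnj z" .
    have 2: "(1 / A - 1) / (1 / A + 1) = - ((A - 1) / (A + 1))"
    proof -
      have "1 / A - 1 = (1 - A) / A" "1 / A + 1 = (A + 1) / A" using A by (simp_all add: field_simps)
      then have "(1 / A - 1) / (1 / A + 1) = (1 - A) / (A + 1)" using A by simp
      then show ?thesis by (metis minus_diff_eq minus_divide_left)
    qed
    have 3: "stereo (sinv (Some z)) = (of_real (2 / (1 + 1 / A)) * inverse z, (1 / A - 1) / (1 / A + 1))"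
      by (simp only: sinv_simps(3)[OF False] stereo_def option.case iA)
    have 4: "stereo (Some z) = (of_real (2 / (1 + A)) * z, (A - 1) / (A + 1))"
      by (simp only: stereo_def option.case A_def)
    show ?thesis
      unfolding Some 3 4 1 2 fst_conv snd_conv complex_cnj_mult complex_cnj_complex_of_real ..
  qed (simp add: Some stereo_def)
qed (simp add: stereo_def)

lemma chordal_sinv [simp]: "chordal (sinv x) (sinv y) = chordal x y"
proof -
  have "dist (cnj a) (cnj b) = dist a b" for a b :: complex
    by (metis complex_cnj_diff complex_mod_cnj dist_norm)
  then show ?thesis
    by (simp add: chordal_def stereo_sinv dist_prod_def dist_minus)
qed

lemma chordal_flip [simp]: "chordal (flip b x) (flip b y) = chordal x y"
  by (simp add: flip_def)

lemma chordal_flip_left: "chordal (flip b x) y = chordal x (flip b y)"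
  by (metis chordal_flip flip_flip)

lemma chordal_Some_Some:
  "(chordal (Some z) (Some w))\<^sup>2 = 4 * (cmod (z - w))\<^sup>2 / ((1 + (cmod z)\<^sup>2) * (1 + (cmod w)\<^sup>2))"
proof -
  define A B where "A = 1 + (cmod z)\<^sup>2" and "B = 1 + (cmod w)\<^sup>2"
  have AB: "A > 0" "B > 0" by (simp_all add: A_def B_def add_pos_nonneg)
  define R where "R = Re z * Re w + Im z * Im w"
  have nz: "(Re z)\<^sup>2 + (Im z)\<^sup>2 = A - 1" by (simp add: A_def cmod_power2)
  have nw: "(Re w)\<^sup>2 + (Im w)\<^sup>2 = B - 1" by (simp add: B_def cmod_power2)
  \<comment> \<open>The expansion for arbitrary real weights is needed twice: with the stereographic
    factors \<open>2 / A\<close>, \<open>2 / B\<close>, and with both weights equal to 1.\<close>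
  have c: "(cmod (of_real s * z - of_real t * w))\<^sup>2 = s\<^sup>2 * (A - 1) + t\<^sup>2 * (B - 1) - 2 * s * t * R" for s t :: real
    unfolding nz[symmetric] nw[symmetric] R_def cmod_power2 by (simp add: power2_eq_square algebra_simps)
  have zw: "(cmod (z - w))\<^sup>2 = A + B - 2 - 2 * R"
    using c[of 1 1] by simp
  have "(a - 1) / (a + 1) = 1 - 2 / (1 + a)" if "1 + a > 0" for a :: real
    using that by (simp add: field_simps)
  then have h: "((cmod z)\<^sup>2 - 1) / ((cmod z)\<^sup>2 + 1) = 1 - 2 / A" "((cmod w)\<^sup>2 - 1) / ((cmod w)\<^sup>2 + 1) = 1 - 2 / B"
    using AB by (simp_all add: A_def B_def)
  have "(chordal (Some z) (Some w))\<^sup>2 = (cmod (of_real (2 / A) * z - of_real (2 / B) * w))\<^sup>2 + (2 / B - 2 / A)\<^sup>2"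
    unfolding chordal_def stereo_def option.case dist_prod_def h A_def[symmetric] B_def[symmetric]
    by (simp add: dist_norm)
  also have "\<dots> = (2 / A)\<^sup>2 * (A - 1) + (2 / B)\<^sup>2 * (B - 1) - 2 * (2 / A) * (2 / B) * R + (2 / B - 2 / A)\<^sup>2"
    by (simp only: c)
  also have "\<dots> = 4 * (A + B - 2 - 2 * R) / (A * B)"
    using AB by (simp add: field_simps power2_eq_square)
  finally show ?thesis by (simp add: zw A_def B_def)
qed

lemma chordal_Some_None: "(chordal (Some z) None)\<^sup>2 = 4 / (1 + (cmod z)\<^sup>2)"
proof (cases "z = 0")
  case True
  then show ?thesis by (simp add: chordal_def stereo_def dist_prod_def dist_norm)
next
  case False
  have "(chordal (Some z) None)\<^sup>2 = (chordal (sinv (Some z)) (sinv None))\<^sup>2" by (simp only: chordal_sinv)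
  also have "\<dots> = 4 * (cmod (inverse z))\<^sup>2 / (1 + (cmod (inverse z))\<^sup>2)"
    using False by (simp add: chordal_Some_Some del: chordal_sinv)
  also have "\<dots> = 4 / (1 + (cmod z)\<^sup>2)"
  proof -
    have "4 * (1 / A) / (1 + 1 / A) = 4 / (1 + A)" if "A > 0" for A :: real
      using that by (simp add: divide_simps)
    moreover have "(cmod (inverse z))\<^sup>2 = 1 / (cmod z)\<^sup>2" "(cmod z)\<^sup>2 > 0"
      using False by (simp_all add: norm_inverse power_inverse divide_inverse)
    ultimately show ?thesis by presburger
  qed
  finally show ?thesis .
qed

lemma chordal_le: "chordal (Some z) (Some w) \<le> 2 * cmod (z - w)"
proof -
  have "1 \<le> (1 + (cmod z)\<^sup>2) * (1 + (cmod w)\<^sup>2)"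
    by (simp add: algebra_simps)
  then have "4 * (cmod (z - w))\<^sup>2 / ((1 + (cmod z)\<^sup>2) * (1 + (cmod w)\<^sup>2)) \<le> 4 * (cmod (z - w))\<^sup>2"
    by (auto intro!: divide_le_eq[THEN iffD2] mult_le_cancel_left1[THEN iffD2] simp: )
  then have "(chordal (Some z) (Some w))\<^sup>2 \<le> (2 * cmod (z - w))\<^sup>2"
    by (simp add: chordal_Some_Some power_mult_distrib)
  then show ?thesis by (rule power2_le_imp_le) simp
qed

text \<open>On the disc of radius \<open>M\<close> the denominator in the chordal formula is at most
  \<open>(1 + M\<^sup>2)\<^sup>2\<close>; the factor 4 is given away.\<close>

lemma dist_le_chordal:
  assumes "cmod z \<le> M" "cmod w \<le> M"
  shows "cmod (z - w) \<le> (1 + M\<^sup>2) * chordal (Some z) (Some w)"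
proof -
  have M: "(cmod z)\<^sup>2 \<le> M\<^sup>2" "(cmod w)\<^sup>2 \<le> M\<^sup>2" using assms by (simp_all add: power_mono)
  define P where "P = (1 + (cmod z)\<^sup>2) * (1 + (cmod w)\<^sup>2)"
  have P: "P > 0" "P \<le> (1 + M\<^sup>2)\<^sup>2"
    using M by (auto simp: P_def power2_eq_square[of "1 + M\<^sup>2"] add_pos_nonneg intro!: mult_mono)
  have "(cmod (z - w))\<^sup>2 \<le> 4 * (cmod (z - w))\<^sup>2" by simp
  also have "\<dots> = P * (chordal (Some z) (Some w))\<^sup>2"
    using P by (simp add: chordal_Some_Some P_def[symmetric])
  also have "\<dots> \<le> (1 + M\<^sup>2)\<^sup>2 * (chordal (Some z) (Some w))\<^sup>2"
    using P by (intro mult_right_mono) auto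
  finally have "(cmod (z - w))\<^sup>2 \<le> ((1 + M\<^sup>2) * chordal (Some z) (Some w))\<^sup>2"
    by (simp add: power_mult_distrib)
  then show ?thesis by (rule power2_le_imp_le) simp
qed

lemma chordal_None_ge:
  assumes "e \<le> chordal x None" "e > 0"
  obtains z where "x = Some z" "cmod z \<le> 2 / e"
proof (cases x)
  case None
  then show ?thesis using assms by simp
next
  case (Some z)
  have "e\<^sup>2 \<le> 4 / (1 + (cmod z)\<^sup>2)"
    using assms Some by (metis chordal_Some_None power_mono less_eq_real_def)
  then have "e\<^sup>2 * (1 + (cmod z)\<^sup>2) \<le> 4" by (simp add: le_divide_eq add_pos_nonneg)
  then have "e\<^sup>2 * (cmod z)\<^sup>2 \<le> 4"
    unfolding distrib_left using zero_le_power2[of e] by linarith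
  then have "(e * cmod z)\<^sup>2 \<le> 2\<^sup>2"
    by (simp add: power_mult_distrib)
  then have "e * cmod z \<le> 2" by (rule power2_le_imp_le) simp
  then have "cmod z \<le> 2 / e" using assms by (simp add: field_simps)
  then show ?thesis using Some that by blast
qed

text \<open>The closed unit discs of the two charts cover the sphere. The bound 1 makes the
  constants of chart estimates independent of the point.\<close>

lemma flip_chart:
  obtains b z where "flip b x = Some z" "cmod z \<le> 1"
proof (cases x)
  case None
  then show ?thesis using that[of True 0] by simp
next
  case (Some z)
  show ?thesis
  proof (cases "cmod z \<le> 1")
    case False
    then have "z \<noteq> 0" by auto
    then show ?thesis using that[of True "inverse z"] False Some by (simp add: norm_inverse inverse_le_1_iff)
  qed (use Some that[of False] in auto)
qed

lemma continuous_on_stereo_flip: "continuous_on S (\<lambda>z. stereo (flip b (Some z)))"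
proof (rule continuous_on_subset[OF _ subset_UNIV])
  show "continuous_on UNIV (\<lambda>z. stereo (flip b (Some z)))"
    unfolding continuous_on_iff
  proof (intro ballI allI impI)
    fix z and e :: real assume "e > 0"
    have "dist (stereo (flip b (Some w))) (stereo (flip b (Some z))) \<le> 2 * dist w z" for w
      using chordal_le[of w z] by (metis chordal_def chordal_flip dist_norm)
    with \<open>e > 0\<close> show "\<exists>d>0. \<forall>w\<in>UNIV. dist w z < d \<longrightarrow> dist (stereo (flip b (Some w))) (stereo (flip b (Some z))) < e"
      by (intro exI[of _ "e / 2"]) (force intro: le_less_trans)
  qed
qed

section \<open>Compactness and topology of the sphere in stereographic coordinates\<close>

lemma compact_range_stereo: "compact (range stereo)"
proof -
  let ?T = "\<lambda>b. (\<lambda>z. stereo (flip b (Some z))) ` cball 0 1"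
  have "compact (?T True \<union> ?T False)"
    by (intro compact_Un compact_continuous_image continuous_on_stereo_flip) auto
  moreover have "?T True \<union> ?T False = range stereo"
  proof
    show "range stereo \<subseteq> ?T True \<union> ?T False"
    proof (intro subsetI UnCI)
      fix p assume "p \<in> range stereo" and n: "p \<notin> ?T False"
      then obtain x where [simp]: "p = stereo x" by blast
      obtain b z where bz: "flip b x = Some z" "cmod z \<le> 1" using flip_chart by blast
      then have "x = flip b (Some z)" by (metis flip_flip)
      moreover have "z \<in> cball 0 1" using bz by simp
      ultimately show "p \<in> ?T True" using n by (cases b) auto
    qed
  qed blast
  ultimately show ?thesis by metis
qed

lemma chordal_compact:
  fixes x :: "nat \<Rightarrow> csphere"
  obtains r l where "strict_mono (r :: nat \<Rightarrow> nat)" "\<And>e. e > 0 \<Longrightarrow> \<exists>N. \<forall>n\<ge>N. chordal (x (r n)) l < e"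
proof -
  obtain p r where p: "p \<in> range stereo" "strict_mono (r :: nat \<Rightarrow> nat)" "((\<lambda>n. stereo (x n)) \<circ> r) \<longlonglongrightarrow> p"
    using compact_range_stereo unfolding compact_def by (metis rangeI)
  then obtain l where "p = stereo l" by blast
  with p that show ?thesis by (auto simp: lim_sequentially chordal_def)
qed

lemma stereo_bounded: "norm (stereo x) \<le> 1"
proof (cases x)
  case (Some z)
  define A where "A = (cmod z)\<^sup>2"
  have A: "A \<ge> 0" by (simp add: A_def)
  have "(2 / (1 + A))\<^sup>2 * A + ((A - 1) / (A + 1))\<^sup>2 = 1"
    using A by (simp add: divide_simps) (simp add: algebra_simps power2_eq_square)
  moreover have "norm (stereo x) = sqrt ((2 / (1 + A))\<^sup>2 * A + ((A - 1) / (A + 1))\<^sup>2)"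
    using A unfolding Some stereo_def option.case A_def[symmetric] norm_prod_def
    by (simp add: norm_mult norm_divide power_mult_distrib power_divide A_def[symmetric] del: of_real_add)
  ultimately show ?thesis by simp
qed (simp add: stereo_def)

lemma topspace_riemann_sphere [simp]: "topspace riemann_sphere = UNIV"
  by (auto simp: riemann_sphere_def) (metis not_None_eq rangeI)

lemma openin_riemann_sphere_stereo:
  "openin riemann_sphere S \<longleftrightarrow> (\<exists>T. open T \<and> S = stereo -` T)"
proof
  assume "openin riemann_sphere S"
  then obtain e where e: "\<And>x. x \<in> S \<Longrightarrow> e x > 0" "\<And>x y. x \<in> S \<Longrightarrow> chordal x y < e x \<Longrightarrow> y \<in> S"
    unfolding openin_riemann_sphere by metis
  have "S = stereo -` (\<Union>x\<in>S. ball (stereo x) (e x))"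
    using e by (force simp: chordal_def)
  moreover have "open (\<Union>x\<in>S. ball (stereo x) (e x))" by (intro open_UN ballI open_ball)
  ultimately show "\<exists>T. open T \<and> S = stereo -` T" by (intro exI conjI)
next
  assume "\<exists>T. open T \<and> S = stereo -` T"
  then obtain T where T: "open T" "S = stereo -` T" by blast
  then show "openin riemann_sphere S"
    unfolding openin_riemann_sphere chordal_def
    unfolding T(2)
  proof (intro ballI)
    fix x assume "x \<in> stereo -` T"
    then obtain e where "e > 0" "ball (stereo x) e \<subseteq> T" using T openE by blast
    then show "\<exists>e>0. \<forall>y. dist (stereo x) (stereo y) < e \<longrightarrow> y \<in> stereo -` T"
      by (intro exI[of _ e]) auto
  qed
qed

lemma continuous_map_riemann_sphere:
  "continuous_map X riemann_sphere g \<longleftrightarrow> continuous_map X euclidean (stereo \<circ> g)"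
proof
  have "continuous_map riemann_sphere euclidean stereo"
    by (auto simp: continuous_map_def openin_riemann_sphere_stereo vimage_def)
  then show "continuous_map X riemann_sphere g \<Longrightarrow> continuous_map X euclidean (stereo \<circ> g)"
    using continuous_map_compose by blast
next
  assume c: "continuous_map X euclidean (stereo \<circ> g)"
  show "continuous_map X riemann_sphere g"
    unfolding continuous_map_def
  proof (intro conjI allI impI)
    fix U assume "openin riemann_sphere U"
    then obtain T where T: "open T" "U = stereo -` T" by (auto simp: openin_riemann_sphere_stereo)
    have "{x \<in> topspace X. g x \<in> U} = {x \<in> topspace X. (stereo \<circ> g) x \<in> T}" using T by auto
    then show "openin X {x \<in> topspace X. g x \<in> U}"
      using openin_continuous_map_preimage[OF c, of T] T by simp
  qed simp
qed

lemma openin_chordal_ball: "openin riemann_sphere {y. chordal x y < e}"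
  unfolding openin_riemann_sphere
proof (clarsimp)
  fix y assume "chordal x y < e"
  then show "\<exists>d>0. \<forall>z. chordal y z < d \<longrightarrow> chordal x z < e"
    by (intro exI[of _ "e - chordal x y"]) (smt (verit) chordal_triangle)
qed

text \<open>Chordal uniform convergence, phrased through \<open>stereo\<close> so that theorems
  about \<open>uniform_limit\<close> apply to it directly.\<close>

definition uconv :: "complex set \<Rightarrow> (nat \<Rightarrow> complex \<Rightarrow> csphere) \<Rightarrow> (complex \<Rightarrow> csphere) \<Rightarrow> bool" where
  "uconv K F g \<longleftrightarrow> uniform_limit K (\<lambda>k z. stereo (F k z)) (\<lambda>z. stereo (g z)) sequentially"

lemma uconv_iff: "uconv K F g \<longleftrightarrow> (\<forall>e>0. \<exists>N. \<forall>k\<ge>N. \<forall>u\<in>K. chordal (F k u) (g u) < e)"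
  by (simp add: uconv_def uniform_limit_iff chordal_def eventually_sequentially)

lemma uconv_subset: "uconv K F g \<Longrightarrow> L \<subseteq> K \<Longrightarrow> uconv L F g"
  unfolding uconv_iff by blast

lemma uconv_const [simp]: "uconv K (\<lambda>k. g) g"
  by (simp add: uconv_iff)

section \<open>Holomorphic maps into the sphere\<close>

definition shol :: "(complex \<Rightarrow> csphere) \<Rightarrow> complex set \<Rightarrow> bool" where
  "shol \<psi> S \<longleftrightarrow> (\<forall>w\<in>S. \<exists>b h r. r > 0 \<and> h holomorphic_on ball w r \<and> (\<forall>u\<in>ball w r. \<psi> u = flip b (Some (h u))))"

lemma shol_subset: "shol \<psi> S \<Longrightarrow> T \<subseteq> S \<Longrightarrow> shol \<psi> T"
  unfolding shol_def by blast

lemma sholI: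
  assumes "h holomorphic_on S" "open S" "\<And>u. u \<in> S \<Longrightarrow> \<psi> u = flip b (Some (h u))"
  shows "shol \<psi> S"
  unfolding shol_def
proof
  fix w assume "w \<in> S"
  then obtain r where "r > 0" "ball w r \<subseteq> S" using assms(2) openE by blast
  then show "\<exists>b h r. r > 0 \<and> h holomorphic_on ball w r \<and> (\<forall>u\<in>ball w r. \<psi> u = flip b (Some (h u)))"
    using assms by (intro exI[of _ b] exI[of _ h] exI[of _ r]) (auto intro: holomorphic_on_subset)
qed

text \<open>The local representation comes in an unspecified chart. If it is the wrong one, its
  function is non-zero at \<open>w\<close>, because the value there is not the point at infinity of
  chart \<open>b\<close>, and its reciprocal represents the map in chart \<open>b\<close>.\<close>

lemma shol_chartE:
  assumes "shol \<psi> S" "w \<in> S" "flip b (\<psi> w) \<noteq> None"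
  obtains h r where "r > 0" "h holomorphic_on ball w r" "\<And>u. u \<in> ball w r \<Longrightarrow> flip b (\<psi> u) = Some (h u)"
proof -
  obtain b' h r where h: "r > 0" "h holomorphic_on ball w r" "\<And>u. u \<in> ball w r \<Longrightarrow> \<psi> u = flip b' (Some (h u))"
    using assms(1,2) unfolding shol_def by metis
  show ?thesis
  proof (cases "b = b'")
    case True
    then show ?thesis using h that by simp
  next
    case False
    then have *: "flip b (flip b' x) = sinv x" for x by (cases b; cases b') auto
    have "h w \<noteq> 0"
    proof
      assume "h w = 0"
      with h have "flip b (\<psi> w) = None" by (simp add: *)
      then show False using assms by simp
    qed
    then obtain e where e: "e > 0" "\<And>u. dist w u < e \<Longrightarrow> h u \<noteq> 0"
      using continuous_on_open_avoid[of "ball w r" h w 0] h(1,2) holomorphic_on_imp_continuous_on by auto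
    show ?thesis
    proof (rule that[of "min e r" "\<lambda>u. inverse (h u)"])
      show "(\<lambda>u. inverse (h u)) holomorphic_on ball w (min e r)"
        using h(2) e by (intro holomorphic_intros) (auto elim: holomorphic_on_subset)
      show "flip b (\<psi> u) = Some (inverse (h u))" if "u \<in> ball w (min e r)" for u
        using that h(3) e by (simp add: *)
    qed (use h e in auto)
  qed
qed

lemma shol_isCont:
  assumes "shol \<psi> S" "w \<in> S"
  shows "isCont (\<lambda>z. stereo (\<psi> z)) w"
proof -
  obtain b h r where h: "r > 0" "h holomorphic_on ball w r" "\<And>u. u \<in> ball w r \<Longrightarrow> \<psi> u = flip b (Some (h u))"
    using assms unfolding shol_def by metis
  have "continuous_on (ball w r) (\<lambda>u. stereo (flip b (Some (h u))))"
    using continuous_on_compose[OF holomorphic_on_imp_continuous_on[OF h(2)] continuous_on_stereo_flip]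
    by (simp add: o_def)
  then have "continuous_on (ball w r) (\<lambda>z. stereo (\<psi> z))"
    using h(3) by (metis (no_types, lifting) continuous_on_cong)
  then show ?thesis using h(1) by (simp add: continuous_on_eq_continuous_at)
qed

lemma shol_continuous_on: "shol \<psi> S \<Longrightarrow> continuous_on S (\<lambda>z. stereo (\<psi> z))"
  by (simp add: continuous_at_imp_continuous_on shol_isCont)

lemma shol_near:
  assumes "shol \<psi> S" "w \<in> S" "e > 0"
  obtains d where "d > 0" "\<And>u. dist w u < d \<Longrightarrow> chordal (\<psi> w) (\<psi> u) < e"
  using shol_isCont[OF assms(1,2)] assms(3) unfolding continuous_at_eps_delta chordal_def
  by (metis dist_commute)

lemma shol_holomorphic:
  assumes "shol \<psi> S" "open S" "\<And>u. u \<in> S \<Longrightarrow> flip b (\<psi> u) \<noteq> None"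
  shows "(\<lambda>u. the (flip b (\<psi> u))) holomorphic_on S"
  unfolding holomorphic_on_def
proof
  fix w assume w: "w \<in> S"
  obtain h r where h: "r > 0" "h holomorphic_on ball w r" "\<And>u. u \<in> ball w r \<Longrightarrow> flip b (\<psi> u) = Some (h u)"
    using shol_chartE[OF assms(1) w assms(3)[OF w]] by metis
  have "(\<lambda>u. the (flip b (\<psi> u))) holomorphic_on ball w r"
    using h(2) by (rule holomorphic_transform) (simp add: h(3))
  then have "(\<lambda>u. the (flip b (\<psi> u))) field_differentiable at w"
    using h(1) holomorphic_on_imp_differentiable_at[of _ "ball w r" w] by simp
  then show "(\<lambda>u. the (flip b (\<psi> u))) field_differentiable at w within S"
    using field_differentiable_at_within by blast
qed

lemma shol_compose:
  assumes "shol \<psi> T" "h holomorphic_on S" "open S" "h ` S \<subseteq> T"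
  shows "shol (\<lambda>u. \<psi> (h u)) S"
  unfolding shol_def
proof
  fix w assume w: "w \<in> S"
  then obtain b g r where g: "r > 0" "g holomorphic_on ball (h w) r" "\<And>u. u \<in> ball (h w) r \<Longrightarrow> \<psi> u = flip b (Some (g u))"
    using assms(1,4) unfolding shol_def by (metis image_subset_iff)
  have "isCont h w"
    using assms(2,3) w continuous_on_eq_continuous_at holomorphic_on_imp_continuous_on by blast
  then obtain d where d: "d > 0" "\<And>u. dist w u < d \<Longrightarrow> dist (h w) (h u) < r"
    using g(1) unfolding continuous_at_eps_delta by (metis dist_commute)
  obtain d' where d': "d' > 0" "ball w d' \<subseteq> S" using assms(3) w openE by blast
  have "(g \<circ> h) holomorphic_on ball w (min d d')"
    using d d' g(2)
    by (intro holomorphic_on_compose_gen[where t = "ball (h w) r"] holomorphic_on_subset[OF assms(2)]) auto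
  then show "\<exists>b h' r. r > 0 \<and> h' holomorphic_on ball w r \<and> (\<forall>u\<in>ball w r. \<psi> (h u) = flip b (Some (h' u)))"
    using d d' g(3) by (intro exI[of _ b] exI[of _ "g \<circ> h"] exI[of _ "min d d'"]) auto
qed

lemma shol_flip_imp:
  assumes "shol \<psi> S"
  shows "shol (\<lambda>u. flip b (\<psi> u)) S"
  unfolding shol_def
proof
  fix w assume "w \<in> S"
  then obtain b' h r where h: "r > 0" "h holomorphic_on ball w r" "\<And>u. u \<in> ball w r \<Longrightarrow> \<psi> u = flip b' (Some (h u))"
    using assms unfolding shol_def by metis
  have "flip b (flip b' x) = flip (b \<noteq> b') x" for x by (cases b; cases b') auto
  with h show "\<exists>b'' h r. r > 0 \<and> h holomorphic_on ball w r \<and> (\<forall>u\<in>ball w r. flip b (\<psi> u) = flip b'' (Some (h u)))"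
    by metis
qed

lemma shol_flip [simp]: "shol (\<lambda>u. flip b (\<psi> u)) S \<longleftrightarrow> shol \<psi> S"
  using shol_flip_imp[of \<psi> S b] shol_flip_imp[of "\<lambda>u. flip b (\<psi> u)" S b] by auto

text \<open>Identity theorem. A single chart may not serve on all of \<open>S\<close>, so the set of
  accumulation points of the level set is shown to be open and closed; the identity theorem for
  ordinary functions enters in a chart around each of its points.\<close>

lemma shol_const_extend:
  assumes "shol \<psi> S" "open S" "connected S" "w \<in> S" "w islimpt {u\<in>S. \<psi> u = c}" "v \<in> S"
  shows "\<psi> v = c"
proof -
  define X where "X = {w\<in>S. w islimpt {u\<in>S. \<psi> u = c}}"
  have val: "\<psi> w = c" if w: "w \<in> X" for w
  proof (rule ccontr)
    assume "\<psi> w \<noteq> c"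
    then have "chordal (\<psi> w) c > 0" by (simp add: chordal_pos_iff)
    then obtain d where "d > 0" "\<And>u. dist w u < d \<Longrightarrow> chordal (\<psi> w) (\<psi> u) < chordal (\<psi> w) c"
      using shol_near[OF assms(1), of w] w unfolding X_def by auto
    moreover obtain u where "u \<in> S" "\<psi> u = c" "dist u w < d"
      using w \<open>d > 0\<close> unfolding X_def islimpt_approachable by blast
    ultimately show False by (metis dist_commute less_irrefl)
  qed
  have op: "\<exists>e>0. ball w e \<subseteq> X" if w: "w \<in> X" for w
  proof -
    obtain b z where bz: "flip b c = Some z" using flip_chart by blast
    have wS: "w \<in> S" using w by (simp add: X_def)
    obtain h r where h: "r > 0" "h holomorphic_on ball w r" "\<And>u. u \<in> ball w r \<Longrightarrow> flip b (\<psi> u) = Some (h u)"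
      using shol_chartE[OF assms(1) wS, of b] bz val[OF w] by (metis option.distinct(1))
    obtain r' where r': "r' > 0" "ball w r' \<subseteq> S" using assms(2) wS openE by blast
    define e where "e = min r r'"
    have e: "e > 0" "ball w e \<subseteq> S" "ball w e \<subseteq> ball w r" using r' h by (auto simp: e_def)
    have eq: "\<psi> u = c \<longleftrightarrow> h u = z" if "u \<in> ball w e" for u
    proof -
      have "flip b (\<psi> u) = Some (h u)" using h(3) that e(3) by blast
      moreover have "\<psi> u = c \<longleftrightarrow> flip b (\<psi> u) = flip b c" by simp
      ultimately show ?thesis by (simp add: bz)
    qed
    have lim: "w islimpt {u \<in> ball w e. h u = z}"
      unfolding islimpt_approachable
    proof (intro allI impI)
      fix d :: real assume "d > 0"
      moreover have "w islimpt {u \<in> S. \<psi> u = c}" using w by (simp add: X_def)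
      ultimately have "\<exists>u\<in>{u \<in> S. \<psi> u = c}. u \<noteq> w \<and> dist u w < min d e"
        using e(1) unfolding islimpt_approachable by (meson min_less_iff_conj)
      then obtain u where "u \<in> S" "\<psi> u = c" "u \<noteq> w" "dist u w < min d e" by blast
      then show "\<exists>u\<in>{u \<in> ball w e. h u = z}. u \<noteq> w \<and> dist u w < d"
        using eq[of u] by (auto simp: dist_commute)
    qed
    have "h u = z" if "u \<in> ball w e" for u
    proof -
      have "(\<lambda>u. h u - z) holomorphic_on ball w e"
        using h(2) e(3) by (intro holomorphic_intros) (auto elim: holomorphic_on_subset)
      then have "h u - z = 0"
        by (rule analytic_continuation[of _ _ "{u \<in> ball w e. h u = z}" w]) (use lim that e(1) in auto)
      then show ?thesis by simp
    qed
    then have "ball w e \<subseteq> {u \<in> S. \<psi> u = c}" using eq e by auto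
    moreover have "v islimpt ball w e" if "v \<in> ball w e" for v
      using that by (simp add: interior_limit_point interior_open)
    ultimately have "ball w e \<subseteq> X" unfolding X_def using e(2) islimpt_subset by blast
    then show ?thesis using e(1) by blast
  qed
  have "open X" unfolding open_contains_ball using op by blast
  moreover have "X \<subseteq> S" by (auto simp: X_def)
  ultimately have "openin (top_of_set S) X" by (simp add: open_subset)
  moreover have "closedin (top_of_set S) X"
  proof -
    have "X = S \<inter> {x. x islimpt {u \<in> S. \<psi> u = c}}" by (auto simp: X_def)
    then show ?thesis by (simp add: closedin_closed_Int closed_limpts)
  qed
  ultimately have "X = {} \<or> X = S" using assms(3) by (simp add: connected_clopen)
  moreover have "w \<in> X" using assms by (simp add: X_def)
  ultimately show ?thesis using val assms(6) by auto
qed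

lemma shol_const_extend_open:
  assumes "shol \<psi> S" "open S" "connected S" "open T" "T \<noteq> {}" "T \<subseteq> S" "\<And>u. u \<in> T \<Longrightarrow> \<psi> u = c" "v \<in> S"
  shows "\<psi> v = c"
proof -
  obtain w where "w \<in> T" using assms by blast
  then have "w islimpt T" using assms(4) by (simp add: interior_limit_point interior_open)
  then have "w islimpt {u\<in>S. \<psi> u = c}" by (rule islimpt_subset) (use assms in auto)
  then show ?thesis using shol_const_extend[OF assms(1-3)] assms(6,8) \<open>w \<in> T\<close> by blast
qed

text \<open>A point of the closed unit disc has chordal distance at least 1 from infinity, so
  \<open>y\<close> stays at least 1/2 away from it, which bounds its coordinate by 4. The factor 17
  is \<open>1 + 4\<^sup>2\<close> from \<open>dist_le_chordal\<close>.\<close>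

lemma near_chart:
  assumes "cmod z \<le> 1" "chordal (Some z) y < 1 / 2"
  obtains u where "y = Some u" "cmod u \<le> 4" "cmod (z - u) \<le> 17 * chordal (Some z) y"
proof -
  have "4 / (1 + 1) \<le> 4 / (1 + (cmod z)\<^sup>2)"
    using assms(1) by (intro divide_left_mono add_left_mono) (simp_all add: add_pos_nonneg abs_square_le_1)
  then have "1\<^sup>2 \<le> (chordal (Some z) None)\<^sup>2" by (simp add: chordal_Some_None)
  then have "1 \<le> chordal (Some z) None" using chordal_nonneg by (rule power2_le_imp_le)
  then have "1 / 2 \<le> chordal y None" using assms(2) chordal_triangle[of "Some z" None y] by linarith
  then obtain u where u: "y = Some u" "cmod u \<le> 4" using chordal_None_ge[of "1 / 2" y] by auto
  moreover have "cmod (z - u) \<le> (1 + 4\<^sup>2) * chordal (Some z) (Some u)"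
    by (rule dist_le_chordal) (use u assms in auto)
  ultimately show ?thesis using that by auto
qed

section \<open>Continuous and holomorphic self-maps of the sphere\<close>

definition scont :: "(csphere \<Rightarrow> csphere) \<Rightarrow> bool" where
  "scont f \<longleftrightarrow> (\<forall>x. \<forall>e>0. \<exists>d>0. \<forall>y. chordal x y < d \<longrightarrow> chordal (f x) (f y) < e)"

lemma scont_uniform:
  assumes "scont f" "e > 0"
  obtains d where "d > 0" "\<And>x y. chordal x y < d \<Longrightarrow> chordal (f x) (f y) < e"
proof (rule ccontr)
  assume "\<not> thesis"
  then have "\<forall>d>0. \<exists>x y. chordal x y < d \<and> \<not> chordal (f x) (f y) < e" using that by blast
  then have "\<forall>n. \<exists>x y. chordal x y < 1 / real (Suc n) \<and> \<not> chordal (f x) (f y) < e" by simp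
  then obtain x y where xy: "\<And>n. chordal (x n) (y n) < 1 / real (Suc n)" "\<And>n. \<not> chordal (f (x n)) (f (y n)) < e"
    by metis
  obtain r l where r: "strict_mono (r :: nat \<Rightarrow> nat)" "\<And>e. e > 0 \<Longrightarrow> \<exists>N. \<forall>n\<ge>N. chordal (x (r n)) l < e"
    using chordal_compact by blast
  obtain d where d: "d > 0" "\<And>y. chordal l y < d \<Longrightarrow> chordal (f l) (f y) < e / 2"
    using assms unfolding scont_def by (metis half_gt_zero)
  obtain N where N: "\<And>n. n \<ge> N \<Longrightarrow> chordal (x (r n)) l < d / 2" using r(2)[of "d / 2"] d by auto
  obtain M where M: "1 / real (Suc M) < d / 2" using d by (meson half_gt_zero nat_approx_posE)
  define n where "n = max N M"
  have "1 / real (Suc (r n)) \<le> 1 / real (Suc M)"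
    using seq_suble[OF r(1), of n] by (intro divide_left_mono) (auto simp: n_def)
  then have "chordal (x (r n)) (y (r n)) < d / 2" using xy(1)[of "r n"] M by linarith
  moreover have "chordal (x (r n)) l < d / 2" using N n_def by simp
  ultimately have "chordal l (x (r n)) < d" "chordal l (y (r n)) < d"
    using chordal_triangle[of l "y (r n)" "x (r n)"] d(1) by (auto simp: chordal_commute)
  then have "chordal (f l) (f (x (r n))) < e / 2" "chordal (f l) (f (y (r n))) < e / 2" using d by auto
  then show False using xy(2)[of "r n"] chordal_triangle[of "f (x (r n))" "f (y (r n))" "f l"]
    by (simp add: chordal_commute)
qed

lemma scont_continuous_map: "scont f \<Longrightarrow> continuous_map riemann_sphere riemann_sphere f"
  unfolding continuous_map_def
proof (intro conjI allI impI)
  fix U assume f: "scont f" and U: "openin riemann_sphere U"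
  show "openin riemann_sphere {x \<in> topspace riemann_sphere. f x \<in> U}"
    using f U unfolding openin_riemann_sphere scont_def by simp metis
qed simp

text \<open>Holomorphy of self-maps of the sphere is tested on holomorphic maps into the sphere; constant
  maps are included.\<close>

definition hmap :: "(csphere \<Rightarrow> csphere) \<Rightarrow> bool" where
  "hmap f \<longleftrightarrow> (\<forall>\<psi> S. shol \<psi> S \<longrightarrow> shol (\<lambda>u. f (\<psi> u)) S)"

lemma hmapD: "hmap f \<Longrightarrow> shol \<psi> S \<Longrightarrow> shol (\<lambda>u. f (\<psi> u)) S"
  unfolding hmap_def by blast

lemma hmap_flip: "hmap (flip b)" by (simp add: hmap_def)

lemma hmap_compose: "hmap f \<Longrightarrow> hmap g \<Longrightarrow> hmap (\<lambda>x. f (g x))"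
  unfolding hmap_def by blast

lemma hmap_funpow: "hmap f \<Longrightarrow> hmap (f ^^ n)"
  by (induction n) (auto simp: hmap_def)

lemma shol_flip_Some: "shol (\<lambda>z. flip b (Some z)) UNIV"
  by (rule sholI[of "\<lambda>z. z"]) auto

text \<open>A holomorphic map into the sphere factors locally through one of the two inverse charts,
  so these two test maps decide.\<close>

lemma hmapI:
  assumes "\<And>b. shol (\<lambda>z. f (flip b (Some z))) UNIV"
  shows "hmap f"
  unfolding hmap_def
proof (intro allI impI)
  fix \<psi> S assume \<psi>: "shol \<psi> S"
  show "shol (\<lambda>u. f (\<psi> u)) S"
    unfolding shol_def
  proof
    fix w assume "w \<in> S"
    then obtain b h r where h: "r > 0" "h holomorphic_on ball w r" "\<And>u. u \<in> ball w r \<Longrightarrow> \<psi> u = flip b (Some (h u))"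
      using \<psi> unfolding shol_def by metis
    have "shol (\<lambda>u. f (flip b (Some (h u)))) (ball w r)"
      using shol_compose[OF assms[of b] h(2)] by simp
    then obtain b' g d where g: "d > 0" "g holomorphic_on ball w d" "\<And>u. u \<in> ball w d \<Longrightarrow> f (flip b (Some (h u))) = flip b' (Some (g u))"
      using h(1) unfolding shol_def by (metis centre_in_ball)
    then have "g holomorphic_on ball w (min d r)" by (auto elim: holomorphic_on_subset)
    then show "\<exists>b h r. r > 0 \<and> h holomorphic_on ball w r \<and> (\<forall>u\<in>ball w r. f (\<psi> u) = flip b (Some (h u)))"
      using g h by (intro exI[of _ b'] exI[of _ g] exI[of _ "min d r"]) auto
  qed
qed

lemma hmap_scont:
  assumes "hmap f"
  shows "scont f"
  unfolding scont_def
proof (intro allI impI)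
  fix x and e :: real assume e: "e > 0"
  obtain b z where bz: "flip b x = Some z" "cmod z \<le> 1" using flip_chart by blast
  obtain d where d: "d > 0" "\<And>u. dist z u < d \<Longrightarrow> chordal (f (flip b (Some z))) (f (flip b (Some u))) < e"
    using shol_near[OF hmapD[OF assms shol_flip_Some] UNIV_I e] by metis
  show "\<exists>d>0. \<forall>y. chordal x y < d \<longrightarrow> chordal (f x) (f y) < e"
  proof (intro exI[of _ "min (1/2) (d / 17)"] conjI allI impI)
    fix y assume y: "chordal x y < min (1/2) (d / 17)"
    have eq: "chordal (Some z) (flip b y) = chordal x y" using bz by (metis chordal_flip)
    obtain u where u: "flip b y = Some u" "cmod (z - u) \<le> 17 * chordal (Some z) (flip b y)"
      using near_chart[OF bz(2), of "flip b y"] eq y by (metis min_less_iff_conj)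
    then have "dist z u < d" using y eq by (simp add: dist_norm)
    from d(2)[OF this] show "chordal (f x) (f y) < e" using bz u by (metis flip_flip)
  qed (use d in auto)
qed

section \<open>Locally uniform limits\<close>

text \<open>Reduction to ordinary function theory: around \<open>w\<close> the limit and all late
  terms keep a definite distance from the point at infinity of one chart, and there chordal
  convergence implies uniform convergence of the coordinates.\<close>

lemma uconv_chart:
  assumes F: "\<And>k. shol (F k) (ball w r)" and r: "r > 0" and conv: "uconv (ball w r) F \<psi>"
    and cont: "isCont (\<lambda>z. stereo (\<psi> z)) w" and b: "flip b (\<psi> w) \<noteq> None"
  obtains \<rho> K where "0 < \<rho>" "\<rho> \<le> r" "\<And>u. u \<in> ball w \<rho> \<Longrightarrow> flip b (\<psi> u) \<noteq> None"
    "\<And>k u. K \<le> k \<Longrightarrow> u \<in> ball w \<rho> \<Longrightarrow> flip b (F k u) \<noteq> None"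
    "uniform_limit (ball w \<rho>) (\<lambda>k u. the (flip b (F (k + K) u))) (\<lambda>u. the (flip b (\<psi> u))) sequentially"
proof -
  define e where "e = chordal (flip b (\<psi> w)) None"
  have e: "e > 0" using b by (simp add: e_def chordal_pos_iff)
  obtain d where d: "d > 0" "\<And>u. dist w u < d \<Longrightarrow> chordal (\<psi> w) (\<psi> u) < e / 4"
    using cont e unfolding continuous_at_eps_delta chordal_def
    by (metis dist_commute zero_less_divide_iff zero_less_numeral)
  have "\<exists>N. \<forall>k\<ge>N. \<forall>u\<in>ball w r. chordal (F k u) (\<psi> u) < e / 4"
    using conv[unfolded uconv_iff] e by (metis zero_less_divide_iff zero_less_numeral)
  then obtain K where K: "\<And>k u. k \<ge> K \<Longrightarrow> u \<in> ball w r \<Longrightarrow> chordal (F k u) (\<psi> u) < e / 4" by blast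
  have far: "e / 2 \<le> chordal (flip b (\<psi> u)) None" "k \<ge> K \<Longrightarrow> e / 2 \<le> chordal (flip b (F k u)) None"
    if "u \<in> ball w (min d r)" for k u
  proof -
    have 1: "chordal (flip b (\<psi> w)) (flip b (\<psi> u)) < e / 4" using d(2)[of u] that by simp
    have 2: "e \<le> chordal (flip b (\<psi> w)) (flip b (\<psi> u)) + chordal (flip b (\<psi> u)) None"
      unfolding e_def by (rule chordal_triangle)
    show "e / 2 \<le> chordal (flip b (\<psi> u)) None" using 1 2 e by linarith
    assume "k \<ge> K"
    then have 3: "chordal (flip b (\<psi> u)) (flip b (F k u)) < e / 4" using K[of k u] that by (simp add: chordal_commute)
    have 4: "chordal (flip b (\<psi> u)) None \<le> chordal (flip b (\<psi> u)) (flip b (F k u)) + chordal (flip b (F k u)) None"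
      by (rule chordal_triangle)
    show "e / 2 \<le> chordal (flip b (F k u)) None" using 1 2 3 4 e by linarith
  qed
  have bd: "\<exists>z. x = Some z \<and> cmod z \<le> 4 / e" if "e / 2 \<le> chordal x None" for x
    using chordal_None_ge[OF that] e by (auto simp: divide_divide_eq_right)
  show ?thesis
  proof (rule that[of "min d r" K])
    show "flip b (\<psi> u) \<noteq> None" if "u \<in> ball w (min d r)" for u using far(1)[OF that] bd by blast
    show "flip b (F k u) \<noteq> None" if "K \<le> k" "u \<in> ball w (min d r)" for k u
      using far(2)[OF that(2,1)] bd by blast
    show "uniform_limit (ball w (min d r)) (\<lambda>k u. the (flip b (F (k + K) u))) (\<lambda>u. the (flip b (\<psi> u))) sequentially"
      unfolding uniform_limit_iff eventually_sequentially
    proof (intro allI impI)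
      fix \<epsilon> :: real assume "\<epsilon> > 0"
      define M where "M = 1 + (4 / e)\<^sup>2"
      have M: "M > 0" by (simp add: M_def add_pos_nonneg)
      then obtain N where N: "\<And>k u. k \<ge> N \<Longrightarrow> u \<in> ball w r \<Longrightarrow> chordal (F k u) (\<psi> u) < \<epsilon> / M"
        using conv[unfolded uconv_iff] \<open>\<epsilon> > 0\<close> divide_pos_pos by meson
      show "\<exists>N. \<forall>k\<ge>N. \<forall>u\<in>ball w (min d r). dist (the (flip b (F (k + K) u))) (the (flip b (\<psi> u))) < \<epsilon>"
      proof (intro exI[of _ N] allI impI ballI)
        fix k u assume k: "k \<ge> N" and u: "u \<in> ball w (min d r)"
        obtain x where x: "flip b (F (k + K) u) = Some x" "cmod x \<le> 4 / e"
          using bd[OF far(2)[OF u]] by (metis le_add2)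
        obtain y where y: "flip b (\<psi> u) = Some y" "cmod y \<le> 4 / e" using bd[OF far(1)[OF u]] by metis
        have "cmod (x - y) \<le> M * chordal (Some x) (Some y)"
          unfolding M_def by (rule dist_le_chordal) fact+
        also have "chordal (Some x) (Some y) = chordal (F (k + K) u) (\<psi> u)"
          unfolding x(1)[symmetric] y(1)[symmetric] by simp
        also have "M * \<dots> < M * (\<epsilon> / M)" using N[of "k + K" u] k u M by (intro mult_strict_left_mono) auto
        finally show "dist (the (flip b (F (k + K) u))) (the (flip b (\<psi> u))) < \<epsilon>"
          using M by (simp add: x y dist_norm)
      qed
    qed
  qed (use d r in auto)
qed

text \<open>In a chart suited to the limit at \<open>w\<close> this is Weierstrass' theorem on
  locally uniform limits.\<close>

lemma shol_limit:
  assumes F: "\<And>k. shol (F k) S" and "open S" and "\<And>w. w \<in> S \<Longrightarrow> \<exists>r>0. uconv (ball w r \<inter> S) F \<psi>"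
  shows "shol \<psi> S"
proof -
  have "\<exists>\<rho>>0. shol \<psi> (ball w \<rho>)" if w: "w \<in> S" for w
  proof -
    obtain r1 where r1: "r1 > 0" "ball w r1 \<subseteq> S" using \<open>open S\<close> w openE by blast
    obtain r2 where r2: "r2 > 0" "uconv (ball w r2 \<inter> S) F \<psi>" using assms(3)[OF w] by blast
    define r where "r = min r1 r2"
    have r: "r > 0" "ball w r \<subseteq> S" using r1 r2 by (auto simp: r_def)
    have conv: "uconv (ball w r) F \<psi>" by (rule uconv_subset[OF r2(2)]) (use r in \<open>auto simp: r_def\<close>)
    have F': "shol (F k) (ball w r)" for k using F r(2) shol_subset by blast
    have "continuous_on (ball w r) (\<lambda>z. stereo (\<psi> z))"
      using conv unfolding uconv_def
      by (rule uniform_limit_theorem[rotated]) (auto simp: shol_continuous_on[OF F'])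
    then have cont: "isCont (\<lambda>z. stereo (\<psi> z)) w" using r(1) by (simp add: continuous_on_eq_continuous_at)
    obtain b z where bz: "flip b (\<psi> w) = Some z" using flip_chart by blast
    then have "flip b (\<psi> w) \<noteq> None" by simp
    from uconv_chart[OF F' r(1) conv cont this] obtain \<rho> K where
      \<rho>: "0 < \<rho>" "\<rho> \<le> r" "\<And>u. u \<in> ball w \<rho> \<Longrightarrow> flip b (\<psi> u) \<noteq> None"
      and FK: "\<And>k u. K \<le> k \<Longrightarrow> u \<in> ball w \<rho> \<Longrightarrow> flip b (F k u) \<noteq> None"
      and ul: "uniform_limit (ball w \<rho>) (\<lambda>k u. the (flip b (F (k + K) u))) (\<lambda>u. the (flip b (\<psi> u))) sequentially"
      by blast
    have hol: "(\<lambda>u. the (flip b (F (k + K) u))) holomorphic_on ball w \<rho>" for k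
      using \<rho>(2) by (intro shol_holomorphic FK shol_subset[OF F']) auto
    have sub: "cball w (\<rho> / 2) \<subseteq> ball w \<rho>" "ball w (\<rho> / 2) \<subseteq> ball w \<rho>" using \<rho> by auto
    obtain "(\<lambda>u. the (flip b (\<psi> u))) holomorphic_on ball w (\<rho> / 2)"
    proof (rule holomorphic_uniform_limit[where r = "\<rho> / 2" and z = w and F = sequentially])
      show "\<forall>\<^sub>F n in sequentially. continuous_on (cball w (\<rho> / 2)) (\<lambda>u. the (flip b (F (n + K) u))) \<and>
        (\<lambda>u. the (flip b (F (n + K) u))) holomorphic_on ball w (\<rho> / 2)"
        using hol sub by (intro always_eventually allI conjI)
          (meson continuous_on_subset holomorphic_on_imp_continuous_on, meson holomorphic_on_subset)
      show "uniform_limit (cball w (\<rho> / 2)) (\<lambda>k u. the (flip b (F (k + K) u))) (\<lambda>u. the (flip b (\<psi> u))) sequentially"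
        using uniform_limit_on_subset[OF ul sub(1)] .
    qed auto
    then have "shol \<psi> (ball w (\<rho> / 2))"
    proof (rule sholI[where b = b])
      fix u assume "u \<in> ball w (\<rho> / 2)"
      then have "flip b (\<psi> u) \<noteq> None" using \<rho>(3) sub by blast
      then show "\<psi> u = flip b (Some (the (flip b (\<psi> u))))" by simp
    qed simp
    then show ?thesis using \<rho>(1) half_gt_zero by blast
  qed
  then show ?thesis unfolding shol_def by (metis centre_in_ball)
qed

text \<open>Hurwitz's theorem with moving targets. If values \<open>y j\<close> tending to
  \<open>\<psi> w\<close> were missed by arbitrarily late maps, the differences from these values
  would be zero-free in a chart, while their non-constant limit vanishes at
  \<open>w\<close>.\<close>

lemma shol_cover:
  assumes F: "\<And>k. shol (F k) (ball w r)" and r: "r > 0" and conv: "uconv (ball w r) F \<psi>"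
    and \<psi>: "shol \<psi> (ball w r)" and nc: "u0 \<in> ball w r" "\<psi> u0 \<noteq> \<psi> w"
  obtains e K where "e > 0" "\<And>k y. k \<ge> K \<Longrightarrow> chordal (\<psi> w) y < e \<Longrightarrow> \<exists>u\<in>ball w r. F k u = y"
proof (rule ccontr)
  assume no: "\<not> thesis"
  have "\<exists>k y. k \<ge> j \<and> chordal (\<psi> w) y < 1 / real (Suc j) \<and> (\<forall>u\<in>ball w r. F k u \<noteq> y)" for j :: nat
  proof (rule ccontr)
    assume "\<not> ?thesis"
    then have "\<And>k y. k \<ge> j \<Longrightarrow> chordal (\<psi> w) y < 1 / real (Suc j) \<Longrightarrow> \<exists>u\<in>ball w r. F k u = y" by blast
    then show False using that[of "1 / real (Suc j)" j] no by simp
  qed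
  then obtain \<kappa> y where \<kappa>: "\<And>j. \<kappa> j \<ge> j" "\<And>j. chordal (\<psi> w) (y j) < 1 / real (Suc j)"
    "\<And>j u. u \<in> ball w r \<Longrightarrow> F (\<kappa> j) u \<noteq> y j" by metis
  obtain b z where bz: "flip b (\<psi> w) = Some z" "cmod z \<le> 1" using flip_chart by blast
  then have "flip b (\<psi> w) \<noteq> None" by simp
  from uconv_chart[OF F r conv shol_isCont[OF \<psi>] this] r obtain \<rho> K where
    \<rho>: "0 < \<rho>" "\<rho> \<le> r" "\<And>u. u \<in> ball w \<rho> \<Longrightarrow> flip b (\<psi> u) \<noteq> None"
    and FK: "\<And>k u. K \<le> k \<Longrightarrow> u \<in> ball w \<rho> \<Longrightarrow> flip b (F k u) \<noteq> None"
    and ul: "uniform_limit (ball w \<rho>) (\<lambda>k u. the (flip b (F (k + K) u))) (\<lambda>u. the (flip b (\<psi> u))) sequentially"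
    by (metis centre_in_ball)
  define t where "t j = the (flip b (y j))" for j
  have t: "flip b (y j) = Some (t j)" "cmod (z - t j) \<le> 17 / real (Suc j)" if j: "j \<ge> 1" for j
  proof -
    have "chordal (Some z) (flip b (y j)) = chordal (\<psi> w) (y j)" unfolding bz(1)[symmetric] by simp
    moreover have "1 / real (Suc j) \<le> 1 / 2" using j by (intro divide_left_mono) auto
    ultimately have c: "chordal (Some z) (flip b (y j)) < 1 / 2" "chordal (Some z) (flip b (y j)) < 1 / real (Suc j)"
      using \<kappa>(2)[of j] by linarith+
    obtain u where "flip b (y j) = Some u" "cmod (z - u) \<le> 17 * chordal (Some z) (flip b (y j))"
      using near_chart[OF bz(2) c(1)] by metis
    then show "flip b (y j) = Some (t j)" "cmod (z - t j) \<le> 17 / real (Suc j)"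
      using c(2) by (auto simp: t_def)
  qed
  define h where "h u = the (flip b (\<psi> u))" for u
  define H where "H k u = the (flip b (F (k + K) u))" for k u
  have hol: "H k holomorphic_on ball w \<rho>" for k
    unfolding H_def using \<rho>(2) by (intro shol_holomorphic FK shol_subset[OF F]) auto
  have holh: "h holomorphic_on ball w \<rho>"
    unfolding h_def using \<rho>(2) by (intro shol_holomorphic \<rho> shol_subset[OF \<psi>]) auto
  \<comment> \<open>\<open>H\<close> counts from index \<open>K\<close>, and \<open>t\<close> is
    known to be a coordinate only from index 1 on; the shift by \<open>K + 1\<close> respects
    both.\<close>
  define n where "n j = \<kappa> (j + K + 1) - K" for j
  have n: "n j + K = \<kappa> (j + K + 1)" "n j \<ge> j" for j using \<kappa>(1)[of "j + K + 1"] by (auto simp: n_def)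
  define G where "G j u = H (n j) u - t (j + K + 1)" for j u
  have "h w - z \<noteq> 0"
  proof (rule Hurwitz_no_zeros[of "ball w \<rho>" G "\<lambda>u. h u - z"])
    show "G j holomorphic_on ball w \<rho>" for j unfolding G_def by (intro holomorphic_intros hol)
    show "(\<lambda>u. h u - z) holomorphic_on ball w \<rho>" by (intro holomorphic_intros holh)
    show "uniform_limit C G (\<lambda>u. h u - z) sequentially" if "compact C" "C \<subseteq> ball w \<rho>" for C
      unfolding uniform_limit_iff eventually_sequentially
    proof (intro allI impI)
      fix \<epsilon> :: real assume \<epsilon>: "\<epsilon> > 0"
      obtain N where N: "\<And>k u. k \<ge> N \<Longrightarrow> u \<in> ball w \<rho> \<Longrightarrow> dist (H k u) (h u) < \<epsilon> / 2"
        using ul \<epsilon> unfolding uniform_limit_iff eventually_sequentially H_def h_def by (meson half_gt_zero)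
      obtain M where M: "17 / real (Suc M) < \<epsilon> / 2"
        using \<epsilon> nat_approx_posE[of "\<epsilon> / 2 / 17"] by (auto simp: field_simps)
      show "\<exists>N. \<forall>j\<ge>N. \<forall>u\<in>C. dist (G j u) (h u - z) < \<epsilon>"
      proof (intro exI[of _ "max N M"] allI impI ballI)
        fix j u assume j: "max N M \<le> j" and u: "u \<in> C"
        have 1: "cmod (H (n j) u - h u) < \<epsilon> / 2"
          using N[of "n j" u] n(2)[of j] j u that by (auto simp: dist_norm)
        have "cmod (z - t (j + K + 1)) \<le> 17 / real (Suc (j + K + 1))" by (rule t(2)) simp
        also have "\<dots> \<le> 17 / real (Suc M)" using j by (intro divide_left_mono) auto
        finally have 2: "cmod (z - t (j + K + 1)) < \<epsilon> / 2" using M by simp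
        have "G j u - (h u - z) = (H (n j) u - h u) + (z - t (j + K + 1))" by (simp add: G_def)
        then have "cmod (G j u - (h u - z)) \<le> cmod (H (n j) u - h u) + cmod (z - t (j + K + 1))"
          by (metis norm_triangle_ineq)
        then show "dist (G j u) (h u - z) < \<epsilon>" using 1 2 unfolding dist_norm by linarith
      qed
    qed
    show "\<not> (\<lambda>u. h u - z) constant_on ball w \<rho>"
    proof
      assume "(\<lambda>u. h u - z) constant_on ball w \<rho>"
      then have "h u = h w" if "u \<in> ball w \<rho>" for u
        using that \<rho>(1) unfolding constant_on_def by (metis centre_in_ball diff_add_cancel)
      moreover have "h w = z" by (simp add: h_def bz)
      ultimately have const: "\<psi> u = \<psi> w" if "u \<in> ball w \<rho>" for u
        using that \<rho>(3)[OF that] bz unfolding h_def by (metis flip_eq_iff option.collapse)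
      have "\<psi> u0 = \<psi> w"
        by (rule shol_const_extend_open[OF \<psi> _ _ _ _ _ const, of "ball w \<rho>"]) (use \<rho>(1,2) nc(1) in auto)
      then show False using nc by simp
    qed
    show "G j u \<noteq> 0" if u: "u \<in> ball w \<rho>" for j u
    proof
      assume "G j u = 0"
      then have "the (flip b (F (\<kappa> (j + K + 1)) u)) = t (j + K + 1)" by (simp add: G_def H_def n)
      moreover have "flip b (F (\<kappa> (j + K + 1)) u) \<noteq> None" using FK[OF _ u, of "\<kappa> (j + K + 1)"] \<kappa>(1)[of "j + K + 1"] by auto
      ultimately have "flip b (F (\<kappa> (j + K + 1)) u) = flip b (y (j + K + 1))" using t(1)[of "j + K + 1"] by auto
      then show False using \<kappa>(3)[of u "j + K + 1"] u \<rho>(2) by auto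
    qed
  qed (use \<rho> in auto)
  then show False by (simp add: h_def bz)
qed

lemma shol_open_map:
  assumes \<psi>: "shol \<psi> (ball w r)" and r: "r > 0" and nc: "u0 \<in> ball w r" "\<psi> u0 \<noteq> \<psi> w"
  obtains e where "e > 0" "\<And>y. chordal (\<psi> w) y < e \<Longrightarrow> \<exists>u\<in>ball w r. \<psi> u = y"
  using shol_cover[OF \<psi> r uconv_const \<psi> nc] by (metis order_refl)

text \<open>Rouche's theorem: near a \<open>c\<close>-point of order \<open>M\<close> of the limit,
  late terms take the value \<open>c\<close> at most \<open>M\<close> times. What matters is that
  the bound is the same for all late \<open>k\<close>.\<close>

lemma shol_count:
  assumes F: "\<And>k. shol (F k) (ball w r)" and r: "r > 0" and conv: "uconv (ball w r) F \<psi>"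
    and \<psi>: "shol \<psi> (ball w r)" and nc: "u0 \<in> ball w r" "\<psi> u0 \<noteq> c"
  obtains s M K where "0 < s" "s \<le> r"
    "\<And>k. K \<le> k \<Longrightarrow> finite {u\<in>ball w s. F k u = c} \<and> card {u\<in>ball w s. F k u = c} \<le> (M::nat)"
proof (cases "\<psi> w = c")
  case False
  define e where "e = chordal (\<psi> w) c"
  have e: "e > 0" using False by (simp add: e_def chordal_pos_iff)
  obtain d where d: "d > 0" "\<And>u. dist w u < d \<Longrightarrow> chordal (\<psi> w) (\<psi> u) < e / 2"
    using shol_near[OF \<psi>, of w "e / 2"] e r by auto
  obtain K where K: "\<And>k u. k \<ge> K \<Longrightarrow> u \<in> ball w r \<Longrightarrow> chordal (F k u) (\<psi> u) < e / 2"
    using conv[unfolded uconv_iff] e half_gt_zero by meson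
  have emp: "{u\<in>ball w (min d r). F k u = c} = {}" if k: "k \<ge> K" for k
  proof -
    have "F k u \<noteq> c" if u: "u \<in> ball w (min d r)" for u
      using K[OF k, of u] d(2)[of u] u chordal_triangle[of "\<psi> w" c "\<psi> u"]
      by (auto simp: e_def chordal_commute)
    then show ?thesis by blast
  qed
  show ?thesis
  proof (rule that[of "min d r" K 0])
    fix k assume "K \<le> k"
    from emp[OF this] show "finite {u\<in>ball w (min d r). F k u = c} \<and> card {u\<in>ball w (min d r). F k u = c} \<le> 0"
      by (simp only:) simp
  qed (use d(1) r in auto)
next
  case True
  obtain b z where bz: "flip b c = Some z" using flip_chart by blast
  then have "flip b (\<psi> w) \<noteq> None" using True by simp
  from uconv_chart[OF F r conv shol_isCont[OF \<psi>] this] r obtain \<rho> K where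
    \<rho>: "0 < \<rho>" "\<rho> \<le> r" "\<And>u. u \<in> ball w \<rho> \<Longrightarrow> flip b (\<psi> u) \<noteq> None"
    and FK: "\<And>k u. K \<le> k \<Longrightarrow> u \<in> ball w \<rho> \<Longrightarrow> flip b (F k u) \<noteq> None"
    and ul: "uniform_limit (ball w \<rho>) (\<lambda>k u. the (flip b (F (k + K) u))) (\<lambda>u. the (flip b (\<psi> u))) sequentially"
    by (metis centre_in_ball)
  define h where "h u = the (flip b (\<psi> u))" for u
  define H where "H k u = the (flip b (F (k + K) u))" for k u
  have hol: "H k holomorphic_on ball w \<rho>" for k
    unfolding H_def using \<rho>(2) by (intro shol_holomorphic FK shol_subset[OF F]) auto
  have holh: "h holomorphic_on ball w \<rho>"
    unfolding h_def using \<rho>(2) by (intro shol_holomorphic \<rho> shol_subset[OF \<psi>]) auto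
  have hw: "h w = z" by (simp add: h_def True bz)
  have "\<exists>\<beta>\<in>ball w \<rho>. h \<beta> \<noteq> z"
  proof (rule ccontr)
    assume "\<not> ?thesis"
    then have const: "\<psi> u = c" if "u \<in> ball w \<rho>" for u
      using that \<rho>(3)[OF that] bz unfolding h_def by (metis flip_eq_iff option.collapse)
    have "\<psi> u0 = c"
      by (rule shol_const_extend_open[OF \<psi> _ _ _ _ _ const, of "ball w \<rho>"]) (use \<rho>(1,2) nc(1) in auto)
    then show False using nc by simp
  qed
  then obtain \<beta> where \<beta>: "\<beta> \<in> ball w \<rho>" "h \<beta> - z \<noteq> 0" by auto
  have hz: "(\<lambda>u. h u - z) holomorphic_on ball w \<rho>" by (intro holomorphic_intros holh)
  have hw0: "h w - z = 0" using hw by simp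
  have wb: "w \<in> ball w \<rho>" using \<rho>(1) by simp
  obtain s0 where
    s0: "0 < s0" "ball w s0 \<subseteq> ball w \<rho>" "\<And>u. u \<in> ball w s0 - {w} \<Longrightarrow> h u - z \<noteq> 0"
    using isolated_zeros[OF hz open_ball connected_ball wb hw0 \<beta>] by metis
  \<comment> \<open>The circle of radius \<open>s0 / 2\<close> avoids the zeros of
    \<open>h - z\<close>, and the open set \<open>S\<close> around it has its closure inside
    \<open>ball w s0\<close>, so that the zeros in \<open>S\<close> are finite in number.\<close>
  define s S where "s = s0 / 2" and "S = ball w (3 / 4 * s0)"
  have s: "s > 0" "s \<le> r" "ball w s \<subseteq> S" "sphere w s \<subseteq> S" "S \<subseteq> ball w s0" "cball w (3 / 4 * s0) \<subseteq> ball w s0"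
  proof -
    have "s0 \<le> \<rho>" using s0(2) \<rho>(1) s0(1) by (simp add: ball_subset_ball_iff)
    then show "s \<le> r" using \<rho>(2) s0(1) by (simp add: s_def)
  qed (use s0(1) in \<open>auto simp: s_def S_def\<close>)
  have "continuous_on (sphere w s) (\<lambda>u. cmod (h u - z))"
    using s(4,5) s0(2) by (intro continuous_intros continuous_on_subset[OF holomorphic_on_imp_continuous_on[OF holh]]) blast
  then obtain p where p: "p \<in> sphere w s" "\<And>u. u \<in> sphere w s \<Longrightarrow> cmod (h p - z) \<le> cmod (h u - z)"
    using continuous_attains_inf[of "sphere w s" "\<lambda>u. cmod (h u - z)"] s(1) by auto
  have "p \<in> ball w s0" using p(1) s(4,5) by blast
  moreover have "p \<noteq> w" using p(1) s(1) by auto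
  ultimately have m: "cmod (h p - z) > 0" using s0(3)[of p] by simp
  obtain N where N: "\<And>k u. k \<ge> N \<Longrightarrow> u \<in> ball w \<rho> \<Longrightarrow> dist (H k u) (h u) < cmod (h p - z)"
    using ul m unfolding uniform_limit_iff eventually_sequentially H_def h_def by meson
  define M where "M = zorder (\<lambda>u. h u - z) w"
  have main: "finite {u\<in>ball w s. F (k + K) u = c} \<and> card {u\<in>ball w s. F (k + K) u = c} \<le> nat M" if k: "k \<ge> N" for k
  proof -
    define f g where "f = (\<lambda>u. h u - z)" and "g = (\<lambda>u. H k u - h u)"
    have fg: "(\<lambda>u. f u + g u) = (\<lambda>u. H k u - z)" by (auto simp: f_def g_def)
    have less: "cmod (g u) < cmod (f u)" if "u \<in> sphere w s" for u
    proof -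
      have "u \<in> ball w \<rho>" using that s(4,5) s0(2) by blast
      then show ?thesis using N[OF k, of u] p(2)[OF that] by (simp add: g_def f_def dist_norm)
    qed
    have holS: "f holomorphic_on S" "g holomorphic_on S" "f holomorphic_on ball w s0" "(\<lambda>u. f u + g u) holomorphic_on ball w s0"
      unfolding f_def g_def using s(5) s0(2)
      by (intro holomorphic_intros holomorphic_on_subset[OF hol] holomorphic_on_subset[OF holh]; blast)+
    define Zf Zg where "Zf = {p\<in>S. f p = 0}" and "Zg = {p\<in>S. f p + g p = 0}"
    have "f x \<noteq> 0" if "x \<in> S" "x \<noteq> w" for x
      unfolding f_def by (rule s0(3)) (use that s(5) in blast)
    moreover have "w \<in> S" "f w = 0" using s(1,3) hw by (auto simp: f_def)
    ultimately have Zf: "Zf = {w}" by (auto simp: Zf_def)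
    have nzp: "f p + g p \<noteq> 0" using less[OF p(1)] by (metis add_eq_0_iff norm_minus_cancel order_less_irrefl)
    \<comment> \<open>Finiteness of the zero set is a fact about non-constant functions; a constant
      one has no zero here, since it does not vanish on the circle.\<close>
    have finZ: "finite Zg"
    proof (cases "(\<lambda>u. f u + g u) constant_on ball w s0")
      case True
      then have "f u + g u = f p + g p" if "u \<in> S" for u
        using that p(1) s unfolding constant_on_def by (metis subset_iff)
      then have "Zg = {}" using nzp by (auto simp: Zg_def)
      then show ?thesis by simp
    next
      case False
      have "finite {u\<in>cball w (3 / 4 * s0). f u + g u = 0}"
        by (rule holomorphic_compact_finite_zeros[OF holS(4)]) (use False s in auto)
      then show ?thesis by (rule finite_subset[rotated]) (auto simp: Zg_def S_def)
    qed
    have wz: "winding_number (circlepath w s) x = 0" if "x \<notin> cball w s" for x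
      using that s(1) by (intro winding_number_zero_outside[of _ "cball w s"]) auto
    have rouche: "(\<Sum>p\<in>Zg. winding_number (circlepath w s) p * zorder (\<lambda>p. f p + g p) p) =
        (\<Sum>p\<in>Zf. winding_number (circlepath w s) p * zorder f p)"
      unfolding Zf_def Zg_def
    proof (rule Rouche_theorem)
      show "finite {p\<in>S. f p + g p = 0}" "finite {p\<in>S. f p = 0}" using finZ Zf unfolding Zg_def Zf_def by auto
      show "\<forall>x. x \<notin> S \<longrightarrow> winding_number (circlepath w s) x = 0"
      proof -
        have "cball w s \<subseteq> S" using s(1) s0(1) by (auto simp: S_def s_def)
        then show ?thesis using wz by blast
      qed
    qed (use s less holS in \<open>auto simp: S_def\<close>)
    have wn: "winding_number (circlepath w s) x = (if x \<in> ball w s then 1 else 0)" if x: "x \<in> Zg" for x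
    proof (cases "x \<in> ball w s")
      case True
      then show ?thesis using winding_number_circlepath[of x w s] by (simp add: dist_norm norm_minus_commute)
    next
      case False
      have "x \<notin> sphere w s"
      proof
        assume "x \<in> sphere w s"
        from less[OF this] x show False unfolding Zg_def
          by (metis (mono_tags, lifting) add_eq_0_iff mem_Collect_eq norm_minus_cancel order_less_irrefl)
      qed
      then show ?thesis using False wz[of x] by auto
    qed
    \<comment> \<open>Each zero has order at least 1, so the number of distinct zeros is at most the
      total order given by Rouche's theorem.\<close>
    have ord: "zorder (\<lambda>p. f p + g p) x \<ge> 1" if x: "x \<in> Zg" for x
      using zorder_exist_zero[OF holS(4), of x] x s nzp p(1) by (force simp: Zg_def)
    have "complex_of_int (\<Sum>x\<in>Zg \<inter> ball w s. zorder (\<lambda>p. f p + g p) x)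
        = (\<Sum>x\<in>Zg. winding_number (circlepath w s) x * zorder (\<lambda>p. f p + g p) x)"
      using finZ by (simp add: sum.inter_restrict wn cong: if_cong) (intro sum.cong, auto simp: wn)
    also note rouche
    also have "(\<Sum>p\<in>Zf. winding_number (circlepath w s) p * zorder f p) = complex_of_int M"
      using s(1) by (simp add: Zf M_def f_def winding_number_circlepath_centre)
    finally have "(\<Sum>x\<in>Zg \<inter> ball w s. zorder (\<lambda>p. f p + g p) x) = M" by (simp only: of_int_eq_iff)
    moreover have "int (card (Zg \<inter> ball w s)) \<le> (\<Sum>x\<in>Zg \<inter> ball w s. zorder (\<lambda>p. f p + g p) x)"
      using sum_mono[of "Zg \<inter> ball w s" "\<lambda>_. 1::int"] ord by simp
    moreover have "{u\<in>ball w s. F (k + K) u = c} = Zg \<inter> ball w s"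
    proof -
      have "F (k + K) u = c \<longleftrightarrow> f u + g u = 0" if u: "u \<in> ball w s" for u
      proof -
        have "u \<in> ball w \<rho>" using u s s0 by blast
        then have "flip b (F (k + K) u) = Some (H k u)" using FK[of "k + K" u] by (simp add: H_def)
        then have "F (k + K) u = c \<longleftrightarrow> H k u = z" using bz by (metis flip_eq_iff option.inject)
        then show ?thesis by (simp add: f_def g_def)
      qed
      then show ?thesis using s(3) by (auto simp: Zg_def)
    qed
    ultimately show ?thesis using finZ by simp
  qed
  show ?thesis
  proof (rule that[of s "N + K" "nat M"])
    fix k assume "N + K \<le> k"
    then show "finite {u\<in>ball w s. F k u = c} \<and> card {u\<in>ball w s. F k u = c} \<le> nat M"
      using main[of "k - K"] by simp
  qed (use s in auto)
qed

text \<open>At a pole the reciprocal extends holomorphically with value 0, which is a local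
  representation in the chart at infinity. Conversely, a zero of such a representation is isolated
  because the map is not constantly infinity, and so it gives a pole.\<close>

lemma mero_space_iff: "\<psi> \<in> mero_space \<longleftrightarrow> shol \<psi> UNIV \<and> \<not> \<psi> constant_on UNIV"
proof
  assume "\<psi> \<in> mero_space"
  then obtain g where nc: "\<not> \<psi> constant_on UNIV" and g: "g nicely_meromorphic_on UNIV"
    and \<psi>: "\<psi> = (\<lambda>z. if is_pole g z then None else Some (g z))"
    by (auto simp: mero_space_def)
  have "\<exists>b h r. r > 0 \<and> h holomorphic_on ball w r \<and> (\<forall>u\<in>ball w r. \<psi> u = flip b (Some (h u)))" for w
  proof (cases "is_pole g w")
    case False
    then have "g analytic_on {w}" using g nicely_meromorphic_on_imp_analytic_at by blast
    then obtain r where r: "r > 0" "g holomorphic_on ball w r" by (auto simp: analytic_at_ball)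
    then have "\<not> is_pole g u" if "u \<in> ball w r" for u using not_is_pole_holomorphic[of "ball w r" u g] that by simp
    then show ?thesis using r by (intro exI[of _ False] exI[of _ g] exI[of _ r]) (simp add: \<psi>)
  next
    case True
    have "isolated_singularity_at g w"
      using g unfolding nicely_meromorphic_on_def
      by (meson UNIV_I meromorphic_on_isolated_singularity meromorphic_on_subset subset_UNIV)
    then obtain r1 where r1: "r1 > 0" "g analytic_on ball w r1 - {w}" by (auto simp: isolated_singularity_at_def)
    have "\<forall>\<^sub>F u in at w. g u \<noteq> 0"
      using True unfolding is_pole_def by (rule filterlim_at_infinity_imp_eventually_ne)
    then obtain r2 where r2: "r2 > 0" "\<And>u. u \<noteq> w \<Longrightarrow> dist u w < r2 \<Longrightarrow> g u \<noteq> 0"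
      by (auto simp: eventually_at)
    define r where "r = min r1 r2"
    have "g holomorphic_on ball w r - {w}"
      by (rule holomorphic_on_subset[OF analytic_imp_holomorphic[OF r1(2)]]) (auto simp: r_def)
    then have r: "r > 0" "g holomorphic_on ball w r - {w}" "\<forall>u\<in>ball w r - {w}. g u \<noteq> 0"
      using r1 r2 by (auto simp: r_def dist_commute)
    define h where "h x = (if x = w then 0 else inverse (g x))" for x
    have "h holomorphic_on ball w r"
      using is_pole_inverse_holomorphic[of "ball w r" g w] True r unfolding h_def by simp
    moreover have "\<psi> u = flip True (Some (h u))" if u: "u \<in> ball w r" for u
    proof (cases "u = w")
      case False
      then have "\<not> is_pole g u" using not_is_pole_holomorphic[of "ball w r - {w}" u g] u r(2) by (simp add: open_delete)
      then show ?thesis using False u r(3) by (simp add: \<psi> h_def)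
    qed (use True in \<open>simp add: \<psi> h_def\<close>)
    ultimately show ?thesis using r(1) by blast
  qed
  then show "shol \<psi> UNIV \<and> \<not> \<psi> constant_on UNIV" using nc unfolding shol_def by blast
next
  assume *: "shol \<psi> UNIV \<and> \<not> \<psi> constant_on UNIV"
  \<comment> \<open>The value 0 at poles is the one that \<open>nicely_meromorphic_on\<close>
    prescribes.\<close>
  define g where "g z = (case \<psi> z of None \<Rightarrow> 0 | Some u \<Rightarrow> u)" for z
  have fin: "g analytic_on {w}" if w: "\<psi> w \<noteq> None" for w
  proof -
    obtain h r where h: "r > 0" "h holomorphic_on ball w r" "\<And>u. u \<in> ball w r \<Longrightarrow> flip False (\<psi> u) = Some (h u)"
      by (rule shol_chartE[of \<psi> UNIV w False]) (use * w in auto)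
    have "g holomorphic_on ball w r" using h(2) by (rule holomorphic_transform) (use h(3) in \<open>auto simp: g_def\<close>)
    then show ?thesis using h(1) by (auto simp: analytic_at_ball)
  qed
  have inf: "is_pole g w \<and> isolated_singularity_at g w" if w: "\<psi> w = None" for w
  proof -
    obtain h r where h: "r > 0" "h holomorphic_on ball w r" "\<And>u. u \<in> ball w r \<Longrightarrow> flip True (\<psi> u) = Some (h u)"
      by (rule shol_chartE[of \<psi> UNIV w True]) (use * w in auto)
    have h0: "h w = 0" using h(3)[of w] h(1) w by simp
    have "\<exists>\<beta>\<in>ball w r. h \<beta> \<noteq> 0"
    proof (rule ccontr)
      assume "\<not> ?thesis"
      then have "\<psi> u = None" if "u \<in> ball w r" for u
        using h(3)[OF that] that by (metis flip_simps(2) sinv_simps(2) sinv_sinv)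
      then have "\<psi> u = None" for u
        using shol_const_extend_open[of \<psi> UNIV "ball w r" None u] * h(1) by auto
      then show False using * unfolding constant_on_def by blast
    qed
    then obtain \<beta> where \<beta>: "\<beta> \<in> ball w r" "h \<beta> \<noteq> 0" by blast
    obtain s where s: "0 < s" "ball w s \<subseteq> ball w r" "\<And>u. u \<in> ball w s - {w} \<Longrightarrow> h u \<noteq> 0"
      using isolated_zeros[OF h(2) _ _ _ h0 \<beta>] h(1) by auto
    have gh: "g u = inverse (h u)" if u: "u \<in> ball w s - {w}" for u
    proof -
      have "sinv (\<psi> u) = Some (h u)" using h(3)[of u] u s by auto
      then have "\<psi> u = Some (inverse (h u))" using s(3)[OF u] by (metis sinv_simps(3) sinv_sinv)
      then show ?thesis by (simp add: g_def)
    qed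
    have ev: "\<forall>\<^sub>F u in at w. u \<in> ball w s - {w}"
      using s(1) by (auto simp: eventually_at dist_commute)
    have "isCont h w" using h(1,2) holomorphic_on_imp_continuous_on continuous_on_eq_continuous_at by (metis centre_in_ball open_ball)
    then have "filterlim h (at 0) (at w)"
      unfolding filterlim_at isCont_def h0 using eventually_mono[OF ev s(3)] by simp
    then have "filterlim (\<lambda>u. inverse (h u)) at_infinity (at w)"
      using filterlim_compose[OF filterlim_inverse_at_infinity] by blast
    then have "is_pole (\<lambda>u. inverse (h u)) w" by (simp add: is_pole_def)
    moreover have "\<forall>\<^sub>F u in at w. inverse (h u) = g u" using ev by (rule eventually_mono) (simp add: gh)
    ultimately have 1: "is_pole g w" by (rule is_pole_transform) simp
    have "(\<lambda>u. inverse (h u)) holomorphic_on ball w s - {w}"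
      using h(2) s by (intro holomorphic_intros) (auto elim: holomorphic_on_subset)
    then have "g holomorphic_on ball w s - {w}" by (rule holomorphic_transform) (simp add: gh)
    then have "g analytic_on ball w s - {w}" by (simp add: analytic_on_open open_delete)
    then show ?thesis using 1 s(1) by (auto simp: isolated_singularity_at_def)
  qed
  have nopole: "\<not> is_pole g w" if "\<psi> w \<noteq> None" for w
    using fin[OF that] analytic_at not_is_pole_holomorphic by blast
  have "g nicely_meromorphic_on UNIV"
  proof (rule nicely_meromorphic_onI_open[where pts = "{w. \<psi> w = None}"])
    show "g analytic_on UNIV - {w. \<psi> w = None}"
      by (subst analytic_on_analytic_at) (use fin in auto)
    show "isolated_singularity_at g w" for w
      using fin[of w] inf[of w] isolated_singularity_at_analytic by blast
    show "is_pole g w \<and> g w = 0" if "w \<in> {w. \<psi> w = None}" for w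
      using inf[of w] that by (auto simp: g_def)
  qed simp
  moreover have "\<psi> = (\<lambda>z. if is_pole g z then None else Some (g z))"
  proof
    fix z show "\<psi> z = (if is_pole g z then None else Some (g z))"
      using nopole[of z] inf[of z] by (cases "\<psi> z") (auto simp: g_def)
  qed
  ultimately show "\<psi> \<in> mero_space" using * unfolding mero_space_def by blast
qed

section \<open>Omitted values\<close>

lemma Schwarz_bound:
  assumes h: "h holomorphic_on ball w \<rho>" and \<rho>: "\<rho> > 0"
    and B: "\<And>u. u \<in> ball w \<rho> \<Longrightarrow> cmod (h u - h w) < B" and u: "u \<in> ball w \<rho>"
  shows "cmod (h u - h w) \<le> B * cmod (u - w) / \<rho>"
proof -
  have Bpos: "B > 0" using B[of w] \<rho> by simp
  define g where "g \<zeta> = (h (w + \<rho> * \<zeta>) - h w) / B" for \<zeta> :: complex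
  have mem: "w + \<rho> * \<zeta> \<in> ball w \<rho>" if "cmod \<zeta> < 1" for \<zeta> :: complex
    using that \<rho> by (simp add: dist_norm norm_mult)
  have "(\<lambda>\<zeta>. h (w + \<rho> * \<zeta>)) holomorphic_on ball 0 1"
    by (rule holomorphic_on_compose_gen[OF _ h, unfolded o_def]) (use mem in \<open>auto intro!: holomorphic_intros\<close>)
  then have "g holomorphic_on ball 0 1" unfolding g_def using Bpos by (intro holomorphic_intros) auto
  moreover have "cmod (g \<zeta>) < 1" if "cmod \<zeta> < 1" for \<zeta>
    using B[OF mem[OF that]] Bpos by (simp add: g_def norm_divide)
  moreover have "cmod ((u - w) / \<rho>) < 1" using u \<rho> by (simp add: dist_norm norm_divide norm_minus_commute)
  moreover have "g 0 = 0" by (simp add: g_def)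
  ultimately have "cmod (g ((u - w) / \<rho>)) \<le> cmod ((u - w) / \<rho>)"
    by (intro Schwarz_Lemma(1))
  moreover have "g ((u - w) / \<rho>) = (h u - h w) / B" using \<rho> by (simp add: g_def)
  ultimately show ?thesis using Bpos \<rho> by (simp add: norm_divide field_simps)
qed

text \<open>The bound of Schottky's theorem for a function of modulus at most 1 at the centre,
  evaluated on the disc of half the radius.\<close>

definition schottky_const :: real where
  "schottky_const = exp (pi * exp (pi * (2 + 2 * 1 + 12 * (1/2) / (1 - 1/2))))"

lemma schottky_const_pos: "schottky_const > 0" by (simp add: schottky_const_def)

text \<open>Schottky's theorem is applied on the closed disc of radius \<open>r / 2\<close>, which
  lies inside the domain of \<open>h\<close>; half of that radius is the \<open>r / 4\<close> of the
  claim.\<close>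

lemma Schottky_ball:
  assumes h: "h holomorphic_on ball w r" and r: "r > 0" and h01: "\<And>u. u \<in> ball w r \<Longrightarrow> h u \<noteq> 0 \<and> h u \<noteq> 1"
    and h1: "cmod (h w) \<le> 1" and u: "u \<in> cball w (r / 4)"
  shows "cmod (h u) \<le> schottky_const"
proof -
  have mem: "w + (r / 2) * \<zeta> \<in> ball w r" if "\<zeta> \<in> cball 0 1" for \<zeta> :: complex
    using that r by (simp add: dist_norm norm_mult)
  have "(\<lambda>\<zeta>. h (w + (r / 2) * \<zeta>)) holomorphic_on cball 0 1"
    by (rule holomorphic_on_compose_gen[OF _ h, unfolded o_def]) (use mem in \<open>auto intro!: holomorphic_intros\<close>)
  moreover have "cmod ((u - w) / (r / 2)) \<le> 1 / 2"
  proof -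
    have "cmod ((u - w) / (r / 2)) = 2 * cmod (u - w) / r" unfolding norm_divide norm_of_real using r by simp
    moreover have "cmod (u - w) \<le> r / 4" using u by (simp add: dist_norm norm_minus_commute)
    moreover from this have "2 * cmod (u - w) / r \<le> 1 / 2" using r by (simp add: field_simps)
    ultimately show ?thesis by (simp only:)
  qed
  ultimately have "cmod (h (w + (r / 2) * ((u - w) / (r / 2)))) \<le> exp (pi * exp (pi * (2 + 2 * 1 + 12 * (1/2) / (1 - 1/2))))"
    by (intro Schottky) (use mem h01 h1 in auto)
  moreover have "w + (r / 2) * ((u - w) / (r / 2)) = u" using r by (simp add: field_simps)
  ultimately show ?thesis by (simp only: schottky_const_def)
qed

text \<open>If the value at the centre lies outside the unit disc, \<open>1 / h\<close> also omits 0
  and 1 and has the same chordal distances, so Schottky's bound is always available. The constant is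
  2 from \<open>chordal_le\<close>, times 4 from the radius \<open>r / 4\<close>, times 2 for a
  strict bound in \<open>Schwarz_bound\<close>, times \<open>schottky_const + 1\<close>.\<close>

lemma shol_omit_standard:
  assumes \<psi>: "shol \<psi> (ball w r)" and r: "r > 0"
    and om: "\<And>u. u \<in> ball w r \<Longrightarrow> \<psi> u \<notin> {None, Some 0, Some 1}" and u: "u \<in> ball w (r / 4)"
  shows "chordal (\<psi> u) (\<psi> w) \<le> 16 * (schottky_const + 1) * cmod (u - w) / r"
proof -
  have *: "chordal (Some (h u)) (Some (h w)) \<le> 16 * (schottky_const + 1) * cmod (u - w) / r"
    if h: "h holomorphic_on ball w r" "\<And>u. u \<in> ball w r \<Longrightarrow> h u \<noteq> 0 \<and> h u \<noteq> 1" "cmod (h w) \<le> 1" for h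
  proof -
    have "cmod (h v - h w) < 2 * (schottky_const + 1)" if v: "v \<in> ball w (r / 4)" for v
    proof -
      have "cmod (h v) \<le> schottky_const" by (rule Schottky_ball[OF h(1) r h(2,3)]) (use v in auto)
      then have "cmod (h v - h w) \<le> schottky_const + 1"
        using h(3) norm_triangle_ineq4[of "h v" "h w"] by linarith
      also have "\<dots> < 2 * (schottky_const + 1)" using schottky_const_pos by simp
      finally show ?thesis .
    qed
    then have "cmod (h u - h w) \<le> 2 * (schottky_const + 1) * cmod (u - w) / (r / 4)"
      by (intro Schwarz_bound) (use h(1) r u in \<open>auto elim!: holomorphic_on_subset\<close>)
    then have "2 * cmod (h u - h w) \<le> 2 * (2 * (schottky_const + 1) * cmod (u - w) / (r / 4))"
      by (rule mult_left_mono) simp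
    also have "\<dots> = 16 * (schottky_const + 1) * cmod (u - w) / r" by simp
    finally show ?thesis using chordal_le[of "h u" "h w"] by (rule order_trans[rotated])
  qed
  define h where "h = (\<lambda>v. the (\<psi> v))"
  have "flip False (\<psi> v) \<noteq> None" if "v \<in> ball w r" for v using om[OF that] by simp
  then have h: "h holomorphic_on ball w r"
    using shol_holomorphic[OF \<psi>, of False] by (simp add: h_def)
  have eq: "\<psi> v = Some (h v)" if "v \<in> ball w r" for v using om[OF that] by (auto simp: h_def)
  have h01: "h v \<noteq> 0 \<and> h v \<noteq> 1" if "v \<in> ball w r" for v using om[OF that] eq[OF that] by auto
  have uw: "u \<in> ball w r" "w \<in> ball w r" using u r by auto
  show ?thesis
  proof (cases "cmod (h w) \<le> 1")
    case True
    then show ?thesis using *[OF h h01] eq uw by simp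
  next
    case False
    have "chordal (Some (inverse (h u))) (Some (inverse (h w))) \<le> 16 * (schottky_const + 1) * cmod (u - w) / r"
    proof (rule *)
      show "(\<lambda>v. inverse (h v)) holomorphic_on ball w r" using h h01 by (intro holomorphic_intros) auto
      show "cmod (inverse (h w)) \<le> 1" using False by (simp add: norm_inverse inverse_le_1_iff)
    qed (use h01 in auto)
    also have "chordal (Some (inverse (h u))) (Some (inverse (h w))) = chordal (sinv (\<psi> u)) (sinv (\<psi> w))"
      using eq uw h01 by simp
    finally show ?thesis by simp
  qed
qed

section \<open>Moebius normalisation of omitted values\<close>

definition affine_sphere :: "complex \<Rightarrow> complex \<Rightarrow> csphere \<Rightarrow> csphere" where
  "affine_sphere \<alpha> \<beta> = map_option (\<lambda>z. \<alpha> * z + \<beta>)"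

lemma affine_sphere_simps [simp]: "affine_sphere \<alpha> \<beta> None = None" "affine_sphere \<alpha> \<beta> (Some z) = Some (\<alpha> * z + \<beta>)"
  by (simp_all add: affine_sphere_def)

lemma affine_sphere_inverse: "\<alpha> \<noteq> 0 \<Longrightarrow> affine_sphere (1 / \<alpha>) (- \<beta> / \<alpha>) (affine_sphere \<alpha> \<beta> x) = x"
  by (cases x) (auto simp: field_simps)

lemma hmap_affine_sphere:
  assumes "\<alpha> \<noteq> 0"
  shows "hmap (affine_sphere \<alpha> \<beta>)"
proof (rule hmapI)
  fix b
  show "shol (\<lambda>z. affine_sphere \<alpha> \<beta> (flip b (Some z))) UNIV"
  proof (cases b)
    case False
    then show ?thesis by (intro sholI[of "\<lambda>z. \<alpha> * z + \<beta>" _ _ False]) (auto intro!: holomorphic_intros)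
  next
    case True
    have 1: "shol (\<lambda>z. affine_sphere \<alpha> \<beta> (sinv (Some z))) (- {0})"
      by (rule sholI[of "\<lambda>z. \<alpha> * inverse z + \<beta>" _ _ False]) (auto intro!: holomorphic_intros)
    have "open {z. \<alpha> + \<beta> * z \<noteq> 0}"
      by (intro open_Collect_neq continuous_intros)
    then have 2: "shol (\<lambda>z. affine_sphere \<alpha> \<beta> (sinv (Some z))) {z. \<alpha> + \<beta> * z \<noteq> 0}"
    proof (rule sholI[of "\<lambda>z. z / (\<alpha> + \<beta> * z)" _ _ True, rotated])
      fix u assume u: "u \<in> {z. \<alpha> + \<beta> * z \<noteq> 0}"
      show "affine_sphere \<alpha> \<beta> (sinv (Some u)) = flip True (Some (u / (\<alpha> + \<beta> * u)))"
        using u by (cases "u = 0") (auto simp: field_simps)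
    qed (auto intro!: holomorphic_intros)
    have "shol (\<lambda>z. affine_sphere \<alpha> \<beta> (sinv (Some z))) (- {0} \<union> {z. \<alpha> + \<beta> * z \<noteq> 0})"
      using 1 2 unfolding shol_def by blast
    moreover have "- {0} \<union> {z. \<alpha> + \<beta> * z \<noteq> 0} = UNIV" using assms by auto
    ultimately show ?thesis using True by simp
  qed
qed

lemma Moebius_to_None:
  obtains T T' where "\<And>x. T' (T x) = x" "hmap T" "hmap T'" "T a = None"
proof (cases a)
  case None
  have "hmap (\<lambda>x. x)" by (simp add: hmap_def)
  then show ?thesis using that[of "\<lambda>x. x" "\<lambda>x. x"] None by simp
next
  case (Some z)
  define T where "T x = flip True (affine_sphere 1 (- z) x)" for x
  define T' where "T' x = affine_sphere 1 z (flip True x)" for x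
  have h: "hmap (affine_sphere 1 t)" for t by (rule hmap_affine_sphere) simp
  have "T' (T x) = x" for x using affine_sphere_inverse[of 1 "- z" x] by (simp add: T_def T'_def)
  moreover have "hmap T" unfolding T_def by (rule hmap_compose[OF hmap_flip h])
  moreover have "hmap T'" unfolding T'_def by (rule hmap_compose[OF h hmap_flip])
  moreover have "T a = None" by (simp add: T_def Some)
  ultimately show ?thesis using that by blast
qed

text \<open>The left inverse \<open>T'\<close> is holomorphic too, hence uniformly continuous, so
  that estimates in normalised coordinates can be carried back.\<close>

lemma Moebius_to_standard:
  assumes "a \<noteq> b" "b \<noteq> c" "a \<noteq> c"
  obtains T T' where "\<And>x. T' (T x) = x" "hmap T" "hmap T'" "T a = None" "T b = Some 0" "T c = Some 1"
proof -
  obtain T T' where T: "\<And>x. T' (T x) = x" "hmap T" "hmap T'" "T a = None" by (rule Moebius_to_None[of a]) (rule that)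
  obtain \<beta> \<gamma> where bc: "T b = Some \<beta>" "T c = Some \<gamma>"
    using T(1,4) assms by (metis not_None_eq)
  have ne: "\<gamma> - \<beta> \<noteq> 0" using bc T(1) assms by (metis right_minus_eq)
  define s where "s = 1 / (\<gamma> - \<beta>)"
  have s: "s \<noteq> 0" using ne by (simp add: s_def)
  define U where "U x = affine_sphere s (- \<beta> * s) (T x)" for x
  define U' where "U' x = T' (affine_sphere (1 / s) (- (- \<beta> * s) / s) x)" for x
  have s': "1 / s \<noteq> 0" using s by simp
  show ?thesis
  proof (rule that[of U' U])
    show "U' (U x) = x" for x unfolding U_def U'_def affine_sphere_inverse[OF s] by (rule T)
    show "hmap U" unfolding U_def by (rule hmap_compose[OF hmap_affine_sphere[OF s] T(2)])
    show "hmap U'" unfolding U'_def by (rule hmap_compose[OF T(3) hmap_affine_sphere[OF s']])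
    show "U a = None" "U b = Some 0" by (simp_all add: U_def T bc)
    have "s * (\<gamma> - \<beta>) = 1" using ne by (simp add: s_def)
    then show "U c = Some 1" by (simp add: U_def T bc algebra_simps)
  qed
qed

text \<open>Montel's theorem in a scale-invariant form: \<open>\<eta>\<close> depends on the three
  values and on \<open>e\<close>, not on the map or the ball, and is measured relative to the
  radius.\<close>

lemma shol_omit3:
  assumes "a \<noteq> b" "b \<noteq> c" "a \<noteq> c" "e > 0"
  obtains \<eta> where "\<eta> > 0"
    "\<And>\<psi> w r u. r > 0 \<Longrightarrow> shol \<psi> (ball w r) \<Longrightarrow> (\<And>u. u \<in> ball w r \<Longrightarrow> \<psi> u \<notin> {a, b, c}) \<Longrightarrow>
        cmod (u - w) < \<eta> * r \<Longrightarrow> chordal (\<psi> u) (\<psi> w) < e"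
proof -
  obtain T T' where T: "\<And>x. T' (T x) = x" "hmap T" "hmap T'" "T a = None" "T b = Some 0" "T c = Some 1"
    using Moebius_to_standard[OF assms(1-3)] by metis
  obtain d where d: "d > 0" "\<And>x y. chordal x y < d \<Longrightarrow> chordal (T' x) (T' y) < e"
    using scont_uniform[OF hmap_scont[OF T(3)] assms(4)] by metis
  define C where "C = 16 * (schottky_const + 1)"
  have C: "C > 0" using schottky_const_pos by (simp add: C_def)
  show ?thesis
  proof (rule that[of "min (1/4) (d / C)"])
    show "min (1/4) (d / C) > 0" using d C by simp
    fix \<psi> w r u
    assume r: "r > 0" and \<psi>: "shol \<psi> (ball w r)" and om: "\<And>u. u \<in> ball w r \<Longrightarrow> \<psi> u \<notin> {a, b, c}"
      and u: "cmod (u - w) < min (1/4) (d / C) * r"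
    have u1: "cmod (u - w) < r / 4" "C * cmod (u - w) / r < d"
    proof -
      have "min (1/4) (d / C) * r \<le> 1/4 * r" "min (1/4) (d / C) * r \<le> d / C * r"
        using r by (intro mult_right_mono min.cobounded1 min.cobounded2 less_imp_le; assumption)+
      then have "cmod (u - w) < 1/4 * r" "cmod (u - w) < d / C * r" using u by linarith+
      then show "cmod (u - w) < r / 4" "C * cmod (u - w) / r < d" using C r by (simp_all add: field_simps)
    qed
    have "chordal (T (\<psi> u)) (T (\<psi> w)) \<le> C * cmod (u - w) / r"
      unfolding C_def
    proof (rule shol_omit_standard[OF hmapD[OF T(2) \<psi>] r])
      show "T (\<psi> v) \<notin> {None, Some 0, Some 1}" if "v \<in> ball w r" for v
        using om[OF that] T(1,4,5,6) by (metis insertE insertI1 insertI2 singletonD)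
    qed (use u1 in \<open>simp add: dist_norm norm_minus_commute\<close>)
    then have "chordal (T' (T (\<psi> u))) (T' (T (\<psi> w))) < e" using u1 by (intro d) simp
    then show "chordal (\<psi> u) (\<psi> w) < e" by (simp add: T(1))
  qed
qed

text \<open>Different maps may omit different triples of \<open>Z\<close>; the minimum over the
  finitely many triples serves them all.\<close>

lemma shol_omit_finite:
  assumes "finite Z" "e > 0"
  obtains \<eta> where "\<eta> > 0"
    "\<And>\<psi> w r u. r > 0 \<Longrightarrow> shol \<psi> (ball w r) \<Longrightarrow> card (Z \<inter> \<psi> ` ball w r) + 3 \<le> card Z \<Longrightarrow>
        cmod (u - w) < \<eta> * r \<Longrightarrow> chordal (\<psi> u) (\<psi> w) < e"
proof -
  have "\<exists>\<eta>>0. \<forall>\<psi> w r u. r > 0 \<longrightarrow> shol \<psi> (ball w r) \<longrightarrow> (\<forall>u\<in>ball w r. \<psi> u \<notin> {a, b, c}) \<longrightarrow>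
        cmod (u - w) < \<eta> * r \<longrightarrow> chordal (\<psi> u) (\<psi> w) < e" if "a \<noteq> b" "b \<noteq> c" "a \<noteq> c" for a b c
    using shol_omit3[OF that assms(2)] by metis
  then obtain \<eta> where \<eta>: "\<And>a b c. a \<noteq> b \<Longrightarrow> b \<noteq> c \<Longrightarrow> a \<noteq> c \<Longrightarrow> \<eta> a b c > 0"
    "\<And>a b c \<psi> w r u. a \<noteq> b \<Longrightarrow> b \<noteq> c \<Longrightarrow> a \<noteq> c \<Longrightarrow> r > 0 \<Longrightarrow> shol \<psi> (ball w r) \<Longrightarrow>
        (\<And>u. u \<in> ball w r \<Longrightarrow> \<psi> u \<notin> {a, b, c}) \<Longrightarrow>
        cmod (u - w) < \<eta> a b c * r \<Longrightarrow> chordal (\<psi> u) (\<psi> w) < e" by metis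
  \<comment> \<open>The element 1 keeps the minimum meaningful when \<open>Z\<close> contains no
    three distinct points.\<close>
  define X where "X = insert 1 ((\<lambda>(a, b, c). \<eta> a b c) ` {(a, b, c) \<in> Z \<times> Z \<times> Z. a \<noteq> b \<and> b \<noteq> c \<and> a \<noteq> c})"
  have "finite {(a, b, c) \<in> Z \<times> Z \<times> Z. a \<noteq> b \<and> b \<noteq> c \<and> a \<noteq> c}"
    by (rule finite_subset[of _ "Z \<times> Z \<times> Z"]) (use assms(1) in auto)
  then have X: "finite X" "X \<noteq> {}" by (auto simp: X_def)
  show ?thesis
  proof (rule that[of "Min X"])
    show "Min X > 0" using X \<eta>(1) by (subst Min_gr_iff) (auto simp: X_def)
    fix \<psi> w r u
    assume r: "r > 0" and \<psi>: "shol \<psi> (ball w r)" and cd: "card (Z \<inter> \<psi> ` ball w r) + 3 \<le> card Z"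
      and u: "cmod (u - w) < Min X * r"
    have "card (Z - \<psi> ` ball w r) = card Z - card (Z \<inter> \<psi> ` ball w r)"
      using card_Diff_subset_Int[of Z "\<psi> ` ball w r"] assms(1) by simp
    then have "3 \<le> card (Z - \<psi> ` ball w r)" using cd by simp
    then obtain A where "A \<subseteq> Z - \<psi> ` ball w r" "card A = 3" by (rule obtain_subset_with_card_n)
    then obtain a b c where "A = {a, b, c}" and ne: "a \<noteq> b" "b \<noteq> c" "a \<noteq> c"
      unfolding card_3_iff by blast
    with \<open>A \<subseteq> Z - \<psi> ` ball w r\<close> have abc: "{a, b, c} \<subseteq> Z - \<psi> ` ball w r" "a \<noteq> b" "b \<noteq> c" "a \<noteq> c"
      by simp_all
    then have "(a, b, c) \<in> {(a, b, c) \<in> Z \<times> Z \<times> Z. a \<noteq> b \<and> b \<noteq> c \<and> a \<noteq> c}" by simp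
    from imageI[OF this, of "\<lambda>(a, b, c). \<eta> a b c"] have "\<eta> a b c \<in> X" by (simp add: X_def)
    then have "Min X * r \<le> \<eta> a b c * r" using X r by (intro mult_right_mono Min_le) auto
    then have "cmod (u - w) < \<eta> a b c * r" using u by linarith
    moreover have "\<psi> v \<notin> {a, b, c}" if "v \<in> ball w r" for v using abc(1) that by blast
    ultimately show "chordal (\<psi> u) (\<psi> w) < e" by (intro \<eta>(2)[OF abc(2-4) r \<psi>])
  qed
qed

lemma shol_Picard:
  assumes \<psi>: "shol \<psi> UNIV" and abc: "a \<noteq> b" "b \<noteq> c" "a \<noteq> c" and om: "\<And>u. \<psi> u \<notin> {a, b, c}"
  shows "\<psi> constant_on UNIV"
proof -
  obtain T T' where T: "\<And>x. T' (T x) = x" "hmap T" "hmap T'" "T a = None" "T b = Some 0" "T c = Some 1"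
    using Moebius_to_standard[OF abc] by metis
  have om': "T (\<psi> u) \<notin> {None, Some 0, Some 1}" for u
    using om[of u] T(1,4,5,6) by (metis insertE insertI1 insertI2 singletonD)
  define h where "h = (\<lambda>u. the (T (\<psi> u)))"
  have eq: "T (\<psi> u) = Some (h u)" for u using om'[of u] by (auto simp: h_def)
  have "flip False (T (\<psi> u)) \<noteq> None" for u using om'[of u] by simp
  then have "h holomorphic_on UNIV"
    unfolding h_def using shol_holomorphic[OF hmapD[OF T(2) \<psi>], of False] by simp
  moreover have "h u \<noteq> 0 \<and> h u \<noteq> 1" for u using om'[of u] eq[of u] by auto
  ultimately obtain c where "h = (\<lambda>u. c)" using little_Picard_01 by metis
  then have "\<psi> u = T' (Some c)" for u using eq[of u] T(1)[of "\<psi> u"] by simp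
  then show ?thesis by (auto simp: constant_on_def)
qed

section \<open>Weak forms of the Koebe theorems\<close>

text \<open>Schottky's theorem applies to the branch of \<open>sqrt ((v - F) / (v - F w))\<close> with value \<open>-1\<close> at \<open>w\<close>: it omits \<open>0\<close>
  because \<open>F\<close> omits \<open>v\<close>, and \<open>1\<close> because \<open>F\<close> is injective.\<close>

lemma Koebe_omitted:
  assumes F: "F holomorphic_on ball w R" and R: "R > 0" and inj: "inj_on F (ball w R)" and v: "v \<notin> F ` ball w R"
    and u: "u \<in> cball w (R / 4)"
  shows "cmod (F u - F w) \<le> (1 + schottky_const\<^sup>2) * cmod (v - F w)"
proof -
  have vne: "v - F x \<noteq> 0" if "x \<in> ball w R" for x using v that by auto
  then have vw: "v - F w \<noteq> 0" using R by simp
  define G where "G x = (v - F x) / (v - F w)" for x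
  have "G holomorphic_on ball w R" unfolding G_def using vw by (intro holomorphic_intros F) auto
  moreover have "G x \<noteq> 0" if "x \<in> ball w R" for x using vne[OF that] vw by (simp add: G_def)
  ultimately obtain s where s: "s holomorphic_on ball w R" "\<And>x. x \<in> ball w R \<Longrightarrow> G x = s x ^ 2"
    using contractible_imp_holomorphic_sqrt[of G "ball w R"] convex_imp_contractible by blast
  have G1: "G w = 1" using vw by (simp add: G_def)
  then have sw: "s w ^ 2 = 1" using s(2)[of w] R by simp
  define h where "h x = - s x * s w" for x
  have h2: "(h x)\<^sup>2 = G x" if "x \<in> ball w R" for x
    using s(2)[OF that] sw by (simp add: h_def power_mult_distrib)
  have hw: "h w = - 1" using sw by (simp add: h_def power2_eq_square)
  have "h x \<noteq> 0 \<and> h x \<noteq> 1" if x: "x \<in> ball w R" for x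
  proof
    show "h x \<noteq> 0" using h2[OF x] vne[OF x] vw by (auto simp: G_def)
    show "h x \<noteq> 1"
    proof
      assume 1: "h x = 1"
      then have "G x = 1" using h2[OF x] by simp
      then have "F x = F w" using vw by (simp add: G_def)
      then have "x = w" using inj x R by (auto simp: inj_on_def)
      then show False using 1 hw by simp
    qed
  qed
  moreover have "h holomorphic_on ball w R" unfolding h_def by (intro holomorphic_intros s)
  ultimately have "cmod (h u) \<le> schottky_const"
    by (intro Schottky_ball[OF _ R]) (use u hw in auto)
  then have "(cmod (h u))\<^sup>2 \<le> schottky_const\<^sup>2" by (simp add: power_mono)
  moreover have "u \<in> ball w R" using u R by auto
  ultimately have "cmod (G u) \<le> schottky_const\<^sup>2" using h2[of u] by (metis norm_power)
  then have "cmod (1 - G u) \<le> 1 + schottky_const\<^sup>2" using norm_triangle_ineq4[of 1 "G u"] by simp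
  moreover have "F u - F w = (1 - G u) * (v - F w)" using vw by (simp add: G_def field_simps)
  ultimately show ?thesis by (simp add: norm_mult mult_right_mono)
qed

text \<open>The factor 16 is 2 times 8: a Cauchy estimate on the disc of radius
  \<open>R / 8\<close>, with the bound of \<open>Koebe_omitted\<close> doubled to make it
  strict.\<close>

definition koebe_const :: real where "koebe_const = 16 * (1 + schottky_const\<^sup>2)"

lemma koebe_const_pos: "koebe_const > 0"
  by (simp add: koebe_const_def add_pos_nonneg)

text \<open>A weak one-quarter theorem: Cauchy's estimate turns the growth bound in terms of an
  omitted value into a bound on the derivative at the centre.\<close>

lemma Koebe_deriv_omitted:
  assumes F: "F holomorphic_on ball w R" and R: "R > 0" and inj: "inj_on F (ball w R)" and v: "v \<notin> F ` ball w R"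
  shows "R * cmod (deriv F w) \<le> koebe_const * cmod (v - F w)"
proof -
  have vw: "cmod (v - F w) > 0" using v R by auto
  define B where "B = (1 + schottky_const\<^sup>2) * cmod (v - F w)"
  have B: "B > 0" using vw by (simp add: B_def add_pos_nonneg)
  have "cmod ((deriv ^^ 1) F w) \<le> fact 1 * (2 * B) / (R / 8) ^ 1"
  proof (rule Cauchy_higher_deriv_bound)
    show "F holomorphic_on ball w (R / 8)" "continuous_on (cball w (R / 8)) F"
      using R by (auto intro!: holomorphic_on_subset[OF F] continuous_on_subset[OF holomorphic_on_imp_continuous_on[OF F]])
    show "F x \<in> ball (F w) (2 * B)" if "x \<in> ball w (R / 8)" for x
    proof -
      have "cmod (F x - F w) \<le> B" unfolding B_def by (rule Koebe_omitted[OF F R inj v]) (use that R in auto)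
      then show ?thesis using B by (simp add: dist_norm norm_minus_commute)
    qed
  qed (use R in auto)
  then show ?thesis using R by (simp add: koebe_const_def B_def field_simps)
qed

text \<open>A weak growth theorem. If the image contained the closed disc of radius
  \<open>2 * R * cmod (deriv F w)\<close> about \<open>F w\<close>, Cauchy's estimate would bound
  the derivative of the inverse map by half of its actual size. Hence some value \<open>v\<close> in
  that disc is omitted, and \<open>Koebe_omitted\<close> applies to it.\<close>

lemma Koebe_growth:
  assumes F: "F holomorphic_on ball w R" and R: "R > 0" and inj: "inj_on F (ball w R)" and u: "u \<in> cball w (R / 4)"
  shows "cmod (F u - F w) \<le> koebe_const * R * cmod (deriv F w)"
proof -
  have wb: "w \<in> ball w R" using R by simp
  have d: "deriv F w \<noteq> 0" using holomorphic_injective_imp_regular[OF F open_ball inj wb] .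
  define \<rho> where "\<rho> = 2 * R * cmod (deriv F w)"
  have \<rho>: "\<rho> > 0" using R d by (simp add: \<rho>_def)
  obtain v where v: "v \<in> cball (F w) \<rho>" "v \<notin> F ` ball w R"
  proof (rule ccontr)
    assume "\<not> thesis"
    then have sub: "cball (F w) \<rho> \<subseteq> F ` ball w R" using that by blast
    obtain H where H: "H holomorphic_on (F ` ball w R)" "\<And>z. z \<in> ball w R \<Longrightarrow> deriv F z * deriv H (F z) = 1"
      "\<And>z. z \<in> ball w R \<Longrightarrow> H (F z) = z"
      using holomorphic_has_inverse[OF F open_ball inj] by metis
    have "cmod ((deriv ^^ 1) H (F w)) \<le> fact 1 * R / \<rho> ^ 1"
    proof (rule Cauchy_higher_deriv_bound)
      show "H holomorphic_on ball (F w) \<rho>" "continuous_on (cball (F w) \<rho>) H"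
        using sub ball_subset_cball by (blast intro: holomorphic_on_subset[OF H(1)] continuous_on_subset[OF holomorphic_on_imp_continuous_on[OF H(1)]])+
      show "H x \<in> ball w R" if "x \<in> ball (F w) \<rho>" for x
      proof -
        have "x \<in> F ` ball w R" using that sub by auto
        then show ?thesis using H(3) by auto
      qed
    qed (use \<rho> in auto)
    then have "cmod (deriv H (F w)) \<le> R / \<rho>" by simp
    moreover have "cmod (deriv F w) * cmod (deriv H (F w)) = 1" using H(2)[OF wb] by (metis norm_mult norm_one)
    ultimately have "1 \<le> cmod (deriv F w) * (R / \<rho>)" by (metis mult_left_mono norm_ge_zero)
    then show False using R d by (simp add: \<rho>_def)
  qed
  have "cmod (F u - F w) \<le> (1 + schottky_const\<^sup>2) * cmod (v - F w)" by (rule Koebe_omitted) fact+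
  also have "\<dots> \<le> (1 + schottky_const\<^sup>2) * \<rho>"
    using v(1) by (intro mult_left_mono) (auto simp: dist_norm norm_minus_commute add_nonneg_nonneg)
  also have "\<dots> = 2 * (1 + schottky_const\<^sup>2) * (R * cmod (deriv F w))" by (simp add: \<rho>_def)
  also have "\<dots> \<le> koebe_const * (R * cmod (deriv F w))"
    using R by (intro mult_right_mono) (auto simp: koebe_const_def add_nonneg_nonneg)
  finally show ?thesis by (simp add: mult.assoc)
qed

section \<open>Rational maps\<close>

lemma shol_fraction:
  assumes nz: "\<And>z. poly P z \<noteq> 0 \<or> poly Q z \<noteq> 0"
  shows "shol (\<lambda>z. if poly Q z = 0 then None else Some (poly P z / poly Q z)) UNIV" (is "shol ?f _")
proof -
  have o: "open {z. poly R z \<noteq> 0}" for R :: "complex poly"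
    by (intro open_Collect_neq continuous_intros)
  have 1: "shol ?f {z. poly Q z \<noteq> 0}"
    by (rule sholI[of "\<lambda>z. poly P z / poly Q z" _ _ False]) (auto intro!: holomorphic_intros o)
  have 2: "shol ?f {z. poly P z \<noteq> 0}"
    by (rule sholI[of "\<lambda>z. poly Q z / poly P z" _ _ True]) (auto intro!: holomorphic_intros o)
  have "{z. poly Q z \<noteq> 0} \<union> {z. poly P z \<noteq> 0} = UNIV" using nz by auto
  then show ?thesis using 1 2 unfolding shol_def by blast
qed

lemma coprime_no_common_root:
  fixes p q :: "complex poly"
  assumes "coprime p q"
  shows "poly p z \<noteq> 0 \<or> poly q z \<noteq> 0"
proof (rule ccontr)
  assume "\<not> ?thesis"
  then have "[:- z, 1:] dvd p" "[:- z, 1:] dvd q" by (auto simp: poly_eq_0_iff_dvd)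
  then have "is_unit [:- z, 1:]" using assms coprime_common_divisor by blast
  then show False by (simp add: is_unit_iff_degree)
qed

lemma poly_root_exists:
  fixes P :: "complex poly"
  assumes "degree P \<noteq> 0"
  obtains z where "poly P z = 0"
proof -
  have "\<not> constant (poly P)" using assms by (simp add: constant_degree)
  from Fundamental_Theorem_Algebra.fundamental_theorem_of_algebra[OF this] that show ?thesis by blast
qed

locale rational_data =
  fixes p q :: "complex poly" and d :: nat and f :: "csphere \<Rightarrow> csphere"
  assumes cop: "coprime p q" and deg: "max (degree p) (degree q) = d" and d2: "d \<ge> 2" and f_def: "f = rational_fun p q"
begin

lemma common_root: "poly p z \<noteq> 0 \<or> poly q z \<noteq> 0"
  using cop by (rule coprime_no_common_root)

lemma coeff_d: "coeff p d \<noteq> 0 \<or> coeff q d \<noteq> 0"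
proof (cases "degree p = d")
  case True
  then have "p \<noteq> 0" using d2 by auto
  then have "lead_coeff p \<noteq> 0" by simp
  then show ?thesis using True by simp
next
  case False
  then have *: "degree q = d" using deg by (auto simp: max_def split: if_splits)
  then have "q \<noteq> 0" using d2 by auto
  then have "lead_coeff q \<noteq> 0" by simp
  then show ?thesis using * by simp
qed

lemma f_Some: "f (Some z) = (if poly q z = 0 then None else Some (poly p z / poly q z))"
  by (simp add: f_def rational_fun_def)

lemma f_None: "f None = (if coeff q d = 0 then None else Some (coeff p d / coeff q d))"
  by (simp add: f_def rational_fun_def deg Let_def)

lemma hmap_f: "hmap f"
proof (rule hmapI)
  fix b
  show "shol (\<lambda>z. f (flip b (Some z))) UNIV"
  proof (cases b)
    case False
    then show ?thesis using shol_fraction[OF common_root] by (simp add: f_Some)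
  next
    case True
    \<comment> \<open>This is \<open>z ^ d\<close> times \<open>r\<close> at \<open>1 / z\<close>,
      as a polynomial. \<open>reflect_poly\<close> reverses up to the degree of \<open>r\<close>,
      and the monomial makes up the difference to \<open>d\<close>, so that numerator and
      denominator are scaled alike.\<close>
    define rf where "rf r = monom 1 (d - degree r) * reflect_poly r" for r :: "complex poly"
    have rf_nz: "poly (rf r) z = z ^ d * poly r (inverse z)" if "degree r \<le> d" "z \<noteq> 0" for r z
    proof -
      have "z ^ (d - degree r) * z ^ degree r = z ^ d" using that(1) by (simp add: power_add[symmetric])
      then show ?thesis using that by (simp add: rf_def poly_monom poly_reflect_poly_nz mult.assoc[symmetric])
    qed
    have rf_0: "poly (rf r) 0 = coeff r d" if "degree r \<le> d" for r
    proof (cases "degree r = d")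
      case True
      then show ?thesis by (simp add: rf_def poly_monom)
    next
      case False
      then have "coeff r d = 0" using that by (simp add: coeff_eq_0)
      then show ?thesis using False that by (simp add: rf_def poly_monom)
    qed
    have dp: "degree p \<le> d" "degree q \<le> d" using deg by auto
    have nz: "poly (rf p) z \<noteq> 0 \<or> poly (rf q) z \<noteq> 0" for z
      using rf_nz[OF dp(1), of z] rf_nz[OF dp(2), of z] rf_0[OF dp(1)] rf_0[OF dp(2)] coeff_d common_root[of "inverse z"]
      by (cases "z = 0") auto
    have "f (sinv (Some z)) = (if poly (rf q) z = 0 then None else Some (poly (rf p) z / poly (rf q) z))" for z
      using rf_nz[OF dp(1), of z] rf_nz[OF dp(2), of z] rf_0[OF dp(1)] rf_0[OF dp(2)]
      by (cases "z = 0") (auto simp: f_Some f_None)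
    then show ?thesis using True shol_fraction[OF nz] by simp
  qed
qed

lemma f_eq_SomeI: "poly (p - smult a q) z = 0 \<Longrightarrow> f (Some z) = Some a"
  using common_root[of z] by (auto simp: f_Some field_simps)

lemma diff_nonzero: "p - smult a q \<noteq> 0"
proof
  assume "p - smult a q = 0"
  then have p: "p = smult a q" by simp
  then have "q dvd p" by (simp add: dvd_smult)
  then have "is_unit q" using cop by (metis coprime_common_divisor dvd_refl)
  then have "degree q = 0" by (metis is_unit_iff_degree not_is_unit_0)
  then have "degree p = 0" using p by simp
  then show False using deg d2 \<open>degree q = 0\<close> by simp
qed

lemma surj_f: "\<exists>x. f x = y"
proof (cases y)
  case None
  show ?thesis
  proof (cases "degree q = 0")
    case True
    then have "coeff q d = 0" using d2 by (simp add: coeff_eq_0)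
    then show ?thesis using None f_None by auto
  next
    case False
    then obtain z where "poly q z = 0" by (rule poly_root_exists)
    then have "f (Some z) = None" by (simp add: f_Some)
    then show ?thesis using None by blast
  qed
next
  case (Some a)
  show ?thesis
  proof (cases "degree (p - smult a q) = 0")
    case True
    then have "coeff (p - smult a q) d = 0" using d2 by (intro coeff_eq_0) linarith
    then have "coeff p d = a * coeff q d" by simp
    moreover from this have "coeff q d \<noteq> 0" using coeff_d by auto
    ultimately show ?thesis using Some f_None by auto
  next
    case False
    then obtain z where "poly (p - smult a q) z = 0" by (rule poly_root_exists)
    then show ?thesis using Some f_eq_SomeI by blast
  qed
qed

text \<open>Since infinity is not a preimage, \<open>p - smult a q\<close> keeps the full degree
  \<open>d\<close>; its roots are the preimages of \<open>Some a\<close>, and there is only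
  one.\<close>

lemma pure_power:
  assumes "\<And>x. f x = Some a \<longleftrightarrow> x = Some r"
  obtains \<alpha> where "\<alpha> \<noteq> 0" "p - smult a q = smult \<alpha> ([:- r, 1:] ^ d)"
proof -
  define R where "R = p - smult a q"
  have "degree R \<le> d" unfolding R_def using deg by (intro degree_diff_le order_trans[OF degree_smult_le]) auto
  have "f None \<noteq> Some a" using assms by simp
  then have "coeff R d \<noteq> 0"
    unfolding R_def f_None using coeff_d by (cases "coeff q d = 0") (auto simp: field_simps)
  with \<open>degree R \<le> d\<close> have dR: "degree R = d" by (meson le_antisym le_degree)
  have R0: "R \<noteq> 0" using diff_nonzero by (simp add: R_def)
  have "poly R z = 0 \<longleftrightarrow> z = r" for z
  proof
    show "poly R z = 0 \<Longrightarrow> z = r" using f_eq_SomeI[of a z] assms unfolding R_def by auto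
    have "f (Some r) = Some a" using assms by simp
    then show "z = r \<Longrightarrow> poly R z = 0" by (auto simp: R_def f_Some split: if_splits)
  qed
  then have "{z. poly R z = 0} = {r}" by auto
  then have R: "smult (lead_coeff R) ([:- r, 1:] ^ order r R) = R" using complex_poly_decompose[of R] by simp
  then have "degree R = order r R"
    using R0 by (metis degree_linear_power degree_smult_eq leading_coeff_0_iff)
  with R dR have "R = smult (lead_coeff R) ([:- r, 1:] ^ d)" by metis
  then show ?thesis using that[of "lead_coeff R"] R0 unfolding R_def[symmetric] by (metis leading_coeff_0_iff)
qed

text \<open>Eliminating \<open>p\<close> and \<open>q\<close> from the three identities of
  \<open>pure_power\<close> leaves a linear relation between three \<open>d\<close>-th powers. It
  and its derivative are evaluated at \<open>r\<close>, where one of the powers vanishes, and the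
  two resulting equations are incompatible.\<close>

lemma no_three_pure:
  assumes abc: "a \<noteq> b" "b \<noteq> c" "a \<noteq> c"
    and a: "\<And>x. f x = Some a \<longleftrightarrow> x = Some r" and b: "\<And>x. f x = Some b \<longleftrightarrow> x = Some s"
    and c: "\<And>x. f x = Some c \<longleftrightarrow> x = Some t"
  shows False
proof -
  obtain \<alpha> \<beta> \<gamma> where \<alpha>: "\<alpha> \<noteq> 0" "p - smult a q = smult \<alpha> ([:- r, 1:] ^ d)"
    and \<beta>: "\<beta> \<noteq> 0" "p - smult b q = smult \<beta> ([:- s, 1:] ^ d)"
    and \<gamma>: "\<gamma> \<noteq> 0" "p - smult c q = smult \<gamma> ([:- t, 1:] ^ d)"
    using pure_power[OF a] pure_power[OF b] pure_power[OF c] by metis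
  have rst: "r \<noteq> s" "s \<noteq> t" "r \<noteq> t" using a b c abc by (metis option.inject)+
  define A B C where "A = (b - c) * \<alpha>" and "B = (c - a) * \<beta>" and "C = (a - b) * \<gamma>"
  have e: "poly p x - a * poly q x = \<alpha> * (x - r) ^ d" "poly p x - b * poly q x = \<beta> * (x - s) ^ d"
    "poly p x - c * poly q x = \<gamma> * (x - t) ^ d" for x
    using arg_cong[OF \<alpha>(2), of "\<lambda>P. poly P x"] arg_cong[OF \<beta>(2), of "\<lambda>P. poly P x"] arg_cong[OF \<gamma>(2), of "\<lambda>P. poly P x"]
    by (simp_all add: poly_power)
  have z: "A * (x - r) ^ d + B * (x - s) ^ d + C * (x - t) ^ d = 0" for x
  proof -
    have "A * (x - r) ^ d + B * (x - s) ^ d + C * (x - t) ^ d =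
      (b - c) * (\<alpha> * (x - r) ^ d) + (c - a) * (\<beta> * (x - s) ^ d) + (a - b) * (\<gamma> * (x - t) ^ d)"
      by (simp add: A_def B_def C_def)
    also have "\<dots> = 0" unfolding e[symmetric] by (simp add: algebra_simps)
    finally show ?thesis .
  qed
  have z': "A * (x - r) ^ (d - 1) + B * (x - s) ^ (d - 1) + C * (x - t) ^ (d - 1) = 0" for x
  proof -
    have "((\<lambda>x. A * (x - r) ^ d + B * (x - s) ^ d + C * (x - t) ^ d) has_field_derivative
       d * (A * (x - r) ^ (d - 1) + B * (x - s) ^ (d - 1) + C * (x - t) ^ (d - 1))) (at x)"
      by (auto intro!: derivative_eq_intros simp: algebra_simps)
    moreover have "((\<lambda>x. A * (x - r) ^ d + B * (x - s) ^ d + C * (x - t) ^ d) has_field_derivative 0) (at x)"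
      unfolding z by simp
    ultimately have "of_nat d * (A * (x - r) ^ (d - 1) + B * (x - s) ^ (d - 1) + C * (x - t) ^ (d - 1)) = 0"
      using DERIV_unique by blast
    then show ?thesis using d2 by simp
  qed
  have pw: "x ^ d = x * x ^ (d - 1)" for x :: complex using d2 by (cases d) auto
  define U V where "U = (r - s) ^ (d - 1)" and "V = (r - t) ^ (d - 1)"
  have "(0::complex) ^ (d - 1) = 0" using d2 by simp
  then have "B * U + C * V = 0" using z'[of r] unfolding U_def V_def by (metis add_0 diff_self mult_zero_right)
  moreover have "B * ((r - s) * U) + C * ((r - t) * V) = 0"
    using z[of r] unfolding pw by (simp add: U_def V_def)
  ultimately have "B * U * (t - s) = 0" by algebra
  moreover have "B \<noteq> 0" "U \<noteq> 0" "t - s \<noteq> 0" using \<beta> abc rst by (auto simp: B_def U_def)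
  ultimately show False by simp
qed

text \<open>Discarding the values \<open>None\<close> and \<open>f None\<close> leaves finite values
  whose only preimage is finite too; by \<open>no_three_pure\<close> at most two of them
  remain.\<close>

lemma finite_pure: "finite {y. \<exists>x. f -` {y} = {x}}"
proof (rule ccontr)
  define Y where "Y = {y. \<exists>x. f -` {y} = {x}}"
  assume "infinite {y. \<exists>x. f -` {y} = {x}}"
  then have "infinite (Y - {None, f None})" by (simp add: Y_def)
  then have "\<exists>T. finite T \<and> card T = 3 \<and> T \<subseteq> Y - {None, f None}" by (rule infinite_arbitrarily_large)
  then obtain T where T: "T \<subseteq> Y - {None, f None}" "card T = 3" by metis
  from T(2)[unfolded card_3_iff] obtain u v w where uvw: "T = {u, v, w}" "u \<noteq> v" "v \<noteq> w" "u \<noteq> w"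
    by metis
  have *: "\<exists>a r. y = Some a \<and> (\<forall>x. f x = Some a \<longleftrightarrow> x = Some r)" if y: "y \<in> T" for y
  proof -
    have "y \<noteq> None" "y \<noteq> f None" "y \<in> Y" using y T by auto
    then obtain a x where a: "y = Some a" and x: "f -` {y} = {x}" by (auto simp: Y_def)
    have eq: "f x' = y \<longleftrightarrow> x' = x" for x' using x by auto
    have "x \<noteq> None" using eq[of None] \<open>y \<noteq> f None\<close> by metis
    then obtain r where "x = Some r" by auto
    then show ?thesis using a eq by auto
  qed
  obtain a r where a: "u = Some a" "\<forall>x. f x = Some a \<longleftrightarrow> x = Some r" using *[of u] uvw by auto
  obtain b s where b: "v = Some b" "\<forall>x. f x = Some b \<longleftrightarrow> x = Some s" using *[of v] uvw by auto
  obtain c t where c: "w = Some c" "\<forall>x. f x = Some c \<longleftrightarrow> x = Some t" using *[of w] uvw by auto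
  show False using no_three_pure[of a b c r s t] a b c uvw by auto
qed

lemma roots_rsquarefree:
  fixes P :: "complex poly"
  assumes "rsquarefree P"
  shows "card {z. poly P z = 0} = degree P"
proof -
  have P: "P \<noteq> 0" using assms by (simp add: rsquarefree_def)
  have "degree P = degree (smult (lead_coeff P) (\<Prod>z|poly P z = 0. [:- z, 1:]))"
    using complex_poly_decompose_rsquarefree[OF assms] by simp
  also have "\<dots> = degree (\<Prod>z|poly P z = 0. [:- z, 1:])" using P by simp
  also have "\<dots> = (\<Sum>z|poly P z = 0. degree [:- z, 1:])" by (intro degree_prod_eq_sum_degree) auto
  finally show ?thesis by simp
qed

text \<open>If every fixed point were its own only preimage, each finite fixed point
  \<open>a\<close> would be a simple root of \<open>p - z q\<close>, because \<open>p - a q\<close>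
  vanishes there to order \<open>d\<close>. The number of finite fixed points is then the degree of
  \<open>P\<close>: either three pure values arise, or infinity is fixed and there are at least two
  others.\<close>

lemma fixed_point: obtains x y where "f x = x" "f y = x" "y \<noteq> x"
proof (rule ccontr)
  assume no: "\<not> thesis"
  then have no': "\<And>x y. f x = x \<Longrightarrow> f y = x \<Longrightarrow> y = x" using that by blast
  then have exc: "f y = x \<longleftrightarrow> y = x" if "f x = x" for x y using that by metis
  define P where "P = p - pCons 0 q"
  have fixP: "f (Some a) = Some a" "poly q a \<noteq> 0" if "poly P a = 0" for a
    using that common_root[of a] by (auto simp: P_def f_Some field_simps)
  have pure: "\<exists>\<alpha>. \<alpha> \<noteq> 0 \<and> p - smult a q = smult \<alpha> ([:- a, 1:] ^ d)" if "poly P a = 0" for a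
    using pure_power[of a a] exc[OF fixP(1)[OF that]] by metis
  have deriv_pure: "poly (pderiv (smult \<alpha> ([:- a, 1:] ^ d))) x = \<alpha> * d * (x - a) ^ (d - 1)" for \<alpha> a x :: complex
    by (simp add: pderiv_smult pderiv_power poly_power pderiv_pCons) 
  have P0: "P \<noteq> 0"
  proof
    assume "P = 0"
    then have p: "p = pCons 0 q" by (simp add: P_def)
    have "pCons 0 q = [:0, 1:] * q" by simp
    then have "q dvd p" unfolding p by (metis dvd_triv_right)
    then have "is_unit q" using cop by (metis coprime_common_divisor dvd_refl)
    then have "degree q = 0" by (metis is_unit_iff_degree not_is_unit_0)
    then show False using p deg d2 by (auto simp: degree_pCons_eq_if split: if_splits)
  qed
  have rsq: "rsquarefree P"
    unfolding rsquarefree_roots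
  proof (intro allI notI)
    fix a assume a: "poly P a = 0 \<and> poly (pderiv P) a = 0"
    obtain \<alpha> where \<alpha>: "p - smult a q = smult \<alpha> ([:- a, 1:] ^ d)" using pure a by blast
    have "P = (p - smult a q) - [:- a, 1:] * q" by (simp add: P_def algebra_simps)
    then have "poly (pderiv P) a = poly (pderiv (smult \<alpha> ([:- a, 1:] ^ d))) a - poly q a"
      unfolding \<alpha> by (simp only: pderiv_diff pderiv_mult poly_diff poly_add poly_mult) (simp add: pderiv_pCons)
    then have "poly q a = 0" using a d2 by (simp add: deriv_pure power_0_left)
    then show False using fixP a by blast
  qed
  define Z where "Z = {z. poly P z = 0}"
  have cardZ: "card Z = degree P" using roots_rsquarefree[OF rsq] by (simp add: Z_def)
  show False
  proof (cases "coeff q d = 0")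
    \<comment> \<open>Here infinity is fixed, hence by assumption not the image of a finite point,
      so \<open>q\<close> is constant and \<open>f\<close> is a polynomial. Two finite fixed points
      give pure powers that differ by a constant, which their derivatives at \<open>a\<close>
      contradict.\<close>
    case True
    then have "f None = None" by (simp add: f_None)
    then have "poly q z \<noteq> 0" for z using exc[of None "Some z"] by (auto simp: f_Some)
    then have q0: "degree q = 0" using poly_root_exists by metis
    have "coeff p d \<noteq> 0" using coeff_d True by simp
    moreover have "coeff (pCons 0 q) d = 0" using q0 d2 by (cases d) (auto simp: coeff_eq_0)
    ultimately have "coeff P d \<noteq> 0" by (simp add: P_def)
    then have "card Z \<ge> 2" using cardZ d2 le_degree[of P d] by linarith
    then obtain a b where ab: "a \<in> Z" "b \<in> Z" "a \<noteq> b"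
      by (metis card_le_Suc0_iff_eq card_gt_0_iff not_less_eq_eq numeral_2_eq_2 less_le_trans zero_less_numeral)
    obtain \<alpha> \<beta> where \<alpha>: "p - smult a q = smult \<alpha> ([:- a, 1:] ^ d)" and \<beta>: "\<beta> \<noteq> 0" "p - smult b q = smult \<beta> ([:- b, 1:] ^ d)"
      using pure ab unfolding Z_def by blast
    have "(p - smult a q) - (p - smult b q) = smult (b - a) q" by (simp add: smult_diff_left)
    then have "pderiv (smult \<alpha> ([:- a, 1:] ^ d)) - pderiv (smult \<beta> ([:- b, 1:] ^ d)) = 0"
      unfolding \<alpha> \<beta>(2) using q0 by (metis degree_smult_le le_zero_eq pderiv_diff pderiv_eq_0_iff)
    then have "poly (pderiv (smult \<alpha> ([:- a, 1:] ^ d))) a - poly (pderiv (smult \<beta> ([:- b, 1:] ^ d))) a = 0"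
      by (metis poly_0 poly_diff)
    then have "\<beta> * d * (a - b) ^ (d - 1) = 0" using d2 unfolding deriv_pure by (simp add: power_0_left)
    then show False using \<beta> ab d2 by simp
  next
    case False
    have "coeff p (Suc d) = 0" using deg by (intro coeff_eq_0) auto
    then have "coeff P (Suc d) \<noteq> 0" using False by (simp add: P_def)
    then have "card Z \<ge> 3" using cardZ d2 le_degree[of P "Suc d"] by linarith
    then obtain A where A: "A \<subseteq> Z" "card A = 3" by (rule obtain_subset_with_card_n)
    from A(2)[unfolded card_3_iff] obtain a b c where "A = {a, b, c}" and ne: "a \<noteq> b" "b \<noteq> c" "a \<noteq> c" by metis
    with A(1) have abc: "{a, b, c} \<subseteq> Z" "a \<noteq> b" "b \<noteq> c" "a \<noteq> c" by simp_all
    then have "f x = Some a \<longleftrightarrow> x = Some a" "f x = Some b \<longleftrightarrow> x = Some b" "f x = Some c \<longleftrightarrow> x = Some c" for x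
      using exc fixP(1) unfolding Z_def by blast+
    then show False using no_three_pure[of a b c a b c] abc by blast
  qed
qed

end

section \<open>Local behaviour of holomorphic self-maps of the sphere\<close>

lemma chordal_flip_Some_le: "chordal (flip b (Some t)) (flip b (Some u)) \<le> 2 * cmod (t - u)"
  using chordal_le by simp

lemma chart_nbhd:
  assumes "flip b x = Some t" "cmod t \<le> 1" "chordal x y < 1 / 2"
  obtains u where "y = flip b (Some u)" "cmod (t - u) \<le> 17 * chordal x y"
proof -
  have eq: "chordal (Some t) (flip b y) = chordal x y" using assms(1) by (metis chordal_flip)
  obtain u where "flip b y = Some u" "cmod (t - u) \<le> 17 * chordal (Some t) (flip b y)"
    using near_chart[of t "flip b y"] assms eq by metis
  then show ?thesis using that eq by (metis flip_flip)
qed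

lemma infinite_chordal_ball:
  assumes "e > 0" shows "infinite {y. chordal x y < e}"
proof
  assume fin: "finite {y. chordal x y < e}"
  obtain b t where bt: "flip b x = Some t" using flip_chart by blast
  then have x: "x = flip b (Some t)" by (metis flip_flip)
  have "(\<lambda>u. flip b (Some u)) ` ball t (e / 2) \<subseteq> {y. chordal x y < e}"
  proof (intro image_subsetI CollectI)
    fix u assume "u \<in> ball t (e / 2)"
    then show "chordal x (flip b (Some u)) < e"
      using chordal_flip_Some_le[of b t u] by (simp add: x dist_norm)
  qed
  then have "finite ((\<lambda>u. flip b (Some u)) ` ball t (e / 2))" using fin by (rule finite_subset)
  moreover have "inj_on (\<lambda>u. flip b (Some u)) (ball t (e / 2))" by (auto simp: inj_on_def)
  ultimately have "finite (ball t (e / 2))" by (rule finite_imageD)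
  then have "\<not> t islimpt ball t (e / 2)" by (rule islimpt_finite)
  then show False using assms by (simp add: interior_limit_point interior_open)
qed

lemma two_roots:
  fixes s :: complex
  assumes "n \<ge> 2" "s \<noteq> 0"
  obtains u u' where "u ^ n = s" "u' ^ n = s" "u \<noteq> u'"
proof -
  have "card {z. z ^ n = s} = n" using assms by (intro card_nth_roots) auto
  then have "2 \<le> card {z. z ^ n = s}" using assms by simp
  then obtain A where A: "A \<subseteq> {z. z ^ n = s}" "card A = 2" by (rule obtain_subset_with_card_n)
  from A(2)[unfolded card_2_iff] obtain u u' where "A = {u, u'}" "u \<noteq> u'" by metis
  then show ?thesis using A(1) that by auto
qed

text \<open>In charts \<open>F\<close> is \<open>s0 + (t - t0) ^ n * g t\<close> with
  \<open>g\<close> zero-free. Order 1 gives local injectivity. Order at least 2 makes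
  \<open>F\<close> an \<open>n\<close>-th power up to a change of coordinate, so nearby values have
  two preimages, and a fixed point of this kind is superattracting.\<close>

lemma hmap_local:
  assumes F: "hmap F" and nc: "\<And>e. e > 0 \<Longrightarrow> \<exists>y. chordal c y < e \<and> F y \<noteq> F c"
  obtains (inj) e where "e > 0" "inj_on F {x. chordal c x < e}"
  | (branched) "\<And>e. e > 0 \<Longrightarrow> \<exists>\<delta>>0. \<forall>y. y \<noteq> F c \<longrightarrow> chordal (F c) y < \<delta> \<longrightarrow>
        (\<exists>x1 x2. x1 \<noteq> x2 \<and> chordal c x1 < e \<and> chordal c x2 < e \<and> F x1 = y \<and> F x2 = y)"
     "F c = c \<Longrightarrow> \<exists>b t0 h \<rho>. flip b c = Some t0 \<and> cmod t0 \<le> 1 \<and> 0 < \<rho> \<and>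
        (\<forall>t\<in>ball t0 \<rho>. F (flip b (Some t)) = flip b (Some (h t)) \<and> cmod (h t - t0) \<le> cmod (t - t0) / 2)"
proof -
  obtain b t0 where bt: "flip b c = Some t0" "cmod t0 \<le> 1" using flip_chart by blast
  then have c: "c = flip b (Some t0)" by (metis flip_flip)
  \<comment> \<open>At a fixed point source and target must use the same chart, since the
    contraction estimate compares \<open>h t\<close> with \<open>t0\<close>.\<close>
  obtain b' s0 where bs: "flip b' (F c) = Some s0" "cmod s0 \<le> 1" "F c = c \<longrightarrow> b' = b"
    using bt flip_chart by metis
  obtain r h where r: "r > 0" "h holomorphic_on ball t0 r"
    and h: "\<And>t. t \<in> ball t0 r \<Longrightarrow> flip b' (F (flip b (Some t))) = Some (h t)"
    using shol_chartE[OF hmapD[OF F shol_flip_Some, of b], of t0 b'] bs(1) c by (metis UNIV_I option.distinct(1))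
  have h0: "h t0 = s0" using h[of t0] r bs c by simp
  have near: "\<exists>u. y = flip b (Some u) \<and> u \<in> ball t0 r'" if "chordal c y < min (1/2) (r' / 17)" for y r'
  proof -
    have "chordal c y < 1 / 2" using that by simp
    then obtain u where "y = flip b (Some u)" "cmod (t0 - u) \<le> 17 * chordal c y"
      using chart_nbhd[OF bt, of y] by metis
    then show ?thesis using that by (intro exI[of _ u]) (auto simp: dist_norm)
  qed
  have nconst: "\<not> (\<lambda>t. h t - s0) constant_on ball t0 r"
  proof
    assume const: "(\<lambda>t. h t - s0) constant_on ball t0 r"
    obtain y where y: "chordal c y < min (1/2) (r / 17)" "F y \<noteq> F c" using nc[of "min (1/2) (r / 17)"] r by auto
    obtain u where u: "y = flip b (Some u)" "u \<in> ball t0 r" using near[OF y(1)] by blast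
    have "h u - s0 = h t0 - s0" using const u(2) r unfolding constant_on_def by (metis centre_in_ball)
    then have "flip b' (F y) = flip b' (F c)" using h[OF u(2)] h0 bs u by simp
    then show False using y by simp
  qed
  have hs: "(\<lambda>t. h t - s0) holomorphic_on ball t0 r" by (intro holomorphic_intros r)
  have t0r: "t0 \<in> ball t0 r" "h t0 - s0 = 0" using r h0 by auto
  obtain g r1 n where n: "0 < n" and r1: "0 < r1" "ball t0 r1 \<subseteq> ball t0 r" "g holomorphic_on ball t0 r1"
    and hg: "\<And>t. t \<in> ball t0 r1 \<Longrightarrow> h t - s0 = (t - t0) ^ n * g t" and gnz: "\<And>t. t \<in> ball t0 r1 \<Longrightarrow> g t \<noteq> 0"
    using holomorphic_factor_zero_nonconstant[OF hs open_ball connected_ball t0r nconst] by metis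
  have t0r1: "t0 \<in> ball t0 r1" using r1 by simp
  show ?thesis
  proof (cases "n = 1")
    case True
    have gd: "(g has_field_derivative deriv g t0) (at t0)"
      using r1 t0r1 holomorphic_derivI by blast
    have "((\<lambda>t. s0 + (t - t0) * g t) has_field_derivative g t0) (at t0)"
      by (auto intro!: derivative_eq_intros gd)
    moreover have "s0 + (t - t0) * g t = h t" if "t \<in> ball t0 r1" for t
      using hg[OF that] True by (simp add: algebra_simps)
    ultimately have "(h has_field_derivative g t0) (at t0)"
      using has_field_derivative_transform_within_open[OF _ open_ball t0r1] by blast
    then have "deriv h t0 \<noteq> 0" using gnz[OF t0r1] DERIV_imp_deriv by metis
    then obtain r2 where r2: "r2 > 0" "ball t0 r2 \<subseteq> ball t0 r" "inj_on h (ball t0 r2)"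
      using has_complex_derivative_locally_injective[OF r(2) _ open_ball] r(1) by (metis centre_in_ball)
    have "inj_on F {x. chordal c x < min (1/2) (r2 / 17)}"
    proof (rule inj_onI)
      fix x y assume x: "x \<in> {x. chordal c x < min (1/2) (r2 / 17)}" and y: "y \<in> {x. chordal c x < min (1/2) (r2 / 17)}"
        and eq: "F x = F y"
      obtain u where u: "x = flip b (Some u)" "u \<in> ball t0 r2" using near x by blast
      obtain v where v: "y = flip b (Some v)" "v \<in> ball t0 r2" using near y by blast
      have "u \<in> ball t0 r" "v \<in> ball t0 r" using u(2) v(2) r2(2) by blast+
      then have "h u = h v" using h[of u] h[of v] eq u(1) v(1) by simp
      then show "x = y" using r2(3) u v by (metis inj_onD)
    qed
    then show ?thesis using inj[of "min (1/2) (r2 / 17)"] r2(1) by simp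
  next
    case False
    then have n2: "n \<ge> 2" using n by simp
    obtain l where l: "l holomorphic_on ball t0 r1" "\<And>t. t \<in> ball t0 r1 \<Longrightarrow> g t = exp (l t)"
      using contractible_imp_holomorphic_log[OF r1(3) convex_imp_contractible[OF convex_ball] gnz] by metis
    \<comment> \<open>A holomorphic \<open>n\<close>-th root of \<open>h - s0\<close>. It is
      non-constant, hence open, and so covers a disc about 0 that contains all \<open>n\<close>-th
      roots of \<open>s - s0\<close> for \<open>s\<close> near \<open>s0\<close>.\<close>
    define k where "k t = (t - t0) * exp (l t / n)" for t
    have kn: "k t ^ n = h t - s0" if "t \<in> ball t0 r1" for t
    proof -
      have "exp (l t / n) ^ n = exp (l t)" using n by (simp add: exp_of_nat_mult[symmetric])
      then show ?thesis using hg[OF that] l(2)[OF that] by (simp add: k_def power_mult_distrib)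
    qed
    have k_hol: "k holomorphic_on ball t0 r1" unfolding k_def using n by (intro holomorphic_intros l) auto
    show ?thesis
    proof (rule branched)
      fix e :: real assume e: "e > 0"
      define \<rho> where "\<rho> = min r1 (e / 2)"
      have \<rho>: "\<rho> > 0" "ball t0 \<rho> \<subseteq> ball t0 r1" using r1 e by (auto simp: \<rho>_def)
      have "k u \<noteq> 0" if "u \<noteq> t0" for u using that by (simp add: k_def)
      moreover have "k t0 = 0" by (simp add: k_def)
      moreover have "t0 + \<rho> / 2 \<in> ball t0 \<rho>" "t0 + \<rho> / 2 \<noteq> t0" using \<rho>(1) by (auto simp: dist_norm)
      ultimately have "\<not> k constant_on ball t0 \<rho>" using \<rho>(1) unfolding constant_on_def by (metis centre_in_ball)
      then have "open (k ` ball t0 \<rho>)"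
        using open_mapping_thm[of k "ball t0 \<rho>" "ball t0 \<rho>"] holomorphic_on_subset[OF k_hol \<rho>(2)] by auto
      moreover have "0 \<in> k ` ball t0 \<rho>" using \<open>k t0 = 0\<close> \<rho>(1) by (metis centre_in_ball image_eqI)
      ultimately obtain \<eta> where \<eta>: "\<eta> > 0" "ball 0 \<eta> \<subseteq> k ` ball t0 \<rho>" using openE by blast
      show "\<exists>\<delta>>0. \<forall>y. y \<noteq> F c \<longrightarrow> chordal (F c) y < \<delta> \<longrightarrow>
        (\<exists>x1 x2. x1 \<noteq> x2 \<and> chordal c x1 < e \<and> chordal c x2 < e \<and> F x1 = y \<and> F x2 = y)"
      proof (intro exI[of _ "min (1/2) (\<eta> ^ n / 17)"] conjI allI impI)
        fix y assume yne: "y \<noteq> F c" and y: "chordal (F c) y < min (1/2) (\<eta> ^ n / 17)"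
        have "chordal (F c) y < 1 / 2" using y by simp
        then obtain s where s: "y = flip b' (Some s)" "cmod (s0 - s) \<le> 17 * chordal (F c) y"
          using chart_nbhd[OF bs(1,2), of y] by metis
        have "s \<noteq> s0"
        proof
          assume "s = s0"
          then have "y = flip b' (flip b' (F c))" using s(1) bs(1) by simp
          then show False using yne by simp
        qed
        then have "s - s0 \<noteq> 0" by simp
        with n2 obtain u1 u2 where u: "u1 ^ n = s - s0" "u2 ^ n = s - s0" "u1 \<noteq> u2" by (rule two_roots)
        have lt: "cmod (s - s0) < \<eta> ^ n" using s(2) y by (simp add: norm_minus_commute)
        have ex: "chordal c (flip b (Some t)) < e \<and> F (flip b (Some t)) = y" if "u ^ n = s - s0" "t \<in> ball t0 \<rho>" "k t = u" for u t
        proof -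
          have "h t = s" using kn[of t] that \<rho>(2) by auto
          moreover have "t \<in> ball t0 r" using that \<rho>(2) r1(2) by blast
          ultimately have "flip b' (F (flip b (Some t))) = flip b' y" using h[of t] s(1) by simp
          then have "F (flip b (Some t)) = y" by simp
          moreover have "chordal c (flip b (Some t)) < e"
            using chordal_flip_Some_le[of b t0 t] that(2) by (simp add: c \<rho>_def dist_norm)
          ultimately show ?thesis by blast
        qed
        have "cmod u1 ^ n < \<eta> ^ n" "cmod u2 ^ n < \<eta> ^ n"
          using lt unfolding norm_power[symmetric] by (simp_all only: u(1,2))
        then have "cmod u1 < \<eta>" "cmod u2 < \<eta>"
          using \<eta>(1) by (auto intro: power_less_imp_less_base[of _ n])
        then have "u1 \<in> k ` ball t0 \<rho>" "u2 \<in> k ` ball t0 \<rho>" using \<eta>(2) by auto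
        then obtain t1 t2 where t12: "t1 \<in> ball t0 \<rho>" "k t1 = u1" "t2 \<in> ball t0 \<rho>" "k t2 = u2" by blast
        then have "t1 \<noteq> t2" using u(3) by auto
        then have "flip b (Some t1) \<noteq> flip b (Some t2)" by simp
        with ex[OF u(1) t12(1,2)] ex[OF u(2) t12(3,4)]
        show "\<exists>x1 x2. x1 \<noteq> x2 \<and> chordal c x1 < e \<and> chordal c x2 < e \<and> F x1 = y \<and> F x2 = y"
          by blast
      qed (use \<eta> in auto)
    next
      assume "F c = c"
      then have b': "b' = b" "s0 = t0" using bs bt by auto
      have "isCont g t0" using r1(3) t0r1 by (meson continuous_on_eq_continuous_at holomorphic_on_imp_continuous_on open_ball)
      then obtain r2 where r2: "r2 > 0" "\<And>t. dist t0 t < r2 \<Longrightarrow> dist (g t0) (g t) < 1"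
        unfolding continuous_at_eps_delta by (metis dist_commute zero_less_one)
      define B where "B = cmod (g t0) + 1"
      have B: "B > 0" by (simp add: B_def add_nonneg_pos)
      have gB: "cmod (g t) \<le> B" if "dist t0 t < r2" for t
        using r2(2)[OF that] norm_triangle_ineq2[of "g t" "g t0"] by (simp add: B_def dist_norm norm_minus_commute)
      \<comment> \<open>For \<open>x = cmod (t - t0)\<close> at most 1 and at most
        \<open>1 / (2 * B)\<close>, the bound \<open>x ^ n * B\<close> is at most
        \<open>x / 2\<close>, because \<open>n\<close> is at least 2.\<close>
      define \<rho> where "\<rho> = min (min r1 r2) (min 1 (1 / (2 * B)))"
      have \<rho>: "\<rho> > 0" using r1 r2 B by (simp add: \<rho>_def)
      have "F (flip b (Some t)) = flip b (Some (h t)) \<and> cmod (h t - t0) \<le> cmod (t - t0) / 2" if t: "t \<in> ball t0 \<rho>" for t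
      proof
        have t': "t \<in> ball t0 r1" "t \<in> ball t0 r" "dist t0 t < r2" "cmod (t - t0) \<le> 1" "cmod (t - t0) \<le> 1 / (2 * B)"
          using t r1(2) by (auto simp: \<rho>_def dist_norm norm_minus_commute)
        have "flip b (F (flip b (Some t))) = flip b (flip b (Some (h t)))" using h[OF t'(2)] b'(1) by simp
        then show "F (flip b (Some t)) = flip b (Some (h t))" by (simp only: flip_eq_iff)
        define x where "x = cmod (t - t0)"
        have x: "0 \<le> x" "x \<le> 1" "x \<le> 1 / (2 * B)" using t' by (auto simp: x_def)
        have "cmod (h t - t0) = x ^ n * cmod (g t)" using hg[OF t'(1)] b' by (simp add: norm_mult norm_power x_def)
        also have "\<dots> \<le> x ^ 2 * B"
          using x n2 gB[OF t'(3)] by (intro mult_mono power_decreasing) auto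
        also have "\<dots> = x * (x * B)" by (simp add: power2_eq_square)
        also have "\<dots> \<le> x * (1 / 2)" using x B by (intro mult_left_mono) (auto simp: field_simps)
        finally show "cmod (h t - t0) \<le> cmod (t - t0) / 2" by (simp add: x_def)
      qed
      then show "\<exists>b t0 h \<rho>. flip b c = Some t0 \<and> cmod t0 \<le> 1 \<and> 0 < \<rho> \<and>
        (\<forall>t\<in>ball t0 \<rho>. F (flip b (Some t)) = flip b (Some (h t)) \<and> cmod (h t - t0) \<le> cmod (t - t0) / 2)"
        using bt \<rho> by blast
    qed
  qed
qed

text \<open>Everything below uses only these four properties of a rational map of degree at least 2.\<close>

locale sphere_map =
  fixes f :: "csphere \<Rightarrow> csphere"
  assumes hmap_f: "hmap f" and surj_f: "\<And>y. \<exists>x. f x = y"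
    and finite_pure: "finite {y. \<exists>x. f -` {y} = {x}}"
    and fixed_point: "\<exists>x y. f x = x \<and> f y = x \<and> y \<noteq> x"
begin

lemma hmap_iter: "hmap (f ^^ n)" by (rule hmap_funpow[OF hmap_f])

lemma scont_iter: "scont (f ^^ n)" by (rule hmap_scont[OF hmap_iter])

lemma surj_iter: "\<exists>x. (f ^^ n) x = y"
proof (induction n arbitrary: y)
  case (Suc n)
  obtain y' where "f y' = y" using surj_f by blast
  moreover obtain x where "(f ^^ n) x = y'" using Suc by blast
  ultimately show ?case by auto
qed simp

lemma shol_iter: "shol \<psi> S \<Longrightarrow> shol (\<lambda>u. (f ^^ n) (\<psi> u)) S"
  using hmapD[OF hmap_iter] .

text \<open>By the identity theorem the iterate would be constant on a whole chart. A chart misses a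
  single point, so the iterate would take at most two values, contrary to surjectivity.\<close>

lemma iter_not_const:
  assumes "t islimpt {u. (f ^^ n) (flip b (Some u)) = c}"
  shows False
proof -
  have *: "(f ^^ n) (flip b (Some u)) = c" for u
    using shol_const_extend[OF shol_iter[OF shol_flip_Some], of t] assms connected_UNIV by auto
  have "infinite {y. chordal c y < 1}" by (rule infinite_chordal_ball) simp
  then have "infinite ({y. chordal c y < 1} - {c, (f ^^ n) (flip b None)})" by simp
  then have "{y. chordal c y < 1} - {c, (f ^^ n) (flip b None)} \<noteq> {}" by (metis finite.emptyI)
  then obtain y where y: "y \<noteq> c" "y \<noteq> (f ^^ n) (flip b None)" by blast
  obtain x where "(f ^^ n) x = y" using surj_iter by blast
  then show False using * y by (metis flip_flip not_Some_eq)
qed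

lemma iter_nonconst:
  assumes "e > 0"
  shows "\<exists>y. chordal c y < e \<and> (f ^^ n) y \<noteq> (f ^^ n) c"
proof (rule ccontr)
  assume no: "\<not> ?thesis"
  obtain b t where bt: "flip b c = Some t" using flip_chart by blast
  then have c: "c = flip b (Some t)" by (metis flip_flip)
  have "ball t (e / 2) \<subseteq> {u. (f ^^ n) (flip b (Some u)) = (f ^^ n) c}"
  proof
    fix u assume "u \<in> ball t (e / 2)"
    then have "chordal c (flip b (Some u)) < e" using chordal_flip_Some_le[of b t u] by (simp add: c dist_norm)
    then show "u \<in> {u. (f ^^ n) (flip b (Some u)) = (f ^^ n) c}" using no by blast
  qed
  moreover have "t islimpt ball t (e / 2)" using assms by (simp add: interior_limit_point interior_open)
  ultimately show False using iter_not_const islimpt_subset by blast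
qed

lemma iter_open:
  assumes "e > 0"
  obtains d where "d > 0" "\<And>y. chordal ((f ^^ n) c) y < d \<Longrightarrow> \<exists>x. chordal c x < e \<and> (f ^^ n) x = y"
proof -
  obtain b t where bt: "flip b c = Some t" "cmod t \<le> 1" using flip_chart by blast
  then have c: "c = flip b (Some t)" by (metis flip_flip)
  have sh: "shol (\<lambda>u. (f ^^ n) (flip b (Some u))) (ball t (e / 2))"
    using shol_iter[OF shol_flip_Some] shol_subset by blast
  have "\<exists>y. chordal c y < min (1/2) (e / 34) \<and> (f ^^ n) y \<noteq> (f ^^ n) c"
    using assms by (intro iter_nonconst) simp
  then obtain y where y: "chordal c y < min (1/2) (e / 34)" "(f ^^ n) y \<noteq> (f ^^ n) c" by blast
  have "chordal c y < 1 / 2" using y by simp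
  then obtain u0 where u0: "y = flip b (Some u0)" "cmod (t - u0) \<le> 17 * chordal c y"
    using chart_nbhd[OF bt, of y] by metis
  have u0': "u0 \<in> ball t (e / 2)" "(f ^^ n) (flip b (Some u0)) \<noteq> (f ^^ n) (flip b (Some t))"
    using u0 y c by (auto simp: dist_norm)
  obtain d where d: "d > 0" "\<And>y. chordal ((f ^^ n) (flip b (Some t))) y < d \<Longrightarrow> \<exists>u\<in>ball t (e / 2). (f ^^ n) (flip b (Some u)) = y"
    using shol_open_map[OF sh _ u0'] assms by auto
  show ?thesis
  proof (rule that[OF d(1)])
    fix y assume "chordal ((f ^^ n) c) y < d"
    then have "\<exists>u\<in>ball t (e / 2). (f ^^ n) (flip b (Some u)) = y" using d(2) by (simp add: c)
    then obtain u where u: "u \<in> ball t (e / 2)" "(f ^^ n) (flip b (Some u)) = y" by blast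
    then have "chordal c (flip b (Some u)) < e" using chordal_flip_Some_le[of b t u] by (simp add: c dist_norm)
    then show "\<exists>x. chordal c x < e \<and> (f ^^ n) x = y" using u(2) by blast
  qed
qed

text \<open>\<open>Y i\<close> reaches \<open>y0\<close> after \<open>i\<close> steps and the fixed
  point \<open>x0\<close> one step later, where it stays. Any finite set of these points therefore
  lies over \<open>x0\<close> at every large depth and can supply the omitted values. The points are
  distinct because they arrive at \<open>x0\<close> at different times.\<close>

lemma backward_orbit:
  obtains x0 y0 Y where "f x0 = x0" "y0 \<noteq> x0" "\<And>i n. i < n \<Longrightarrow> (f ^^ n) (Y i) = x0" "\<And>i. (f ^^ i) (Y i) = y0" "inj (Y :: nat \<Rightarrow> csphere)"
proof -
  obtain x0 y0 where x0: "f x0 = x0" "f y0 = x0" "y0 \<noteq> x0" using fixed_point by blast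
  have "\<exists>y. (f ^^ i) y = y0" for i using surj_iter by blast
  then obtain Y where Y: "\<And>i. (f ^^ i) (Y i) = y0" by metis
  have fixd: "(f ^^ n) x0 = x0" for n by (induction n) (auto simp: x0)
  have Y2: "(f ^^ n) (Y i) = x0" if "i < n" for i n
  proof -
    have "(f ^^ n) (Y i) = (f ^^ (n - Suc i)) ((f ^^ Suc i) (Y i))"
      using that by (metis Suc_leI comp_apply funpow_add le_add_diff_inverse2)
    then show ?thesis by (simp add: Y x0 fixd)
  qed
  have "inj Y"
  proof (rule linorder_injI)
    fix i j :: nat assume "i < j"
    then show "Y i \<noteq> Y j" using Y2[of i j] Y[of j] x0(3) by metis
  qed
  then show ?thesis using that x0 Y Y2 by blast
qed

end

section \<open>The Julia set\<close>

lemma compact_stereo_cball: "compact (stereo ` {y. chordal x y \<le> e})"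
proof -
  have "stereo ` {y. chordal x y \<le> e} = range stereo \<inter> cball (stereo x) e"
    by (auto simp: chordal_def)
  then show ?thesis using compact_range_stereo by (simp add: compact_Int_closed)
qed

lemma compactin_chordal_cball: "compactin riemann_sphere {y. chordal x y \<le> e}"
proof (rule closedin_compact_space)
  show "compact_space riemann_sphere" by (simp add: riemann_sphere_def)
  have "openin riemann_sphere (UNIV - {y. chordal x y \<le> e})"
    unfolding openin_riemann_sphere
  proof (intro ballI)
    fix y assume "y \<in> UNIV - {y. chordal x y \<le> e}"
    then have y: "chordal x y > e" by simp
    show "\<exists>d>0. \<forall>z. chordal y z < d \<longrightarrow> z \<in> UNIV - {y. chordal x y \<le> e}"
    proof (intro exI[of _ "chordal x y - e"] conjI allI impI)
      fix z assume "chordal y z < chordal x y - e"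
      then show "z \<in> UNIV - {y. chordal x y \<le> e}"
        using chordal_triangle[of x y z] by (simp add: chordal_commute)
    qed (use y in simp)
  qed
  then show "closedin riemann_sphere {y. chordal x y \<le> e}" by (simp add: closedin_def)
qed

text \<open>The analogue of \<open>chart_nbhd\<close> for a coordinate \<open>t\<close> outside the
  unit disc; the constants then depend on \<open>t\<close>.\<close>

lemma chart_nbhd_any:
  assumes "e > 0"
  obtains d where "d > 0" "\<And>y. chordal (flip b (Some t)) y < d \<Longrightarrow> \<exists>u\<in>ball t e. y = flip b (Some u)"
proof -
  define c where "c = chordal (Some t) None"
  have c: "c > 0" by (simp add: c_def chordal_pos_iff)
  define M where "M = max (cmod t) (4 / c)"
  have M: "1 + M\<^sup>2 > 0" by (simp add: add_pos_nonneg)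
  show ?thesis
  proof (rule that[of "min (c / 2) (e / (1 + M\<^sup>2))"])
    show "min (c / 2) (e / (1 + M\<^sup>2)) > 0" using c M assms by simp
    fix y assume y: "chordal (flip b (Some t)) y < min (c / 2) (e / (1 + M\<^sup>2))"
    have eq: "chordal (flip b (Some t)) y = chordal (Some t) (flip b y)" by (rule chordal_flip_left)
    have "c / 2 \<le> chordal (flip b y) None"
      using y eq chordal_triangle[of "Some t" None "flip b y"] by (simp add: c_def)
    then obtain u where u: "flip b y = Some u" "cmod u \<le> 2 / (c / 2)" using chordal_None_ge c by (metis half_gt_zero)
    then have "cmod (t - u) \<le> (1 + M\<^sup>2) * chordal (Some t) (Some u)"
      by (intro dist_le_chordal) (auto simp: M_def)
    also have "\<dots> < (1 + M\<^sup>2) * (e / (1 + M\<^sup>2))" using y eq u M by (intro mult_strict_left_mono) auto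
    finally have "cmod (t - u) < e" using M by simp
    moreover have "flip b (flip b y) = flip b (Some u)" using u(1) by (rule arg_cong)
    ultimately show "\<exists>u\<in>ball t e. y = flip b (Some u)" by (auto simp: dist_norm)
  qed
qed

context sphere_map
begin

text \<open>Equicontinuity of all iterates at a point is the working substitute for normality;
  \<open>fatou_iff\<close> connects the two.\<close>

definition equi :: "csphere \<Rightarrow> bool" where
  "equi x \<longleftrightarrow> (\<forall>e>0. \<exists>d>0. \<forall>n y. chordal x y < d \<longrightarrow> chordal ((f ^^ n) x) ((f ^^ n) y) < e)"

text \<open>If equicontinuity failed at \<open>y\<close>, the violating iterates would have a
  subsequence converging uniformly near \<open>y\<close>, whose late members are close to one fixed,
  continuous member \<open>?G\<close>. The five terms of size \<open>e / 5\<close> are this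
  comparison.\<close>

lemma normal_imp_equi:
  assumes U: "openin riemann_sphere U" "iterates_normal_on f U" and y: "y \<in> U"
  shows "equi y"
proof (rule ccontr)
  assume "\<not> equi y"
  then obtain e where e: "e > 0" "\<And>d. d > 0 \<Longrightarrow> \<exists>n z. chordal y z < d \<and> \<not> chordal ((f ^^ n) y) ((f ^^ n) z) < e"
    unfolding equi_def by blast
  have "\<exists>n z. chordal y z < 1 / real (Suc j) \<and> \<not> chordal ((f ^^ n) y) ((f ^^ n) z) < e" for j
    by (rule e(2)) simp
  then obtain n z where nz: "\<And>j. chordal y (z j) < 1 / real (Suc j)"
    "\<And>j. \<not> chordal ((f ^^ n j) y) ((f ^^ n j) (z j)) < e" by metis
  obtain s g where s: "strict_mono (s :: nat \<Rightarrow> nat)" and g: "\<And>K. compactin riemann_sphere K \<Longrightarrow> K \<subseteq> U \<Longrightarrow>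
    uniform_limit K (\<lambda>k x. stereo ((f ^^ n (s k)) x)) (\<lambda>x. stereo (g x)) sequentially"
    using U(2)[unfolded iterates_normal_on_def, rule_format, of n] by blast
  obtain e' where e': "e' > 0" "\<And>x. chordal y x < e' \<Longrightarrow> x \<in> U" using U(1) y unfolding openin_riemann_sphere by metis
  define K where "K = {x. chordal y x \<le> e' / 2}"
  have "K \<subseteq> U" using e' by (auto simp: K_def)
  then have "uniform_limit K (\<lambda>k x. stereo ((f ^^ n (s k)) x)) (\<lambda>x. stereo (g x)) sequentially"
    using g compactin_chordal_cball unfolding K_def by blast
  moreover have "e / 5 > 0" using e by simp
  ultimately have "\<exists>N. \<forall>k\<ge>N. \<forall>x\<in>K. chordal ((f ^^ n (s k)) x) (g x) < e / 5"
    unfolding uniform_limit_iff eventually_sequentially chordal_def by blast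
  then obtain N where N: "\<And>k x. k \<ge> N \<Longrightarrow> x \<in> K \<Longrightarrow> chordal ((f ^^ n (s k)) x) (g x) < e / 5" by blast
  obtain d where d: "d > 0" "\<And>x. chordal y x < d \<Longrightarrow> chordal ((f ^^ n (s N)) y) ((f ^^ n (s N)) x) < e / 5"
    using scont_iter[of "n (s N)"] \<open>e / 5 > 0\<close> unfolding scont_def by metis
  obtain M where M: "1 / real (Suc M) < min d (e' / 2)" using nat_approx_posE[of "min d (e' / 2)"] d e' by auto
  define k where "k = max N M"
  have "1 / real (Suc (s k)) \<le> 1 / real (Suc M)"
    using seq_suble[OF s, of k] by (intro divide_left_mono) (auto simp: k_def)
  then have zk: "chordal y (z (s k)) < min d (e' / 2)" using nz(1)[of "s k"] M by linarith
  then have K: "z (s k) \<in> K" "y \<in> K" using e' by (auto simp: K_def)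
  let ?F = "f ^^ n (s k)" and ?G = "f ^^ n (s N)"
  have "chordal (?F y) (?F (z (s k))) \<le> chordal (?F y) (g y) + (chordal (g y) (?G y) + (chordal (?G y) (?G (z (s k)))
     + (chordal (?G (z (s k))) (g (z (s k))) + chordal (g (z (s k))) (?F (z (s k))))))"
    using chordal_triangle[of "?F y" "?F (z (s k))" "g y"] chordal_triangle[of "g y" "?F (z (s k))" "?G y"]
      chordal_triangle[of "?G y" "?F (z (s k))" "?G (z (s k))"]
      chordal_triangle[of "?G (z (s k))" "?F (z (s k))" "g (z (s k))"] by linarith
  also have "\<dots> < e / 5 + (e / 5 + (e / 5 + (e / 5 + e / 5)))"
    using N[of k] N[of N] K d(2)[of "z (s k)"] zk by (intro add_strict_mono) (auto simp: k_def chordal_commute)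
  finally show False using nz(2)[of "s k"] by simp
qed

text \<open>Arzela-Ascoli is applied on the stereographic image of a closed ball, and the limit
  takes values in the sphere because the image of \<open>stereo\<close> is closed. Halving the
  radius keeps the closed ball inside the region of equicontinuity.\<close>

lemma equi_imp_normal:
  assumes e: "e > 0" and eq: "\<And>y. chordal x y < e \<Longrightarrow> equi y"
  shows "iterates_normal_on f {y. chordal x y < e / 2}"
  unfolding iterates_normal_on_def
proof
  fix r :: "nat \<Rightarrow> nat"
  define K0 where "K0 = {y. chordal x y \<le> e / 2}"
  define F where "F n p = stereo ((f ^^ r n) (inv stereo p))" for n p
  have inv: "inv stereo (stereo y) = y" for y using inj_stereo by simp
  obtain g k where k: "strict_mono (k :: nat \<Rightarrow> nat)"
    and g: "\<And>\<epsilon>. 0 < \<epsilon> \<Longrightarrow> \<exists>N. \<forall>n p. n \<ge> N \<and> p \<in> stereo ` K0 \<longrightarrow> norm (F (k n) p - g p) < \<epsilon>"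
  proof (rule Arzela_Ascoli[of "stereo ` K0" F 1])
    show "compact (stereo ` K0)" unfolding K0_def by (rule compact_stereo_cball)
    show "norm (F n p) \<le> 1" for n p by (simp add: F_def stereo_bounded)
    fix p and \<epsilon> :: real assume p: "p \<in> stereo ` K0" and \<epsilon>: "0 < \<epsilon>"
    then obtain y where y: "p = stereo y" "chordal x y \<le> e / 2" by (auto simp: K0_def)
    then have "equi y" using eq e by simp
    then obtain d where d: "d > 0" "\<And>n z. chordal y z < d \<Longrightarrow> chordal ((f ^^ n) y) ((f ^^ n) z) < \<epsilon>"
      using \<epsilon> unfolding equi_def by metis
    show "\<exists>d>0. \<forall>n q. q \<in> stereo ` K0 \<and> norm (p - q) < d \<longrightarrow> norm (F n p - F n q) < \<epsilon>"
    proof (intro exI[of _ d] conjI allI impI)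
      fix n q assume q: "q \<in> stereo ` K0 \<and> norm (p - q) < d"
      then obtain z where z: "q = stereo z" by blast
      then have "chordal y z < d" using q y by (simp add: chordal_def dist_norm)
      from d(2)[OF this] show "norm (F n p - F n q) < \<epsilon>"
        by (simp add: F_def y z inv chordal_def dist_norm)
    qed (use d in simp)
  qed blast
  define g' where "g' z = inv stereo (g (stereo z))" for z
  have g': "stereo (g' z) = g (stereo z)" if z: "z \<in> K0" for z
  proof -
    have "(\<lambda>n. F (k n) (stereo z)) \<longlonglongrightarrow> g (stereo z)"
      unfolding LIMSEQ_iff using g z by blast
    then have "g (stereo z) \<in> range stereo"
      by (rule closed_sequentially[OF compact_imp_closed[OF compact_range_stereo], rotated]) (simp add: F_def)
    then show ?thesis by (simp add: g'_def f_inv_into_f)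
  qed
  show "\<exists>s g. strict_mono (s :: nat \<Rightarrow> nat) \<and>
        (\<forall>K. compactin riemann_sphere K \<and> K \<subseteq> {y. chordal x y < e / 2} \<longrightarrow>
           uniform_limit K (\<lambda>k x. stereo ((f ^^ r (s k)) x)) (\<lambda>x. stereo (g x)) sequentially)"
  proof (intro exI[of _ k] exI[of _ g'] conjI allI impI k)
    fix K assume "compactin riemann_sphere K \<and> K \<subseteq> {y. chordal x y < e / 2}"
    then have K: "K \<subseteq> K0" by (auto simp: K0_def)
    show "uniform_limit K (\<lambda>j x. stereo ((f ^^ r (k j)) x)) (\<lambda>x. stereo (g' x)) sequentially"
      unfolding uniform_limit_iff eventually_sequentially
    proof (intro allI impI)
      fix \<epsilon> :: real assume "0 < \<epsilon>"
      then obtain N where N: "\<And>n p. n \<ge> N \<Longrightarrow> p \<in> stereo ` K0 \<Longrightarrow> norm (F (k n) p - g p) < \<epsilon>" using g by blast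
      show "\<exists>N. \<forall>j\<ge>N. \<forall>z\<in>K. dist (stereo ((f ^^ r (k j)) z)) (stereo (g' z)) < \<epsilon>"
      proof (intro exI[of _ N] allI impI ballI)
        fix j z assume "N \<le> j" "z \<in> K"
        then have "norm (F (k j) (stereo z) - g (stereo z)) < \<epsilon>" using N K by blast
        then show "dist (stereo ((f ^^ r (k j)) z)) (stereo (g' z)) < \<epsilon>"
          using g'[of z] \<open>z \<in> K\<close> K by (simp add: F_def inv dist_norm subset_iff)
      qed
    qed
  qed
qed

lemma fatou_iff: "x \<in> fatou_set f \<longleftrightarrow> (\<exists>e>0. \<forall>y. chordal x y < e \<longrightarrow> equi y)"
proof
  assume "x \<in> fatou_set f"
  then obtain U where U: "openin riemann_sphere U" "iterates_normal_on f U" "x \<in> U" by (auto simp: fatou_set_def)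
  then obtain e where "e > 0" "\<And>y. chordal x y < e \<Longrightarrow> y \<in> U" unfolding openin_riemann_sphere by metis
  then show "\<exists>e>0. \<forall>y. chordal x y < e \<longrightarrow> equi y" using normal_imp_equi[OF U(1,2)] by blast
next
  assume "\<exists>e>0. \<forall>y. chordal x y < e \<longrightarrow> equi y"
  then obtain e where e: "e > 0" "\<And>y. chordal x y < e \<Longrightarrow> equi y" by blast
  then have "iterates_normal_on f {y. chordal x y < e / 2}" by (intro equi_imp_normal)
  moreover have "openin riemann_sphere {y. chordal x y < e / 2}" by (rule openin_chordal_ball)
  ultimately show "x \<in> fatou_set f" using e(1) unfolding fatou_set_def by (intro UnionI[of "{y. chordal x y < e / 2}"]) auto
qed

lemma julia_iff: "x \<in> julia_set f \<longleftrightarrow> (\<forall>e>0. \<exists>y. chordal x y < e \<and> \<not> equi y)"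
  using fatou_iff[of x] by (auto simp: julia_set_def)

section \<open>Invariance, non-emptiness, infinitude and perfectness of the Julia set\<close>

lemma not_equi_julia: "\<not> equi x \<Longrightarrow> x \<in> julia_set f"
  unfolding julia_iff by (metis chordal_self)

lemma julia_closed:
  assumes "\<And>e. e > 0 \<Longrightarrow> \<exists>y\<in>julia_set f. chordal x y < e"
  shows "x \<in> julia_set f"
  unfolding julia_iff
proof (intro allI impI)
  fix e :: real assume "e > 0"
  then obtain y where y: "y \<in> julia_set f" "chordal x y < e / 2" using assms half_gt_zero by blast
  obtain z where z: "chordal y z < e / 2" "\<not> equi z" using y(1) \<open>e > 0\<close> unfolding julia_iff by (meson half_gt_zero)
  then show "\<exists>y. chordal x y < e \<and> \<not> equi y" using y(2) chordal_triangle[of x z y] by (intro exI[of _ z]) auto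
qed

text \<open>Continuity of \<open>f\<close> carries equicontinuity from \<open>f x\<close> back to
  \<open>x\<close>; openness of \<open>f\<close> carries it forward.\<close>

lemma equi_f: "equi (f x) \<longleftrightarrow> equi x"
proof
  assume R: "equi (f x)"
  show "equi x"
    unfolding equi_def
  proof (intro allI impI)
    fix e :: real assume e: "e > 0"
    obtain d where d: "d > 0" "\<And>n y. chordal (f x) y < d \<Longrightarrow> chordal ((f ^^ n) (f x)) ((f ^^ n) y) < e"
      using R e unfolding equi_def by metis
    obtain d' where d': "d' > 0" "\<And>y. chordal x y < d' \<Longrightarrow> chordal (f x) (f y) < d"
      using hmap_scont[OF hmap_f] d(1) unfolding scont_def by metis
    show "\<exists>d>0. \<forall>n y. chordal x y < d \<longrightarrow> chordal ((f ^^ n) x) ((f ^^ n) y) < e"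
    \<comment> \<open>The bound \<open>e\<close> covers the iterate of order 0, which does not
      factor through \<open>f\<close>.\<close>
    proof (intro exI[of _ "min e d'"] conjI allI impI)
      fix n y assume y: "chordal x y < min e d'"
      show "chordal ((f ^^ n) x) ((f ^^ n) y) < e"
      proof (cases n)
        case (Suc m)
        then show ?thesis using d(2)[OF d'(2), of y m] y by (simp add: funpow_swap1)
      qed (use y in simp)
    qed (use e d' in simp)
  qed
next
  assume R: "equi x"
  show "equi (f x)"
    unfolding equi_def
  proof (intro allI impI)
    fix e :: real assume e: "e > 0"
    obtain d where d: "d > 0" "\<And>n y. chordal x y < d \<Longrightarrow> chordal ((f ^^ n) x) ((f ^^ n) y) < e"
      using R e unfolding equi_def by metis
    obtain d' where d': "d' > 0" "\<And>y. chordal ((f ^^ 1) x) y < d' \<Longrightarrow> \<exists>z. chordal x z < d \<and> (f ^^ 1) z = y"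
      using iter_open[OF d(1), of 1 x] by metis
    show "\<exists>d>0. \<forall>n y. chordal (f x) y < d \<longrightarrow> chordal ((f ^^ n) (f x)) ((f ^^ n) y) < e"
    proof (intro exI[of _ d'] conjI allI impI)
      fix n y assume "chordal (f x) y < d'"
      then obtain z where "chordal x z < d" "f z = y" using d'(2)[of y] by auto
      then show "chordal ((f ^^ n) (f x)) ((f ^^ n) y) < e" using d(2)[of z "Suc n"] by (simp add: funpow_swap1)
    qed (use d' in simp)
  qed
qed

lemma julia_f: "f x \<in> julia_set f \<longleftrightarrow> x \<in> julia_set f"
proof
  assume R: "f x \<in> julia_set f"
  show "x \<in> julia_set f"
    unfolding julia_iff
  proof (intro allI impI)
    fix e :: real assume e: "e > 0"
    obtain d' where d': "d' > 0" "\<And>y. chordal ((f ^^ 1) x) y < d' \<Longrightarrow> \<exists>z. chordal x z < e \<and> (f ^^ 1) z = y"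
      using iter_open[OF e, of 1 x] by metis
    obtain y where y: "chordal (f x) y < d'" "\<not> equi y" using R d'(1) unfolding julia_iff by blast
    obtain z where "chordal x z < e" "f z = y" using d'(2)[of y] y by auto
    then show "\<exists>y. chordal x y < e \<and> \<not> equi y" using y(2) equi_f by blast
  qed
next
  assume R: "x \<in> julia_set f"
  show "f x \<in> julia_set f"
    unfolding julia_iff
  proof (intro allI impI)
    fix e :: real assume "e > 0"
    then obtain d where d: "d > 0" "\<And>y. chordal x y < d \<Longrightarrow> chordal (f x) (f y) < e"
      using hmap_scont[OF hmap_f] unfolding scont_def by metis
    obtain y where "chordal x y < d" "\<not> equi y" using R d(1) unfolding julia_iff by blast
    then show "\<exists>y. chordal (f x) y < e \<and> \<not> equi y" using d(2) equi_f by blast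
  qed
qed

lemma julia_iter: "(f ^^ n) x \<in> julia_set f \<longleftrightarrow> x \<in> julia_set f"
  by (induction n) (auto simp: julia_f)

text \<open>Let \<open>l\<close> be an accumulation point of the points \<open>Y i\<close>. For
  \<open>i < j\<close> the \<open>j\<close>-th iterate sends \<open>Y i\<close> to \<open>x0\<close>
  and \<open>Y j\<close> to \<open>y0\<close>, although both may be arbitrarily close to
  \<open>l\<close>; so equicontinuity fails at \<open>l\<close>.\<close>

lemma julia_nonempty: "julia_set f \<noteq> {}"
proof -
  obtain x0 y0 Y where Y: "f x0 = x0" "y0 \<noteq> x0" "\<And>i n. i < n \<Longrightarrow> (f ^^ n) (Y i) = x0" "\<And>i. (f ^^ i) (Y i) = y0" "inj (Y :: nat \<Rightarrow> csphere)"
    by (rule backward_orbit) (rule that)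
  obtain r l where r: "strict_mono (r :: nat \<Rightarrow> nat)" "\<And>e. e > 0 \<Longrightarrow> \<exists>N. \<forall>n\<ge>N. chordal (Y (r n)) l < e"
    using chordal_compact by blast
  have "\<not> equi l"
  proof
    assume eq: "equi l"
    define e where "e = chordal x0 y0 / 2"
    have "e > 0" using Y(2) by (simp add: e_def chordal_pos_iff)
    then obtain d where d: "d > 0" "\<And>n y. chordal l y < d \<Longrightarrow> chordal ((f ^^ n) l) ((f ^^ n) y) < e"
      using eq unfolding equi_def by metis
    obtain N where N: "\<And>n. n \<ge> N \<Longrightarrow> chordal (Y (r n)) l < d" using r(2) d(1) by blast
    define i j where "i = r N" and "j = r (Suc N)"
    have ij: "i < j" using r(1) by (simp add: i_def j_def strict_mono_def)
    have "chordal l (Y i) < d" "chordal l (Y j) < d" using N by (simp_all add: i_def j_def chordal_commute)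
    then have "chordal ((f ^^ j) l) x0 < e" "chordal ((f ^^ j) l) y0 < e"
      using d(2)[of "Y i" j] d(2)[of "Y j" j] Y(3)[OF ij] Y(4)[of j] by auto
    then show False using chordal_triangle[of x0 y0 "(f ^^ j) l"] by (simp add: e_def chordal_commute)
  qed
  then show ?thesis using not_equi_julia by blast
qed

lemma equi_chart:
  assumes bt: "flip b x = Some t" "cmod t \<le> 1"
    and eq: "\<And>e. e > 0 \<Longrightarrow> \<exists>d>0. \<forall>n u. cmod (u - t) < d \<longrightarrow> chordal ((f ^^ n) (flip b (Some u))) ((f ^^ n) x) < e"
  shows "equi x"
  unfolding equi_def
proof (intro allI impI)
  fix e :: real assume "e > 0"
  then obtain d where d: "d > 0" "\<And>n u. cmod (u - t) < d \<Longrightarrow> chordal ((f ^^ n) (flip b (Some u))) ((f ^^ n) x) < e"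
    using eq by blast
  show "\<exists>d>0. \<forall>n y. chordal x y < d \<longrightarrow> chordal ((f ^^ n) x) ((f ^^ n) y) < e"
  proof (intro exI[of _ "min (1/2) (d / 17)"] conjI allI impI)
    fix n y assume y: "chordal x y < min (1/2) (d / 17)"
    then have "chordal x y < 1 / 2" by simp
    then obtain u where u: "y = flip b (Some u)" "cmod (t - u) \<le> 17 * chordal x y" using chart_nbhd[OF bt] by metis
    then have "cmod (u - t) < d" using y by (simp add: norm_minus_commute)
    then show "chordal ((f ^^ n) x) ((f ^^ n) y) < e" using d(2)[of u n] u(1) by (simp add: chordal_commute)
  qed (use d in simp)
qed

text \<open>Failure of injectivity puts \<open>f ^^ N\<close> in the branched case at
  \<open>c\<close>, so in a chart it at least halves distances to \<open>c\<close>. The powers of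
  \<open>f ^^ N\<close> are then equicontinuous near \<open>c\<close>, and the remaining fewer than
  \<open>N\<close> steps are absorbed by uniform continuity.\<close>

lemma superattracting_fatou:
  assumes N: "N > 0" "(f ^^ N) c = c" and ninj: "\<And>e. e > 0 \<Longrightarrow> \<not> inj_on (f ^^ N) {x. chordal c x < e}"
  shows "c \<notin> julia_set f"
proof -
  let ?F = "f ^^ N"
  obtain b t0 h \<rho> where bt: "flip b c = Some t0" "cmod t0 \<le> 1" "0 < \<rho>"
    and h: "\<And>t. t \<in> ball t0 \<rho> \<Longrightarrow> ?F (flip b (Some t)) = flip b (Some (h t))"
    and hc: "\<And>t. t \<in> ball t0 \<rho> \<Longrightarrow> cmod (h t - t0) \<le> cmod (t - t0) / 2"
  proof (rule hmap_local[OF hmap_iter[of N] iter_nonconst[where c = c and n = N]])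
    show "?thesis" if "e > 0" "inj_on ?F {x. chordal c x < e}" for e using ninj that by blast
  next
    assume "?F c = c \<Longrightarrow> \<exists>b t0 h \<rho>. flip b c = Some t0 \<and> cmod t0 \<le> 1 \<and> 0 < \<rho> \<and>
        (\<forall>t\<in>ball t0 \<rho>. ?F (flip b (Some t)) = flip b (Some (h t)) \<and> cmod (h t - t0) \<le> cmod (t - t0) / 2)"
    then show ?thesis using N(2) that by blast
  qed
  have c: "c = flip b (Some t0)" using bt(1) by (metis flip_flip)
  have it: "(?F ^^ k) (flip b (Some t)) = flip b (Some ((h ^^ k) t)) \<and> cmod ((h ^^ k) t - t0) \<le> cmod (t - t0) / 2 ^ k"
    if t: "t \<in> ball t0 \<rho>" for t k
  proof (induction k)
    case (Suc k)
    have "cmod (t - t0) / 2 ^ k \<le> cmod (t - t0) / 1" by (intro divide_left_mono) auto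
    then have "(h ^^ k) t \<in> ball t0 \<rho>" using Suc t by (auto simp: dist_norm norm_minus_commute)
    then show ?case using Suc h[of "(h ^^ k) t"] hc[of "(h ^^ k) t"] by simp
  qed simp
  have eq0: "equi (flip b (Some t))" if t: "t \<in> ball t0 (min \<rho> (1/17))" for t
  proof -
    define x where "x = flip b (Some t)"
    have t\<rho>: "t \<in> ball t0 \<rho>" using t by simp
    show ?thesis
      unfolding equi_def x_def[symmetric]
    proof (intro allI impI)
      fix e :: real assume e: "e > 0"
      have "\<exists>d. \<forall>r. d r > 0 \<and> (\<forall>a b. chordal a b < d r \<longrightarrow> chordal ((f ^^ r) a) ((f ^^ r) b) < e)"
        by (rule choice) (metis scont_uniform[OF scont_iter e])
      then obtain D where D: "\<And>r. D r > 0" "\<And>r a b. chordal a b < D r \<Longrightarrow> chordal ((f ^^ r) a) ((f ^^ r) b) < e" by blast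
      define \<delta> where "\<delta> = Min (insert 1 (D ` {..<N}))"
      have \<delta>: "\<delta> > 0" "\<And>r. r < N \<Longrightarrow> \<delta> \<le> D r" unfolding \<delta>_def using D N by (auto simp: Min_gr_iff intro!: Min_le)
      \<comment> \<open>From \<open>K\<close> on both orbits lie within
        \<open>\<rho> / 2 ^ K\<close> of \<open>t0\<close>; the 4 is 2 for the two orbits times 2
        from \<open>chordal_flip_Some_le\<close>. The finitely many earlier powers are handled by
        continuity, through \<open>\<gamma>\<close>.\<close>
      obtain K where K: "(1/2) ^ K < \<delta> / (4 * \<rho>)" using real_arch_pow_inv[of "\<delta> / (4 * \<rho>)" "1/2"] \<delta> bt(3) by auto
      have big: "chordal ((?F ^^ k) x) ((?F ^^ k) (flip b (Some u))) < \<delta>" if "k \<ge> K" "u \<in> ball t0 \<rho>" for k u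
      proof -
        have "cmod ((h ^^ k) v - t0) \<le> \<rho> * (1/2) ^ K" if v: "v \<in> ball t0 \<rho>" for v
        proof -
          have "cmod ((h ^^ k) v - t0) \<le> cmod (v - t0) / 2 ^ k" using it[OF v] by blast
          also have "\<dots> \<le> \<rho> / 2 ^ k" using v by (intro divide_right_mono) (auto simp: dist_norm norm_minus_commute)
          also have "\<dots> \<le> \<rho> / 2 ^ K" using \<open>k \<ge> K\<close> bt(3) by (intro divide_left_mono power_increasing) auto
          finally show ?thesis by (simp add: power_divide)
        qed
        from this[OF t\<rho>] this[OF that(2)] have "cmod ((h ^^ k) t - (h ^^ k) u) \<le> 2 * (\<rho> * (1/2) ^ K)"
          using norm_triangle_ineq4[of "(h ^^ k) t - t0" "(h ^^ k) u - t0"] by simp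
        then have "chordal ((?F ^^ k) x) ((?F ^^ k) (flip b (Some u))) \<le> 4 * \<rho> * (1/2) ^ K"
          using chordal_flip_Some_le[of b "(h ^^ k) t" "(h ^^ k) u"] it[OF t\<rho>, of k] it[OF that(2), of k] by (simp add: x_def)
        also have "\<dots> < \<delta>" using K bt(3) by (simp add: field_simps)
        finally show ?thesis .
      qed
      have "\<exists>d. \<forall>k. d k > 0 \<and> (\<forall>y. chordal x y < d k \<longrightarrow> chordal ((?F ^^ k) x) ((?F ^^ k) y) < \<delta>)"
        by (rule choice) (metis scont_iter[of "N * _"] \<delta>(1) scont_def funpow_mult)
      then obtain C where C: "\<And>k. C k > 0" "\<And>k y. chordal x y < C k \<Longrightarrow> chordal ((?F ^^ k) x) ((?F ^^ k) y) < \<delta>" by blast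
      define \<gamma> where "\<gamma> = Min (insert 1 (C ` {..<K}))"
      have \<gamma>: "\<gamma> > 0" "\<And>k. k < K \<Longrightarrow> \<gamma> \<le> C k" unfolding \<gamma>_def using C by (auto simp: Min_gr_iff intro!: Min_le)
      have "\<rho> - dist t0 t > 0" using t\<rho> by simp
      then obtain d1 where d1: "d1 > 0" "\<And>y. chordal x y < d1 \<Longrightarrow> \<exists>u\<in>ball t (\<rho> - dist t0 t). y = flip b (Some u)"
        unfolding x_def using chart_nbhd_any by metis
      show "\<exists>d>0. \<forall>n y. chordal x y < d \<longrightarrow> chordal ((f ^^ n) x) ((f ^^ n) y) < e"
      proof (intro exI[of _ "min \<gamma> d1"] conjI allI impI)
        fix n y assume y: "chordal x y < min \<gamma> d1"
        define k r where "k = n div N" and "r = n mod N"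
        have n: "(f ^^ n) z = (f ^^ r) ((?F ^^ k) z)" for z
        proof -
          have "n = r + N * k" by (simp add: k_def r_def)
          then show ?thesis by (metis comp_apply funpow_add funpow_mult mult.commute)
        qed
        have r: "r < N" using N by (simp add: r_def)
        have "chordal ((?F ^^ k) x) ((?F ^^ k) y) < \<delta>"
        proof (cases "k < K")
          case True
          then show ?thesis using C(2)[of y k] \<gamma>(2)[OF True] y by simp
        next
          case False
          obtain u where u: "u \<in> ball t (\<rho> - dist t0 t)" "y = flip b (Some u)" using d1(2)[of y] y by auto
          moreover have "u \<in> ball t0 \<rho>" using u(1) dist_triangle[of t0 u t] by simp
          ultimately show ?thesis using big[of k u] False by simp
        qed
        then show "chordal ((f ^^ n) x) ((f ^^ n) y) < e" unfolding n using D(2) \<delta>(2)[OF r] by force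
      qed (use \<gamma> d1 in simp)
    qed
  qed
  have "\<exists>e>0. \<forall>y. chordal c y < e \<longrightarrow> equi y"
  proof (intro exI[of _ "min (1/2) (min \<rho> (1/17) / 17)"] conjI allI impI)
    fix y assume y: "chordal c y < min (1/2) (min \<rho> (1/17) / 17)"
    then have "chordal c y < 1 / 2" by simp
    then obtain u where u: "y = flip b (Some u)" "cmod (t0 - u) \<le> 17 * chordal c y" using chart_nbhd[OF bt(1,2)] by metis
    moreover have "17 * chordal c y < min \<rho> (1/17)" using y by simp
    ultimately show "equi y" using eq0[of u] by (simp add: dist_norm)
  qed (use bt in simp)
  then show ?thesis using fatou_iff by (auto simp: julia_set_def)
qed

text \<open>Since \<open>c\<close> is the only point over \<open>f c\<close>, compactness forces all
  preimages of values near \<open>f c\<close> to be near \<open>c\<close>. Injectivity there would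
  leave each of these infinitely many values with a single preimage, against
  \<open>finite_pure\<close>.\<close>

lemma pure_not_inj:
  assumes pure: "f -` {f c} = {c}" and "\<epsilon> > 0"
  shows "\<not> inj_on f {x. chordal c x < \<epsilon>}"
proof
  assume inj: "inj_on f {x. chordal c x < \<epsilon>}"
  have "\<exists>\<delta>>0. \<forall>x. chordal (f c) (f x) < \<delta> \<longrightarrow> chordal c x < \<epsilon>"
  proof (rule ccontr)
    assume no: "\<not> ?thesis"
    have "\<exists>x. chordal (f c) (f x) < 1 / real (Suc j) \<and> \<not> chordal c x < \<epsilon>" for j
      using no[simplified not_ex, rule_format, of "1 / real (Suc j)"] by auto
    then obtain x where x: "\<And>j. chordal (f c) (f (x j)) < 1 / real (Suc j)" "\<And>j. \<not> chordal c (x j) < \<epsilon>" by metis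
    obtain r l where r: "strict_mono (r :: nat \<Rightarrow> nat)" "\<And>e. e > 0 \<Longrightarrow> \<exists>N. \<forall>n\<ge>N. chordal (x (r n)) l < e"
      using chordal_compact by blast
    have "f l = f c"
    proof (rule ccontr)
      assume "f l \<noteq> f c"
      define e where "e = chordal (f l) (f c) / 2"
      have e: "e > 0" using \<open>f l \<noteq> f c\<close> by (simp add: e_def chordal_pos_iff)
      obtain d where d: "d > 0" "\<And>y. chordal l y < d \<Longrightarrow> chordal (f l) (f y) < e"
        using hmap_scont[OF hmap_f] e unfolding scont_def by metis
      obtain N where N: "\<And>n. n \<ge> N \<Longrightarrow> chordal (x (r n)) l < d" using r(2) d by blast
      obtain M where M: "1 / real (Suc M) < e" using e by (meson nat_approx_posE)
      define n where "n = max N M"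
      have "1 / real (Suc (r n)) \<le> 1 / real (Suc M)"
        using seq_suble[OF r(1), of n] by (intro divide_left_mono) (auto simp: n_def)
      then have "chordal (f c) (f (x (r n))) < e" using x(1)[of "r n"] M by linarith
      moreover have "chordal (f l) (f (x (r n))) < e" using N[of n] by (intro d) (simp add: n_def chordal_commute)
      ultimately show False using chordal_triangle[of "f l" "f c" "f (x (r n))"] by (simp add: e_def chordal_commute)
    qed
    then have "l = c" using pure by blast
    then obtain n where "chordal (x (r n)) c < \<epsilon>" using r(2)[OF \<open>\<epsilon> > 0\<close>] by blast
    then show False using x(2)[of "r n"] by (simp add: chordal_commute)
  qed
  then obtain \<delta> where \<delta>: "\<delta> > 0" "\<And>x. chordal (f c) (f x) < \<delta> \<Longrightarrow> chordal c x < \<epsilon>" by blast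
  have "infinite ({y. chordal (f c) y < \<delta>} - {y. \<exists>x. f -` {y} = {x}})"
    using infinite_chordal_ball[OF \<delta>(1)] finite_pure by (rule Diff_infinite_finite[rotated])
  then have "{y. chordal (f c) y < \<delta>} - {y. \<exists>x. f -` {y} = {x}} \<noteq> {}" by (metis finite.emptyI)
  then obtain y where y: "chordal (f c) y < \<delta>" "\<nexists>x. f -` {y} = {x}" by blast
  obtain x where x: "f x = y" using surj_f by blast
  have "f -` {y} \<noteq> {x}" using y(2) by blast
  then obtain x' where x': "f x' = y" "x' \<noteq> x" using x by blast
  have "chordal c x < \<epsilon>" "chordal c x' < \<epsilon>" using \<delta>(2)[of x] \<delta>(2)[of x'] y(1) x x'(1) by simp_all
  then show False using inj x x' by (auto simp: inj_on_def)
qed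

text \<open>On a finite Julia set \<open>f\<close> would be a permutation with \<open>f\<^sup>-\<^sup>1(f(c)) = {c}\<close>, so that all its points would
  be superattracting periodic points.\<close>

lemma infinite_julia: "infinite (julia_set f)"
proof
  assume fin: "finite (julia_set f)"
  have "f ` julia_set f = julia_set f"
  proof
    show "f ` julia_set f \<subseteq> julia_set f" using julia_f by blast
    show "julia_set f \<subseteq> f ` julia_set f"
    proof
      fix y assume "y \<in> julia_set f"
      moreover obtain x where "f x = y" using surj_f by blast
      ultimately show "y \<in> f ` julia_set f" using julia_f by blast
    qed
  qed
  then have inj: "inj_on f (julia_set f)" using fin by (intro eq_card_imp_inj_on) auto
  obtain e where e: "e \<in> julia_set f" using julia_nonempty by blast
  have pure: "f -` {f c} = {c}" if c: "c \<in> julia_set f" for c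
  proof -
    have "x = c" if x: "f x = f c" for x
    proof -
      have "f x \<in> julia_set f" using c julia_f[of c] x by simp
      then have "x \<in> julia_set f" using julia_f by blast
      then show ?thesis using inj x c by (auto simp: inj_on_def)
    qed
    then show ?thesis by auto
  qed
  have "\<not> inj (\<lambda>i. (f ^^ i) e)"
  proof
    assume "inj (\<lambda>i. (f ^^ i) e)"
    moreover have "range (\<lambda>i. (f ^^ i) e) \<subseteq> julia_set f" using julia_iter e by blast
    ultimately show False using fin by (metis finite_imageD finite_subset infinite_UNIV_nat)
  qed
  then obtain i j where ij: "i < j" "(f ^^ i) e = (f ^^ j) e"
    unfolding inj_def by (metis linorder_neqE_nat)
  have inj_n: "inj_on (f ^^ n) (julia_set f)" for n
  proof (induction n)
    case (Suc n)
    have "inj_on f ((f ^^ n) ` julia_set f)" by (rule inj_on_subset[OF inj]) (use julia_iter in blast)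
    from comp_inj_on[OF Suc this] show ?case by (simp add: o_def)
  qed simp
  \<comment> \<open>By finiteness \<open>e\<close> is preperiodic, and injectivity of
    \<open>f ^^ i\<close> on the Julia set makes it periodic.\<close>
  define N where "N = j - i"
  have "(f ^^ i) ((f ^^ N) e) = (f ^^ i) e"
    using ij unfolding N_def by (metis comp_apply funpow_add le_add_diff_inverse less_imp_le_nat)
  then have N: "N > 0" "(f ^^ N) e = e" using inj_n[of i] e julia_iter ij(1) by (auto simp: inj_on_def N_def)
  have "e \<notin> julia_set f"
  proof (rule superattracting_fatou[OF N])
    fix \<epsilon> :: real assume "\<epsilon> > 0"
    then have "\<not> inj_on f {x. chordal e x < \<epsilon>}" using pure_not_inj pure[OF e] by blast
    then obtain x y where xy: "chordal e x < \<epsilon>" "chordal e y < \<epsilon>" "f x = f y" "x \<noteq> y" by (auto simp: inj_on_def)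
    obtain M where "N = Suc M" using N(1) gr0_implies_Suc by blast
    then have "(f ^^ N) x = (f ^^ N) y" using xy(3) by (simp add: funpow_Suc_right del: funpow.simps)
    then show "\<not> inj_on (f ^^ N) {x. chordal e x < \<epsilon>}" using xy by (auto simp: inj_on_def)
  qed
  then show False using e by blast
qed

text \<open>Near an isolated Julia point \<open>c\<close> an iterate can take only one Julia value,
  the image of \<open>c\<close>. So it omits three of any four Julia points, the iterates are
  equicontinuous near \<open>c\<close>, and \<open>c\<close> would lie in the Fatou set.\<close>

lemma julia_perfect:
  assumes c: "c \<in> julia_set f" and e: "e > 0"
  obtains y where "y \<in> julia_set f" "y \<noteq> c" "chordal c y < e"
proof (rule ccontr)
  assume "\<not> thesis"
  then have iso: "\<And>y. y \<in> julia_set f \<Longrightarrow> chordal c y < e \<Longrightarrow> y = c" using that by blast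
  obtain Z where Z: "finite Z" "card Z = 4" "Z \<subseteq> julia_set f" using infinite_arbitrarily_large[OF infinite_julia] by blast
  have "equi x" if x: "chordal c x < e / 2" for x
  proof -
    obtain b t where bt: "flip b x = Some t" "cmod t \<le> 1" using flip_chart by blast
    then have xt: "x = flip b (Some t)" by (metis flip_flip)
    define r where "r = e / 4"
    have r: "r > 0" using e by (simp add: r_def)
    have near: "chordal c (flip b (Some u)) < e" if "u \<in> ball t r" for u
      using that x chordal_flip_Some_le[of b t u] chordal_triangle[of c "flip b (Some u)" x]
      by (simp add: xt r_def dist_norm)
    show ?thesis
    proof (rule equi_chart[OF bt])
      fix \<epsilon> :: real assume "\<epsilon> > 0"
      then obtain \<eta> where \<eta>: "\<eta> > 0"
        "\<And>\<psi> w r u. r > 0 \<Longrightarrow> shol \<psi> (ball w r) \<Longrightarrow> card (Z \<inter> \<psi> ` ball w r) + 3 \<le> card Z \<Longrightarrow>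
            cmod (u - w) < \<eta> * r \<Longrightarrow> chordal (\<psi> u) (\<psi> w) < \<epsilon>"
        using shol_omit_finite[OF Z(1)] by metis
      show "\<exists>d>0. \<forall>n u. cmod (u - t) < d \<longrightarrow> chordal ((f ^^ n) (flip b (Some u))) ((f ^^ n) x) < \<epsilon>"
      proof (intro exI[of _ "\<eta> * r"] conjI allI impI)
        fix n u assume u: "cmod (u - t) < \<eta> * r"
        define \<psi> where "\<psi> = (\<lambda>u. (f ^^ n) (flip b (Some u)))"
        have "shol \<psi> (ball t r)" unfolding \<psi>_def using shol_iter[OF shol_flip_Some] shol_subset by blast
        moreover have "Z \<inter> \<psi> ` ball t r \<subseteq> {(f ^^ n) c}"
        proof
          fix z assume "z \<in> Z \<inter> \<psi> ` ball t r"
          then obtain v where v: "v \<in> ball t r" "z = (f ^^ n) (flip b (Some v))" "z \<in> julia_set f"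
            using Z(3) by (auto simp: \<psi>_def)
          then have "flip b (Some v) = c" using iso near julia_iter by blast
          then show "z \<in> {(f ^^ n) c}" using v(2) by simp
        qed
        then have "card (Z \<inter> \<psi> ` ball t r) \<le> 1" using card_mono[of "{(f ^^ n) c}"] by simp
        then have "card (Z \<inter> \<psi> ` ball t r) + 3 \<le> card Z" using Z(2) by simp
        ultimately have "chordal (\<psi> u) (\<psi> t) < \<epsilon>" using \<eta>(2)[OF r] u by blast
        then show "chordal ((f ^^ n) (flip b (Some u))) ((f ^^ n) x) < \<epsilon>" by (simp add: \<psi>_def xt)
      qed (use \<eta> r in simp)
    qed
  qed
  then have "c \<in> fatou_set f" unfolding fatou_iff using e by (intro exI[of _ "e / 2"]) auto
  then show False using c by (simp add: julia_set_def)
qed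

text \<open>At a branch point, a Julia point \<open>y\<close> close to \<open>f c\<close>, provided
  by perfectness, has two preimages within \<open>\<delta> / 2\<close> of \<open>c\<close>. They lie
  in the Julia set, start less than \<open>\<delta>\<close> apart and coincide after one step,
  against expansiveness.\<close>

lemma julia_locally_inj:
  assumes exp: "expansive f" and c: "c \<in> julia_set f"
  obtains e where "e > 0" "inj_on f {x. chordal c x < e}"
proof -
  obtain \<delta> where \<delta>: "\<delta> > 0" "\<And>x y. x \<in> julia_set f \<Longrightarrow> y \<in> julia_set f \<Longrightarrow> x \<noteq> y \<Longrightarrow> \<exists>n. chordal ((f ^^ n) x) ((f ^^ n) y) \<ge> \<delta>"
    using exp unfolding expansive_def by blast
  have nc: "\<exists>y. chordal c y < e \<and> f y \<noteq> f c" if "e > 0" for e using iter_nonconst[OF that, of c 1] by simp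
  show ?thesis
  proof (rule hmap_local[OF hmap_f nc])
    fix e :: real assume "e > 0" "inj_on f {x. chordal c x < e}"
    then show thesis by (rule that)
  next
    assume br: "\<And>e. e > 0 \<Longrightarrow> \<exists>\<delta>>0. \<forall>y. y \<noteq> f c \<longrightarrow> chordal (f c) y < \<delta> \<longrightarrow>
        (\<exists>x1 x2. x1 \<noteq> x2 \<and> chordal c x1 < e \<and> chordal c x2 < e \<and> f x1 = y \<and> f x2 = y)"
    obtain \<eta> where \<eta>: "\<eta> > 0" "\<And>y. y \<noteq> f c \<Longrightarrow> chordal (f c) y < \<eta> \<Longrightarrow>
        \<exists>x1 x2. x1 \<noteq> x2 \<and> chordal c x1 < \<delta> / 2 \<and> chordal c x2 < \<delta> / 2 \<and> f x1 = y \<and> f x2 = y"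
      using br[of "\<delta> / 2"] \<delta>(1) by auto
    have "f c \<in> julia_set f" using c julia_f by blast
    then obtain y where y: "y \<in> julia_set f" "y \<noteq> f c" "chordal (f c) y < \<eta>" using julia_perfect \<eta>(1) by blast
    then obtain x1 x2 where x: "x1 \<noteq> x2" "chordal c x1 < \<delta> / 2" "chordal c x2 < \<delta> / 2" "f x1 = y" "f x2 = y"
      using \<eta>(2) by blast
    then have "x1 \<in> julia_set f" "x2 \<in> julia_set f" using y(1) julia_f[of x1] julia_f[of x2] by simp_all
    then obtain n where n: "chordal ((f ^^ n) x1) ((f ^^ n) x2) \<ge> \<delta>" using \<delta>(2) x(1) by blast
    show thesis
    proof (cases n)
      case 0
      then show ?thesis using n x chordal_triangle[of x1 x2 c] by (simp add: chordal_commute)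
    next
      case (Suc m)
      then have "(f ^^ n) x1 = (f ^^ n) x2" using x by (simp add: funpow_Suc_right del: funpow.simps)
      then show ?thesis using n \<delta>(1) by simp
    qed
  qed
qed

text \<open>Colliding pairs at shrinking scales would accumulate at a point of the closed Julia set,
  where \<open>f\<close> is locally injective. Only the centre \<open>c\<close> has to lie in the
  Julia set; \<open>x\<close> and \<open>y\<close> are arbitrary points near it.\<close>

lemma julia_uniformly_inj:
  assumes exp: "expansive f"
  obtains e where "e > 0" "\<And>c x y. c \<in> julia_set f \<Longrightarrow> chordal c x < e \<Longrightarrow> chordal c y < e \<Longrightarrow> f x = f y \<Longrightarrow> x = y"
proof (rule ccontr)
  assume "\<not> thesis"
  then have no: "\<And>e. e > 0 \<Longrightarrow> \<not> (\<forall>c x y. c \<in> julia_set f \<longrightarrow> chordal c x < e \<longrightarrow> chordal c y < e \<longrightarrow> f x = f y \<longrightarrow> x = y)"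
    using that by blast
  have "\<exists>c x y. c \<in> julia_set f \<and> chordal c x < 1 / real (Suc j) \<and> chordal c y < 1 / real (Suc j) \<and> f x = f y \<and> x \<noteq> y" for j
    using no[of "1 / real (Suc j)"] by auto
  then obtain c x y where cxy: "\<And>j. c j \<in> julia_set f" "\<And>j. chordal (c j) (x j) < 1 / real (Suc j)"
    "\<And>j. chordal (c j) (y j) < 1 / real (Suc j)" "\<And>j. f (x j) = f (y j)" "\<And>j. x j \<noteq> y j" by metis
  obtain r l where r: "strict_mono (r :: nat \<Rightarrow> nat)" "\<And>e. e > 0 \<Longrightarrow> \<exists>N. \<forall>n\<ge>N. chordal (c (r n)) l < e"
    using chordal_compact by blast
  have "l \<in> julia_set f"
  proof (rule julia_closed)
    fix e :: real assume "e > 0"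
    then obtain n where "chordal (c (r n)) l < e" using r(2) by blast
    then show "\<exists>y\<in>julia_set f. chordal l y < e" using cxy(1) by (metis chordal_commute)
  qed
  then obtain e where e: "e > 0" "inj_on f {x. chordal l x < e}" using julia_locally_inj[OF exp] by blast
  obtain N where N: "\<And>n. n \<ge> N \<Longrightarrow> chordal (c (r n)) l < e / 2" using r(2)[of "e / 2"] e by auto
  obtain M where M: "1 / real (Suc M) < e / 2" using e by (meson half_gt_zero nat_approx_posE)
  define n where "n = max N M"
  have "1 / real (Suc (r n)) \<le> 1 / real (Suc M)"
    using seq_suble[OF r(1), of n] by (intro divide_left_mono) (auto simp: n_def)
  then have "chordal (c (r n)) (x (r n)) < e / 2" "chordal (c (r n)) (y (r n)) < e / 2"
    using cxy(2,3)[of "r n"] M by linarith+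
  moreover have "chordal l (c (r n)) < e / 2" using N[of n] by (simp add: n_def chordal_commute)
  ultimately have "chordal l (x (r n)) < e" "chordal l (y (r n)) < e"
    using chordal_triangle[of l "x (r n)" "c (r n)"] chordal_triangle[of l "y (r n)" "c (r n)"] by linarith+
  then show False using e(2) cxy(4,5)[of "r n"] by (auto simp: inj_on_def)
qed

end

section \<open>Convergent sequences of backward orbits of meromorphic functions\<close>

lemma K_hat_shol: "\<psi> \<in> K_hat f \<Longrightarrow> shol (\<psi> n) UNIV"
  using mero_space_iff by (auto simp: K_hat_def)

lemma K_hat_nonconst: "\<psi> \<in> K_hat f \<Longrightarrow> \<not> \<psi> n constant_on UNIV"
  using mero_space_iff by (auto simp: K_hat_def)

lemma K_hat_step: "\<psi> \<in> K_hat f \<Longrightarrow> f (\<psi> (Suc n) w) = \<psi> n w"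
  unfolding K_hat_def by (metis (mono_tags, lifting) comp_apply mem_Collect_eq)

lemma K_hat_iter: "\<psi> \<in> K_hat f \<Longrightarrow> (f ^^ n) (\<psi> (m + n) w) = \<psi> m w"
proof (induction n arbitrary: m)
  case (Suc n)
  have "(f ^^ Suc n) (\<psi> (m + Suc n) w) = f ((f ^^ n) (\<psi> (Suc m + n) w))" by simp
  also have "\<dots> = f (\<psi> (Suc m) w)" using Suc by metis
  finally show ?case using K_hat_step[OF Suc.prems] by simp
qed simp

lemma K_hat_not_const_ball:
  assumes \<psi>: "\<psi> \<in> K_hat f" and r: "r > 0"
  obtains u where "u \<in> ball w r" "\<psi> n u \<noteq> c"
proof (rule ccontr)
  assume "\<not> thesis"
  then have *: "\<And>u. u \<in> ball w r \<Longrightarrow> \<psi> n u = c" using that by blast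
  have "ball w r \<noteq> {}" using r by simp
  then have "\<psi> n v = c" for v
    by (intro shol_const_extend_open[OF K_hat_shol[OF \<psi>] open_UNIV connected_UNIV open_ball _ subset_UNIV *]) auto
  then show False using K_hat_nonconst[OF \<psi>, of n] unfolding constant_on_def by blast
qed

text \<open>Balls about the origin exhaust the plane, so this is sequential convergence in the
  topology of \<open>K_hat f\<close>.\<close>

definition K_hat_conv :: "(csphere \<Rightarrow> csphere) \<Rightarrow> (nat \<Rightarrow> nat \<Rightarrow> complex \<Rightarrow> csphere) \<Rightarrow> (nat \<Rightarrow> complex \<Rightarrow> csphere) \<Rightarrow> bool" where
  "K_hat_conv f \<Psi> \<psi> \<longleftrightarrow> (\<forall>k. \<Psi> k \<in> K_hat f) \<and> \<psi> \<in> K_hat f \<and> (\<forall>n R. uconv (ball 0 R) (\<lambda>k. \<Psi> k n) (\<psi> n))"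

lemma K_hat_convD:
  assumes "K_hat_conv f \<Psi> \<psi>"
  shows "\<Psi> k \<in> K_hat f" "\<psi> \<in> K_hat f" "uconv (ball w r) (\<lambda>k. \<Psi> k n) (\<psi> n)"
proof -
  show "\<Psi> k \<in> K_hat f" "\<psi> \<in> K_hat f" using assms by (auto simp: K_hat_conv_def)
  have "ball w r \<subseteq> ball 0 (cmod w + r)"
  proof
    fix u assume "u \<in> ball w r"
    then show "u \<in> ball 0 (cmod w + r)" using norm_triangle_sub[of u w] by (simp add: dist_norm norm_minus_commute)
  qed
  then show "uconv (ball w r) (\<lambda>k. \<Psi> k n) (\<psi> n)" using assms uconv_subset unfolding K_hat_conv_def by blast
qed

lemma K_hat_conv_const: "\<psi> \<in> K_hat f \<Longrightarrow> K_hat_conv f (\<lambda>k. \<psi>) \<psi>"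
  by (simp add: K_hat_conv_def)

context sphere_map
begin

text \<open>By Picard's theorem a non-constant map on the plane cannot omit three points of the
  infinite Julia set.\<close>

lemma hits_julia:
  assumes "\<psi> \<in> K_hat f"
  obtains w where "\<psi> 0 w \<in> julia_set f"
proof (rule ccontr)
  assume "\<not> thesis"
  then have no: "\<And>w. \<psi> 0 w \<notin> julia_set f" using that by blast
  obtain A where A: "card A = 3" "A \<subseteq> julia_set f" using infinite_arbitrarily_large[OF infinite_julia] by metis
  from A(1)[unfolded card_3_iff] obtain a b c where abc: "A = {a, b, c}" "a \<noteq> b" "b \<noteq> c" "a \<noteq> c" by metis
  have "\<psi> 0 constant_on UNIV"
    by (rule shol_Picard[OF K_hat_shol[OF assms] abc(2-4)]) (use no A(2) abc(1) in blast)
  then show False using K_hat_nonconst[OF assms] by blast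
qed

text \<open>A Julia value of the limit is taken nearby by every late term, by Hurwitz's theorem. The
  Julia set is backward invariant, so the same \<open>w\<close> works at all depths of that
  term.\<close>

lemma conv_hits_julia:
  assumes "K_hat_conv f \<Psi> \<psi>"
  obtains R k0 where "R > 0" "\<And>k n. k \<ge> k0 \<Longrightarrow> \<exists>w\<in>ball 0 R. \<forall>n. \<Psi> k n w \<in> julia_set f"
proof -
  note cv = K_hat_convD[OF assms]
  obtain w where w: "\<psi> 0 w \<in> julia_set f" using hits_julia cv(2) by blast
  obtain u where u: "u \<in> ball w 1" "\<psi> 0 u \<noteq> \<psi> 0 w" using K_hat_not_const_ball[OF cv(2), of 1 w] by auto
  obtain e K where e: "e > 0" "\<And>k y. k \<ge> K \<Longrightarrow> chordal (\<psi> 0 w) y < e \<Longrightarrow> \<exists>u\<in>ball w 1. \<Psi> k 0 u = y"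
    using shol_cover[of "\<lambda>k. \<Psi> k 0" w 1, OF shol_subset[OF K_hat_shol[OF cv(1)]] _ cv(3) shol_subset[OF K_hat_shol[OF cv(2)]] u]
    by (metis subset_UNIV zero_less_one)
  show ?thesis
  proof (rule that[of "cmod w + 1" K])
    show "cmod w + 1 > 0" by (simp add: add_nonneg_pos)
    fix k :: nat assume "k \<ge> K"
    then obtain u where u: "u \<in> ball w 1" "\<Psi> k 0 u = \<psi> 0 w" using e by (metis chordal_self)
    have "\<Psi> k n u \<in> julia_set f" for n
      using K_hat_iter[OF cv(1), of n k 0 u] u(2) w julia_iter[of n "\<Psi> k n u"] by simp
    moreover have "u \<in> ball 0 (cmod w + 1)"
      using u(1) norm_triangle_sub[of u w] by (simp add: dist_norm norm_minus_commute)
    ultimately show "\<exists>w\<in>ball 0 (cmod w + 1). \<forall>n. \<Psi> k n w \<in> julia_set f" by blast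
  qed
qed

text \<open>Near \<open>w\<close> the maps \<open>\<Psi> k 0\<close> take the value \<open>x0\<close> at most \<open>M\<close> times, so \<open>\<Psi> k n\<close> omits all but \<open>M\<close> of any
  \<open>M + 3\<close> points of \<open>f\<^sup>-\<^sup>n(x0)\<close>, and Montel's theorem applies uniformly in \<open>n\<close>.\<close>

lemma conv_equicontinuous:
  assumes cv: "K_hat_conv f \<Psi> \<psi>" and e: "e > 0"
  obtains d k0 where "d > 0" "\<And>k n u. k \<ge> k0 \<Longrightarrow> dist w u < d \<Longrightarrow> chordal (\<Psi> k n u) (\<Psi> k n w) < e"
proof -
  note cvD = K_hat_convD[OF cv]
  have sh: "shol (\<Psi> k n) (ball w r)" "shol (\<psi> n) (ball w r)" for k n w r
    using K_hat_shol cvD shol_subset subset_UNIV by metis+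
  obtain x0 y0 Y where Y: "f x0 = x0" "y0 \<noteq> x0" "\<And>i n. i < n \<Longrightarrow> (f ^^ n) (Y i) = x0" "\<And>i. (f ^^ i) (Y i) = y0" "inj (Y :: nat \<Rightarrow> csphere)"
    by (rule backward_orbit) (rule that)
  obtain u0 where u0: "u0 \<in> ball w 1" "\<psi> 0 u0 \<noteq> x0" using K_hat_not_const_ball[OF cvD(2)] zero_less_one by metis
  obtain s M K where s: "0 < s"
    "\<And>k. K \<le> k \<Longrightarrow> finite {u\<in>ball w s. \<Psi> k 0 u = x0} \<and> card {u\<in>ball w s. \<Psi> k 0 u = x0} \<le> M"
    by (rule shol_count[of "\<lambda>k. \<Psi> k 0" w 1, OF sh(1) zero_less_one cvD(3) sh(2) u0]) (rule that)
  define Z where "Z = Y ` {..<M + 3}"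
  have Z: "finite Z" "card Z = M + 3" using Y(5) by (auto simp: Z_def card_image inj_on_subset)
  obtain \<eta> where \<eta>: "\<eta> > 0"
    "\<And>\<psi> w r u. r > 0 \<Longrightarrow> shol \<psi> (ball w r) \<Longrightarrow> card (Z \<inter> \<psi> ` ball w r) + 3 \<le> card Z \<Longrightarrow>
        cmod (u - w) < \<eta> * r \<Longrightarrow> chordal (\<psi> u) (\<psi> w) < e"
    using shol_omit_finite[OF Z(1) e] by metis
  have large: "chordal (\<Psi> k n u) (\<Psi> k n w) < e" if "k \<ge> K" "n \<ge> M + 3" "dist w u < \<eta> * s" for k n u
  proof -
    have "Z \<inter> \<Psi> k n ` ball w s \<subseteq> \<Psi> k n ` {u\<in>ball w s. \<Psi> k 0 u = x0}"
    proof
      fix z assume "z \<in> Z \<inter> \<Psi> k n ` ball w s"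
      then obtain v i where v: "v \<in> ball w s" "z = \<Psi> k n v" "z = Y i" "i < M + 3" by (auto simp: Z_def)
      then have "(f ^^ n) (\<Psi> k n v) = x0" using Y(3)[of i n] that(2) by simp
      then have "\<Psi> k 0 v = x0" using K_hat_iter[OF cvD(1), of n k 0 v] by simp
      then show "z \<in> \<Psi> k n ` {u\<in>ball w s. \<Psi> k 0 u = x0}" using v by blast
    qed
    then have "card (Z \<inter> \<Psi> k n ` ball w s) \<le> card (\<Psi> k n ` {u\<in>ball w s. \<Psi> k 0 u = x0})"
      using s(2)[OF that(1)] by (intro card_mono) auto
    also have "\<dots> \<le> card {u\<in>ball w s. \<Psi> k 0 u = x0}" using s(2)[OF that(1)] by (intro card_image_le) auto
    finally have "card (Z \<inter> \<Psi> k n ` ball w s) + 3 \<le> card Z" using s(2)[OF that(1)] Z(2) by linarith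
    then show ?thesis by (intro \<eta>(2)[OF s(1) sh(1)]) (use that(3) in \<open>simp_all add: dist_norm norm_minus_commute\<close>)
  qed
  \<comment> \<open>The finitely many depths below \<open>M + 3\<close>, where points of
    \<open>Z\<close> need not yet lie over \<open>x0\<close>, are settled one at a time by
    convergence of the component.\<close>
  have "\<exists>d k0. d > 0 \<and> (\<forall>k\<ge>k0. \<forall>u. dist w u < d \<longrightarrow> chordal (\<Psi> k n u) (\<Psi> k n w) < e)" for n
  proof -
    have e3: "e / 3 > 0" using e by simp
    obtain d where d: "d > 0" "\<And>u. dist w u < d \<Longrightarrow> chordal (\<psi> n w) (\<psi> n u) < e / 3"
      using shol_near[OF K_hat_shol[OF cvD(2)] UNIV_I e3] by metis
    obtain k0 where k0: "\<And>k u. k \<ge> k0 \<Longrightarrow> u \<in> ball w 1 \<Longrightarrow> chordal (\<Psi> k n u) (\<psi> n u) < e / 3"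
      using cvD(3)[of w 1 n] e3 unfolding uconv_iff by metis
    have "chordal (\<Psi> k n u) (\<Psi> k n w) < e" if "k \<ge> k0" "dist w u < min d 1" for k u
    proof -
      have "chordal (\<Psi> k n u) (\<psi> n u) < e / 3" "chordal (\<Psi> k n w) (\<psi> n w) < e / 3" using k0 that by auto
      moreover have "chordal (\<psi> n w) (\<psi> n u) < e / 3" using d that by simp
      ultimately show ?thesis
        using chordal_triangle[of "\<Psi> k n u" "\<Psi> k n w" "\<psi> n u"] chordal_triangle[of "\<psi> n u" "\<Psi> k n w" "\<psi> n w"]
        by (simp add: chordal_commute)
    qed
    then show ?thesis using d(1) by (intro exI[of _ "min d 1"] exI[of _ k0]) auto
  qed
  then obtain D K0 where D: "\<And>n. D n > 0" "\<And>n k u. k \<ge> K0 n \<Longrightarrow> dist w u < D n \<Longrightarrow> chordal (\<Psi> k n u) (\<Psi> k n w) < e"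
    by metis
  define d where "d = Min (insert (\<eta> * s) (D ` {..<M + 3}))"
  define k0 where "k0 = Max (insert K (K0 ` {..<M + 3}))"
  have d: "d > 0" "d \<le> \<eta> * s" "\<And>n. n < M + 3 \<Longrightarrow> d \<le> D n"
    unfolding d_def using D(1) \<eta>(1) s(1) by (auto simp: Min_gr_iff intro!: Min_le)
  have k0: "K \<le> k0" "\<And>n. n < M + 3 \<Longrightarrow> K0 n \<le> k0" unfolding k0_def by (auto intro!: Max_ge)
  show ?thesis
  proof (rule that[OF d(1), of k0])
    fix k n u assume k: "k \<ge> k0" "dist w u < d"
    show "chordal (\<Psi> k n u) (\<Psi> k n w) < e"
    proof (cases "n < M + 3")
      case True
      then show ?thesis using D(2)[of n k u] d(3)[of n] k0(2)[of n] k by linarith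
    next
      case False
      then show ?thesis using large[of k n u] d(2) k0(1) k by linarith
    qed
  qed
qed

text \<open>Otherwise some sequence \<open>\<Psi> k n\<close> with \<open>k, n \<rightarrow> \<infinity>\<close> has a non-constant limit whose image meets the Julia
  set. It covers a neighbourhood of a Julia point, and there \<open>f\<^sup>m\<close> factors through \<open>\<Psi> k (n - m)\<close>,
  which makes the iterates equicontinuous.\<close>

lemma conv_shrink:
  assumes cv: "K_hat_conv f \<Psi> \<psi>" and e: "e > 0"
  obtains N k0 where "\<And>k n u v. k \<ge> k0 \<Longrightarrow> n \<ge> N \<Longrightarrow> u \<in> ball 0 R \<Longrightarrow> v \<in> ball 0 R \<Longrightarrow> chordal (\<Psi> k n u) (\<Psi> k n v) < e"
proof (rule ccontr)
  assume no: "\<not> thesis"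
  note cvD = K_hat_convD[OF cv]
  have sh: "shol (\<Psi> k n) S" for k n S
    using K_hat_shol cvD shol_subset subset_UNIV by metis
  have "\<exists>k n u v. k \<ge> j \<and> n \<ge> j \<and> u \<in> ball 0 R \<and> v \<in> ball 0 R \<and> \<not> chordal (\<Psi> k n u) (\<Psi> k n v) < e" for j :: nat
    using no that[of j j] by blast
  then obtain \<kappa> \<nu> u v where kn: "\<And>j. \<kappa> j \<ge> j" "\<And>j. \<nu> j \<ge> (j::nat)" and uv: "\<And>j. u j \<in> ball 0 R" "\<And>j. v j \<in> ball 0 R"
    "\<And>j. \<not> chordal (\<Psi> (\<kappa> j) (\<nu> j) (u j)) (\<Psi> (\<kappa> j) (\<nu> j) (v j)) < e" by metis
  obtain RJ kJ where RJ: "RJ > 0" "\<And>k n. k \<ge> kJ \<Longrightarrow> \<exists>w\<in>ball 0 RJ. \<forall>n. \<Psi> k n w \<in> julia_set f"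
    using conv_hits_julia[OF cv] by metis
  \<comment> \<open>This ball contains the pairs \<open>u j\<close>, \<open>v j\<close> whose images
    stay apart as well as the points that hit the Julia set; the extra 1 puts limits of the latter
    in its interior.\<close>
  define R0 where "R0 = max R RJ + 1"
  define X where "X j = \<Psi> (\<kappa> j) (\<nu> j)" for j
  \<comment> \<open>Equicontinuity that is uniform in the depth yields a convergent subsequence
    although the depths \<open>\<nu> j\<close> tend to infinity; the finitely many early indices are
    treated individually.\<close>
  obtain g q where gc: "continuous_on (cball 0 R0) g" and q: "strict_mono (q :: nat \<Rightarrow> nat)"
    and g: "\<And>\<epsilon>. 0 < \<epsilon> \<Longrightarrow> \<exists>N. \<forall>n x. n \<ge> N \<and> x \<in> cball 0 R0 \<longrightarrow> norm (stereo (X (q n) x) - g x) < \<epsilon>"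
  proof (rule Arzela_Ascoli[of "cball 0 R0" "\<lambda>j x. stereo (X j x)" 1])
    fix w :: complex and \<epsilon> :: real assume "0 < \<epsilon>"
    then obtain d k0 where d: "d > 0" "\<And>k n u. k \<ge> k0 \<Longrightarrow> dist w u < d \<Longrightarrow> chordal (\<Psi> k n u) (\<Psi> k n w) < \<epsilon>"
      using conv_equicontinuous[OF cv] by metis
    have "\<exists>d>0. \<forall>u. dist w u < d \<longrightarrow> chordal (X j w) (X j u) < \<epsilon>" for j
      unfolding X_def using shol_near[OF sh UNIV_I \<open>0 < \<epsilon>\<close>] by metis
    then obtain D where D: "\<And>j. D j > 0" "\<And>j u. dist w u < D j \<Longrightarrow> chordal (X j w) (X j u) < \<epsilon>" by metis
    define d' where "d' = Min (insert d (D ` {..<k0}))"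
    have d': "d' > 0" "d' \<le> d" "\<And>j. j < k0 \<Longrightarrow> d' \<le> D j"
      unfolding d'_def using d(1) D(1) by (auto simp: Min_gr_iff intro!: Min_le)
    have "chordal (X j w) (X j y) < \<epsilon>" if "dist w y < d'" for j y
    proof (cases "j < k0")
      case True
      then show ?thesis using D(2)[of y j] d'(3)[OF True] that by linarith
    next
      case False
      then have "k0 \<le> \<kappa> j" using kn(1)[of j] by linarith
      then show ?thesis using d(2)[of "\<kappa> j" y "\<nu> j"] d'(2) that by (simp add: X_def chordal_commute)
    qed
    then show "\<exists>d>0. \<forall>n y. y \<in> cball 0 R0 \<and> norm (w - y) < d \<longrightarrow> norm (stereo (X n w) - stereo (X n y)) < \<epsilon>"
      using d'(1) by (intro exI[of _ d']) (simp add: chordal_def dist_norm)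
  qed (auto simp: stereo_bounded)
  define h where "h w = inv stereo (g w)" for w
  have h: "stereo (h w) = g w" if w: "w \<in> cball 0 R0" for w
  proof -
    have "(\<lambda>n. stereo (X (q n) w)) \<longlonglongrightarrow> g w" unfolding LIMSEQ_iff using g w by blast
    then have "g w \<in> range stereo"
      by (rule closed_sequentially[OF compact_imp_closed[OF compact_range_stereo], rotated]) simp
    then show ?thesis by (simp add: h_def f_inv_into_f)
  qed
  have uc: "uconv (cball 0 R0) (\<lambda>j. X (q j)) h"
    unfolding uconv_iff
  proof (intro allI impI)
    fix \<epsilon> :: real assume "0 < \<epsilon>"
    then obtain N where "\<And>n x. n \<ge> N \<Longrightarrow> x \<in> cball 0 R0 \<Longrightarrow> norm (stereo (X (q n) x) - g x) < \<epsilon>" using g by blast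
    then show "\<exists>N. \<forall>k\<ge>N. \<forall>u\<in>cball 0 R0. chordal (X (q k) u) (h u) < \<epsilon>"
      by (intro exI[of _ N]) (simp add: h chordal_def dist_norm)
  qed
  have shh: "shol h (ball 0 R0)"
  proof (rule shol_limit[of "\<lambda>j. X (q j)"])
    show "shol (X (q k)) (ball 0 R0)" for k unfolding X_def by (rule sh)
    show "\<exists>r>0. uconv (ball w r \<inter> ball 0 R0) (\<lambda>j. X (q j)) h" for w
      by (intro exI[of _ 1] conjI uconv_subset[OF uc]) auto
  qed simp
  have qj: "j \<le> q j" for j using seq_suble[OF q] .
  \<comment> \<open>A limit constant on a small ball would be constant on \<open>ball 0 R0\<close>,
    and then the images of \<open>u j\<close> and \<open>v j\<close> could not stay \<open>e\<close>
    apart.\<close>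
  have nch: "\<exists>u\<in>ball w r. h u \<noteq> h w" if w: "w \<in> ball 0 R0" "r > 0" "ball w r \<subseteq> ball 0 R0" for w r
  proof (rule ccontr)
    assume "\<not> ?thesis"
    then have *: "\<And>u. u \<in> ball w r \<Longrightarrow> h u = h w" by blast
    have const: "h x = h w" if "x \<in> ball 0 R0" for x
      by (rule shol_const_extend_open[OF shh open_ball connected_ball open_ball _ w(3) * that]) (use w in auto)
    have "e / 2 > 0" using e by simp
    then obtain N where N: "\<And>k x. k \<ge> N \<Longrightarrow> x \<in> cball 0 R0 \<Longrightarrow> chordal (X (q k) x) (h x) < e / 2"
      using uc unfolding uconv_iff by metis
    have "u (q N) \<in> ball 0 R0" "v (q N) \<in> ball 0 R0" using uv(1,2)[of "q N"] by (auto simp: R0_def)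
    then have "chordal (X (q N) (u (q N))) (h w) < e / 2" "chordal (X (q N) (v (q N))) (h w) < e / 2"
      using N[of N "u (q N)"] N[of N "v (q N)"] const by auto
    then show False using uv(3)[of "q N"] chordal_triangle[of "X (q N) (u (q N))" "X (q N) (v (q N))" "h w"]
      by (simp add: X_def chordal_commute)
  qed
  have equi_h: "equi (h w)" if w: "w \<in> ball 0 R0" for w
    unfolding equi_def
  proof (intro allI impI)
    fix \<epsilon> :: real assume "0 < \<epsilon>"
    then have "\<epsilon> / 2 > 0" by simp
    then obtain d k0 where d: "d > 0" "\<And>k n u. k \<ge> k0 \<Longrightarrow> dist w u < d \<Longrightarrow> chordal (\<Psi> k n u) (\<Psi> k n w) < \<epsilon> / 2"
      using conv_equicontinuous[OF cv] by metis
    obtain d1 where d1: "d1 > 0" "ball w d1 \<subseteq> ball 0 R0" using w open_ball openE by metis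
    define r where "r = min d d1"
    have r: "r > 0" "ball w r \<subseteq> ball 0 R0" "ball w r \<subseteq> cball 0 R0" "r \<le> d"
      using d d1 ball_subset_cball unfolding r_def by (auto simp: subset_iff)
    obtain u0 where u0: "u0 \<in> ball w r" "h u0 \<noteq> h w" using nch[OF w r(1,2)] by blast
    have shX: "shol (X (q k)) (ball w r)" for k unfolding X_def by (rule sh)
    obtain e1 K where e1: "e1 > 0" "\<And>k y. k \<ge> K \<Longrightarrow> chordal (h w) y < e1 \<Longrightarrow> \<exists>u\<in>ball w r. X (q k) u = y"
      by (rule shol_cover[of "\<lambda>j. X (q j)" w r, OF shX r(1) uconv_subset[OF uc r(3)] shol_subset[OF shh r(2)] u0]) (rule that)
    show "\<exists>d>0. \<forall>n y. chordal (h w) y < d \<longrightarrow> chordal ((f ^^ n) (h w)) ((f ^^ n) y) < \<epsilon>"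
    proof (intro exI[of _ e1] conjI allI impI e1)
      fix n y assume y: "chordal (h w) y < e1"
      define j where "j = max K (max k0 n)"
      have j: "K \<le> j" "k0 \<le> \<kappa> (q j)" "n \<le> \<nu> (q j)"
        using qj[of j] kn(1,2)[of "q j"] by (auto simp: j_def)
      obtain a where a: "a \<in> ball w r" "X (q j) a = y" using e1(2)[OF j(1) y] by blast
      obtain a0 where a0: "a0 \<in> ball w r" "X (q j) a0 = h w" using e1(2)[OF j(1), of "h w"] e1(1) by auto
      \<comment> \<open>The depth \<open>\<nu> (q j)\<close> is at least \<open>n\<close>, so
        composing \<open>X (q j)\<close> with the \<open>n\<close>-th iterate only leads to a
        shallower component, which oscillates little on \<open>ball w r\<close>.\<close>
      have it: "(f ^^ n) (X (q j) x) = \<Psi> (\<kappa> (q j)) (\<nu> (q j) - n) x" for x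
        using K_hat_iter[OF cvD(1), of n "\<kappa> (q j)" "\<nu> (q j) - n" x] j(3) by (simp add: X_def)
      have "chordal (\<Psi> (\<kappa> (q j)) (\<nu> (q j) - n) x) (\<Psi> (\<kappa> (q j)) (\<nu> (q j) - n) w) < \<epsilon> / 2" if "x \<in> ball w r" for x
        using d(2)[OF j(2), of x] that r(4) by simp
      from this[OF a(1)] this[OF a0(1)]
      have "chordal ((f ^^ n) (X (q j) a0)) ((f ^^ n) (X (q j) a)) < \<epsilon>"
        unfolding it using chordal_triangle[of "\<Psi> (\<kappa> (q j)) (\<nu> (q j) - n) a0" "\<Psi> (\<kappa> (q j)) (\<nu> (q j) - n) a" "\<Psi> (\<kappa> (q j)) (\<nu> (q j) - n) w"]
        by (simp add: chordal_commute)
      then show "chordal ((f ^^ n) (h w)) ((f ^^ n) y) < \<epsilon>" using a a0 by simp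
    qed
  qed
  have "\<exists>w\<in>cball 0 RJ. X (q (kJ + j)) w \<in> julia_set f" for j
  proof -
    have "kJ \<le> \<kappa> (q (kJ + j))" using qj[of "kJ + j"] kn(1)[of "q (kJ + j)"] by linarith
    then show ?thesis using RJ(2) ball_subset_cball unfolding X_def by (metis subset_iff)
  qed
  then obtain \<omega> where \<omega>: "\<And>j. \<omega> j \<in> cball 0 RJ" "\<And>j. X (q (kJ + j)) (\<omega> j) \<in> julia_set f" by metis
  obtain w p where w: "w \<in> cball 0 RJ" "strict_mono (p :: nat \<Rightarrow> nat)" "(\<omega> \<circ> p) \<longlonglongrightarrow> w"
    using compact_cball[of 0 RJ] \<omega>(1) unfolding compact_def by blast
  have wR: "w \<in> ball 0 R0" using w(1) by (simp add: R0_def)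
  have "h w \<in> julia_set f"
  proof (rule julia_closed)
    fix \<epsilon> :: real assume "\<epsilon> > 0"
    then have \<epsilon>: "\<epsilon> / 2 > 0" by simp
    obtain d where d: "d > 0" "\<And>u. dist w u < d \<Longrightarrow> chordal (h w) (h u) < \<epsilon> / 2"
      using shol_near[OF shh wR \<epsilon>] by metis
    obtain N where N: "\<And>k x. k \<ge> N \<Longrightarrow> x \<in> cball 0 R0 \<Longrightarrow> chordal (X (q k) x) (h x) < \<epsilon> / 2"
      using uc \<epsilon> unfolding uconv_iff by metis
    obtain M where M: "\<And>n. n \<ge> M \<Longrightarrow> dist (\<omega> (p n)) w < d" using w(3) d(1) unfolding lim_sequentially by auto
    define n where "n = max N M"
    have "\<omega> (p n) \<in> cball 0 R0" using \<omega>(1)[of "p n"] by (simp add: R0_def)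
    moreover have "N \<le> kJ + p n" using seq_suble[OF w(2), of n] by (simp add: n_def)
    ultimately have "chordal (X (q (kJ + p n)) (\<omega> (p n))) (h (\<omega> (p n))) < \<epsilon> / 2" using N by blast
    moreover have "chordal (h w) (h (\<omega> (p n))) < \<epsilon> / 2" using M[of n] by (intro d(2)) (simp add: n_def dist_commute)
    ultimately have "chordal (h w) (X (q (kJ + p n)) (\<omega> (p n))) < \<epsilon>"
      using chordal_triangle[of "h w" "X (q (kJ + p n)) (\<omega> (p n))" "h (\<omega> (p n))"] by (simp add: chordal_commute)
    then show "\<exists>y\<in>julia_set f. chordal (h w) y < \<epsilon>" using \<omega>(2) by blast
  qed
  moreover have "h w \<in> fatou_set f"
  proof -
    obtain r where r: "r > 0" "ball w r \<subseteq> ball 0 R0" using wR open_ball openE by metis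
    obtain u0 where u0: "u0 \<in> ball w r" "h u0 \<noteq> h w" using nch[OF wR r] by blast
    obtain e1 where "e1 > 0" "\<And>y. chordal (h w) y < e1 \<Longrightarrow> \<exists>u\<in>ball w r. h u = y"
      by (rule shol_open_map[OF shol_subset[OF shh r(2)] r(1) u0]) (rule that)
    then show ?thesis unfolding fatou_iff using equi_h r(2) by (metis subset_iff)
  qed
  ultimately show False by (simp add: julia_set_def)
qed

text \<open>By \<open>conv_shrink\<close> deep images of a ball have small diameter and meet the Julia set, where \<open>f\<close> is uniformly
  locally injective.\<close>

lemma conv_eventually_inj:
  assumes exp: "expansive f" and cv: "K_hat_conv f \<Psi> \<psi>"
  obtains N k0 where "\<And>k n u v m. k \<ge> k0 \<Longrightarrow> n \<ge> N \<Longrightarrow> u \<in> ball 0 R \<Longrightarrow> v \<in> ball 0 R \<Longrightarrow> \<Psi> k n u = \<Psi> k n v \<Longrightarrow> \<Psi> k m u = \<Psi> k m v"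
proof -
  note cvD = K_hat_convD[OF cv]
  obtain RJ kJ where RJ: "RJ > 0" "\<And>k n. k \<ge> kJ \<Longrightarrow> \<exists>w\<in>ball 0 RJ. \<forall>n. \<Psi> k n w \<in> julia_set f"
    using conv_hits_julia[OF cv] by metis
  obtain e where e: "e > 0" "\<And>c x y. c \<in> julia_set f \<Longrightarrow> chordal c x < e \<Longrightarrow> chordal c y < e \<Longrightarrow> f x = f y \<Longrightarrow> x = y"
    using julia_uniformly_inj[OF exp] by metis
  obtain N k0 where N: "\<And>k n u v. k \<ge> k0 \<Longrightarrow> n \<ge> N \<Longrightarrow> u \<in> ball 0 (max R RJ) \<Longrightarrow> v \<in> ball 0 (max R RJ) \<Longrightarrow> chordal (\<Psi> k n u) (\<Psi> k n v) < e"
    using conv_shrink[OF cv e(1), of "max R RJ"] by metis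
  show ?thesis
  proof (rule that[of "max k0 kJ" N])
    fix k n u v m
    assume k: "max k0 kJ \<le> k" and n: "N \<le> n" and u: "u \<in> ball 0 R" and v: "v \<in> ball 0 R" and eq: "\<Psi> k n u = \<Psi> k n v"
    obtain w where w: "w \<in> ball 0 RJ" "\<And>n. \<Psi> k n w \<in> julia_set f" using RJ(2)[of k] k by auto
    \<comment> \<open>The deeper images of \<open>u\<close> and \<open>v\<close> stay within
      \<open>e\<close> of a Julia point, the image of \<open>w\<close>, and \<open>f\<close> is
      injective there; so equality at depth \<open>n\<close> lifts step by step.\<close>
    have up: "\<Psi> k (n + i) u = \<Psi> k (n + i) v" for i
    proof (induction i)
      case (Suc i)
      show ?case
      proof (rule e(2)[of "\<Psi> k (n + Suc i) w"])
        show "chordal (\<Psi> k (n + Suc i) w) (\<Psi> k (n + Suc i) u) < e" "chordal (\<Psi> k (n + Suc i) w) (\<Psi> k (n + Suc i) v) < e"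
          using N[of k "n + Suc i"] k n u v w(1) by auto
        show "f (\<Psi> k (n + Suc i) u) = f (\<Psi> k (n + Suc i) v)"
          using Suc K_hat_step[OF cvD(1)] by simp
      qed (rule w)
    qed (use eq in simp)
    have "\<Psi> k m x = (f ^^ n) (\<Psi> k (n + m) x)" for x
      using K_hat_iter[OF cvD(1), of n k m x] by (simp add: add.commute)
    then show "\<Psi> k m u = \<Psi> k m v" using up[of m] by simp
  qed
qed

text \<open>The depth \<open>N\<close> is fixed before \<open>k\<close>, so convergence of the
  single component \<open>N\<close> suffices: a late term takes the common value of
  \<open>\<psi> N\<close> at \<open>u\<close> and \<open>v\<close> both near \<open>u\<close> and
  near \<open>v\<close>, hence identifies two distinct points at depth \<open>N\<close> and
  therefore at all depths.\<close>

lemma conv_inj: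
  assumes exp: "expansive f" and cv: "K_hat_conv f \<Psi> \<psi>"
    and inj: "\<And>k. inj (\<lambda>w n. \<Psi> k n w)"
  shows "inj (\<lambda>w n. \<psi> n w)"
proof (rule injI, rule ccontr)
  fix u v assume eq: "(\<lambda>n. \<psi> n u) = (\<lambda>n. \<psi> n v)" and ne: "u \<noteq> v"
  note cvD = K_hat_convD[OF cv]
  \<comment> \<open>Half the distance makes the balls about \<open>u\<close> and \<open>v\<close>
    disjoint.\<close>
  define r where "r = dist u v / 2"
  have r: "r > 0" using ne by (simp add: r_def)
  define R where "R = cmod u + cmod v + r"
  have sub: "ball u r \<subseteq> ball 0 R" "ball v r \<subseteq> ball 0 R"
  proof -
    show "ball u r \<subseteq> ball 0 R"
    proof
      fix x assume "x \<in> ball u r"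
      then have "cmod x < cmod u + r" using norm_triangle_sub[of x u] by (simp add: dist_norm norm_minus_commute)
      then show "x \<in> ball 0 R" unfolding mem_ball_0 R_def using norm_ge_zero[of v] by linarith
    qed
    show "ball v r \<subseteq> ball 0 R"
    proof
      fix x assume "x \<in> ball v r"
      then have "cmod x < cmod v + r" using norm_triangle_sub[of x v] by (simp add: dist_norm norm_minus_commute)
      then show "x \<in> ball 0 R" unfolding mem_ball_0 R_def using norm_ge_zero[of u] by linarith
    qed
  qed
  obtain N k0 where N: "\<And>k n u v m. k \<ge> k0 \<Longrightarrow> n \<ge> N \<Longrightarrow> u \<in> ball 0 R \<Longrightarrow> v \<in> ball 0 R \<Longrightarrow> \<Psi> k n u = \<Psi> k n v \<Longrightarrow> \<Psi> k m u = \<Psi> k m v"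
    using conv_eventually_inj[OF exp cv, of R] by metis
  have cover: "\<exists>K. \<forall>k\<ge>K. \<exists>u\<in>ball w r. \<Psi> k N u = \<psi> N w" for w
  proof -
    have sh: "shol (\<Psi> k N) (ball w r)" "shol (\<psi> N) (ball w r)" for k
      using K_hat_shol cvD(1,2) shol_subset subset_UNIV by metis+
    obtain u0 where u0: "u0 \<in> ball w r" "\<psi> N u0 \<noteq> \<psi> N w" using K_hat_not_const_ball[OF cvD(2) r] by metis
    obtain e1 K where "e1 > 0" "\<And>k y. k \<ge> K \<Longrightarrow> chordal (\<psi> N w) y < e1 \<Longrightarrow> \<exists>u\<in>ball w r. \<Psi> k N u = y"
      by (rule shol_cover[of "\<lambda>k. \<Psi> k N" w r, OF sh(1) r cvD(3) sh(2) u0]) (rule that)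
    then show ?thesis by (metis chordal_self)
  qed
  obtain K1 where K1: "\<And>k. k \<ge> K1 \<Longrightarrow> \<exists>x\<in>ball u r. \<Psi> k N x = \<psi> N u" using cover by blast
  obtain K2 where K2: "\<And>k. k \<ge> K2 \<Longrightarrow> \<exists>x\<in>ball v r. \<Psi> k N x = \<psi> N v" using cover by blast
  define k where "k = max k0 (max K1 K2)"
  have k: "k0 \<le> k" "K1 \<le> k" "K2 \<le> k" by (auto simp: k_def)
  obtain a where a: "a \<in> ball u r" "\<Psi> k N a = \<psi> N u" using K1[OF k(2)] by blast
  obtain b where b: "b \<in> ball v r" "\<Psi> k N b = \<psi> N v" using K2[OF k(3)] by blast
  have "\<psi> N u = \<psi> N v" using eq by (rule fun_cong)
  moreover have "a \<in> ball 0 R" "b \<in> ball 0 R" using a(1) b(1) sub by blast+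
  ultimately have "\<Psi> k m a = \<Psi> k m b" for m
    using N[OF k(1) order_refl, of a b m] a b by simp
  then have "a = b" using inj[of k] by (auto simp: inj_def)
  then show False using a(1) b(1) dist_triangle[of u v a] by (simp add: r_def dist_commute)
qed

text \<open>The constant sequence in \<open>conv_eventually_inj\<close>. On a given ball the deep
  components are themselves injective, which brings univalent function theory into play.\<close>

lemma K_hat_eventually_inj:
  assumes "expansive f" "\<psi> \<in> K_hat f" "inj (\<lambda>w n. \<psi> n w)"
  obtains N where "\<And>n. n \<ge> N \<Longrightarrow> inj_on (\<psi> n) (ball 0 R)"
proof -
  obtain N k0 where N: "\<And>k n u v m. k \<ge> (k0::nat) \<Longrightarrow> n \<ge> N \<Longrightarrow> u \<in> ball 0 R \<Longrightarrow> v \<in> ball 0 R \<Longrightarrow> \<psi> n u = \<psi> n v \<Longrightarrow> \<psi> m u = \<psi> m v"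
    using conv_eventually_inj[OF assms(1) K_hat_conv_const[OF assms(2)], of R] by metis
  show ?thesis
  proof (rule that[of N], rule inj_onI)
    fix n u v assume "N \<le> n" "u \<in> ball 0 R" "v \<in> ball 0 R" "\<psi> n u = \<psi> n v"
    then have "\<psi> m u = \<psi> m v" for m using N[of k0 n u v m] by blast
    then show "u = v" using assms(3) by (auto simp: inj_def)
  qed
qed

end

section \<open>Pull-backs and plaques\<close>

lemma connectedin_image:
  assumes "connected S" "continuous_on S (\<lambda>z. stereo (\<psi> z))"
  shows "connectedin riemann_sphere (\<psi> ` S)"
proof -
  have "continuous_map (top_of_set S) riemann_sphere \<psi>"
    using assms(2) by (simp add: continuous_map_riemann_sphere o_def)
  moreover have "connectedin (top_of_set S) S" using assms(1) by (simp add: connectedin_subtopology)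
  ultimately show ?thesis using connectedin_continuous_map_image by blast
qed

lemma openin_compl_image:
  assumes "compact S" "continuous_on S (\<lambda>z. stereo (\<psi> z))"
  shows "openin riemann_sphere (- \<psi> ` S)"
proof -
  have "closed (stereo ` \<psi> ` S)"
    using compact_continuous_image[OF assms(2,1)] by (simp add: image_image compact_imp_closed)
  moreover have "- \<psi> ` S = stereo -` (- (stereo ` \<psi> ` S))"
    by (simp add: set_eq_iff inj_image_mem_iff[OF inj_stereo])
  ultimately show ?thesis unfolding openin_riemann_sphere_stereo by blast
qed

lemma small_connected_nbhd:
  assumes "e > 0"
  obtains A d where "connectedin riemann_sphere A" "x \<in> A" "A \<subseteq> {y. chordal x y < e}" "d > 0" "{y. chordal x y < d} \<subseteq> A"
proof -
  obtain b t where bt: "flip b x = Some t" using flip_chart by blast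
  then have x: "x = flip b (Some t)" by (metis flip_flip)
  obtain d where d: "d > 0" "\<And>y. chordal (flip b (Some t)) y < d \<Longrightarrow> \<exists>u\<in>ball t (e / 2). y = flip b (Some u)"
    using chart_nbhd_any half_gt_zero[OF assms] by metis
  define A where "A = (\<lambda>u. flip b (Some u)) ` ball t (e / 2)"
  show ?thesis
  proof (rule that[of A d])
    show "connectedin riemann_sphere A"
      unfolding A_def by (rule connectedin_image[OF connected_ball continuous_on_stereo_flip])
    show "x \<in> A" using assms by (auto simp: A_def x)
    show "A \<subseteq> {y. chordal x y < e}"
    proof
      fix y assume "y \<in> A"
      then obtain u where "y = flip b (Some u)" "u \<in> ball t (e / 2)" by (auto simp: A_def)
      then show "y \<in> {y. chordal x y < e}" using chordal_flip_Some_le[of b t u] by (simp add: x dist_norm)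
    qed
    show "{y. chordal x y < d} \<subseteq> A" using d(2) by (auto simp: A_def x)
  qed (rule d)
qed

lemma connectedin_split:
  assumes "connectedin riemann_sphere S" "openin riemann_sphere A" "openin riemann_sphere B"
    "S \<subseteq> A \<union> B" "A \<inter> B \<inter> S = {}" "S \<inter> A \<noteq> {}"
  shows "S \<subseteq> A"
  using assms unfolding connectedin by blast

lemma natural_extension_iter:
  assumes "z \<in> natural_extension f"
  shows "(f ^^ n) (z (m + n)) = z m"
proof (induction n arbitrary: m)
  case (Suc n)
  have "(f ^^ Suc n) (z (m + Suc n)) = f ((f ^^ n) (z (Suc m + n)))" by simp
  also have "\<dots> = f (z (Suc m))" using Suc by metis
  finally show ?case using assms by (simp add: natural_extension_def)
qed simp

lemma natural_extension_eqI:
  assumes v: "v \<in> natural_extension f" and v': "v' \<in> natural_extension f" and eq: "\<And>n. n \<ge> N \<Longrightarrow> v n = v' n"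
  shows "v = v'"
proof
  fix n
  have "v n = (f ^^ N) (v (n + N))" "v' n = (f ^^ N) (v' (n + N))"
    using natural_extension_iter v v' by metis+
  then show "v n = v' n" using eq[of "n + N"] by simp
qed

lemma K_hat_natural_extension: "\<psi> \<in> K_hat f \<Longrightarrow> (\<lambda>n. \<psi> n w) \<in> natural_extension f"
  using K_hat_step by (auto simp: natural_extension_def)

lemma pullback_maximal:
  assumes "connectedin riemann_sphere A" "A \<subseteq> (f ^^ n) -` U" "A \<inter> pullback f z U n \<noteq> {}"
  shows "A \<subseteq> pullback f z U n"
proof -
  obtain x where x: "x \<in> A" "x \<in> pullback f z U n" using assms(3) by blast
  have "connectedin (subtopology riemann_sphere ((f ^^ n) -` U)) A" using assms(1,2) by (simp add: connectedin_subtopology)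
  then have "A \<subseteq> connected_component_of_set (subtopology riemann_sphere ((f ^^ n) -` U)) x"
    using x(1) by (rule connected_component_of_maximal)
  also have "\<dots> = pullback f z U n"
    using x(2) unfolding pullback_def by (simp add: connected_component_of_equiv)
  finally show ?thesis .
qed

lemma pullback_cong:
  assumes "v n \<in> pullback f z U n"
  shows "pullback f v U n = pullback f z U n"
  using assms unfolding pullback_def by (simp add: connected_component_of_equiv)

lemma pullback_connected: "connectedin riemann_sphere (pullback f z U n)"
proof -
  have "connectedin (subtopology riemann_sphere ((f ^^ n) -` U)) (pullback f z U n)"
    unfolding pullback_def by (rule connectedin_connected_component_of)
  then show ?thesis by (simp add: connectedin_subtopology)
qed

lemma pullback_subset: "pullback f z U n \<subseteq> (f ^^ n) -` U"
proof -
  have "pullback f z U n \<subseteq> topspace (subtopology riemann_sphere ((f ^^ n) -` U))"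
    unfolding pullback_def by (rule connected_component_of_subset_topspace)
  then show ?thesis by simp
qed

lemma pullback_base:
  assumes "z \<in> natural_extension f" "z 0 \<in> U"
  shows "z n \<in> pullback f z U n"
  using natural_extension_iter[OF assms(1), of n 0] assms(2)
  by (simp add: pullback_def connected_component_of_refl)

lemma pullback_mono:
  assumes "z \<in> natural_extension f" "z 0 \<in> U'" "U' \<subseteq> U"
  shows "pullback f z U' n \<subseteq> pullback f z U n"
proof (rule pullback_maximal[OF pullback_connected])
  show "pullback f z U' n \<subseteq> (f ^^ n) -` U" using pullback_subset assms(3) by blast
  have "z n \<in> pullback f z U' n" "z n \<in> pullback f z U n"
    using pullback_base[OF assms(1)] assms(2,3) by blast+
  then show "pullback f z U' n \<inter> pullback f z U n \<noteq> {}" by blast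
qed

lemma regular_nbhd_subset:
  assumes z: "z \<in> natural_extension f" and U: "univalent_from f z U N" and U': "z 0 \<in> U'" "U' \<subseteq> U"
  shows "univalent_from f z U' N"
  using U pullback_mono[OF z U'] unfolding univalent_from_def by (meson inj_on_subset)

text \<open>Beyond depth \<open>N\<close> the coordinates are determined one after another by
  injectivity of \<open>f\<close> on the pull-backs, below it by applying \<open>f\<close>.\<close>

lemma plaque_eqI:
  assumes uni: "univalent_from f z U N" and v: "v \<in> plaque f z U" "v' \<in> plaque f z U" and eq: "v N = v' N"
  shows "v = v'"
proof -
  have nv: "v \<in> natural_extension f" "v' \<in> natural_extension f" using v by (auto simp: plaque_def)
  have "v (N + i) = v' (N + i)" for i
  proof (induction i)
    case (Suc i)
    have "f (v (N + Suc i)) = f (v' (N + Suc i))" using nv Suc by (simp add: natural_extension_def)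
    moreover have "inj_on f (pullback f z U (Suc (N + i)))" using uni by (simp add: univalent_from_def)
    moreover have "v (N + Suc i) \<in> pullback f z U (Suc (N + i))" "v' (N + Suc i) \<in> pullback f z U (Suc (N + i))"
      using v by (auto simp: plaque_def)
    ultimately show ?case by (auto simp: inj_on_def)
  qed (use eq in simp)
  then show ?thesis using natural_extension_eqI[OF nv, of N] by (metis le_add_diff_inverse)
qed

context sphere_map
begin

lemma f_image_pullback_subset:
  assumes "z \<in> natural_extension f" "z 0 \<in> U"
  shows "f ` pullback f z U (Suc n) \<subseteq> pullback f z U n"
proof (rule pullback_maximal)
  show "connectedin riemann_sphere (f ` pullback f z U (Suc n))"
    by (rule connectedin_continuous_map_image[OF scont_continuous_map[OF hmap_scont[OF hmap_f]] pullback_connected])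
  show "f ` pullback f z U (Suc n) \<subseteq> (f ^^ n) -` U"
    using pullback_subset[of f z U "Suc n"] by (auto simp: funpow_Suc_right simp del: funpow.simps)
  have "f (z (Suc n)) = z n" using assms(1) by (simp add: natural_extension_def)
  then show "f ` pullback f z U (Suc n) \<inter> pullback f z U n \<noteq> {}"
    using pullback_base[OF assms] by (metis Int_iff empty_iff image_eqI)
qed

lemma open_vimage_iter:
  assumes "openin riemann_sphere U" "(f ^^ n) x \<in> U"
  obtains e where "e > 0" "\<And>y. chordal x y < e \<Longrightarrow> (f ^^ n) y \<in> U"
proof -
  obtain e where "e > 0" "\<And>y. chordal ((f ^^ n) x) y < e \<Longrightarrow> y \<in> U"
    using assms unfolding openin_riemann_sphere by metis
  moreover obtain d where "d > 0" "\<And>y. chordal x y < d \<Longrightarrow> chordal ((f ^^ n) x) ((f ^^ n) y) < e"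
    using scont_iter \<open>e > 0\<close> unfolding scont_def by metis
  ultimately show ?thesis using that by blast
qed

text \<open>The radius \<open>e\<close> depends on neither \<open>y\<close> nor \<open>z\<close>,
  and \<open>x\<close> itself need not lie in the pull-back: a point over \<open>U\<close> that is
  approached by the pull-back is absorbed by it. This yields openness and relative closedness of
  pull-backs alike.\<close>

lemma pullback_nbhd:
  assumes U: "openin riemann_sphere U" and x: "(f ^^ n) x \<in> U"
  obtains e where "e > 0" "\<And>y z. chordal x y < e \<Longrightarrow> y \<in> pullback f z U n \<Longrightarrow> {y. chordal x y < e} \<subseteq> pullback f z U n"
proof -
  obtain e where e: "e > 0" "\<And>y. chordal x y < e \<Longrightarrow> (f ^^ n) y \<in> U" using open_vimage_iter[OF U x] by metis
  obtain A d where A: "connectedin riemann_sphere A" "x \<in> A" "A \<subseteq> {y. chordal x y < e}" "d > 0" "{y. chordal x y < d} \<subseteq> A"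
    using small_connected_nbhd[OF e(1), of x] by metis
  show ?thesis
  proof (rule that[OF A(4)])
    fix y z assume y: "chordal x y < d" "y \<in> pullback f z U n"
    have "A \<subseteq> pullback f z U n"
      by (rule pullback_maximal[OF A(1)]) (use A(3,5) e(2) y in auto)
    then show "{y. chordal x y < d} \<subseteq> pullback f z U n" using A(5) by blast
  qed
qed

lemma openin_pullback:
  assumes U: "openin riemann_sphere U"
  shows "openin riemann_sphere (pullback f z U n)"
  unfolding openin_riemann_sphere
proof
  fix x assume x: "x \<in> pullback f z U n"
  then have "(f ^^ n) x \<in> U" using pullback_subset by blast
  then obtain e where e: "e > 0" "\<And>y z. chordal x y < e \<Longrightarrow> y \<in> pullback f z U n \<Longrightarrow> {y. chordal x y < e} \<subseteq> pullback f z U n"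
    using pullback_nbhd[OF U] by metis
  have "{y. chordal x y < e} \<subseteq> pullback f z U n" using e(2)[of x z] x e(1) by simp
  then show "\<exists>e>0. \<forall>y. chordal x y < e \<longrightarrow> y \<in> pullback f z U n" using e(1) by blast
qed

text \<open>The image of a pull-back is open by the open mapping property, and relatively closed in
  the next shallower pull-back by compactness of the sphere; connectedness does the rest.\<close>

lemma f_image_pullback:
  assumes z: "z \<in> natural_extension f" "z 0 \<in> U" and U: "openin riemann_sphere U"
  shows "f ` pullback f z U (Suc n) = pullback f z U n"
proof
  let ?Q = "pullback f z U n" and ?T = "f ` pullback f z U (Suc n)"
  show TQ: "?T \<subseteq> ?Q" by (rule f_image_pullback_subset[OF z])
  have oQ: "openin riemann_sphere ?Q" by (rule openin_pullback[OF U])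
  have "openin riemann_sphere ?T"
    unfolding openin_riemann_sphere
  proof
    fix y assume "y \<in> ?T"
    then obtain x where x: "x \<in> pullback f z U (Suc n)" "y = f x" by blast
    obtain e where e: "e > 0" "\<And>x'. chordal x x' < e \<Longrightarrow> x' \<in> pullback f z U (Suc n)"
      using openin_pullback[OF U] x(1) unfolding openin_riemann_sphere by metis
    obtain d where "d > 0" "\<And>y. chordal ((f ^^ 1) x) y < d \<Longrightarrow> \<exists>x'. chordal x x' < e \<and> (f ^^ 1) x' = y"
      using iter_open[OF e(1)] by metis
    then show "\<exists>d>0. \<forall>y'. chordal y y' < d \<longrightarrow> y' \<in> ?T" using e(2) x(2) by (intro exI[of _ d]) auto
  qed
  moreover have "openin riemann_sphere (?Q - ?T)"
    unfolding openin_riemann_sphere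
  proof
    fix y assume y: "y \<in> ?Q - ?T"
    \<comment> \<open>A value \<open>y\<close> approached by the image has a preimage
      \<open>l\<close> that is a limit of points of the pull-back, and \<open>pullback_nbhd\<close>
      puts \<open>l\<close> inside it.\<close>
    have "\<exists>d>0. \<forall>x\<in>pullback f z U (Suc n). chordal y (f x) \<ge> d"
    proof (rule ccontr)
      assume "\<not> ?thesis"
      then have no: "\<And>d. d > 0 \<Longrightarrow> \<exists>x\<in>pullback f z U (Suc n). chordal y (f x) < d" by (meson not_le)
      have "\<exists>x\<in>pullback f z U (Suc n). chordal y (f x) < 1 / real (Suc j)" for j by (rule no) simp
      then obtain x where x: "\<And>j. x j \<in> pullback f z U (Suc n)" "\<And>j. chordal y (f (x j)) < 1 / real (Suc j)" by metis
      obtain r l where r: "strict_mono (r :: nat \<Rightarrow> nat)" "\<And>e. e > 0 \<Longrightarrow> \<exists>N. \<forall>n\<ge>N. chordal (x (r n)) l < e"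
        using chordal_compact by blast
      have fl: "f l = y"
      proof (rule ccontr)
        assume ne: "f l \<noteq> y"
        define e where "e = chordal (f l) y / 2"
        have e: "e > 0" using ne by (simp add: e_def chordal_pos_iff)
        obtain d where d: "d > 0" "\<And>y. chordal l y < d \<Longrightarrow> chordal (f l) (f y) < e"
          using hmap_scont[OF hmap_f] e unfolding scont_def by metis
        obtain N where N: "\<And>n. n \<ge> N \<Longrightarrow> chordal (x (r n)) l < d" using r(2) d by blast
        obtain M where M: "1 / real (Suc M) < e" using e by (meson nat_approx_posE)
        define m where "m = max N M"
        have "1 / real (Suc (r m)) \<le> 1 / real (Suc M)"
          using seq_suble[OF r(1), of m] by (intro divide_left_mono) (auto simp: m_def)
        then have "chordal y (f (x (r m))) < e" using x(2)[of "r m"] M by linarith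
        moreover have "chordal (f l) (f (x (r m))) < e" using N[of m] by (intro d) (simp add: m_def chordal_commute)
        ultimately show False using chordal_triangle[of "f l" y "f (x (r m))"] by (simp add: e_def chordal_commute)
      qed
      have "(f ^^ n) y \<in> U" using y pullback_subset by blast
      then have "(f ^^ Suc n) l \<in> U" using fl by (simp add: funpow_swap1)
      then obtain e where e: "e > 0" "\<And>y z. chordal l y < e \<Longrightarrow> y \<in> pullback f z U (Suc n) \<Longrightarrow> {y. chordal l y < e} \<subseteq> pullback f z U (Suc n)"
        using pullback_nbhd[OF U, of "Suc n"] by metis
      obtain N where "chordal (x (r N)) l < e" using r(2)[OF e(1)] by blast
      then have "{y. chordal l y < e} \<subseteq> pullback f z U (Suc n)" using e(2)[of "x (r N)" z] x(1) by (simp add: chordal_commute)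
      then have "l \<in> pullback f z U (Suc n)" using e(1) by auto
      then show False using y fl by blast
    qed
    then obtain d where d: "d > 0" "\<And>x. x \<in> pullback f z U (Suc n) \<Longrightarrow> chordal y (f x) \<ge> d" by blast
    obtain e where e: "e > 0" "\<And>y'. chordal y y' < e \<Longrightarrow> y' \<in> ?Q" using oQ y unfolding openin_riemann_sphere by (metis DiffD1)
    show "\<exists>e>0. \<forall>y'. chordal y y' < e \<longrightarrow> y' \<in> ?Q - ?T"
      using d e by (intro exI[of _ "min d e"]) force
  qed
  ultimately show "?Q \<subseteq> ?T"
  proof (intro connectedin_split[OF pullback_connected, of ?T "?Q - ?T"])
    have "z (Suc n) \<in> pullback f z U (Suc n)" "z n \<in> ?Q" using pullback_base[OF z] by auto
    moreover have "f (z (Suc n)) = z n" using z(1) by (simp add: natural_extension_def)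
    ultimately show "?Q \<inter> ?T \<noteq> {}" by (metis Int_iff empty_iff image_eqI)
  qed auto
qed

text \<open>Around \<open>z N\<close> there is a small circle on which \<open>f ^^ N\<close> avoids
  \<open>z 0\<close>. Removing the image of this circle from \<open>U\<close> prevents the connected
  pull-back from leaving the disc.\<close>

lemma pullback_small:
  assumes z: "z \<in> natural_extension f" and U: "openin riemann_sphere U" "z 0 \<in> U" and e: "e > 0"
  obtains U' where "openin riemann_sphere U'" "z 0 \<in> U'" "U' \<subseteq> U" "pullback f z U' N \<subseteq> {y. chordal (z N) y < e}"
proof -
  obtain b t where bt: "flip b (z N) = Some t" using flip_chart by blast
  then have zN: "z N = flip b (Some t)" by (metis flip_flip)
  let ?g = "\<lambda>u. flip b (Some u)"
  have "\<not> t islimpt {u. (f ^^ N) (flip b (Some u)) = z 0}" using iter_not_const by blast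
  then obtain s0 where s0: "s0 > 0" "\<And>u. u \<noteq> t \<Longrightarrow> dist u t < s0 \<Longrightarrow> (f ^^ N) (flip b (Some u)) \<noteq> z 0"
    unfolding islimpt_approachable by blast
  define s where "s = min (s0 / 2) (e / 2)"
  have s: "s > 0" "s < s0" "2 * s \<le> e" using s0 e by (auto simp: s_def)
  have cont: "continuous_on S (\<lambda>u. stereo ((f ^^ N) (?g u)))" for S
    using shol_continuous_on[OF shol_iter[OF shol_flip_Some]] continuous_on_subset subset_UNIV by metis
  have "openin riemann_sphere (- (\<lambda>u. (f ^^ N) (?g u)) ` sphere t s)"
    by (rule openin_compl_image[OF _ cont]) simp
  moreover have "z 0 \<in> - (\<lambda>u. (f ^^ N) (?g u)) ` sphere t s" using s0(2) s by (force simp: dist_commute)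
  moreover define U' where "U' = U \<inter> - (\<lambda>u. (f ^^ N) (?g u)) ` sphere t s"
  ultimately have U': "openin riemann_sphere U'" "z 0 \<in> U'" using U by auto
  have "pullback f z U' N \<subseteq> ?g ` ball t s"
  proof (rule connectedin_split[OF pullback_connected, of _ "- ?g ` cball t s"])
    show "openin riemann_sphere (?g ` ball t s)"
      unfolding openin_riemann_sphere
    proof
      fix x assume "x \<in> ?g ` ball t s"
      then obtain u where u: "u \<in> ball t s" "x = ?g u" by blast
      then have "s - dist t u > 0" by simp
      then obtain d where d: "d > 0" "\<And>y. chordal (flip b (Some u)) y < d \<Longrightarrow> \<exists>v\<in>ball u (s - dist t u). y = flip b (Some v)"
        using chart_nbhd_any by metis
      have "ball u (s - dist t u) \<subseteq> ball t s"
      proof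
        fix v assume "v \<in> ball u (s - dist t u)"
        then show "v \<in> ball t s" using dist_triangle[of t v u] by simp
      qed
      then show "\<exists>d>0. \<forall>y. chordal x y < d \<longrightarrow> y \<in> ?g ` ball t s" using d u(2) by blast
    qed
    show "openin riemann_sphere (- ?g ` cball t s)"
      by (rule openin_compl_image[OF compact_cball continuous_on_stereo_flip])
    show "pullback f z U' N \<subseteq> ?g ` ball t s \<union> - ?g ` cball t s"
    proof
      fix y assume y: "y \<in> pullback f z U' N"
      then have "(f ^^ N) y \<in> U'" using pullback_subset by blast
      then have "y \<notin> ?g ` sphere t s" by (auto simp: U'_def)
      moreover have "cball t s = ball t s \<union> sphere t s" by auto
      ultimately show "y \<in> ?g ` ball t s \<union> - ?g ` cball t s" by auto
    qed
    show "?g ` ball t s \<inter> - ?g ` cball t s \<inter> pullback f z U' N = {}" by auto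
    have "z N \<in> pullback f z U' N" by (rule pullback_base[OF z U'(2)])
    moreover have "z N \<in> ?g ` ball t s" using s(1) zN by auto
    ultimately show "pullback f z U' N \<inter> ?g ` ball t s \<noteq> {}" by blast
  qed
  also have "\<dots> \<subseteq> {y. chordal (z N) y < e}"
  proof (intro image_subsetI CollectI)
    fix u assume "u \<in> ball t s"
    then show "chordal (z N) (?g u) < e" using chordal_flip_Some_le[of b t u] s(3) by (simp add: zN dist_norm)
  qed
  finally show ?thesis using that[OF U'] by (simp add: U'_def)
qed

text \<open>Once the deep components are injective on a ball, \<open>U\<close> is chosen so small
  that the pull-back of depth \<open>N\<close> lies in the image of a smaller disc. Deeper
  pull-backs cannot cross the image of the bounding circle: iterating \<open>f\<close> down to depth
  \<open>N\<close> would give a point of the circle and an interior point the same image under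
  \<open>\<psi> N\<close>.\<close>

lemma plaque_in_image:
  assumes exp: "expansive f" and \<psi>: "\<psi> \<in> K_hat f" and inj: "inj (\<lambda>w n. \<psi> n w)" and r: "r > 0"
  obtains U where "regular_nbhd f (\<lambda>n. \<psi> n w) U" "plaque f (\<lambda>n. \<psi> n w) U \<subseteq> (\<lambda>u n. \<psi> n u) ` ball w r"
proof -
  define z where "z = (\<lambda>n. \<psi> n w)"
  have z: "z \<in> natural_extension f" unfolding z_def by (rule K_hat_natural_extension[OF \<psi>])
  define R where "R = cmod w + r"
  define s where "s = r / 2"
  have s: "s > 0" "s < r" using r by (auto simp: s_def)
  have sub: "cball w s \<subseteq> ball 0 R"
  proof
    fix u assume "u \<in> cball w s"
    then show "u \<in> ball 0 R" using norm_triangle_sub[of u w] s by (simp add: R_def dist_norm norm_minus_commute)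
  qed
  obtain N where N0: "\<And>n. n \<ge> N \<Longrightarrow> inj_on (\<psi> n) (ball 0 R)" using K_hat_eventually_inj[OF exp \<psi> inj] by metis
  have N: "u = v" if "n \<ge> N" "\<psi> n u = \<psi> n v" "u \<in> cball w s" "v \<in> cball w s" for n u v
  proof -
    have "u \<in> ball 0 R" "v \<in> ball 0 R" using that sub by blast+
    then show ?thesis using N0[OF that(1)] that(2) by (simp add: inj_on_def)
  qed
  have sh: "shol (\<psi> n) S" for n S using K_hat_shol[OF \<psi>] shol_subset subset_UNIV by metis
  have opn: "openin riemann_sphere (\<psi> n ` ball w s)" for n
    unfolding openin_riemann_sphere
  proof
    fix x assume "x \<in> \<psi> n ` ball w s"
    then obtain u where u: "u \<in> ball w s" "x = \<psi> n u" by blast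
    then obtain \<rho> where \<rho>: "\<rho> > 0" "ball u \<rho> \<subseteq> ball w s" using open_ball openE by metis
    obtain u0 where u0: "u0 \<in> ball u \<rho>" "\<psi> n u0 \<noteq> \<psi> n u" using K_hat_not_const_ball[OF \<psi> \<rho>(1)] by metis
    obtain e where "e > 0" "\<And>y. chordal (\<psi> n u) y < e \<Longrightarrow> \<exists>v\<in>ball u \<rho>. \<psi> n v = y"
      by (rule shol_open_map[OF sh \<rho>(1) u0]) (rule that)
    then show "\<exists>e>0. \<forall>y. chordal x y < e \<longrightarrow> y \<in> \<psi> n ` ball w s" using \<rho>(2) u(2) by blast
  qed
  have zin: "z n \<in> \<psi> n ` ball w s" for n using s by (auto simp: z_def)
  obtain e where e: "e > 0" "\<And>y. chordal (z N) y < e \<Longrightarrow> y \<in> \<psi> N ` ball w s"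
    using opn[of N] zin[of N] unfolding openin_riemann_sphere by metis
  have oU: "openin riemann_sphere UNIV" using openin_topspace[of riemann_sphere] by simp
  then obtain U where U: "openin riemann_sphere U" "z 0 \<in> U" "pullback f z U N \<subseteq> {y. chordal (z N) y < e}"
    using pullback_small[OF z oU UNIV_I e(1), of N] by metis
  have iterQ: "(f ^^ i) ` pullback f z U (n + i) \<subseteq> pullback f z U n" for n i
  proof (induction i arbitrary: n)
    case (Suc i)
    have "(f ^^ Suc i) ` pullback f z U (n + Suc i) = f ` (f ^^ i) ` pullback f z U (Suc n + i)"
      by (simp add: image_image)
    also have "\<dots> \<subseteq> f ` pullback f z U (Suc n)" using Suc by (intro image_mono)
    also have "\<dots> \<subseteq> pullback f z U n" by (rule f_image_pullback_subset[OF z U(2)])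
    finally show ?case .
  qed simp
  have Q: "pullback f z U n \<subseteq> \<psi> n ` ball w s" if n: "n \<ge> N" for n
  proof (rule connectedin_split[OF pullback_connected opn, where B = "- \<psi> n ` cball w s"])
    show "openin riemann_sphere (- \<psi> n ` cball w s)"
      by (rule openin_compl_image[OF compact_cball shol_continuous_on[OF sh]])
    show "\<psi> n ` ball w s \<inter> - \<psi> n ` cball w s \<inter> pullback f z U n = {}" by auto
    show "pullback f z U n \<inter> \<psi> n ` ball w s \<noteq> {}" using zin pullback_base[OF z U(2)] by blast
    show "pullback f z U n \<subseteq> \<psi> n ` ball w s \<union> - \<psi> n ` cball w s"
    proof
      fix x assume x: "x \<in> pullback f z U n"
      show "x \<in> \<psi> n ` ball w s \<union> - \<psi> n ` cball w s"
      proof (cases "x \<in> \<psi> n ` cball w s")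
        case True
        then obtain u where u: "u \<in> cball w s" "x = \<psi> n u" by blast
        have "(f ^^ (n - N)) x \<in> pullback f z U N" using iterQ[of "n - N" N] n x by auto
        then have "(f ^^ (n - N)) x \<in> \<psi> N ` ball w s" using U(3) e(2) by blast
        moreover have "(f ^^ (n - N)) x = \<psi> N u" using K_hat_iter[OF \<psi>, of "n - N" N u] n u(2) by simp
        ultimately obtain u' where "u' \<in> ball w s" "\<psi> N u = \<psi> N u'" by auto
        then have "u \<in> ball w s" using N[of N u u'] u(1) by auto
        then show ?thesis using u(2) by blast
      qed simp
    qed
  qed
  \<comment> \<open>Parametrised by \<open>\<psi> (Suc n)\<close>, the map \<open>f\<close> on the
    pull-back becomes \<open>\<psi> n\<close>, which is injective on the disc.\<close>
  have uni: "univalent_from f z U N"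
    unfolding univalent_from_def
  proof (intro allI impI inj_onI)
    fix n x x' assume n: "N \<le> n" and x: "x \<in> pullback f z U (Suc n)" "x' \<in> pullback f z U (Suc n)" and eq: "f x = f x'"
    have "x \<in> \<psi> (Suc n) ` ball w s" "x' \<in> \<psi> (Suc n) ` ball w s" using Q[of "Suc n"] n x by auto
    then obtain u u' where u: "u \<in> ball w s" "x = \<psi> (Suc n) u" "u' \<in> ball w s" "x' = \<psi> (Suc n) u'" by blast
    then have "\<psi> n u = \<psi> n u'" using eq K_hat_step[OF \<psi>] by metis
    then have "u = u'" by (rule N[OF n]) (use u in auto)
    then show "x = x'" using u by simp
  qed
  have "plaque f z U \<subseteq> (\<lambda>u n. \<psi> n u) ` ball w r"
  proof
    fix v assume v: "v \<in> plaque f z U"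
    then have vn: "v \<in> natural_extension f" "\<And>n. v n \<in> pullback f z U n" by (auto simp: plaque_def)
    then have "v N \<in> \<psi> N ` ball w s" using Q by blast
    then obtain u where u: "u \<in> ball w s" "v N = \<psi> N u" by blast
    have "v (N + i) = \<psi> (N + i) u" for i
    proof (induction i)
      case (Suc i)
      have "v (N + Suc i) \<in> \<psi> (N + Suc i) ` ball w s" using Q[of "N + Suc i"] vn(2) by auto
      then obtain u' where u': "u' \<in> ball w s" "v (N + Suc i) = \<psi> (N + Suc i) u'" by blast
      have "\<psi> (N + i) u' = f (v (N + Suc i))" using u'(2) K_hat_step[OF \<psi>] by simp
      also have "\<dots> = \<psi> (N + i) u" using vn(1) Suc by (simp add: natural_extension_def)
      finally have "u' = u" using N[of "N + i" u' u] u u' by auto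
      then show ?case using u' by simp
    qed (use u in simp)
    then have "v = (\<lambda>n. \<psi> n u)"
      by (intro natural_extension_eqI[OF vn(1) K_hat_natural_extension[OF \<psi>], of N]) (metis le_add_diff_inverse)
    then show "v \<in> (\<lambda>u n. \<psi> n u) ` ball w r" using u(1) s by auto
  qed
  moreover have "regular_nbhd f z U" using U uni by (auto simp: regular_nbhd_def)
  ultimately show ?thesis using that unfolding z_def by blast
qed

end

text \<open>Along a connected parameter set the pull-backs cannot be left as long as coordinate 0
  stays in \<open>U\<close>. The parameter space is general because the lemma serves discs in the
  plane as well as paths of regular points.\<close>

lemma plaque_image:
  fixes \<Phi> :: "'a::topological_space \<Rightarrow> nat \<Rightarrow> csphere"
  assumes S: "connected S" and cont: "\<And>n. continuous_on S (\<lambda>s. stereo (\<Phi> s n))"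
    and ne: "\<And>s. s \<in> S \<Longrightarrow> \<Phi> s \<in> natural_extension f" and U: "\<And>s. s \<in> S \<Longrightarrow> \<Phi> s 0 \<in> U"
    and s0: "s0 \<in> S" "\<Phi> s0 \<in> plaque f z U"
  shows "\<Phi> ` S \<subseteq> plaque f z U"
proof -
  have "(\<lambda>s. \<Phi> s n) ` S \<subseteq> pullback f z U n" for n
  proof (rule pullback_maximal)
    show "connectedin riemann_sphere ((\<lambda>s. \<Phi> s n) ` S)" by (rule connectedin_image[OF S cont])
    show "(\<lambda>s. \<Phi> s n) ` S \<subseteq> (f ^^ n) -` U" using natural_extension_iter[OF ne, of _ n 0] U by auto
    have "\<Phi> s0 n \<in> pullback f z U n" using s0(2) by (auto simp: plaque_def)
    then show "(\<lambda>s. \<Phi> s n) ` S \<inter> pullback f z U n \<noteq> {}" using s0(1) by blast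
  qed
  then show ?thesis using ne by (auto simp: plaque_def)
qed

lemma open_vimage_plaque:
  assumes \<psi>: "\<psi> \<in> K_hat f" and U: "openin riemann_sphere U"
  shows "open ((\<lambda>w n. \<psi> n w) -` plaque f z U)"
proof (subst open_subopen, intro ballI)
  fix w assume "w \<in> (\<lambda>w n. \<psi> n w) -` plaque f z U"
  then have w: "(\<lambda>n. \<psi> n w) \<in> plaque f z U" by simp
  then have "\<psi> 0 w \<in> U" using pullback_subset[of f z U 0] by (auto simp: plaque_def)
  then obtain e where e: "e > 0" "\<And>y. chordal (\<psi> 0 w) y < e \<Longrightarrow> y \<in> U" using U(1) unfolding openin_riemann_sphere by metis
  obtain r where r: "r > 0" "\<And>u. dist w u < r \<Longrightarrow> chordal (\<psi> 0 w) (\<psi> 0 u) < e"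
    using shol_near[OF K_hat_shol[OF \<psi>] UNIV_I e(1)] by metis
  have "(\<lambda>w n. \<psi> n w) ` ball w r \<subseteq> plaque f z U"
    by (rule plaque_image[where ?s0.0 = w])
      (use e(2) r w K_hat_natural_extension[OF \<psi>] shol_continuous_on[OF shol_subset[OF K_hat_shol[OF \<psi>]]] in auto)
  then show "\<exists>T. open T \<and> w \<in> T \<and> T \<subseteq> (\<lambda>w n. \<psi> n w) -` plaque f z U"
    using r(1) by (intro exI[of _ "ball w r"]) auto
qed

section \<open>Inverse branches and the plaques covered by an injective element\<close>

lemma deriv_shrink_image:
  assumes "k holomorphic_on ball w r" "r > 0" "open V" "k w \<in> V"
  obtains d where "d > 0" "d \<le> r" "\<And>u. u \<in> ball w d \<Longrightarrow> k u \<in> V"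
proof -
  have "isCont k w" using assms(1,2) by (metis centre_in_ball continuous_on_eq_continuous_at holomorphic_on_imp_continuous_on open_ball)
  moreover obtain e where e: "e > 0" "ball (k w) e \<subseteq> V" using assms(3,4) openE by blast
  ultimately obtain d where d: "d > 0" "\<And>u. dist u w < d \<Longrightarrow> dist (k u) (k w) < e"
    unfolding continuous_at_eps_delta by metis
  show ?thesis
  proof (rule that[of "min d r"])
    fix u assume "u \<in> ball w (min d r)"
    then have "k u \<in> ball (k w) e" using d(2)[of u] by (simp add: dist_commute)
    then show "k u \<in> V" using e(2) by blast
  qed (use d assms in auto)
qed

context sphere_map
begin

text \<open>In charts this is the holomorphic inverse of an injective function; openness of
  \<open>Q\<close> leaves room for a disc around each point.\<close>

lemma inverse_branch_shol:
  assumes Q: "openin riemann_sphere Q" "inj_on f Q" and g: "shol g S" "open S" "g ` S \<subseteq> f ` Q"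
  shows "shol (\<lambda>t. inv_into Q f (g t)) S"
proof -
  have "\<exists>d>0. shol (\<lambda>t. inv_into Q f (g t)) (ball t1 d)" if t1: "t1 \<in> S" for t1
  proof -
    define x1 where "x1 = inv_into Q f (g t1)"
    have gt1: "g t1 \<in> f ` Q" using g(3) t1 by blast
    have x1: "x1 \<in> Q" "f x1 = g t1" unfolding x1_def using inv_into_into[OF gt1] f_inv_into_f[OF gt1] by auto
    obtain b a where ba: "flip b x1 = Some a" using flip_chart by blast
    then have x1a: "x1 = flip b (Some a)" by (metis flip_flip)
    obtain b' c0 where bc: "flip b' (g t1) = Some c0" using flip_chart by blast
    obtain r h where r: "r > 0" "h holomorphic_on ball a r" and h: "\<And>u. u \<in> ball a r \<Longrightarrow> flip b' (f (flip b (Some u))) = Some (h u)"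
      using shol_chartE[OF hmapD[OF hmap_f shol_flip_Some, of b], of a b'] bc x1 x1a by (metis UNIV_I option.distinct(1))
    obtain e where e: "e > 0" "\<And>y. chordal x1 y < e \<Longrightarrow> y \<in> Q" using Q(1) x1(1) unfolding openin_riemann_sphere by metis
    define r' where "r' = min r (e / 2)"
    have r': "r' > 0" "ball a r' \<subseteq> ball a r" using r e by (auto simp: r'_def)
    have inQ: "flip b (Some u) \<in> Q" if "u \<in> ball a r'" for u
      using e(2) chordal_flip_Some_le[of b a u] that by (simp add: x1a r'_def dist_norm)
    have injh: "inj_on h (ball a r')"
    proof (rule inj_onI)
      fix u v assume uv: "u \<in> ball a r'" "v \<in> ball a r'" "h u = h v"
      have "u \<in> ball a r" "v \<in> ball a r" using uv r'(2) by blast+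
      then have "flip b' (f (flip b (Some u))) = flip b' (f (flip b (Some v)))" using h uv(3) by simp
      then have "f (flip b (Some u)) = f (flip b (Some v))" by simp
      then have "flip b (Some u) = flip b (Some v)" using Q(2) inQ uv(1,2) by (meson inj_onD)
      then show "u = v" by simp
    qed
    have hol: "h holomorphic_on ball a r'" using r(2) r'(2) by (rule holomorphic_on_subset)
    obtain k where k: "k holomorphic_on (h ` ball a r')" "\<And>u. u \<in> ball a r' \<Longrightarrow> k (h u) = u"
      using holomorphic_has_inverse[OF hol open_ball injh] by metis
    have oh: "open (h ` ball a r')" by (rule open_mapping_thm3[OF hol open_ball injh])
    obtain d \<gamma> where d: "d > 0" "\<gamma> holomorphic_on ball t1 d" and \<gamma>: "\<And>t. t \<in> ball t1 d \<Longrightarrow> flip b' (g t) = Some (\<gamma> t)"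
      using shol_chartE[OF g(1) t1, of b'] bc by (metis option.distinct(1))
    have "h a = c0" using h[of a] r(1) bc x1 x1a by simp
    moreover have "\<gamma> t1 = c0" using \<gamma>[of t1] d(1) bc by simp
    ultimately have "\<gamma> t1 \<in> h ` ball a r'" using r'(1) by (metis centre_in_ball image_eqI)
    then obtain d1 where d1: "d1 > 0" "d1 \<le> d" "\<And>t. t \<in> ball t1 d1 \<Longrightarrow> \<gamma> t \<in> h ` ball a r'"
      using deriv_shrink_image[OF d(2,1) oh] by metis
    have "shol (\<lambda>t. inv_into Q f (g t)) (ball t1 d1)"
    proof (rule sholI[of "\<lambda>t. k (\<gamma> t)" _ _ b])
      have "\<gamma> holomorphic_on ball t1 d1" using d(2) d1(2) by (auto elim: holomorphic_on_subset)
      then show "(\<lambda>t. k (\<gamma> t)) holomorphic_on ball t1 d1"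
        by (rule holomorphic_on_compose_gen[OF _ k(1), unfolded o_def]) (use d1(3) in blast)
      fix t assume t: "t \<in> ball t1 d1"
      then obtain u where u: "u \<in> ball a r'" "\<gamma> t = h u" using d1(3) by blast
      have "u \<in> ball a r" "t \<in> ball t1 d" using u(1) r'(2) t d1(2) by auto
      then have "flip b' (f (flip b (Some u))) = flip b' (g t)" using h \<gamma> u(2) by simp
      then have "f (flip b (Some u)) = g t" by simp
      then have "inv_into Q f (g t) = flip b (Some u)" using inQ[OF u(1)] Q(2) by (metis inv_into_f_f)
      then show "inv_into Q f (g t) = flip b (Some (k (\<gamma> t)))" using u k(2) by simp
    qed simp
    then show ?thesis using d1(1) by blast
  qed
  then show ?thesis unfolding shol_def by (metis centre_in_ball)
qed

lemma finite_preimage_cball: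
  assumes "\<psi> \<in> K_hat f"
  shows "finite {u\<in>cball w R. \<psi> n u = c}"
proof (rule ccontr)
  assume inf: "infinite {u\<in>cball w R. \<psi> n u = c}"
  have "\<forall>T. infinite T \<and> T \<subseteq> cball w R \<longrightarrow> (\<exists>x\<in>cball w R. x islimpt T)"
    using compact_cball[of w R] by (simp only: compact_eq_Bolzano_Weierstrass)
  moreover have "{u\<in>cball w R. \<psi> n u = c} \<subseteq> cball w R" by blast
  ultimately obtain x where x: "x islimpt {u\<in>cball w R. \<psi> n u = c}" using inf by meson
  then have "x islimpt {u\<in>UNIV. \<psi> n u = c}" by (rule islimpt_subset) auto
  then have "\<psi> n v = c" for v
    using shol_const_extend[OF K_hat_shol[OF assms] open_UNIV connected_UNIV UNIV_I] by blast
  then show False using K_hat_nonconst[OF assms, of n] by (auto simp: constant_on_def)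
qed

text \<open>If \<open>z\<^sub>-\<^sub>n\<close> is missed by the image under \<open>\<psi> n\<close> of a large ball around \<open>w0\<close>, then the weak Koebe theorem bounds the
  derivative of \<open>\<psi> n\<close> at \<open>w0\<close> by the derivative of the inverse branch of \<open>f\<^sup>n\<close> along \<open>z\<close>. But the quotient of the two
  is independent of \<open>n\<close>, which bounds the radius of the ball. A common omitted value \<open>e\<close>, moved to infinity, makes
  both functions finite.\<close>

lemma branch_point_in_image:
  assumes exp: "expansive f" and \<psi>: "\<psi> \<in> K_hat f" and inj: "inj (\<lambda>w n. \<psi> n w)"
    and z: "z \<in> natural_extension f" and U: "openin riemann_sphere U" "z 0 \<in> U" and uni: "univalent_from f z U N"
  obtains \<delta> where "\<delta> > 0"
    "\<And>w0. (\<lambda>n. \<psi> n w0) \<in> plaque f z U \<Longrightarrow> chordal (z N) (\<psi> N w0) < \<delta> \<Longrightarrow> z \<in> range (\<lambda>w n. \<psi> n w)"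
proof -
  define Q where "Q n = pullback f z U n" for n
  have oQ: "openin riemann_sphere (Q n)" for n unfolding Q_def by (rule openin_pullback[OF U(1)])
  have zQ: "z n \<in> Q n" for n unfolding Q_def by (rule pullback_base[OF z U(2)])
  have injQ: "inj_on f (Q (Suc n))" if "n \<ge> N" for n using uni that by (auto simp: Q_def univalent_from_def)
  have fQ: "f ` Q (Suc n) = Q n" for n unfolding Q_def by (rule f_image_pullback[OF z U(2,1)])
  have fz: "f (z (Suc n)) = z n" for n using z by (simp add: natural_extension_def)
  obtain b t0 where bt: "flip b (z N) = Some t0" using flip_chart by blast
  then have zN: "z N = flip b (Some t0)" by (metis flip_flip)
  obtain eQ where eQ: "eQ > 0" "\<And>y. chordal (z N) y < eQ \<Longrightarrow> y \<in> Q N"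
    using oQ[of N] zQ[of N] unfolding openin_riemann_sphere by metis
  define \<rho> where "\<rho> = eQ / 2"
  have \<rho>: "\<rho> > 0" using eQ by (simp add: \<rho>_def)
  have inQN: "flip b (Some t) \<in> Q N" if "t \<in> ball t0 \<rho>" for t
    using eQ(2) chordal_flip_Some_le[of b t0 t] that by (simp add: zN \<rho>_def dist_norm)
  \<comment> \<open>\<open>G n\<close> is the inverse branch of \<open>f ^^ n\<close> on a disc
    about \<open>z N\<close> that follows the pull-backs along \<open>z\<close>; it lands at depth
    \<open>N + n\<close>.\<close>
  define G where "G = rec_nat (\<lambda>t. flip b (Some t)) (\<lambda>n g t. inv_into (Q (Suc (N + n))) f (g t))"
  have G0: "G 0 = (\<lambda>t. flip b (Some t))" by (simp add: G_def)
  have GS: "G (Suc n) = (\<lambda>t. inv_into (Q (Suc (N + n))) f (G n t))" for n by (simp add: G_def)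
  have G: "shol (G n) (ball t0 \<rho>) \<and> G n ` ball t0 \<rho> \<subseteq> Q (N + n)" for n
  proof (induction n)
    case 0
    then show ?case using inQN shol_subset[OF shol_flip_Some] by (auto simp: G0)
  next
    case (Suc n)
    have sub: "G n ` ball t0 \<rho> \<subseteq> f ` Q (Suc (N + n))" using Suc fQ by simp
    have "shol (G (Suc n)) (ball t0 \<rho>)"
      unfolding GS by (rule inverse_branch_shol[OF oQ injQ _ open_ball sub]) (use Suc in auto)
    moreover have "G (Suc n) ` ball t0 \<rho> \<subseteq> Q (N + Suc n)"
      unfolding GS using sub by (auto intro!: inv_into_into)
    ultimately show ?case by blast
  qed
  have fG: "f (G (Suc n) t) = G n t" if "t \<in> ball t0 \<rho>" for n t
  proof -
    have "G n t \<in> f ` Q (Suc (N + n))" using G[of n] fQ that by auto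
    then show ?thesis unfolding GS by (rule f_inv_into_f)
  qed
  have fnG: "(f ^^ n) (G n t) = flip b (Some t)" if "t \<in> ball t0 \<rho>" for n t
    by (induction n) (simp_all add: G0 fG[OF that] funpow_Suc_right del: funpow.simps(2))
  have uniqG: "G n t = v (N + n)" if "t \<in> ball t0 \<rho>" "v N = flip b (Some t)" "\<And>n. f (v (Suc n)) = v n" "\<And>n. v n \<in> Q n" for n t v
  proof (induction n)
    case (Suc n)
    have "f (G (Suc n) t) = f (v (N + Suc n))" using fG[OF that(1)] Suc that(3) by simp
    moreover have "G (Suc n) t \<in> Q (Suc (N + n))" "v (N + Suc n) \<in> Q (Suc (N + n))" using G[of "Suc n"] that(1,4) by auto
    ultimately show ?case using injQ[of "N + n"] by (auto simp: inj_on_def)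
  qed (use that in \<open>simp add: G0\<close>)
  have Gz: "G n t0 = z (N + n)" for n by (rule uniqG) (use \<rho> zN fz zQ in auto)
  \<comment> \<open>With \<open>q\<close> within \<open>\<rho> / 8\<close> of \<open>t0\<close>, the
    disc of radius \<open>\<rho> / 2\<close> about \<open>q\<close> stays in
    \<open>ball t0 \<rho>\<close>, and \<open>t0\<close> lies in its concentric quarter, as
    \<open>Koebe_growth\<close> requires.\<close>
  obtain \<delta> where \<delta>: "\<delta> > 0" "\<And>y. chordal (flip b (Some t0)) y < \<delta> \<Longrightarrow> \<exists>q\<in>ball t0 (\<rho> / 8). y = flip b (Some q)"
    using chart_nbhd_any[of "\<rho> / 8"] \<rho> by (metis divide_pos_pos zero_less_numeral)
  show ?thesis
  proof (rule that[OF \<delta>(1)])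
    fix w0 assume pl: "(\<lambda>n. \<psi> n w0) \<in> plaque f z U" and cl: "chordal (z N) (\<psi> N w0) < \<delta>"
    have \<psi>Q: "\<psi> n w0 \<in> Q n" for n using pl by (auto simp: plaque_def Q_def)
    have "\<exists>q\<in>ball t0 (\<rho> / 8). \<psi> N w0 = flip b (Some q)" using cl unfolding zN by (rule \<delta>(2))
    then obtain q where q: "q \<in> ball t0 (\<rho> / 8)" "\<psi> N w0 = flip b (Some q)" by blast
    have sub: "ball q (\<rho> / 2) \<subseteq> ball t0 \<rho>"
    proof
      fix t assume "t \<in> ball q (\<rho> / 2)"
      then show "t \<in> ball t0 \<rho>" using q(1) dist_triangle[of t0 t q] \<rho> by simp
    qed
    have sh: "shol (\<psi> n) S" for n S using K_hat_shol[OF \<psi>] shol_subset subset_UNIV by metis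
    have "flip b (\<psi> N w0) \<noteq> None" using q(2) by simp
    then obtain r1 k where r1: "r1 > 0" "k holomorphic_on ball w0 r1" and k: "\<And>u. u \<in> ball w0 r1 \<Longrightarrow> flip b (\<psi> N u) = Some (k u)"
      using shol_chartE[OF K_hat_shol[OF \<psi>] UNIV_I] by metis
    have kw: "k w0 = q" using k[of w0] r1(1) q(2) by simp
    obtain r2 where r2: "r2 > 0" "r2 \<le> r1" "\<And>u. u \<in> ball w0 r2 \<Longrightarrow> k u \<in> ball q (\<rho> / 2)"
      using deriv_shrink_image[OF r1(2,1) open_ball, of q "\<rho> / 2"] kw \<rho> by auto
    have "w0 \<in> (\<lambda>w n. \<psi> n w) -` plaque f z U" using pl by simp
    then obtain r3 where r3: "r3 > 0" "ball w0 r3 \<subseteq> (\<lambda>w n. \<psi> n w) -` plaque f z U"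
      by (rule openE[OF open_vimage_plaque[OF \<psi> U(1)]])
    define s where "s = min r2 r3"
    have s: "s > 0" "s \<le> r2" "s \<le> r3" using r2 r3 by (auto simp: s_def)
    have nearQ: "\<psi> n u \<in> Q n" if "u \<in> ball w0 s" for n u
    proof -
      have "u \<in> ball w0 r3" using that s(3) by simp
      then show ?thesis using r3(2) by (auto simp: plaque_def Q_def)
    qed
    have kball: "k u \<in> ball q (\<rho> / 2)" "k u \<in> ball t0 \<rho>" "\<psi> N u = flip b (Some (k u))" if u: "u \<in> ball w0 s" for u
    proof -
      have u': "u \<in> ball w0 r2" "u \<in> ball w0 r1" using u s(2) r2(2) by auto
      show 1: "k u \<in> ball q (\<rho> / 2)" by (rule r2(3)[OF u'(1)])
      then show "k u \<in> ball t0 \<rho>" using sub by blast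
      have "flip b (\<psi> N u) = flip b (flip b (Some (k u)))" using k[OF u'(2)] by simp
      then show "\<psi> N u = flip b (Some (k u))" by (simp only: flip_eq_iff)
    qed
    have G\<psi>: "G n (k u) = \<psi> (N + n) u" if u: "u \<in> ball w0 s" for n u
      by (rule uniqG[where v = "\<lambda>n. \<psi> n u"]) (use kball[OF u] nearQ[OF u] K_hat_step[OF \<psi>] in auto)
    have injk: "inj_on k (ball w0 s)"
    proof (rule inj_onI)
      fix u u' assume u: "u \<in> ball w0 s" "u' \<in> ball w0 s" "k u = k u'"
      have "(\<lambda>n. \<psi> n u) \<in> plaque f z U" "(\<lambda>n. \<psi> n u') \<in> plaque f z U"
        using nearQ u K_hat_natural_extension[OF \<psi>] by (auto simp: plaque_def Q_def)
      moreover have "\<psi> N u = \<psi> N u'" using kball(3) u by simp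
      ultimately have "(\<lambda>n. \<psi> n u) = (\<lambda>n. \<psi> n u')" by (intro plaque_eqI[OF uni])
      then show "u = u'" using inj by (auto simp: inj_def)
    qed
    have hk: "k holomorphic_on ball w0 s" by (rule holomorphic_on_subset[OF r1(2)]) (use s r2 in auto)
    have w0s: "w0 \<in> ball w0 s" using s(1) by simp
    have dk: "deriv k w0 \<noteq> 0" by (rule holomorphic_injective_imp_regular[OF hk open_ball injk w0s])
    \<comment> \<open>Twice the largest radius that the two Koebe estimates allow for a ball whose
      image misses \<open>z\<close>.\<close>
    define R where "R = koebe_const * koebe_const * \<rho> / cmod (deriv k w0)"
    have R: "R > 0" using koebe_const_pos \<rho> dk by (simp add: R_def)
    have subR: "ball w0 R \<subseteq> ball 0 (cmod w0 + R)"
    proof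
      fix u assume "u \<in> ball w0 R"
      then show "u \<in> ball 0 (cmod w0 + R)" using norm_triangle_sub[of u w0] by (simp add: dist_norm norm_minus_commute)
    qed
    obtain N1 where N1: "\<And>n. n \<ge> N1 \<Longrightarrow> inj_on (\<psi> n) (ball w0 R)"
      using K_hat_eventually_inj[OF exp \<psi> inj, of "cmod w0 + R"] inj_on_subset[OF _ subR] by metis
    obtain x0 y0 Y where Y: "f x0 = x0" "y0 \<noteq> x0" "\<And>i n. i < n \<Longrightarrow> (f ^^ n) (Y i) = x0" "\<And>i. (f ^^ i) (Y i) = y0" "Fun.inj (Y :: nat \<Rightarrow> csphere)"
      by (rule backward_orbit) (rule that)
    define A where "A = {u\<in>cball w0 R. \<psi> 0 u = x0}"
    have finA: "finite A" unfolding A_def by (rule finite_preimage_cball[OF \<psi>])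
    \<comment> \<open>At large depth at most \<open>card A\<close> of these points are hit by
      \<open>\<psi> (N + n)\<close> on the ball and at most one by the branch \<open>G n\<close>,
      which leaves a common omitted value.\<close>
    define Z where "Z = Y ` {..<card A + 2}"
    have Z: "finite Z" "card Z = card A + 2" using Y(5) by (auto simp: Z_def card_image inj_on_subset)
    have hit: "z (N + n) \<in> \<psi> (N + n) ` ball w0 R" if n: "n \<ge> card A + 2" "N + n \<ge> N1" for n
    proof (rule ccontr)
      assume miss: "z (N + n) \<notin> \<psi> (N + n) ` ball w0 R"
      have "Z \<inter> \<psi> (N + n) ` ball w0 R \<subseteq> \<psi> (N + n) ` A"
      proof
        fix y assume "y \<in> Z \<inter> \<psi> (N + n) ` ball w0 R"
        then obtain i u where u: "u \<in> ball w0 R" "y = \<psi> (N + n) u" "y = Y i" "i < card A + 2" by (auto simp: Z_def)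
        then have "(f ^^ (N + n)) (\<psi> (N + n) u) = x0" using Y(3)[of i "N + n"] n by simp
        then have "\<psi> 0 u = x0" using K_hat_iter[OF \<psi>, of "N + n" 0 u] by simp
        then show "y \<in> \<psi> (N + n) ` A" using u by (auto simp: A_def)
      qed
      then have c1: "card (Z \<inter> \<psi> (N + n) ` ball w0 R) \<le> card A"
        using finA by (meson card_image_le card_mono finite_imageI order_trans)
      have "\<exists>y. Z \<inter> G n ` ball t0 \<rho> \<subseteq> {y}"
      proof -
        have "y = y'" if y: "y \<in> Z \<inter> G n ` ball t0 \<rho>" "y' \<in> Z \<inter> G n ` ball t0 \<rho>" for y y'
        proof -
          obtain t i where t: "t \<in> ball t0 \<rho>" "y = G n t" "y = Y i" "i < card A + 2" using y(1) by (auto simp: Z_def)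
          obtain t' i' where t': "t' \<in> ball t0 \<rho>" "y' = G n t'" "y' = Y i'" "i' < card A + 2" using y(2) by (auto simp: Z_def)
          have "(f ^^ n) y = x0" "(f ^^ n) y' = x0" using Y(3)[of i n] Y(3)[of i' n] t(3,4) t'(3,4) n(1) by simp_all
          then have "flip b (Some t) = flip b (Some t')"
            using fnG[OF t(1), of n] fnG[OF t'(1), of n] t(2) t'(2) by metis
          then have "t = t'" by simp
          then show ?thesis using t t' by simp
        qed
        then show ?thesis by blast
      qed
      then have c2: "card (Z \<inter> G n ` ball t0 \<rho>) \<le> 1" using card_mono[of "{_}"] by (metis card.empty card_insert_disjoint empty_iff finite.emptyI finite_insert One_nat_def)
      have "Z \<inter> \<psi> (N + n) ` ball w0 R \<union> Z \<inter> G n ` ball t0 \<rho> \<noteq> Z"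
      proof
        assume "Z \<inter> \<psi> (N + n) ` ball w0 R \<union> Z \<inter> G n ` ball t0 \<rho> = Z"
        then have "card Z \<le> card (Z \<inter> \<psi> (N + n) ` ball w0 R) + card (Z \<inter> G n ` ball t0 \<rho>)"
          by (metis card_Un_le)
        then show False using c1 c2 Z(2) by simp
      qed
      then obtain e where e: "e \<notin> \<psi> (N + n) ` ball w0 R" "e \<notin> G n ` ball t0 \<rho>" by blast
      obtain T T' where T: "\<And>x. T' (T x) = x" "hmap T" "hmap T'" "T e = None" by (rule Moebius_to_None[of e]) (rule that)
      have T_inj: "T x = T y \<Longrightarrow> x = y" for x y using T(1) by metis
      have T_fin: "T x = None \<Longrightarrow> x = e" for x using T_inj[of x e] T(4) by simp
      define F1 where "F1 = (\<lambda>u. the (T (\<psi> (N + n) u)))"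
      define F2 where "F2 = (\<lambda>t. the (T (G n t)))"
      have F1: "T (\<psi> (N + n) u) = Some (F1 u)" if "u \<in> ball w0 R" for u
      proof -
        have "\<psi> (N + n) u \<noteq> e" using e(1) that by blast
        then have "T (\<psi> (N + n) u) \<noteq> None" using T_fin by blast
        then show ?thesis by (simp add: F1_def)
      qed
      have F2: "T (G n t) = Some (F2 t)" if "t \<in> ball t0 \<rho>" for t
      proof -
        have "G n t \<noteq> e" using e(2) that by blast
        then have "T (G n t) \<noteq> None" using T_fin by blast
        then show ?thesis by (simp add: F2_def)
      qed
      have "flip False (T (\<psi> (N + n) u)) \<noteq> None" if "u \<in> ball w0 R" for u using F1[OF that] by simp
      from shol_holomorphic[OF hmapD[OF T(2) sh] open_ball this]
      have hol1: "F1 holomorphic_on ball w0 R" unfolding F1_def by simp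
      have "flip False (T (G n t)) \<noteq> None" if "t \<in> ball t0 \<rho>" for t using F2[OF that] by simp
      moreover have "shol (G n) (ball t0 \<rho>)" using G[of n] by blast
      ultimately have hol2: "F2 holomorphic_on ball t0 \<rho>"
        using shol_holomorphic[OF hmapD[OF T(2)] open_ball, of "G n" t0 \<rho> False] unfolding F2_def by simp
      have hol2': "F2 holomorphic_on ball q (\<rho> / 2)" using hol2 sub by (rule holomorphic_on_subset)
      have inj1: "inj_on F1 (ball w0 R)"
      proof (rule inj_onI)
        fix u v assume uv: "u \<in> ball w0 R" "v \<in> ball w0 R" "F1 u = F1 v"
        then have "\<psi> (N + n) u = \<psi> (N + n) v" using F1 T_inj by metis
        then show "u = v" using N1[OF n(2)] uv by (auto simp: inj_on_def)
      qed
      have inj2: "inj_on F2 (ball q (\<rho> / 2))"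
      proof (rule inj_onI)
        fix t t' assume t: "t \<in> ball q (\<rho> / 2)" "t' \<in> ball q (\<rho> / 2)" "F2 t = F2 t'"
        have t': "t \<in> ball t0 \<rho>" "t' \<in> ball t0 \<rho>" using t sub by blast+
        then have "T (G n t) = T (G n t')" using F2 t(3) by simp
        then have "G n t = G n t'" by (rule T_inj)
        then have "(f ^^ n) (G n t) = (f ^^ n) (G n t')" by (rule arg_cong)
        then have "flip b (Some t) = flip b (Some t')" unfolding fnG[OF t'(1)] fnG[OF t'(2)] .
        then show "t = t'" by simp
      qed
      have t0b: "t0 \<in> ball t0 \<rho>" using \<rho> by simp
      have miss': "F2 t0 \<notin> F1 ` ball w0 R"
      proof
        assume "F2 t0 \<in> F1 ` ball w0 R"
        then obtain u where u: "u \<in> ball w0 R" "F2 t0 = F1 u" by blast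
        then have "T (G n t0) = T (\<psi> (N + n) u)" using F1 F2[OF t0b] by simp
        then have "z (N + n) = \<psi> (N + n) u" using T_inj Gz by metis
        then show False using miss u(1) by blast
      qed
      \<comment> \<open>Near \<open>w0\<close> the functions \<open>F1\<close> and \<open>F2\<close>
        differ by the coordinate change \<open>k\<close>, which does not depend on \<open>n\<close>;
        so the uncontrolled derivative of \<open>F2\<close> cancels from the final
        comparison.\<close>
      have F12: "F1 u = F2 (k u)" if "u \<in> ball w0 s" for u
        using G\<psi>[OF that, of n] by (simp add: F1_def F2_def)
      have qb: "q \<in> ball q (\<rho> / 2)" using \<rho> by simp
      have "(F2 has_field_derivative deriv F2 q) (at (k w0))" using hol2' qb kw holomorphic_derivI by blast
      moreover have "(k has_field_derivative deriv k w0) (at w0)" using hk w0s holomorphic_derivI by blast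
      ultimately have "((\<lambda>u. F2 (k u)) has_field_derivative deriv F2 q * deriv k w0) (at w0)"
        using DERIV_chain2 by blast
      then have "(F1 has_field_derivative deriv F2 q * deriv k w0) (at w0)"
        by (rule has_field_derivative_transform_within_open[OF _ open_ball w0s]) (simp add: F12)
      then have dF1: "deriv F1 w0 = deriv F2 q * deriv k w0" by (rule DERIV_imp_deriv)
      have "F1 w0 = F2 q" using F12[OF w0s] kw by simp
      then have "R * cmod (deriv F1 w0) \<le> koebe_const * cmod (F2 t0 - F2 q)"
        using Koebe_deriv_omitted[OF hol1 R inj1 miss'] by simp
      also have "\<dots> \<le> koebe_const * (koebe_const * (\<rho> / 2) * cmod (deriv F2 q))"
        using Koebe_growth[OF hol2' _ inj2, of t0] q(1) \<rho> koebe_const_pos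
        by (intro mult_left_mono) (auto simp: dist_commute)
      finally have "(R * cmod (deriv k w0)) * cmod (deriv F2 q) \<le> (koebe_const * koebe_const * \<rho> / 2) * cmod (deriv F2 q)"
        unfolding dF1 by (simp add: norm_mult mult.assoc mult.left_commute mult.commute)
      moreover have "deriv F2 q \<noteq> 0" by (rule holomorphic_injective_imp_regular[OF hol2' open_ball inj2 qb])
      ultimately have "R * cmod (deriv k w0) \<le> koebe_const * koebe_const * \<rho> / 2" by simp
      moreover have "R * cmod (deriv k w0) = koebe_const * koebe_const * \<rho>" using dk by (simp add: R_def)
      moreover have "koebe_const * koebe_const * \<rho> > 0" using koebe_const_pos \<rho> by simp
      ultimately show False by linarith
    qed
    define m0 where "m0 = N + (card A + 2 + N1)"
    have "z m0 \<in> \<psi> m0 ` ball w0 R" unfolding m0_def by (rule hit) auto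
    then obtain u where u: "u \<in> ball w0 R" "z m0 = \<psi> m0 u" by blast
    \<comment> \<open>Every depth from \<open>m0\<close> on provides a point of the ball over
      \<open>z\<close>, and injectivity of \<open>\<psi>\<close> at these depths shows that it is
      always \<open>u\<close>.\<close>
    have up: "z (m0 + i) = \<psi> (m0 + i) u" for i
    proof (induction i)
      case (Suc i)
      have "z (N + (card A + 2 + N1 + Suc i)) \<in> \<psi> (N + (card A + 2 + N1 + Suc i)) ` ball w0 R" by (rule hit) auto
      then have "z (m0 + Suc i) \<in> \<psi> (m0 + Suc i) ` ball w0 R" by (simp add: m0_def add.assoc)
      then obtain u' where u': "u' \<in> ball w0 R" "z (m0 + Suc i) = \<psi> (m0 + Suc i) u'" by blast
      have "\<psi> (m0 + i) u' = f (z (m0 + Suc i))" using u'(2) K_hat_step[OF \<psi>] by simp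
      also have "\<dots> = \<psi> (m0 + i) u" using fz Suc by simp
      finally have "u' = u" using N1[of "m0 + i"] u(1) u'(1) by (auto simp: inj_on_def m0_def)
      then show ?case using u' by simp
    qed (use u in simp)
    have "z = (\<lambda>n. \<psi> n u)"
      by (rule natural_extension_eqI[OF z K_hat_natural_extension[OF \<psi>], of m0]) (use up in \<open>metis le_add_diff_inverse\<close>)
    then show "z \<in> range (\<lambda>w n. \<psi> n w)" by blast
  qed
qed

text \<open>Since \<open>f\<close> maps each pull-back onto the next shallower one, preimages can be
  chosen depth by depth, starting from \<open>y\<close>.\<close>

lemma plaque_point:
  assumes z: "z \<in> natural_extension f" and U: "openin riemann_sphere U" "z 0 \<in> U" and y: "y \<in> pullback f z U N"
  obtains p where "p \<in> plaque f z U" "p N = y"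
proof -
  define Q where "Q n = pullback f z U n" for n
  have fQ: "f ` Q (Suc n) = Q n" for n unfolding Q_def by (rule f_image_pullback[OF z U(2,1)])
  define P where "P = rec_nat y (\<lambda>n x. inv_into (Q (Suc (N + n))) f x)"
  have P0: "P 0 = y" and PS: "P (Suc n) = inv_into (Q (Suc (N + n))) f (P n)" for n by (simp_all add: P_def)
  have PQ: "P n \<in> Q (N + n)" for n
  proof (induction n)
    case (Suc n)
    then have "P n \<in> f ` Q (Suc (N + n))" using fQ by simp
    from inv_into_into[OF this] show ?case unfolding PS by simp
  qed (use y in \<open>simp add: P0 Q_def\<close>)
  have fP: "f (P (Suc n)) = P n" for n
  proof -
    have "P n \<in> f ` Q (Suc (N + n))" using fQ PQ[of n] by simp
    then show ?thesis unfolding PS by (rule f_inv_into_f)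
  qed
  have fnP: "(f ^^ n) (P (m + n)) = P m" for n m
    by (rule natural_extension_iter) (use fP in \<open>simp add: natural_extension_def\<close>)
  have iterQ: "x \<in> Q (n + i) \<Longrightarrow> (f ^^ i) x \<in> Q n" for n i x
  proof (induction i arbitrary: n)
    case (Suc i)
    then have "(f ^^ i) x \<in> Q (Suc n)" by simp
    then have "f ((f ^^ i) x) \<in> f ` Q (Suc n)" by (rule imageI)
    then show ?case using fQ by simp
  qed simp
  \<comment> \<open>\<open>P m\<close> lives at depth \<open>N + m\<close>, so \<open>N\<close>
    applications of \<open>f\<close> bring it to depth \<open>m\<close>; this also fills in the
    coordinates below \<open>N\<close>.\<close>
  define p where "p = (\<lambda>m. (f ^^ N) (P m))"
  have "p \<in> natural_extension f"
    using fP by (auto simp: p_def natural_extension_def funpow_swap1)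
  moreover have "p m \<in> Q m" for m using iterQ[of "P m" m N] PQ[of m] by (simp add: p_def add.commute)
  ultimately have "p \<in> plaque f z U" by (simp add: plaque_def Q_def)
  moreover have "p N = y" using fnP[of N 0] by (simp add: p_def P0)
  ultimately show ?thesis by (rule that)
qed

text \<open>The points of the depth \<open>N\<close> pull-back that lie under the image form an open and closed subset.\<close>

lemma plaque_subset_image:
  assumes exp: "expansive f" and \<psi>: "\<psi> \<in> K_hat f" and inj: "inj (\<lambda>w n. \<psi> n w)"
    and z: "z \<in> natural_extension f" and reg: "regular_nbhd f z U" and w1: "(\<lambda>n. \<psi> n w1) \<in> plaque f z U"
  shows "plaque f z U \<subseteq> range (\<lambda>w n. \<psi> n w)"
proof -
  obtain N where U: "openin riemann_sphere U" "z 0 \<in> U" and uni: "univalent_from f z U N" using reg by (auto simp: regular_nbhd_def)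
  define E where "E = {y. \<exists>w. \<psi> N w = y \<and> (\<lambda>n. \<psi> n w) \<in> plaque f z U}"
  have sh: "shol (\<psi> n) S" for n S using K_hat_shol[OF \<psi>] shol_subset subset_UNIV by metis
  have "openin riemann_sphere E"
    unfolding openin_riemann_sphere
  proof
    fix y assume "y \<in> E"
    then obtain w where w: "\<psi> N w = y" "(\<lambda>n. \<psi> n w) \<in> plaque f z U" by (auto simp: E_def)
    have "w \<in> (\<lambda>w n. \<psi> n w) -` plaque f z U" using w(2) by simp
    then obtain r where r: "r > 0" "ball w r \<subseteq> (\<lambda>w n. \<psi> n w) -` plaque f z U"
      by (rule openE[OF open_vimage_plaque[OF \<psi> U(1)]])
    then have near: "(\<lambda>n. \<psi> n u) \<in> plaque f z U" if "u \<in> ball w r" for u using that by blast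
    obtain u0 where u0: "u0 \<in> ball w r" "\<psi> N u0 \<noteq> \<psi> N w" using K_hat_not_const_ball[OF \<psi> r(1)] by metis
    obtain d where "d > 0" "\<And>y. chordal (\<psi> N w) y < d \<Longrightarrow> \<exists>u\<in>ball w r. \<psi> N u = y"
      by (rule shol_open_map[OF sh r(1) u0]) (rule that)
    then show "\<exists>d>0. \<forall>y'. chordal y y' < d \<longrightarrow> y' \<in> E" using near w(1) unfolding E_def by blast
  qed
  moreover have "openin riemann_sphere (pullback f z U N - E)"
    unfolding openin_riemann_sphere
  proof
    fix y assume y: "y \<in> pullback f z U N - E"
    then obtain p where p: "p \<in> plaque f z U" "p N = y" using plaque_point[OF z U] by blast
    have pn: "p \<in> natural_extension f" using p(1) by (simp add: plaque_def)
    \<comment> \<open>A plaque may be based at any of its points; re-basing at \<open>p\<close>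
      makes \<open>branch_point_in_image\<close> applicable there.\<close>
    have pb: "pullback f p U n = pullback f z U n" for n
      by (rule pullback_cong) (use p(1) in \<open>simp add: plaque_def\<close>)
    have "p 0 \<in> U" using p(1) pullback_subset[of f z U 0] by (auto simp: plaque_def)
    moreover have "univalent_from f p U N" using uni by (simp add: univalent_from_def pb)
    moreover have pp: "plaque f p U = plaque f z U" by (simp add: plaque_def pb)
    ultimately obtain \<delta> where \<delta>: "\<delta> > 0"
      "\<And>w0. (\<lambda>n. \<psi> n w0) \<in> plaque f z U \<Longrightarrow> chordal (p N) (\<psi> N w0) < \<delta> \<Longrightarrow> p \<in> range (\<lambda>w n. \<psi> n w)"
      using branch_point_in_image[OF exp \<psi> inj pn U(1)] by metis
    have "p \<notin> range (\<lambda>w n. \<psi> n w)"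
    proof
      assume "p \<in> range (\<lambda>w n. \<psi> n w)"
      then obtain w where "p = (\<lambda>n. \<psi> n w)" by blast
      then have "y \<in> E" using p by (auto simp: E_def)
      then show False using y by blast
    qed
    then have far: "y' \<notin> E" if "chordal y y' < \<delta>" for y' using \<delta>(2) that p(2) unfolding E_def by blast
    obtain e where "e > 0" "\<And>y'. chordal y y' < e \<Longrightarrow> y' \<in> pullback f z U N"
      using openin_pullback[OF U(1)] y unfolding openin_riemann_sphere by (metis DiffD1)
    then show "\<exists>e>0. \<forall>y'. chordal y y' < e \<longrightarrow> y' \<in> pullback f z U N - E"
      using far \<delta>(1) by (intro exI[of _ "min e \<delta>"]) auto
  qed
  ultimately have "pullback f z U N \<subseteq> E"
  proof (rule connectedin_split[OF pullback_connected])
    have "\<psi> N w1 \<in> pullback f z U N" "\<psi> N w1 \<in> E" using w1 by (auto simp: plaque_def E_def)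
    then show "pullback f z U N \<inter> E \<noteq> {}" by blast
  qed auto
  show ?thesis
  proof
    fix v assume v: "v \<in> plaque f z U"
    then have "v N \<in> E" using \<open>pullback f z U N \<subseteq> E\<close> by (auto simp: plaque_def)
    then obtain w where w: "\<psi> N w = v N" "(\<lambda>n. \<psi> n w) \<in> plaque f z U" by (auto simp: E_def)
    have "v = (\<lambda>n. \<psi> n w)" by (rule plaque_eqI[OF uni v w(2)]) (simp add: w(1))
    then show "v \<in> range (\<lambda>w n. \<psi> n w)" by blast
  qed
qed

end

section \<open>Leaves parametrised by injective elements\<close>

lemma sphere_chartE:
  assumes "(V, x) \<in> sphere_charts"
  obtains b where "\<And>y. y \<in> V \<Longrightarrow> flip b y = Some (x y)"
proof -
  consider "V = range Some" "x = the" | "V = UNIV - {Some 0}" "x = (\<lambda>x. case x of None \<Rightarrow> 0 | Some w \<Rightarrow> inverse w)"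
    using assms by (auto simp: sphere_charts_def)
  then show ?thesis
  proof cases
    case 1
    then show ?thesis by (intro that[of False]) auto
  next
    case 2
    then show ?thesis by (intro that[of True]) (auto simp: sinv_def split: option.splits)
  qed
qed

lemma sphere_chart_exists:
  obtains V x where "(V, x) \<in> sphere_charts" "V = {y. flip b y \<noteq> None}"
proof (cases b)
  case True
  show ?thesis by (rule that, unfold sphere_charts_def, rule insertI2, rule singletonI) (use True in \<open>auto simp: sinv_def split: option.splits\<close>)
next
  case False
  show ?thesis by (rule that, unfold sphere_charts_def, rule insertI1) (use False in auto)
qed

text \<open>Membership of \<open>\<psi> 0\<close> in \<open>K_space f\<close> comes from the
  sequence itself, as \<open>\<psi> 0\<close> is the \<open>n\<close>-th iterate of \<open>f\<close>
  applied to \<open>\<psi> n\<close>.\<close>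

lemma K_hatI:
  assumes sh: "\<And>n. shol (\<psi> n) UNIV" and nc: "\<And>n. \<not> \<psi> n constant_on UNIV" and st: "\<And>n w. f (\<psi> (Suc n) w) = \<psi> n w"
  shows "\<psi> \<in> K_hat f"
proof -
  have m: "\<psi> n \<in> mero_space" for n using sh nc by (simp add: mero_space_iff)
  have "\<psi> 0 = (f ^^ n) \<circ> \<psi> n" for n
  proof
    fix w
    have "(\<lambda>n. \<psi> n w) \<in> natural_extension f" using st by (simp add: natural_extension_def)
    from natural_extension_iter[OF this, of n 0] show "\<psi> 0 w = ((f ^^ n) \<circ> \<psi> n) w" by simp
  qed
  then have "\<psi> 0 \<in> K_space f" unfolding K_space_def using m by blast
  moreover have "f \<circ> \<psi> (Suc n) = \<psi> n" for n using st by auto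
  ultimately show ?thesis using m by (simp add: K_hat_def)
qed

lemma K_hat_translate:
  assumes "\<psi> \<in> K_hat f"
  shows "(\<lambda>n w. \<psi> n (c + w)) \<in> K_hat f"
proof (rule K_hatI)
  fix n
  show "shol (\<lambda>w. \<psi> n (c + w)) UNIV"
    by (rule shol_compose[OF K_hat_shol[OF assms]]) (auto intro: holomorphic_intros)
  show "\<not> (\<lambda>w. \<psi> n (c + w)) constant_on UNIV"
  proof
    assume "(\<lambda>w. \<psi> n (c + w)) constant_on UNIV"
    then obtain y where y: "\<And>w. \<psi> n (c + w) = y" by (auto simp: constant_on_def)
    have "\<psi> n w = y" for w using y[of "w - c"] by simp
    then show False using K_hat_nonconst[OF assms, of n] by (auto simp: constant_on_def)
  qed
  show "f (\<psi> (Suc n) (c + w)) = \<psi> n (c + w)" for w by (rule K_hat_step[OF assms])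
qed

lemma plaque_base: "z \<in> natural_extension f \<Longrightarrow> z 0 \<in> U \<Longrightarrow> z \<in> plaque f z U"
  by (simp add: plaque_def pullback_base)

lemma regular_points_subset_plaques:
  "regular_points f \<subseteq> \<Union>{plaque f z U |z U. z \<in> natural_extension f \<and> regular_nbhd f z U}"
proof
  fix z assume "z \<in> regular_points f"
  then obtain U where "z \<in> natural_extension f" "regular_nbhd f z U" by (auto simp: regular_points_def)
  moreover from this have "z \<in> plaque f z U" by (auto simp: regular_nbhd_def intro: plaque_base)
  ultimately show "z \<in> \<Union>{plaque f z U |z U. z \<in> natural_extension f \<and> regular_nbhd f z U}" by blast
qed

lemma topspace_leaf_topology:
  assumes "L \<subseteq> regular_points f"
  shows "topspace (leaf_topology f L) = L"
  unfolding leaf_topology_def topspace_subtopology topology_generated_by_topspace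
  using order_trans[OF assms regular_points_subset_plaques] by (rule Int_absorb1)

lemma leaf_subset: "L \<in> leaves f \<Longrightarrow> L \<subseteq> regular_points f"
  using path_components_of_subset unfolding leaves_def by fastforce

lemma openin_leaf_plaque:
  assumes "z \<in> natural_extension f" "regular_nbhd f z U"
  shows "openin (topology_generated_by {plaque f z U |z U. z \<in> natural_extension f \<and> regular_nbhd f z U}) (plaque f z U)"
  by (rule topology_generated_by_Basis) (use assms in blast)

context sphere_map
begin

lemma range_regular:
  assumes "expansive f" "\<psi> \<in> K_hat f" "inj (\<lambda>w n. \<psi> n w)"
  shows "(\<lambda>n. \<psi> n w) \<in> regular_points f"
  using plaque_in_image[OF assms zero_less_one] K_hat_natural_extension[OF assms(2)] unfolding regular_points_def by blast

text \<open>The image of the plane is path connected. Conversely, a path of regular points is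
  continuous for the coarse topology of the natural extension, yet near each time it stays in a
  single plaque, and a plaque that meets the image lies in it; so a path that starts in the image
  remains there.\<close>

lemma range_leaf:
  assumes exp: "expansive f" and \<psi>: "\<psi> \<in> K_hat f" and inj: "inj (\<lambda>w n. \<psi> n w)"
  shows "range (\<lambda>w n. \<psi> n w) \<in> leaves f"
proof -
  define X where "X = subtopology (natural_extension_topology f) (regular_points f)"
  define \<Phi> where "\<Phi> = (\<lambda>w n. \<psi> n w)"
  have top: "topspace X = regular_points f"
    by (auto simp: X_def natural_extension_topology_def regular_points_def)
  have reg: "\<Phi> w \<in> regular_points f" for w unfolding \<Phi>_def by (rule range_regular[OF exp \<psi> inj])
  have comp: "continuous_map (top_of_set S) X g \<longleftrightarrow> (\<forall>n. continuous_on S (\<lambda>t. stereo (g t n))) \<and> g ` S \<subseteq> regular_points f"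
    for S :: "'z::topological_space set" and g
    unfolding X_def natural_extension_topology_def continuous_map_in_subtopology continuous_map_componentwise_UNIV
      continuous_map_riemann_sphere
    by (auto simp: o_def regular_points_def)
  have "continuous_map (top_of_set UNIV) X \<Phi>"
    unfolding comp using reg shol_continuous_on[OF K_hat_shol[OF \<psi>]] by (auto simp: \<Phi>_def)
  then have "continuous_map euclidean X \<Phi>" by simp
  from path_connectedin_continuous_map_image[OF this, of UNIV]
  have "path_connectedin X (range \<Phi>)" by simp
  then have 1: "range \<Phi> \<subseteq> Collect (path_component_of X (\<Phi> 0))" by (intro path_component_of_maximal) auto
  have "v \<in> range \<Phi>" if v: "path_component_of X (\<Phi> 0) v" for v
  proof -
    obtain g where g: "pathin X g" "g 0 = \<Phi> 0" "g 1 = v" using v unfolding path_component_of_def by blast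
    have gc: "continuous_on {0..1} (\<lambda>t. stereo (g t n))" for n using g(1) unfolding pathin_def comp by blast
    have gr: "g t \<in> regular_points f" if "t \<in> {0..1}" for t using g(1) that unfolding pathin_def comp by blast
    have "g (1::real) \<in> range \<Phi>"
    proof (rule connected_induction_simple[of "{0..1}" 0 1 "\<lambda>t. g t \<in> range \<Phi>"])
      fix t0 :: real assume t0: "t0 \<in> {0..1}"
      obtain U where U: "regular_nbhd f (g t0) U" and gn: "g t0 \<in> natural_extension f"
        using gr[OF t0] by (auto simp: regular_points_def)
      have Uo: "openin riemann_sphere U" "g t0 0 \<in> U" using U by (auto simp: regular_nbhd_def)
      then obtain e where e: "e > 0" "\<And>y. chordal (g t0 0) y < e \<Longrightarrow> y \<in> U" unfolding openin_riemann_sphere by metis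
      obtain d where d: "d > 0" "\<And>t. t \<in> {0..1} \<Longrightarrow> dist t t0 < d \<Longrightarrow> dist (stereo (g t 0)) (stereo (g t0 0)) < e"
        using gc[of 0] t0 e(1) unfolding continuous_on_iff by metis
      define S where "S = {0..1} \<inter> ball t0 d"
      have S: "t \<in> S \<Longrightarrow> t \<in> {0..1} \<and> g t 0 \<in> U" for t
        using d(2)[of t] e(2)[of "g t 0"] by (simp add: S_def chordal_def dist_commute)
      have "g ` S \<subseteq> plaque f (g t0) U"
      proof (rule plaque_image[where ?s0.0 = t0])
        show "connected S" unfolding S_def by (intro convex_connected convex_Int convex_ball convex_real_interval)
        show "continuous_on S (\<lambda>s. stereo (g s n))" for n by (rule continuous_on_subset[OF gc]) (simp add: S_def)
        show "g s \<in> natural_extension f" if "s \<in> S" for s using gr S[OF that] by (auto simp: regular_points_def)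
        show "t0 \<in> S" using t0 d(1) by (simp add: S_def)
        show "g t0 \<in> plaque f (g t0) U" by (rule plaque_base[where f = f, OF gn Uo(2)])
      qed (use S in blast)
      then have pl: "g t \<in> plaque f (g t0) U" if "t \<in> S" for t using that by blast
      have "g t' \<in> range \<Phi>" if "t \<in> S" "t' \<in> S" "g t \<in> range \<Phi>" for t t'
      proof -
        obtain w where w: "g t = (\<lambda>n. \<psi> n w)" using \<open>g t \<in> range \<Phi>\<close> by (auto simp: \<Phi>_def)
        have "plaque f (g t0) U \<subseteq> range \<Phi>"
          unfolding \<Phi>_def by (rule plaque_subset_image[OF exp \<psi> inj gn U, of w]) (use pl[OF that(1)] w in simp)
        then show ?thesis using pl[OF that(2)] by blast
      qed
      moreover have "openin (top_of_set {0..1}) S" "t0 \<in> S" using t0 d(1) by (auto simp: S_def intro!: openin_open_Int)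
      ultimately show "\<exists>T. openin (top_of_set {0..1}) T \<and> t0 \<in> T \<and> (\<forall>x\<in>T. \<forall>y\<in>T. g x \<in> range \<Phi> \<longrightarrow> g y \<in> range \<Phi>)" by blast
    qed (auto simp: g(2))
    then show ?thesis using g(3) by simp
  qed
  then have "range \<Phi> = Collect (path_component_of X (\<Phi> 0))" using 1 by blast
  moreover have "Collect (path_component_of X (\<Phi> 0)) \<in> path_components_of X"
    by (simp only: path_component_in_path_components_of top reg)
  ultimately show ?thesis by (simp only: leaves_def X_def[symmetric] \<Phi>_def)
qed

text \<open>Preimages of plaques are open and small plaques fit into images of small discs, so the
  map is a homeomorphism for the leaf topology. In a leaf chart it is a coordinate of one component,
  holomorphic and injective, hence biholomorphic onto its image.\<close>

lemma range_uniformization: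
  assumes exp: "expansive f" and \<psi>: "\<psi> \<in> K_hat f" and inj: "inj (\<lambda>w n. \<psi> n w)"
  shows "leaf_uniformization f (range (\<lambda>w n. \<psi> n w)) (\<lambda>w n. \<psi> n w)"
proof -
  define \<Phi> where "\<Phi> = (\<lambda>w n. \<psi> n w)"
  define L where "L = range \<Phi>"
  define B where "B = {plaque f z U |z U. z \<in> natural_extension f \<and> regular_nbhd f z U}"
  have lt: "leaf_topology f L = subtopology (topology_generated_by B) L" by (simp add: leaf_topology_def B_def)
  have reg: "\<Phi> w \<in> regular_points f" for w unfolding \<Phi>_def by (rule range_regular[OF exp \<psi> inj])
  have inj': "Fun.inj \<Phi>" using inj by (simp add: \<Phi>_def)
  have top: "topspace (leaf_topology f L) = L" by (rule topspace_leaf_topology) (use reg in \<open>auto simp: L_def\<close>)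
  have ext: "\<Phi> w \<in> natural_extension f" for w unfolding \<Phi>_def by (rule K_hat_natural_extension[OF \<psi>])
  have vim: "open (\<Phi> -` plaque f z U)" if "regular_nbhd f z U" for z U
    unfolding \<Phi>_def by (rule open_vimage_plaque[OF \<psi>]) (use that in \<open>simp add: regular_nbhd_def\<close>)
  define h where "h = inv \<Phi>"
  have h: "h (\<Phi> w) = w" for w unfolding h_def by (rule inv_f_f[OF inj'])
  have c1: "continuous_map euclidean (leaf_topology f L) \<Phi>"
    unfolding lt continuous_map_in_subtopology
  proof
    have "range \<Phi> \<subseteq> \<Union>B"
      unfolding B_def using reg regular_points_subset_plaques[of f] by (intro image_subsetI) (rule subsetD)
    then show "continuous_map euclidean (topology_generated_by B) \<Phi>"
      by (intro continuous_on_generated_topo) (use vim in \<open>auto simp: B_def\<close>)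
  qed (simp add: L_def)
  have img: "openin (leaf_topology f L) (\<Phi> ` S)" if S: "open S" for S
  proof -
    have "openin (topology_generated_by B) (\<Phi> ` S)"
    proof (subst openin_subopen, intro ballI)
      fix v assume "v \<in> \<Phi> ` S"
      then obtain w where w: "w \<in> S" "v = \<Phi> w" by blast
      then obtain r where r: "r > 0" "ball w r \<subseteq> S" using S openE by blast
      obtain U where U: "regular_nbhd f (\<Phi> w) U" "plaque f (\<Phi> w) U \<subseteq> \<Phi> ` ball w r"
        using plaque_in_image[OF exp \<psi> inj r(1), of w] unfolding \<Phi>_def by blast
      have "openin (topology_generated_by B) (plaque f (\<Phi> w) U)" unfolding B_def by (rule openin_leaf_plaque[OF ext U(1)])
      moreover have "\<Phi> w \<in> plaque f (\<Phi> w) U" by (rule plaque_base[where f = f, OF ext]) (use U(1) in \<open>simp add: regular_nbhd_def\<close>)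
      ultimately show "\<exists>T. openin (topology_generated_by B) T \<and> v \<in> T \<and> T \<subseteq> \<Phi> ` S"
        using U(2) r(2) w(2) by (intro exI[of _ "plaque f (\<Phi> w) U"]) blast
    qed
    moreover have "\<Phi> ` S = \<Phi> ` S \<inter> L" by (auto simp: L_def)
    ultimately show ?thesis unfolding lt openin_subtopology by blast
  qed
  have c2: "continuous_map (leaf_topology f L) euclidean h"
    unfolding continuous_map_def top
  proof (intro conjI allI impI)
    fix S :: "complex set" assume "openin euclidean S"
    then have "open S" by simp
    moreover have "{x \<in> L. h x \<in> S} = \<Phi> ` S" using h by (auto simp: L_def)
    ultimately show "openin (leaf_topology f L) {x \<in> L. h x \<in> S}" using img by simp
  qed simp
  have hm: "homeomorphic_maps euclidean (leaf_topology f L) \<Phi> h"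
    unfolding homeomorphic_maps_def top using c1 c2 h by (auto simp: L_def)
  have chart: "(\<lambda>w. k (\<Phi> w)) holomorphic_on (\<Phi> -` A) \<and> open (\<Phi> -` A) \<and> A \<subseteq> L \<and> inj_on k A"
    if "(A, k) \<in> leaf_charts f L" for A k
  proof -
    obtain z U N V x where A: "A = plaque f z U" "k = (\<lambda>w. x (w N))" and zU: "z \<in> L" "regular_nbhd f z U" "univalent_from f z U N"
      and V: "(V, x) \<in> sphere_charts" "pullback f z U N \<subseteq> V"
      using \<open>(A, k) \<in> leaf_charts f L\<close> unfolding leaf_charts_def by blast
    obtain b where b: "\<And>y. y \<in> V \<Longrightarrow> flip b y = Some (x y)" using sphere_chartE[OF V(1)] by metis
    have AV: "v N \<in> V" if "v \<in> A" for v using that V(2) by (auto simp: A(1) plaque_def)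
    have fb: "flip b (\<psi> N w) = Some (k (\<Phi> w))" if "w \<in> \<Phi> -` A" for w
      using b[OF AV[of "\<Phi> w"]] that by (simp add: \<Phi>_def A(2))
    have op: "open (\<Phi> -` A)" unfolding A(1) by (rule vim[OF zU(2)])
    have sh: "shol (\<psi> N) (\<Phi> -` A)" by (rule shol_subset[OF K_hat_shol[OF \<psi>]]) simp
    have "(\<lambda>u. the (flip b (\<psi> N u))) holomorphic_on \<Phi> -` A"
      by (rule shol_holomorphic[OF sh op]) (simp add: fb)
    then have 1: "(\<lambda>w. k (\<Phi> w)) holomorphic_on \<Phi> -` A"
      by (rule holomorphic_transform) (simp add: fb)
    obtain w1 where w1: "z = \<Phi> w1" using zU(1) by (auto simp: L_def)
    have zz: "z \<in> natural_extension f" "z 0 \<in> U" using w1 ext zU(2) by (auto simp: regular_nbhd_def)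
    have "z \<in> plaque f z U" by (rule plaque_base[where f = f, OF zz])
    then have 2: "A \<subseteq> L"
      unfolding A(1) L_def \<Phi>_def by (intro plaque_subset_image[OF exp \<psi> inj zz(1) zU(2), of w1]) (simp add: w1 \<Phi>_def)
    have "inj_on k A"
    proof (rule inj_onI)
      fix v v' assume v: "v \<in> A" "v' \<in> A" "k v = k v'"
      have "flip b (v N) = flip b (v' N)" using b[OF AV[OF v(1)]] b[OF AV[OF v(2)]] v(3) by (simp add: A(2))
      then have "v N = v' N" by simp
      then show "v = v'" using plaque_eqI[OF zU(3)] v by (simp add: A(1))
    qed
    then show ?thesis using 1 2 op by blast
  qed
  have s1: "surface_holomorphic euclidean plane_charts (leaf_topology f L) (leaf_charts f L) \<Phi>"
  proof -
    have id: "inv_into UNIV (\<lambda>z::complex. z) = (\<lambda>z. z)" using inv_id unfolding id_def .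
    have "(\<lambda>t. k (\<Phi> t)) holomorphic_on {p. \<Phi> p \<in> A}" if "(A, k) \<in> leaf_charts f L" for A k
      using chart[OF that] by (simp add: vimage_def)
    then show ?thesis unfolding surface_holomorphic_def plane_charts_def using c1 by (auto simp: id)
  qed
  have s2: "surface_holomorphic (leaf_topology f L) (leaf_charts f L) euclidean plane_charts h"
  proof -
    have "(\<lambda>t. h (inv_into A k t)) holomorphic_on k ` A" if Ak: "(A, k) \<in> leaf_charts f L" for A k
    proof -
      note c = chart[OF Ak]
      have "inj_on (\<lambda>w. k (\<Phi> w)) (\<Phi> -` A)"
      proof (rule inj_onI)
        fix u v assume "u \<in> \<Phi> -` A" "v \<in> \<Phi> -` A" "k (\<Phi> u) = k (\<Phi> v)"
        then have "\<Phi> u = \<Phi> v" using c by (auto simp: inj_on_def)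
        then show "u = v" using inj' by (simp add: inj_eq)
      qed
      then obtain g where g: "g holomorphic_on ((\<lambda>w. k (\<Phi> w)) ` (\<Phi> -` A))" "\<And>w. w \<in> \<Phi> -` A \<Longrightarrow> g (k (\<Phi> w)) = w"
        using holomorphic_has_inverse[of "\<lambda>w. k (\<Phi> w)" "\<Phi> -` A"] c by metis
      have im: "(\<lambda>w. k (\<Phi> w)) ` (\<Phi> -` A) = k ` A" using c by (force simp: L_def)
      show ?thesis
      proof (rule holomorphic_transform[OF g(1)[unfolded im]])
        fix t assume "t \<in> k ` A"
        then have "t \<in> (\<lambda>w. k (\<Phi> w)) ` (\<Phi> -` A)" unfolding im .
        then obtain w where w: "w \<in> \<Phi> -` A" "t = k (\<Phi> w)" by blast
        have "inv_into A k t = \<Phi> w" using c w by (simp add: inv_into_f_f)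
        then show "g t = h (inv_into A k t)" using g(2)[OF w(1)] w(2) h by simp
      qed
    qed
    then show ?thesis unfolding surface_holomorphic_def plane_charts_def using c2 by auto
  qed
  have "leaf_uniformization f L \<Phi>"
    unfolding leaf_uniformization_def conformal_isomorphism_def using hm s1 s2 by blast
  then show ?thesis by (simp add: L_def \<Phi>_def)
qed

end

section \<open>Uniformisations of leaves\<close>

text \<open>Leaf charts give holomorphy of deep coordinates, on plaques whose pull-back fits into
  one chart of the sphere; shallower coordinates follow by iterating \<open>f\<close>.\<close>

lemma (in sphere_map) uniformization_K_hat:
  assumes L: "L \<in> leaves f" and u: "leaf_uniformization f L \<phi>"
  shows "(\<lambda>n w. \<phi> w n) \<in> K_hat f" "Fun.inj \<phi>" "range \<phi> = L"
    "\<exists>h. continuous_map (leaf_topology f L) euclidean h \<and> (\<forall>w. h (\<phi> w) = w)"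
proof -
  note LR = leaf_subset[OF L]
  note top = topspace_leaf_topology[OF LR]
  obtain h where hm: "homeomorphic_maps euclidean (leaf_topology f L) \<phi> h"
    and hol: "surface_holomorphic euclidean plane_charts (leaf_topology f L) (leaf_charts f L) \<phi>"
    using u unfolding leaf_uniformization_def conformal_isomorphism_def by blast
  have cont: "continuous_map euclidean (leaf_topology f L) \<phi>" and h: "\<And>w. h (\<phi> w) = w"
    and \<phi>h: "\<And>v. v \<in> L \<Longrightarrow> \<phi> (h v) = v" and hc: "continuous_map (leaf_topology f L) euclidean h"
    using hm by (auto simp: homeomorphic_maps_def top)
  show h_ex: "\<exists>h. continuous_map (leaf_topology f L) euclidean h \<and> (\<forall>w. h (\<phi> w) = w)" using h hc by blast
  show inj: "Fun.inj \<phi>" by (rule inj_on_inverseI[of _ h]) (rule h)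
  have L\<phi>: "\<phi> w \<in> L" for w using cont unfolding continuous_map_def top by auto
  show "range \<phi> = L"
  proof (intro equalityI subsetI)
    fix v assume "v \<in> L"
    then have "v = \<phi> (h v)" using \<phi>h by simp
    then show "v \<in> range \<phi>" by (rule range_eqI)
  qed (use L\<phi> in blast)
  have ext: "\<phi> w \<in> natural_extension f" for w using L\<phi> LR by (auto simp: regular_points_def)
  have st: "f (\<phi> w (Suc n)) = \<phi> w n" for w n using ext[of w] by (simp add: natural_extension_def)
  have it: "(f ^^ n) (\<phi> w (m + n)) = \<phi> w m" for w m n by (rule natural_extension_iter[OF ext])
  have near: "\<exists>E. open E \<and> w1 \<in> E \<and> shol (\<lambda>w. \<phi> w n) E" for w1 n
  proof -
    obtain U N where U: "openin riemann_sphere U" "\<phi> w1 0 \<in> U" "univalent_from f (\<phi> w1) U N"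
      using L\<phi>[of w1] LR by (auto simp: regular_points_def regular_nbhd_def)
    \<comment> \<open>\<open>M\<close> is at least \<open>N\<close>, for univalence, and at least
      \<open>n\<close>, so that coordinate \<open>n\<close> is an iterate of \<open>f\<close>
      applied to coordinate \<open>M\<close>.\<close>
    define M where "M = n + N"
    obtain b t where bt: "flip b (\<phi> w1 M) = Some t" "cmod t \<le> 1" using flip_chart by blast
    have "(1/2::real) > 0" by simp
    then obtain U' where U': "openin riemann_sphere U'" "\<phi> w1 0 \<in> U'" "U' \<subseteq> U"
      "pullback f (\<phi> w1) U' M \<subseteq> {y. chordal (\<phi> w1 M) y < 1 / 2}"
      by (rule pullback_small[OF ext U(1,2), where N = M])
    have uni: "univalent_from f (\<phi> w1) U' M"
      using regular_nbhd_subset[OF ext U(3) U'(2,3)] unfolding univalent_from_def M_def by auto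
    then have reg: "regular_nbhd f (\<phi> w1) U'" using U' by (auto simp: regular_nbhd_def)
    obtain V x where V: "(V, x) \<in> sphere_charts" "V = {y. flip b y \<noteq> None}" using sphere_chart_exists by metis
    have PV: "pullback f (\<phi> w1) U' M \<subseteq> V"
    proof
      fix y assume "y \<in> pullback f (\<phi> w1) U' M"
      then have "chordal (flip b (\<phi> w1 M)) (flip b y) < 1 / 2" using U'(4) by auto
      then obtain u where "flip b y = Some u" using near_chart bt by metis
      then show "y \<in> V" by (simp add: V(2))
    qed
    define A where "A = plaque f (\<phi> w1) U'"
    have "(A, \<lambda>v. x (v M)) \<in> leaf_charts f L"
      unfolding leaf_charts_def A_def using L\<phi> reg uni V(1) PV by blast
    moreover have "(UNIV, \<lambda>z. z) \<in> plane_charts" by (simp add: plane_charts_def)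
    ultimately have "(\<lambda>t. x (\<phi> (inv_into UNIV (\<lambda>z. z) t) M)) holomorphic_on (\<lambda>z. z) ` {p \<in> UNIV. \<phi> p \<in> A}"
      using hol unfolding surface_holomorphic_def by fast
    moreover have "inv_into UNIV (\<lambda>z::complex. z) = (\<lambda>z. z)" using inv_id unfolding id_def .
    ultimately have hol': "(\<lambda>t. x (\<phi> t M)) holomorphic_on {p. \<phi> p \<in> A}" by simp
    obtain b' where b': "\<And>y. y \<in> V \<Longrightarrow> flip b' y = Some (x y)" using sphere_chartE[OF V(1)] by metis
    have "openin (leaf_topology f L) (A \<inter> L)"
      unfolding leaf_topology_def A_def by (intro openin_subtopology_Int openin_leaf_plaque[OF ext reg])
    then have "openin euclidean {p \<in> topspace euclidean. \<phi> p \<in> A \<inter> L}" by (rule openin_continuous_map_preimage[OF cont])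
    then have op: "open {p. \<phi> p \<in> A}" using L\<phi> by simp
    have "\<phi> u M = flip b' (Some (x (\<phi> u M)))" if "u \<in> {p. \<phi> p \<in> A}" for u
    proof -
      have "\<phi> u M \<in> V" using that PV by (auto simp: A_def plaque_def)
      then have "flip b' (flip b' (\<phi> u M)) = flip b' (Some (x (\<phi> u M)))" using b' by simp
      then show ?thesis by simp
    qed
    then have "shol (\<lambda>u. \<phi> u M) {p. \<phi> p \<in> A}" by (rule sholI[OF hol' op])
    then have "shol (\<lambda>u. (f ^^ N) (\<phi> u M)) {p. \<phi> p \<in> A}" by (rule shol_iter)
    then have "shol (\<lambda>u. \<phi> u n) {p. \<phi> p \<in> A}" unfolding M_def it .
    moreover have "\<phi> w1 \<in> A" unfolding A_def by (rule plaque_base[where f = f, OF ext U'(2)])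
    ultimately show ?thesis using op by (intro exI[of _ "{p. \<phi> p \<in> A}"]) simp
  qed
  have sh: "shol (\<lambda>w. \<phi> w n) UNIV" for n
    unfolding shol_def
  proof
    fix w :: complex
    obtain E where E: "w \<in> E" "shol (\<lambda>w. \<phi> w n) E" using near by blast
    show "\<exists>b h r. r > 0 \<and> h holomorphic_on ball w r \<and> (\<forall>u\<in>ball w r. \<phi> u n = flip b (Some (h u)))"
      using E(2)[unfolded shol_def, rule_format, OF E(1)] .
  qed
  show "(\<lambda>n w. \<phi> w n) \<in> K_hat f"
  proof (rule K_hatI[OF sh])
    fix n
    show "\<not> (\<lambda>w. \<phi> w n) constant_on UNIV"
    proof
      assume "(\<lambda>w. \<phi> w n) constant_on UNIV"
      then obtain c where c: "\<And>w. \<phi> w n = c" by (auto simp: constant_on_def)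
      \<comment> \<open>If coordinate \<open>n\<close> is constant, injectivity makes some deeper
        coordinate \<open>m\<close> vary. Its image contains an open set, on which an iterate of
        \<open>f\<close> would then be constant.\<close>
      have "\<phi> 0 \<noteq> \<phi> 1" using inj by (simp add: inj_eq)
      then obtain m where m: "\<phi> 0 m \<noteq> \<phi> 1 m" by blast
      have "\<phi> w m = (f ^^ (n - m)) c" if "m \<le> n" for w
        using it[of "n - m" w m] c[of w] that by simp
      then have "n < m" using m by (metis not_le)
      have u1: "(1::complex) \<in> ball 0 2" "\<phi> 1 m \<noteq> \<phi> 0 m" using m by auto
      have "(2::real) > 0" by simp
      then obtain e where e: "e > 0" "\<And>y. chordal (\<phi> 0 m) y < e \<Longrightarrow> \<exists>u\<in>ball 0 2. \<phi> u m = y"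
        by (rule shol_open_map[OF shol_subset[OF sh[of m] subset_UNIV] _ u1]) (rule that)
      have fc: "(f ^^ (m - n)) y = c" if "chordal (\<phi> 0 m) y < e" for y
      proof -
        obtain u where "\<phi> u m = y" using e(2)[OF \<open>chordal (\<phi> 0 m) y < e\<close>] by blast
        then show ?thesis using it[of "m - n" u n] c[of u] \<open>n < m\<close> by simp
      qed
      obtain y where "chordal (\<phi> 0 m) y < e" "(f ^^ (m - n)) y \<noteq> (f ^^ (m - n)) (\<phi> 0 m)"
        using iter_nonconst[OF e(1)] by blast
      then show False using fc[of y] fc[of "\<phi> 0 m"] e(1) by simp
    qed
  qed (rule st)
qed

text \<open>Applied at radius \<open>4 * cmod z\<close>, the bound of \<open>Koebe_growth\<close> is
  a fixed multiple of \<open>cmod z\<close>, and Liouville's theorem leaves only a linear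
  polynomial.\<close>

lemma injective_entire_linear:
  assumes hol: "\<tau> holomorphic_on UNIV" and inj: "Fun.inj \<tau>" and 0: "\<tau> 0 = 0"
  obtains b where "b \<noteq> 0" "\<And>w. \<tau> w = b * w"
proof -
  have "cmod (\<tau> z) \<le> (koebe_const * 4 * cmod (deriv \<tau> 0)) * cmod z ^ 1" if "1 \<le> cmod z" for z
  proof -
    have "cmod (\<tau> z - \<tau> 0) \<le> koebe_const * (4 * cmod z) * cmod (deriv \<tau> 0)"
    proof (rule Koebe_growth)
      show "\<tau> holomorphic_on ball 0 (4 * cmod z)" using hol by (rule holomorphic_on_subset) simp
      show "inj_on \<tau> (ball 0 (4 * cmod z))" using inj by (rule inj_on_subset) simp
    qed (use that in auto)
    then show ?thesis by (simp add: 0 mult.commute mult.left_commute)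
  qed
  from Liouville_polynomial[OF hol this] have l: "\<tau> w = deriv \<tau> 0 * w" for w by (simp add: 0)
  moreover have "deriv \<tau> 0 \<noteq> 0"
  proof
    assume "deriv \<tau> 0 = 0"
    then have "\<tau> 0 = \<tau> 1" using l by simp
    then show False using inj by (simp add: inj_eq)
  qed
  ultimately show ?thesis by (rule that[rotated])
qed

context sphere_map
begin

text \<open>The transition map \<open>\<tau>\<close> is holomorphic: at a depth where
  \<open>\<phi>'\<close> has an injective coordinate on a ball about \<open>\<tau> w\<close>, it is
  locally that coordinate's inverse composed with the corresponding coordinate of
  \<open>\<phi>\<close>. Being entire, injective and zero at 0, it is linear.\<close>

lemma uniformization_unique:
  assumes exp: "expansive f" and L: "L \<in> leaves f"
    and u: "leaf_uniformization f L \<phi>" and u': "leaf_uniformization f L \<phi>'" and 0: "\<phi> 0 = \<phi>' 0"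
  obtains b where "b \<noteq> 0" "\<And>w. \<phi> w = \<phi>' (b * w)"
proof -
  note K = uniformization_K_hat(1)[OF L u] and K' = uniformization_K_hat(1)[OF L u']
  note inj = uniformization_K_hat(2)[OF L u] and inj' = uniformization_K_hat(2)[OF L u']
  note ran = uniformization_K_hat(3)[OF L u] and ran' = uniformization_K_hat(3)[OF L u']
  obtain h where hc: "continuous_map (leaf_topology f L) euclidean h" and h: "\<And>w. h (\<phi>' w) = w"
    using uniformization_K_hat(4)[OF L u'] by blast
  define \<tau> where "\<tau> = h \<circ> \<phi>"
  have \<phi>\<tau>: "\<phi> w = \<phi>' (\<tau> w)" for w
  proof -
    have "\<phi> w \<in> range \<phi>'" using ran ran' by blast
    then show ?thesis using h by (auto simp: \<tau>_def)
  qed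
  have "continuous_map euclidean (leaf_topology f L) \<phi>"
    using u by (auto simp: leaf_uniformization_def conformal_isomorphism_def surface_holomorphic_def)
  then have "continuous_map euclidean euclidean \<tau>" unfolding \<tau>_def using hc by (rule continuous_map_compose)
  then have cont: "continuous_on UNIV \<tau>" by simp
  have inj\<tau>: "Fun.inj \<tau>"
  proof (rule injI)
    fix x y assume "\<tau> x = \<tau> y"
    then have "\<phi> x = \<phi> y" using \<phi>\<tau> by simp
    then show "x = y" using inj by (simp add: inj_eq)
  qed
  have "\<tau> field_differentiable (at w)" for w
  proof -
    have Ki: "inj (\<lambda>w n. (\<lambda>n w. \<phi>' w n) n w)" using inj' by simp
    obtain N where N: "\<And>n. n \<ge> N \<Longrightarrow> inj_on (\<lambda>w. \<phi>' w n) (ball 0 (cmod (\<tau> w) + 1))"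
      using K_hat_eventually_inj[OF exp K' Ki, of "cmod (\<tau> w) + 1"] by metis
    obtain b t where bt: "flip b (\<phi>' (\<tau> w) N) = Some t" using flip_chart by blast
    obtain g r where r: "r > 0" and g: "g holomorphic_on ball (\<tau> w) r" "\<And>u. u \<in> ball (\<tau> w) r \<Longrightarrow> flip b (\<phi>' u N) = Some (g u)"
      by (rule shol_chartE[OF K_hat_shol[OF K', of N] UNIV_I, of b "\<tau> w"]) (use bt in simp, rule that)
    obtain k s where s: "s > 0" and k: "k holomorphic_on ball w s" "\<And>u. u \<in> ball w s \<Longrightarrow> flip b (\<phi> u N) = Some (k u)"
      by (rule shol_chartE[OF K_hat_shol[OF K, of N] UNIV_I, of b w]) (use bt \<phi>\<tau>[of w] in simp, rule that)
    define r' where "r' = min r 1"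
    have r': "r' > 0" "ball (\<tau> w) r' \<subseteq> ball (\<tau> w) r" using r by (auto simp: r'_def)
    have sub: "ball (\<tau> w) r' \<subseteq> ball 0 (cmod (\<tau> w) + 1)"
    proof
      fix u assume "u \<in> ball (\<tau> w) r'"
      then have "cmod (u - \<tau> w) < 1" by (simp add: r'_def dist_norm norm_minus_commute)
      then show "u \<in> ball 0 (cmod (\<tau> w) + 1)" using norm_triangle_sub[of u "\<tau> w"] by simp
    qed
    have injg: "inj_on g (ball (\<tau> w) r')"
    proof (rule inj_onI)
      fix u v assume uv: "u \<in> ball (\<tau> w) r'" "v \<in> ball (\<tau> w) r'" "g u = g v"
      then have "flip b (\<phi>' u N) = flip b (\<phi>' v N)" using g(2) r'(2) by (metis subsetD)
      then have "\<phi>' u N = \<phi>' v N" by simp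
      then show "u = v" using inj_onD[OF N[OF order_refl]] sub uv(1,2) by blast
    qed
    have holg: "g holomorphic_on ball (\<tau> w) r'" using g(1) r'(2) by (rule holomorphic_on_subset)
    obtain G where G: "G holomorphic_on (g ` ball (\<tau> w) r')" "\<And>u. u \<in> ball (\<tau> w) r' \<Longrightarrow> G (g u) = u"
      using holomorphic_has_inverse[OF holg open_ball injg] by metis
    have "open (\<tau> -` ball (\<tau> w) r')" using cont by (rule open_vimage[OF open_ball])
    then obtain d where d: "d > 0" "ball w d \<subseteq> \<tau> -` ball (\<tau> w) r'" using r'(1) openE[of "\<tau> -` ball (\<tau> w) r'" w] by auto
    define d' where "d' = min d s"
    have dd: "ball w d' \<subseteq> ball w d" "ball w d' \<subseteq> ball w s" "d' > 0" using d(1) s by (auto simp: d'_def)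
    have kg: "k u = g (\<tau> u) \<and> \<tau> u \<in> ball (\<tau> w) r'" if "u \<in> ball w d'" for u
    proof -
      have 1: "\<tau> u \<in> ball (\<tau> w) r'" using that dd d(2) by blast
      then have "Some (k u) = Some (g (\<tau> u))"
        using g(2)[of "\<tau> u"] k(2)[of u] \<phi>\<tau>[of u] that dd r'(2) by (metis subsetD)
      then show ?thesis using 1 by simp
    qed
    have "(G \<circ> k) holomorphic_on ball w d'"
      by (rule holomorphic_on_compose_gen[OF holomorphic_on_subset[OF k(1) dd(2)] G(1)]) (use kg in blast)
    then have "\<tau> holomorphic_on ball w d'" by (rule holomorphic_transform) (use kg G(2) in auto)
    then show ?thesis using dd(3) by (simp add: holomorphic_on_imp_differentiable_at)
  qed
  then have hol: "\<tau> holomorphic_on UNIV" by (simp add: holomorphic_on_def)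
  have "\<tau> 0 = 0" using 0 h by (simp add: \<tau>_def)
  then show ?thesis using injective_entire_linear[OF hol inj\<tau>] \<phi>\<tau> that by metis
qed

text \<open>The choices in \<open>iota\<close> return the leaf, unique because leaves are disjoint,
  and some uniformisation of it; this differs from \<open>\<psi>\<close> by a scaling and defines
  the same class.\<close>

lemma iota_range:
  assumes exp: "expansive f" and \<psi>: "\<psi> \<in> K_hat f" and inj: "inj (\<lambda>w n. \<psi> n w)"
  shows "iota f (\<lambda>n. \<psi> n 0) = affine_rel f `` {\<psi>}"
proof -
  define L where "L = range (\<lambda>w n. \<psi> n w)"
  define z where "z = (\<lambda>n. \<psi> n 0)"
  have L: "L \<in> leaves f" unfolding L_def by (rule range_leaf[OF exp \<psi> inj])
  have u: "leaf_uniformization f L (\<lambda>w n. \<psi> n w)" unfolding L_def by (rule range_uniformization[OF exp \<psi> inj])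
  have zL: "z \<in> L" by (simp add: z_def L_def)
  have the: "(THE L. L \<in> leaves f \<and> z \<in> L) = L"
  proof (rule the_equality)
    fix L' assume "L' \<in> leaves f \<and> z \<in> L'"
    then show "L' = L" using pairwise_disjoint_path_components_of L zL
      unfolding leaves_def pairwise_def disjnt_def by (metis IntI empty_iff)
  qed (use L zL in blast)
  define \<phi> where "\<phi> = (SOME \<phi>. leaf_uniformization f L \<phi> \<and> \<phi> 0 = z)"
  have "leaf_uniformization f L \<phi> \<and> \<phi> 0 = z"
    unfolding \<phi>_def by (rule someI[of _ "\<lambda>w n. \<psi> n w"]) (use u in \<open>simp add: z_def\<close>)
  then have \<phi>: "leaf_uniformization f L \<phi>" "\<phi> 0 = z" by auto
  have \<phi>0: "\<phi> 0 = (\<lambda>n. \<psi> n 0)" using \<phi>(2) by (simp add: z_def)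
  obtain b where b: "b \<noteq> 0" "\<And>w. \<phi> w = (\<lambda>n. \<psi> n (b * w))"
    using uniformization_unique[OF exp L \<phi>(1) u \<phi>0] by metis
  define \<xi> where "\<xi> = (\<lambda>n w. \<phi> w n)"
  have K: "\<xi> \<in> K_hat f" unfolding \<xi>_def by (rule uniformization_K_hat(1)[OF L \<phi>(1)])
  have "\<xi> n w = \<psi> n (b * w)" for n w using b(2) by (simp add: \<xi>_def)
  then have "(\<xi>, \<psi>) \<in> affine_rel f" using K \<psi> b(1) unfolding affine_rel_def by blast
  then have "affine_rel f `` {\<xi>} = affine_rel f `` {\<psi>}" by (rule equiv_class_eq[OF equiv_affine_rel])
  moreover have "iota f z = affine_rel f `` {\<lambda>N w. nat_proj ((fhat_inv f ^^ N) (\<phi> w))}"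
    unfolding iota_def the Let_def \<phi>_def ..
  moreover have "nat_proj ((fhat_inv f ^^ N) (\<phi> w)) = \<xi> N w" for N w
    using nat_proj_fhat_inv[OF K_hat_natural_extension[OF K, of w]] by (simp add: \<xi>_def)
  ultimately show ?thesis by (simp add: z_def)
qed

lemma affine_leaves_eq:
  assumes exp: "expansive f"
  shows "affine_leaves f = {affine_rel f `` {\<psi>} |\<psi>. \<psi> \<in> K_hat f \<and> inj (\<lambda>w n. \<psi> n w)}"
proof (intro equalityI subsetI)
  fix c assume "c \<in> affine_leaves f"
  then obtain z L \<phi> where c: "c = iota f z" "L \<in> leaves f" "leaf_uniformization f L \<phi>" "z \<in> L"
    unfolding affine_leaves_def affine_part_def by blast
  obtain w0 where w0: "\<phi> w0 = z" using uniformization_K_hat(3)[OF c(2,3)] c(4) by blast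
  \<comment> \<open>Translation moves the base point to 0 without leaving
    \<open>K_hat f\<close>.\<close>
  define \<psi> where "\<psi> = (\<lambda>n w. \<phi> (w0 + w) n)"
  have K: "\<psi> \<in> K_hat f" unfolding \<psi>_def using K_hat_translate[OF uniformization_K_hat(1)[OF c(2,3)]] .
  have "inj (\<lambda>w n. \<psi> n w)"
  proof (rule injI)
    fix u v assume "(\<lambda>n. \<psi> n u) = (\<lambda>n. \<psi> n v)"
    then have "\<phi> (w0 + u) = \<phi> (w0 + v)" by (simp add: \<psi>_def)
    then show "u = v" using uniformization_K_hat(2)[OF c(2,3)] by (simp add: inj_eq)
  qed
  moreover from iota_range[OF exp K this] have "c = affine_rel f `` {\<psi>}" using w0 c(1) by (simp add: \<psi>_def)
  ultimately show "c \<in> {affine_rel f `` {\<psi>} |\<psi>. \<psi> \<in> K_hat f \<and> inj (\<lambda>w n. \<psi> n w)}" using K by blast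
next
  fix c assume "c \<in> {affine_rel f `` {\<psi>} |\<psi>. \<psi> \<in> K_hat f \<and> inj (\<lambda>w n. \<psi> n w)}"
  then obtain \<psi> where \<psi>: "c = affine_rel f `` {\<psi>}" "\<psi> \<in> K_hat f" "inj (\<lambda>w n. \<psi> n w)" by blast
  have "(\<lambda>n. \<psi> n 0) \<in> affine_part f"
    unfolding affine_part_def using range_leaf[OF exp \<psi>(2,3)] range_uniformization[OF exp \<psi>(2,3)] by blast
  then show "c \<in> affine_leaves f" unfolding affine_leaves_def \<psi>(1) iota_range[OF exp \<psi>(2,3), symmetric] by (rule imageI)
qed

end

section \<open>Closedness\<close>

lemma mero_topology_nbhd:
  assumes "\<psi> \<in> mero_space" "e > 0"
  obtains T where "openin mero_topology T" "\<psi> \<in> T" "\<And>\<xi> z. \<xi> \<in> T \<Longrightarrow> z \<in> ball 0 R \<Longrightarrow> chordal (\<xi> z) (\<psi> z) < e"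
proof -
  \<comment> \<open>The identity converges to \<open>\<psi>\<close> along the neighbourhood filter,
    so the description of limits yields an open set on which the uniform estimate holds.\<close>
  have "limitin mero_topology (\<lambda>\<xi>. \<xi>) \<psi> (nhdsin mero_topology \<psi>)"
    unfolding limitin_def eventually_nhdsin using assms(1) by auto
  then have "uniform_limit (cball 0 R) (\<lambda>\<xi> z. stereo (\<xi> z)) (\<lambda>z. stereo (\<psi> z)) (nhdsin mero_topology \<psi>)"
    unfolding limitin_mero_topology by simp
  from uniform_limitD[OF this assms(2)] obtain T where
    "openin mero_topology T" "\<psi> \<in> T" "\<And>\<xi>. \<xi> \<in> T \<Longrightarrow> \<forall>z\<in>cball 0 R. dist (stereo (\<xi> z)) (stereo (\<psi> z)) < e"
    unfolding eventually_nhdsin using assms(1) by auto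
  then show ?thesis by (intro that[of T]) (auto simp: chordal_def)
qed

lemma K_hat_topology_nbhd:
  assumes \<psi>: "\<psi> \<in> K_hat f" and e: "e > 0"
  obtains T where "openin (K_hat_topology f) T" "\<psi> \<in> T"
    "\<And>\<xi> n z. \<xi> \<in> T \<Longrightarrow> n < m \<Longrightarrow> z \<in> ball 0 R \<Longrightarrow> chordal (\<xi> n z) (\<psi> n z) < e"
proof -
  have mero: "\<psi> n \<in> mero_space" for n using \<psi> by (simp add: K_hat_def)
  have "\<exists>T. openin mero_topology T \<and> \<psi> n \<in> T \<and> (\<forall>\<xi>\<in>T. \<forall>z\<in>ball 0 R. chordal (\<xi> z) (\<psi> n z) < e)" for n
    by (rule mero_topology_nbhd[OF mero[of n] e, of R]) blast
  then obtain S where S: "\<And>n. openin mero_topology (S n)" "\<And>n. \<psi> n \<in> S n"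
    "\<And>n \<xi> z. \<xi> \<in> S n \<Longrightarrow> z \<in> ball 0 R \<Longrightarrow> chordal (\<xi> z) (\<psi> n z) < e" by metis
  \<comment> \<open>Only the first \<open>m\<close> components are constrained, as a basic open set
    of the product topology demands.\<close>
  define S' where "S' n = (if n < m then S n else mero_space)" for n
  have "openin mero_topology mero_space" using openin_topspace[of mero_topology] by simp
  then have op: "openin mero_topology (S' n)" for n using S(1) by (simp add: S'_def)
  have "{i \<in> UNIV. S' i \<noteq> topspace mero_topology} \<subseteq> {..<m}" by (auto simp: S'_def)
  then have "finite {i \<in> UNIV. S' i \<noteq> topspace mero_topology}" by (rule finite_subset) simp
  then have "openin (product_topology (\<lambda>_. mero_topology) UNIV) (PiE UNIV S')"
    unfolding openin_PiE_gen using op by blast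
  then have o: "openin (K_hat_topology f) (PiE UNIV S' \<inter> K_hat f)"
    unfolding K_hat_topology_def by (rule openin_subtopology_Int)
  show ?thesis
  proof (rule that[OF o])
    show "\<psi> \<in> PiE UNIV S' \<inter> K_hat f" using \<psi> S(2) mero by (auto simp: S'_def)
    fix \<xi> n and z :: complex assume a: "\<xi> \<in> PiE UNIV S' \<inter> K_hat f" "n < m" "z \<in> ball 0 R"
    then have "\<xi> n \<in> S' n" by auto
    then show "chordal (\<xi> n z) (\<psi> n z) < e" using S(3)[of "\<xi> n" n z] a by (simp add: S'_def)
  qed
qed

context sphere_map
begin

text \<open>Were openness to fail at \<open>\<psi>\<close>, injective elements would approximate its
  first \<open>k\<close> components on \<open>ball 0 (real k)\<close> up to
  \<open>1 / real (Suc k)\<close>, for every \<open>k\<close>. This diagonal choice produces a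
  convergent sequence, to which \<open>conv_inj\<close> applies.\<close>

lemma openin_not_inj:
  assumes exp: "expansive f"
  shows "openin (K_hat_topology f) {\<psi> \<in> K_hat f. \<not> inj (\<lambda>w n. \<psi> n w)}"
proof (subst openin_subopen, intro ballI, rule ccontr)
  fix \<psi> assume \<psi>: "\<psi> \<in> {\<psi> \<in> K_hat f. \<not> inj (\<lambda>w n. \<psi> n w)}"
    and no: "\<not> (\<exists>T. openin (K_hat_topology f) T \<and> \<psi> \<in> T \<and> T \<subseteq> {\<psi> \<in> K_hat f. \<not> inj (\<lambda>w n. \<psi> n w)})"
  have "\<exists>\<xi>. \<xi> \<in> K_hat f \<and> inj (\<lambda>w n. \<xi> n w) \<and>
      (\<forall>n z. n < k \<longrightarrow> z \<in> ball 0 (real k) \<longrightarrow> chordal (\<xi> n z) (\<psi> n z) < 1 / real (Suc k))" for k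
  proof -
    have "1 / real (Suc k) > 0" by simp
    then obtain T where T: "openin (K_hat_topology f) T" "\<psi> \<in> T"
      "\<And>\<xi> n z. \<xi> \<in> T \<Longrightarrow> n < k \<Longrightarrow> z \<in> ball 0 (real k) \<Longrightarrow> chordal (\<xi> n z) (\<psi> n z) < 1 / real (Suc k)"
      using K_hat_topology_nbhd[of \<psi> f "1 / real (Suc k)" k "real k"] \<psi> by blast
    obtain \<xi> where \<xi>: "\<xi> \<in> T" "\<xi> \<notin> {\<psi> \<in> K_hat f. \<not> inj (\<lambda>w n. \<psi> n w)}" using no T(1,2) by blast
    moreover have "\<xi> \<in> K_hat f" using openin_subset[OF T(1)] \<xi>(1) by auto
    ultimately show ?thesis using T(3)[OF \<xi>(1)] by blast
  qed
  then obtain \<Psi> where \<Psi>: "\<And>k. \<Psi> k \<in> K_hat f" "\<And>k. inj (\<lambda>w n. \<Psi> k n w)"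
    "\<And>k n z. n < k \<Longrightarrow> z \<in> ball 0 (real k) \<Longrightarrow> chordal (\<Psi> k n z) (\<psi> n z) < 1 / real (Suc k)" by metis
  have "uconv (ball 0 R) (\<lambda>k. \<Psi> k n) (\<psi> n)" for n R
    unfolding uconv_iff
  proof (intro allI impI)
    fix e :: real assume "e > 0"
    then obtain N where N: "1 / real (Suc N) < e" using nat_approx_posE by metis
    define N' where "N' = Suc (n + N + nat \<lceil>R\<rceil>)"
    have "chordal (\<Psi> k n u) (\<psi> n u) < e" if k: "k \<ge> N'" and u: "u \<in> ball 0 R" for k u
    proof -
      have "R \<le> real k" using k real_nat_ceiling_ge[of R] by (simp add: N'_def)
      then have "chordal (\<Psi> k n u) (\<psi> n u) < 1 / real (Suc k)" using \<Psi>(3)[of n k u] k u by (simp add: N'_def)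
      also have "\<dots> \<le> 1 / real (Suc N)" using k by (simp add: N'_def field_simps)
      finally show ?thesis using N by linarith
    qed
    then show "\<exists>N. \<forall>k\<ge>N. \<forall>u\<in>ball 0 R. chordal (\<Psi> k n u) (\<psi> n u) < e" by blast
  qed
  then have "K_hat_conv f \<Psi> \<psi>" using \<Psi>(1) \<psi> by (simp add: K_hat_conv_def)
  from conv_inj[OF exp this \<Psi>(2)] show False using \<psi> by blast
qed

lemma affine_rel_inj:
  assumes "(\<psi>, \<psi>') \<in> affine_rel f" "inj (\<lambda>w n. \<psi>' n w)"
  shows "inj (\<lambda>w n. \<psi> n w)"
proof (rule injI)
  fix u v assume uv: "(\<lambda>n. \<psi> n u) = (\<lambda>n. \<psi> n v)"
  obtain b where b: "b \<noteq> 0" "\<And>n w. \<psi> n w = \<psi>' n (b * w)" using assms(1) unfolding affine_rel_def by blast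
  have "(\<lambda>n. \<psi>' n (b * u)) = (\<lambda>n. \<psi>' n (b * v))" using uv b(2) by simp
  then have "b * u = b * v" by (rule injD[OF assms(2)])
  then show "u = v" using b(1) by simp
qed

text \<open>Injectivity is invariant under \<open>affine_rel\<close>, so the complement in the
  quotient pulls back exactly to the set of non-injective elements, which is open.\<close>

lemma closedin_affine_leaves:
  assumes exp: "expansive f"
  shows "closedin (K_hat_affine f) (affine_leaves f)"
proof -
  have in_iff: "affine_rel f `` {\<psi>} \<in> affine_leaves f \<longleftrightarrow> inj (\<lambda>w n. \<psi> n w)" if \<psi>: "\<psi> \<in> K_hat f" for \<psi>
  proof
    assume "affine_rel f `` {\<psi>} \<in> affine_leaves f"
    then obtain \<psi>' where \<psi>': "affine_rel f `` {\<psi>} = affine_rel f `` {\<psi>'}" "\<psi>' \<in> K_hat f" "inj (\<lambda>w n. \<psi>' n w)"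
      unfolding affine_leaves_eq[OF exp] by blast
    have "(\<psi>, \<psi>') \<in> affine_rel f" by (rule eq_equiv_class[OF \<psi>'(1) equiv_affine_rel \<psi>'(2)])
    then show "inj (\<lambda>w n. \<psi> n w)" using \<psi>'(3) by (rule affine_rel_inj)
  qed (use \<psi> affine_leaves_eq[OF exp] in blast)
  have "affine_leaves f \<subseteq> K_hat f // affine_rel f"
    unfolding affine_leaves_eq[OF exp] by (auto intro: quotientI)
  moreover have "{\<psi> \<in> K_hat f. affine_rel f `` {\<psi>} \<in> K_hat f // affine_rel f - affine_leaves f} =
      {\<psi> \<in> K_hat f. \<not> inj (\<lambda>w n. \<psi> n w)}"
    using in_iff by (auto intro: quotientI)
  ultimately show ?thesis
    using openin_not_inj[OF exp] by (simp add: closedin_def K_hat_affine_def openin_quotient_topology)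
qed

end

theorem proposition2p2:
  fixes f :: "csphere \<Rightarrow> csphere" and d :: nat
  assumes "rational_map_of_degree d f"
    and "d \<ge> 2"
    and "expansive f"
  shows "closedin (K_hat_affine f) (affine_leaves f) \<and> affine_lamination f = affine_leaves f"
proof -
  obtain p q where "coprime p q" "max (degree p) (degree q) = d" "f = rational_fun p q"
    using assms(1) unfolding rational_map_of_degree_def by blast
  then interpret rational_data p q d f using assms(2) by unfold_locales
  interpret sphere_map f
    using hmap_f surj_f finite_pure fixed_point by unfold_locales blast+
  have "closedin (K_hat_affine f) (affine_leaves f)" by (rule closedin_affine_leaves[OF assms(3)])
  then show ?thesis using closure_of_closedin unfolding affine_lamination_def affine_leaves_def by blast
qed

end
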